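(* Let $F_0$, $R$, $S$ be the analytic planar limit and endpoint maps, defined on the set $\mathfrak S$ of 1-cut admissible potentials analytic near $0$ and extended to analytic functions on $B_{1/\sqrt{12}}$ (see context). Regard their Taylor series at $\mathbf a=0$ as formal power series in $\mathcal A=\mathbb Q[[a_1,a_2,a_3,\dots]]$. Then, in $\mathcal A$, $$R=\mathcal R,\qquad S=\mathcal S,\qquad F_0=\mathcal F_0,$$ where $(\mathcal R,\mathcal S)$ is the formal solution of the system given in the context and $\mathcal F_0$ is the planar limit of the formal matrix model.
   Context: Analytic side. An admissible potential is a lower semicontinuous $V:\mathbb R\to\mathbb R$ with $\lim_{|x|\to\infty}\frac{V(x)}{2\log|x|}>1$. Put $I_V=\inf_{\mu\in\mathcal P(\mathbb R)}\{\int V\,d\mu-\iint\log|x-y|\,\mu(dx)\mu(dy)\}$, the infimum over all probability measures on $\mathbb R$; the unique minimizer is the equilibrium measure of $V$, and $V$ is 1-cut if its equilibrium measure has support a single interval $[b-2c,b+2c]$. $\mathfrak S\subset\mathbb R^{\mathbb N}$ is the set of real sequences $\mathbf a=(a_n)_{n\ge1}$ such that $V(x)=\frac{x^2}{2}-\sum_{n\ge1}\frac{a_nx^n}{n}$ is a 1-cut admissible potential which is analytic near $0$. For $\mathbf a\in\mathfrak S$ put $F_0(\mathbf a)=\frac34-I_V$, $R(\mathbf a)=c^2$, $S(\mathbf a)=b$. For $r>0$, $\ell^1_r(\mathbb N)$ is the space of complex sequences with $\|\mathbf a\|_r=\sum_{n\ge1}|a_n|r^n<\infty$ and $B_r$ is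 its open ball of radius $1$ centred at $0$. A companion theorem of the same paper asserts that $F_0,R,S$ uniquely extend to analytic functions on $B_{1/\sqrt{12}}$; in particular they have Taylor series at $0$, for instance $F_0=\sum_\lambda c_\lambda a_\lambda$, the sum being over all partitions $\lambda$, including the empty one, with $c_\lambda\in\mathbb Q$ and $a_\lambda$ the monomial in the $a_j$ associated with $\lambda$. Formal side. $\mathcal A^+\subset\mathcal A$ is the set of formal power series without constant term. $(\mathcal R,\mathcal S)$ is the unique pair with $\mathcal R\in1+\mathcal A^+$, $\mathcal S\in\mathcal A^+$ satisfying $$\mathcal R=1+\sum_{n\ge1}a_n\sum_{j\ge1}\binom{n-1}{j-1}\binom{n-j}{j}\mathcal R^j\mathcal S^{n-2j},\qquad \mathcal S=\sum_{n\ge1}a_n\sum_{j\ge0}\binom{n-1}{2j}\binom{2j}{j}\mathcal R^j\mathcal S^{n-2j-1}.$$ Let $\mathcal H_N$ be the space of $N\times N$ Hermitian matrices and $$\mathcal Z=\frac{\int_{\mathcal H_N}\exp\big(-N\,\mathrm{Tr}(M^2/2)+N\sum_{n\ge1}\frac{a_n}{n}\mathrm{Tr}(M^n)\big)dM}{\int_{\mathcal H_N}\exp(-N\,\mathrm{Tr}(M^2/2))\,dM},$$ where $\exp(N\sum_n\frac{a_n}{n}\mathrm{Tr}(M^n))$ is expanded as a formal power series and integrated coefficientwise against the Gaussian. Then $\log\mathcal Z\in N^2\mathcal A[[1/N^2]]$ is written $\sum_{g\ge0}N^{2-2g}\mathcal F_g$ with $\mathcal F_g\in\mathcal A$, and $\mathcal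 F_0$ is the formal planar limit. *)

theory Defs
  imports "HOL-Probability.Probability" "Jordan_Normal_Form.Matrix"
begin

text \<open>
  All families indexed by the positive integers are shifted by one: the sequence \<open>a\<close> stands for
  $(a_n)_{n \geq 1}$ with \<open>a i\<close> $= a_{i+1}$, the formal variable $a_{i+1}$ is \<open>mps_X i\<close>, and a
  partition is encoded by the multiset of its parts, each diminished by one.
\<close>

section \<open>Formal power series in countably many variables\<close>

text \<open>
  A series is its family of coefficients; the monomial with exponents $m_i$ is the multiset in
  which \<open>i\<close> has multiplicity $m_i$.  The coefficient families are arbitrary.
\<close>

typedef 'a mps = "UNIV :: (nat multiset \<Rightarrow> 'a) set"
  morphisms mps_coeff Mps
  by simp

lemma mps_coeff_Mps [simp]: "mps_coeff (Mps c) = c"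
  by (simp add: Mps_inverse)

lemma mps_eqI: "(\<And>l. mps_coeff f l = mps_coeff g l) \<Longrightarrow> f = g"
  by (metis ext mps_coeff_inject)

lemma finite_submultisets: "finite {k. k \<subseteq># (l :: 'a multiset)}"
proof (rule finite_subset)
  show "{k. k \<subseteq># l} \<subseteq> mset ` {xs. set xs \<subseteq> set_mset l \<and> length xs \<le> size l}"
  proof
    fix k assume "k \<in> {k. k \<subseteq># l}"
    then have k: "k \<subseteq># l" by simp
    obtain xs where xs: "mset xs = k" using ex_mset by blast
    have "set xs \<subseteq> set_mset l" using k xs by (metis set_mset_mono set_mset_mset)
    moreover have "length xs \<le> size l" using k xs by (metis size_mset size_mset_mono)
    ultimately show "k \<in> mset ` {xs. set xs \<subseteq> set_mset l \<and> length xs \<le> size l}"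
      using xs by blast
  qed
  show "finite (mset ` {xs. set xs \<subseteq> set_mset l \<and> length xs \<le> size l})"
    by (intro finite_imageI finite_lists_length_le) simp
qed

lemma submultiset_diff_diff: "k \<subseteq># l \<Longrightarrow> l - (l - k) = k"
  by (auto simp: mset_subset_eq_exists_conv)

instantiation mps :: (comm_ring_1) comm_ring_1
begin

definition "0 = Mps (\<lambda>l. 0)"
definition "1 = Mps (\<lambda>l. if l = {#} then 1 else 0)"
definition "f + g = Mps (\<lambda>l. mps_coeff f l + mps_coeff g l)"
definition "- f = Mps (\<lambda>l. - mps_coeff f l)"
definition "f - g = Mps (\<lambda>l. mps_coeff f l - mps_coeff g l)"
definition "f * g = Mps (\<lambda>l. \<Sum>k | k \<subseteq># l. mps_coeff f k * mps_coeff g (l - k))"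

instance
proof
  fix f g h :: "'a mps"
  show "f + g + h = f + (g + h)"
    by (simp add: plus_mps_def add.assoc)
  show "f + g = g + f"
    by (simp add: plus_mps_def add.commute)
  show "0 + f = f"
    by (simp add: plus_mps_def zero_mps_def mps_coeff_inverse)
  show "- f + f = 0"
    by (simp add: plus_mps_def uminus_mps_def zero_mps_def)
  show "f - g = f + - g"
    by (simp add: plus_mps_def uminus_mps_def minus_mps_def)
  show "(0 :: 'a mps) \<noteq> 1"
  proof
    assume "(0 :: 'a mps) = 1"
    then have "mps_coeff (0 :: 'a mps) {#} = mps_coeff 1 {#}" by simp
    then show False by (simp add: zero_mps_def one_mps_def)
  qed
  show "f * g = g * f"
  proof (rule mps_eqI)
    fix l
    have "(\<Sum>k | k \<subseteq># l. mps_coeff f k * mps_coeff g (l - k))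
        = (\<Sum>k | k \<subseteq># l. mps_coeff f (l - k) * mps_coeff g k)"
      by (rule sum.reindex_bij_witness[where i = "\<lambda>k. l - k" and j = "\<lambda>k. l - k"])
        (auto simp: submultiset_diff_diff)
    then show "mps_coeff (f * g) l = mps_coeff (g * f) l"
      by (simp add: times_mps_def mult.commute)
  qed
  show "1 * f = f"
  proof (rule mps_eqI)
    fix l
    have "(\<Sum>k | k \<subseteq># l. (if k = {#} then 1 else 0) * mps_coeff f (l - k))
        = (\<Sum>k \<in> {{#}}. (if k = {#} then 1 else 0) * mps_coeff f (l - k))"
      by (rule sum.mono_neutral_right) (auto simp: finite_submultisets)
    then show "mps_coeff (1 * f) l = mps_coeff f l"
      by (simp add: times_mps_def one_mps_def)
  qed
  show "(f + g) * h = f * h + g * h"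
    by (simp add: plus_mps_def times_mps_def ring_distribs sum.distrib)
  show "f * g * h = f * (g * h)"
  proof (rule mps_eqI)
    fix l :: "nat multiset"
    let ?t = "\<lambda>k m. mps_coeff f m * mps_coeff g (k - m) * mps_coeff h (l - k)"
    have "mps_coeff (f * g * h) l = (\<Sum>k | k \<subseteq># l. \<Sum>m | m \<subseteq># k. ?t k m)"
      by (simp add: times_mps_def sum_distrib_right)
    also have "\<dots> = (\<Sum>(k, m) \<in> (SIGMA k:{k. k \<subseteq># l}. {m. m \<subseteq># k}). ?t k m)"
      by (rule sum.Sigma) (auto simp: finite_submultisets)
    also have "\<dots> = (\<Sum>(m, k) \<in> (SIGMA m:{m. m \<subseteq># l}. {k. k \<subseteq># l - m}).
        mps_coeff f m * (mps_coeff g k * mps_coeff h (l - m - k)))"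
      by (rule sum.reindex_bij_witness[where i = "\<lambda>(m, k). (m + k, m)" and j = "\<lambda>(k, m). (m, k - m)"])
        (auto simp: mset_subset_eq_exists_conv mult.assoc ac_simps)
    also have "\<dots> = (\<Sum>m | m \<subseteq># l. \<Sum>k | k \<subseteq># l - m.
        mps_coeff f m * (mps_coeff g k * mps_coeff h (l - m - k)))"
      by (rule sum.Sigma[symmetric]) (auto simp: finite_submultisets)
    also have "\<dots> = mps_coeff (f * (g * h)) l"
      by (simp add: times_mps_def sum_distrib_left)
    finally show "mps_coeff (f * g * h) l = mps_coeff (f * (g * h)) l" .
  qed
qed

end

definition mps_const :: "'a \<Rightarrow> 'a::zero mps" where
  "mps_const c = Mps (\<lambda>l. if l = {#} then c else 0)"

definition mps_X :: "nat \<Rightarrow> 'a::zero_neq_one mps" where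
  "mps_X i = Mps (\<lambda>l. if l = {#i#} then 1 else 0)"

definition mps_map :: "('a \<Rightarrow> 'b) \<Rightarrow> 'a mps \<Rightarrow> 'b mps" where
  "mps_map \<phi> f = Mps (\<lambda>l. \<phi> (mps_coeff f l))"

text \<open>Coefficientwise sum of a family of which only finitely many members contribute to any given
  coefficient.\<close>

definition mps_suminf :: "(nat \<Rightarrow> 'a::comm_monoid_add mps) \<Rightarrow> 'a mps" where
  "mps_suminf f = Mps (\<lambda>l. \<Sum>i | mps_coeff (f i) l \<noteq> 0. mps_coeff (f i) l)"

text \<open>Meaningful for \<open>f\<close> with constant term 0, resp. 1: then $f^k$, resp. $(f-1)^k$, has no
  monomials of degree less than \<open>k\<close>.\<close>

definition mps_exp :: "'a::field_char_0 mps \<Rightarrow> 'a mps" where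
  "mps_exp f = mps_suminf (\<lambda>k. mps_const (1 / fact k) * f ^ k)"

definition mps_log :: "'a::field_char_0 mps \<Rightarrow> 'a mps" where
  "mps_log f = mps_suminf (\<lambda>k. mps_const ((-1) ^ k / of_nat (Suc k)) * (f - 1) ^ Suc k)"


section \<open>Admissible potentials and their equilibrium measures\<close>

definition lower_semicontinuous :: "(real \<Rightarrow> real) \<Rightarrow> bool" where
  "lower_semicontinuous V \<longleftrightarrow> (\<forall>x y. y < V x \<longrightarrow> (\<forall>\<^sub>F z in nhds x. y < V z))"

definition admissible :: "(real \<Rightarrow> real) \<Rightarrow> bool" where
  "admissible V \<longleftrightarrow> lower_semicontinuous V \<and>
     (\<exists>L :: ereal. L > 1 \<and> ((\<lambda>x. ereal (V x / (2 * ln \<bar>x\<bar>))) \<longlongrightarrow> L) at_infinity)"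

text \<open>$\log|t|$ with the value $-\infty$ at 0, where the library's \<open>ln\<close> has the value 0.\<close>

definition log_abs :: "real \<Rightarrow> ereal" where
  "log_abs t = (if t = 0 then -\<infinity> else ereal (ln \<bar>t\<bar>))"

text \<open>Integral of an extended-real function as the difference of the integrals of its positive and
  negative parts.\<close>

definition ereal_integral :: "'a measure \<Rightarrow> ('a \<Rightarrow> ereal) \<Rightarrow> ereal" where
  "ereal_integral M f =
     enn2ereal (\<integral>\<^sup>+x. e2ennreal (f x) \<partial>M) - enn2ereal (\<integral>\<^sup>+x. e2ennreal (- f x) \<partial>M)"

text \<open>
  For admissible \<open>V\<close> the only possible ambiguity is $\int V\,d\mu = \infty$ with a logarithmic term
  that is $+\infty$ or undefined.  The library's convention $\infty - \infty = \infty$ then gives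
  such a measure infinite energy.  If $\int V\,d\mu < \infty$, then
  $\int\log(1+|x|)\,d\mu < \infty$ and both terms are well defined.
\<close>

definition log_energy :: "(real \<Rightarrow> real) \<Rightarrow> real measure \<Rightarrow> ereal" where
  "log_energy V \<mu> =
     ereal_integral \<mu> (\<lambda>x. ereal (V x)) -
     ereal_integral (\<mu> \<Otimes>\<^sub>M \<mu>) (\<lambda>(x, y). log_abs (x - y))"

definition min_energy :: "(real \<Rightarrow> real) \<Rightarrow> ereal" where
  "min_energy V = (INF \<mu> \<in> {\<mu>. real_distribution \<mu>}. log_energy V \<mu>)"

definition equilibrium_measure :: "(real \<Rightarrow> real) \<Rightarrow> real measure" where
  "equilibrium_measure V = (THE \<mu>. real_distribution \<mu> \<and> log_energy V \<mu> = min_energy V)"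

definition measure_support :: "real measure \<Rightarrow> real set" where
  "measure_support \<mu> = {x. \<forall>U. open U \<and> x \<in> U \<longrightarrow> emeasure \<mu> U > 0}"

definition has_cut :: "(real \<Rightarrow> real) \<Rightarrow> real \<Rightarrow> real \<Rightarrow> bool" where
  "has_cut V b c \<longleftrightarrow> c > 0 \<and> measure_support (equilibrium_measure V) = {b - 2 * c .. b + 2 * c}"

definition one_cut :: "(real \<Rightarrow> real) \<Rightarrow> bool" where
  "one_cut V \<longleftrightarrow> (\<exists>b c. has_cut V b c)"


section \<open>The analytic planar limit and endpoint maps\<close>

definition potential :: "(nat \<Rightarrow> real) \<Rightarrow> real \<Rightarrow> real" where
  "potential a x = x\<^sup>2 / 2 - (\<Sum>i. a i * x ^ Suc i / real (Suc i))"

text \<open>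
  The potential must be given by its series on all of $\mathbb R$, since otherwise the sequence
  does not determine it.  It is then automatically analytic near 0.
\<close>

definition one_cut_seqs :: "(nat \<Rightarrow> real) set" where
  "one_cut_seqs = {a. (\<forall>x :: real. summable (\<lambda>i. a i * x ^ Suc i / real (Suc i))) \<and>
     admissible (potential a) \<and> one_cut (potential a)}"

definition planar_F :: "(nat \<Rightarrow> real) \<Rightarrow> real" where
  "planar_F a = 3 / 4 - real_of_ereal (min_energy (potential a))"

definition planar_R :: "(nat \<Rightarrow> real) \<Rightarrow> real" where
  "planar_R a = (THE c. \<exists>b. has_cut (potential a) b c)\<^sup>2"

definition planar_S :: "(nat \<Rightarrow> real) \<Rightarrow> real" where
  "planar_S a = (THE b. \<exists>c. has_cut (potential a) b c)"


section \<open>Analytic functions on balls of weighted sequence spaces\<close>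

definition l1_space :: "real \<Rightarrow> (nat \<Rightarrow> complex) set" where
  "l1_space r = {a. summable (\<lambda>i. cmod (a i) * r ^ Suc i)}"

definition l1_norm :: "real \<Rightarrow> (nat \<Rightarrow> complex) \<Rightarrow> real" where
  "l1_norm r a = (\<Sum>i. cmod (a i) * r ^ Suc i)"

definition l1_ball :: "real \<Rightarrow> (nat \<Rightarrow> complex) set" where
  "l1_ball r = {a \<in> l1_space r. l1_norm r a < 1}"

text \<open>
  \<open>has_taylor_series r f a c\<close>: near \<open>a\<close>, in the norm of $\ell^1_r$, the function \<open>f\<close> is the sum of
  the (unconditionally convergent) series in monomials of the increment with coefficients \<open>c\<close>.  A
  bounded homogeneous polynomial on $\ell^1_r$ has an absolutely convergent monomial expansion, so
  this is local expandability into bounded homogeneous polynomials.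
\<close>

definition has_taylor_series ::
    "real \<Rightarrow> ((nat \<Rightarrow> complex) \<Rightarrow> complex) \<Rightarrow> (nat \<Rightarrow> complex) \<Rightarrow> complex mps \<Rightarrow> bool" where
  "has_taylor_series r f a c \<longleftrightarrow> (\<exists>\<rho>>0. \<forall>h \<in> l1_space r. l1_norm r h < \<rho> \<longrightarrow>
     ((\<lambda>l. mps_coeff c l * (\<Prod>i\<in>#l. h i)) has_sum f (\<lambda>i. a i + h i)) UNIV)"

definition analytic_on_ball :: "real \<Rightarrow> ((nat \<Rightarrow> complex) \<Rightarrow> complex) \<Rightarrow> bool" where
  "analytic_on_ball r f \<longleftrightarrow> (\<forall>a \<in> l1_ball r. \<exists>c. has_taylor_series r f a c)"

text \<open>
  The function \<open>f\<close> on the ball extends \<open>\<phi>\<close> in the sense of germs at 0: on the ray through any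
  \<open>a\<close> in the domain of \<open>\<phi>\<close> they agree close to 0.  Agreement on the whole intersection of the
  domain with the ball implies this (see below), but is not satisfiable for the three planar
  functions: arbitrarily close to 0 there are 1-cut potentials, such as
  $x^2/2 - a x^3/3 + b x^4/4$ with $0 < b \ll a^2$, whose equilibrium measure sits in a deep well far
  away from the origin.

  The parameter \<open>r\<close> is free, so \<open>r = 1 / sqrt 12\<close> is included.  With weights $r^n$ that value
  admits no extension of $R$: for $x^2/2 - a_2 x^2/2$ one has $R = 1/(1-a_2)$, whose pole has norm
  $r^2$.  For weights $r^{-n}$ the ball is the one with \<open>r = sqrt 12\<close> here.
\<close>

definition analytic_extension ::
    "real \<Rightarrow> ((nat \<Rightarrow> real) \<Rightarrow> real) \<Rightarrow> ((nat \<Rightarrow> complex) \<Rightarrow> complex) \<Rightarrow> bool" where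
  "analytic_extension r \<phi> f \<longleftrightarrow> analytic_on_ball r f \<and>
     (\<forall>a \<in> one_cut_seqs. \<forall>\<^sub>F t in at_right 0.
        (\<lambda>i. t * a i) \<in> one_cut_seqs \<and> (\<lambda>i. complex_of_real (t * a i)) \<in> l1_ball r \<longrightarrow>
        f (\<lambda>i. complex_of_real (t * a i)) = complex_of_real (\<phi> (\<lambda>i. t * a i)))"

lemma analytic_extensionI:
  assumes "analytic_on_ball r f"
    and "\<And>a. a \<in> one_cut_seqs \<Longrightarrow> (\<lambda>i. complex_of_real (a i)) \<in> l1_ball r \<Longrightarrow>
      f (\<lambda>i. complex_of_real (a i)) = complex_of_real (\<phi> a)"
  shows "analytic_extension r \<phi> f"
  using assms(1) assms(2)[of "\<lambda>i. t * a i" for t a]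
  unfolding analytic_extension_def by (intro conjI ballI always_eventually) blast+


section \<open>The formal side\<close>

definition formal_system :: "rat mps \<Rightarrow> rat mps \<Rightarrow> bool" where
  "formal_system R S \<longleftrightarrow>
     mps_coeff R {#} = 1 \<and> mps_coeff S {#} = 0 \<and>
     R = 1 + mps_suminf (\<lambda>i. let n = Suc i in mps_X i *
       (\<Sum>j = 1..n. of_nat ((n - 1 choose (j - 1)) * (n - j choose j)) * R ^ j * S ^ (n - 2 * j))) \<and>
     S = mps_suminf (\<lambda>i. let n = Suc i in mps_X i *
       (\<Sum>j = 0..n. of_nat ((n - 1 choose (2 * j)) * (2 * j choose j)) * R ^ j * S ^ (n - 2 * j - 1)))"

text \<open>
  Hermitian matrices in real coordinates: \<open>x (i, i)\<close> on the diagonal and, for \<open>i < j\<close>, real part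
  \<open>x (i, j)\<close> and imaginary part \<open>x (j, i)\<close> of the entry at \<open>(i, j)\<close>.  The normalisation of the
  Lebesgue measure is irrelevant to the quotient below.
\<close>

definition hermitian_mat :: "nat \<Rightarrow> (nat \<times> nat \<Rightarrow> real) \<Rightarrow> complex mat" where
  "hermitian_mat N x = mat N N (\<lambda>(i, j).
     if i = j then complex_of_real (x (i, i))
     else if i < j then Complex (x (i, j)) (x (j, i))
     else Complex (x (j, i)) (- x (i, j)))"

definition hermitian_lborel :: "nat \<Rightarrow> (nat \<times> nat \<Rightarrow> real) measure" where
  "hermitian_lborel N = (\<Pi>\<^sub>M p \<in> {..<N} \<times> {..<N}. lborel)"

definition mat_trace :: "complex mat \<Rightarrow> complex" where
  "mat_trace M = (\<Sum>i < dim_row M. M $$ (i, i))"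

definition gaussian_weight :: "nat \<Rightarrow> complex mat \<Rightarrow> complex" where
  "gaussian_weight N M = exp (- of_nat N * (mat_trace (M ^\<^sub>m 2) / 2))"

definition interaction :: "nat \<Rightarrow> complex mat \<Rightarrow> complex mps" where
  "interaction N M = mps_exp (mps_const (of_nat N) *
     mps_suminf (\<lambda>i. mps_const (mat_trace (M ^\<^sub>m Suc i) / of_nat (Suc i)) * mps_X i))"

definition partition_function :: "nat \<Rightarrow> complex mps" where
  "partition_function N = Mps (\<lambda>l.
     (LINT x|hermitian_lborel N.
        gaussian_weight N (hermitian_mat N x) * mps_coeff (interaction N (hermitian_mat N x)) l) /
     (LINT x|hermitian_lborel N. gaussian_weight N (hermitian_mat N x)))"

text \<open>
  $\log\mathcal Z = \sum_g N^{2-2g} F_g$, coefficient by coefficient and for every matrix size.  Each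
  coefficient of $\log\mathcal Z$ is a Laurent polynomial in \<open>N\<close>, so only finitely many \<open>g\<close>
  contribute to it, and the \<open>F g\<close> are uniquely determined.
\<close>

definition genus_expansion :: "(nat \<Rightarrow> rat mps) \<Rightarrow> bool" where
  "genus_expansion F \<longleftrightarrow> (\<forall>l. finite {g. mps_coeff (F g) l \<noteq> 0} \<and>
     (\<forall>N\<ge>1. mps_coeff (mps_log (partition_function N)) l =
        (\<Sum>g | mps_coeff (F g) l \<noteq> 0. of_nat N powi (2 - 2 * int g) * of_rat (mps_coeff (F g) l))))"

end

theory Submission
  imports Defs "HOL-Real_Asymp.Real_Asymp" "HOL-Computational_Algebra.Formal_Power_Series"
begin

text \<open>
  A formal power series in the $a_i$ is determined by its restrictions to rays $t \mapsto ta$, where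
  $a$ has finite support and the last coefficient, of even degree in the potential, is negative.
  For such \<open>a\<close> and small $t > 0$ the potential of $ta$ is a strictly convex polynomial, and its
  equilibrium measure is explicit: endpoints $(c, b)$ solving the algebraic system exist by Brouwer's
  theorem, the density comes from the Chebyshev expansion of the potential, and the Euler--Lagrange
  conditions together with positivity of the logarithmic energy show that it is the minimizer.
  Iterating the algebraic system yields the expansion of \<open>R\<close> and \<open>S\<close> in \<open>t\<close>.

  For the planar limit, the moments of the equilibrium measure satisfy the planar loop equation
  (first variation of the energy), as do the one-trace moments of the formal model: this is the limit
  of the finite-\<open>N\<close> loop equation, which is Gaussian integration by parts, with the connected
  correlators suppressed by the genus expansion.  The loop equation determines the expansion of
  the moments in \<open>t\<close>.  Both free energies vanish at 0, and both have the derivative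
  $\sum_i a_i m_{i+1}/(i+1)$ along the ray.  On the analytic side this holds because the minimal
  energy is an infimum of functions that are affine in the potential.
\<close>

section \<open>Formal power series in infinitely many variables\<close>

text \<open>The extensions are tied to the planar functions only on positive rays, and a finitely
  supported direction of degree above two reaches admissible potentials only if its top term is a
  negative multiple of an even power. The sign restriction costs nothing: a polynomial that vanishes
  while each variable ranges over an infinite set is zero.

  Brouwer's theorem says nothing about how (R, S) depends on t. Uniqueness of the equilibrium
  measure makes any solution equal to (c^2, b), and expansions with error O(t^K), meaningful for
  arbitrary functions of t > 0, take the place of an implicit function theorem.

  The explicit density must be positive on the cut and of the opposite sign beyond it. Global strong
  convexity, V'' at least 1/2, gives both at once, because the density factor is 4 - w^2 times an
  average of divided differences of V'. This is why the perturbation needs a second derivative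
  bounded from above on the whole line.

  In the formal model the genus expansion is a hypothesis, so the limit of large N is taken
  coefficient by coefficient, without counting maps.\<close>

lemma mps_coeff_0 [simp]: "mps_coeff 0 l = 0"
  by (simp add: zero_mps_def)

lemma mps_coeff_1: "mps_coeff 1 l = (if l = {#} then 1 else 0)"
  by (simp add: one_mps_def)

lemma mps_coeff_add [simp]: "mps_coeff (f + g) l = mps_coeff f l + mps_coeff g l"
  by (simp add: plus_mps_def)

lemma mps_coeff_diff [simp]: "mps_coeff (f - g) l = mps_coeff f l - mps_coeff g l"
  by (simp add: minus_mps_def)

lemma mps_coeff_uminus [simp]: "mps_coeff (- f) l = - mps_coeff f l"
  by (simp add: uminus_mps_def)

lemma mps_coeff_mult: "mps_coeff (f * g) l = (\<Sum>k | k \<subseteq># l. mps_coeff f k * mps_coeff g (l - k))"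
  by (simp add: times_mps_def)

lemma mps_coeff_sum [simp]: "mps_coeff (sum f A) l = (\<Sum>x\<in>A. mps_coeff (f x) l)"
  by (induction A rule: infinite_finite_induct) auto

lemma mps_coeff_const: "mps_coeff (mps_const c) l = (if l = {#} then c else 0)"
  by (simp add: mps_const_def)

lemma mps_const_1 [simp]: "mps_const 1 = 1"
  by (simp add: mps_const_def one_mps_def)

lemma mps_coeff_const_mult [simp]: "mps_coeff (mps_const c * f) l = c * mps_coeff f l"
proof -
  have "(\<Sum>k | k \<subseteq># l. mps_coeff (mps_const c) k * mps_coeff f (l - k)) =
      (\<Sum>k \<in> {{#}}. mps_coeff (mps_const c) k * mps_coeff f (l - k))"
    by (rule sum.mono_neutral_right) (auto simp: finite_submultisets mps_coeff_const)
  then show ?thesis by (simp add: mps_coeff_mult mps_coeff_const)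
qed

lemma mps_coeff_X_mult:
  "mps_coeff (mps_X i * f) l = (if i \<in># l then mps_coeff f (l - {#i#}) else 0)"
proof -
  have "(\<Sum>k | k \<subseteq># l. mps_coeff (mps_X i) k * mps_coeff f (l - k)) =
      (\<Sum>k \<in> (if i \<in># l then {{#i#}} else {}). mps_coeff (mps_X i) k * mps_coeff f (l - k))"
    by (rule sum.mono_neutral_right) (auto simp: finite_submultisets mps_X_def)
  then show ?thesis by (simp add: mps_coeff_mult mps_X_def)
qed

lemma mps_coeff_const_term_mult [simp]:
  "mps_coeff (f * g) {#} = mps_coeff f {#} * mps_coeff g {#}"
proof -
  have "{k. k \<subseteq># {#}} = {{#}}" by auto
  then show ?thesis by (simp add: mps_coeff_mult)
qed

lemma of_nat_mps: "of_nat n = mps_const (of_nat n :: 'a::comm_ring_1)"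
  by (induction n) (auto intro!: mps_eqI simp: mps_coeff_1 mps_coeff_const)

lemma mps_coeff_of_nat_mult [simp]:
  "mps_coeff (of_nat n * f) l = of_nat n * mps_coeff (f :: 'a::comm_ring_1 mps) l"
  by (simp add: of_nat_mps)

text \<open>A coefficient of a product involves only submultisets of its index. This is what allows
  an infinite series to be replaced by a truncation when a single coefficient is computed.\<close>

lemma mps_coeff_mult_cong:
  assumes "\<And>k. size k \<le> size l \<Longrightarrow> mps_coeff g k = mps_coeff g' k"
  shows "mps_coeff (f * g) l = mps_coeff (f * g') l"
  unfolding mps_coeff_mult
  by (intro sum.cong refl arg_cong2[of _ _ _ _ "(*)"] assms) (auto simp: size_mset_mono)

lemma mps_coeff_power_eq_0:
  assumes "mps_coeff f {#} = 0" "size l < k"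
  shows "mps_coeff (f ^ k) l = 0"
  using assms(2)
proof (induction k arbitrary: l)
  case (Suc k)
  have "mps_coeff f j * mps_coeff (f ^ k) (l - j) = 0" if "j \<subseteq># l" for j
  proof (cases "j = {#}")
    case False
    then have "size (l - j) < k"
      using Suc.prems that by (auto simp: size_Diff_submset) (meson nonempty_has_size less_le_trans size_mset_mono diff_less less_Suc_eq_le)
    then show ?thesis using Suc.IH by simp
  qed (use assms in simp)
  then show ?case by (simp add: mps_coeff_mult)
qed simp

lemma mps_coeff_suminf:
  assumes "finite A" "\<And>k. k \<notin> A \<Longrightarrow> mps_coeff (f k) l = 0"
  shows "mps_coeff (mps_suminf f) l = (\<Sum>k\<in>A. mps_coeff (f k) l)"
  unfolding mps_suminf_def mps_coeff_Mps
  by (rule sum.mono_neutral_left) (use assms in auto)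

lemma mps_coeff_suminf_X:
  "mps_coeff (mps_suminf (\<lambda>i. mps_X i * f i)) l = (\<Sum>i\<in>set_mset l. mps_coeff (f i) (l - {#i#}))"
  by (subst mps_coeff_suminf[of "set_mset l"]) (auto simp: mps_coeff_X_mult)

section \<open>Partial derivatives, exponential and logarithm\<close>

definition mps_deriv :: "nat \<Rightarrow> 'a::comm_ring_1 mps \<Rightarrow> 'a mps" where
  "mps_deriv i f = Mps (\<lambda>l. of_nat (Suc (count l i)) * mps_coeff f (add_mset i l))"

lemma mps_coeff_deriv:
  "mps_coeff (mps_deriv i f) l = of_nat (Suc (count l i)) * mps_coeff f (add_mset i l)"
  by (simp add: mps_deriv_def)

lemma mps_deriv_add [simp]: "mps_deriv i (f + g) = mps_deriv i f + mps_deriv i g"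
  by (rule mps_eqI) (simp add: mps_coeff_deriv algebra_simps)

text \<open>The exponent of the variable in a monomial is the sum of its exponents in a divisor k
  and in the complementary divisor; the two summands give the two terms of the Leibniz rule, each by
  \<open>half\<close>.\<close>

lemma mps_deriv_mult: "mps_deriv i (f * g) = mps_deriv i f * g + f * mps_deriv i g"
proof -
  have half: "(\<Sum>k | k \<subseteq># add_mset i l. of_nat (count k i) * mps_coeff f k * mps_coeff g (add_mset i l - k))
      = mps_coeff (mps_deriv i f * g) l" for f g :: "'a mps" and l
  proof -
    have "(\<Sum>k | k \<subseteq># add_mset i l. of_nat (count k i) * mps_coeff f k * mps_coeff g (add_mset i l - k))
      = (\<Sum>k | k \<subseteq># add_mset i l \<and> i \<in># k. of_nat (count k i) * mps_coeff f k * mps_coeff g (add_mset i l - k))"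
      by (rule sum.mono_neutral_right) (auto simp: finite_submultisets not_in_iff)
    also have "\<dots> = (\<Sum>k | k \<subseteq># l. mps_coeff (mps_deriv i f) k * mps_coeff g (l - k))"
    proof (rule sum.reindex_bij_witness[where i = "add_mset i" and j = "\<lambda>k. k - {#i#}"])
      fix k assume "k \<in> {k. k \<subseteq># add_mset i l \<and> i \<in># k}"
      then obtain k' where "k = add_mset i k'" "k' \<subseteq># l"
        by (auto dest!: multi_member_split)
      then show "mps_coeff (mps_deriv i f) (k - {#i#}) * mps_coeff g (l - (k - {#i#})) =
          of_nat (count k i) * mps_coeff f k * mps_coeff g (add_mset i l - k)"
        by (simp add: mps_coeff_deriv)
    qed (auto dest!: multi_member_split)
    finally show ?thesis by (simp add: mps_coeff_mult)
  qed
  show ?thesis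
  proof (rule mps_eqI)
    fix l
    have "mps_coeff (mps_deriv i (f * g)) l =
        (\<Sum>k | k \<subseteq># add_mset i l. of_nat (Suc (count l i)) * (mps_coeff f k * mps_coeff g (add_mset i l - k)))"
      by (simp add: mps_coeff_deriv mps_coeff_mult sum_distrib_left)
    also have "\<dots> = (\<Sum>k | k \<subseteq># add_mset i l. of_nat (count k i) * mps_coeff f k * mps_coeff g (add_mset i l - k)
       + of_nat (count (add_mset i l - k) i) * mps_coeff g (add_mset i l - k) * mps_coeff f k)"
    proof (rule sum.cong[OF refl])
      fix k assume "k \<in> {k. k \<subseteq># add_mset i l}"
      then have "count k i \<le> Suc (count l i)"
        using mset_subset_eq_count[of k "add_mset i l" i] by auto
      then have "Suc (count l i) = count k i + count (add_mset i l - k) i" by simp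
      then have "(of_nat (Suc (count l i)) :: 'a) = of_nat (count k i) + of_nat (count (add_mset i l - k) i)"
        using of_nat_add by metis
      then show "of_nat (Suc (count l i)) * (mps_coeff f k * mps_coeff g (add_mset i l - k)) =
         of_nat (count k i) * mps_coeff f k * mps_coeff g (add_mset i l - k)
       + of_nat (count (add_mset i l - k) i) * mps_coeff g (add_mset i l - k) * mps_coeff f k"
        by (simp only:) (simp only: algebra_simps)
    qed
    also have "\<dots> = mps_coeff (mps_deriv i f * g) l +
      (\<Sum>k | k \<subseteq># add_mset i l. of_nat (count (add_mset i l - k) i) * mps_coeff g (add_mset i l - k) * mps_coeff f k)"
      by (simp only: sum.distrib half)
    also have "(\<Sum>k | k \<subseteq># add_mset i l. of_nat (count (add_mset i l - k) i) * mps_coeff g (add_mset i l - k) * mps_coeff f k)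
      = (\<Sum>k | k \<subseteq># add_mset i l. of_nat (count k i) * mps_coeff g k * mps_coeff f (add_mset i l - k))"
      by (rule sum.reindex_bij_witness[where i = "\<lambda>k. add_mset i l - k" and j = "\<lambda>k. add_mset i l - k"])
        (auto simp: submultiset_diff_diff)
    finally show "mps_coeff (mps_deriv i (f * g)) l = mps_coeff (mps_deriv i f * g + f * mps_deriv i g) l"
      by (simp only: half mps_coeff_add) (simp only: mult.commute)
  qed
qed

lemma mps_deriv_1 [simp]: "mps_deriv i 1 = 0"
  by (rule mps_eqI) (simp add: mps_coeff_deriv mps_coeff_1)

lemma mps_deriv_power: "mps_deriv i (f ^ Suc k) = of_nat (Suc k) * (f ^ k * mps_deriv i f)"
proof (induction k)
  case (Suc k)
  have "mps_deriv i (f ^ Suc (Suc k)) = mps_deriv i f * f ^ Suc k + f * mps_deriv i (f ^ Suc k)"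
    by (simp only: power_Suc mps_deriv_mult)
  also have "\<dots> = of_nat (Suc (Suc k)) * (f ^ Suc k * mps_deriv i f)"
    by (simp only: Suc.IH) (simp add: algebra_simps)
  finally show ?case .
qed simp

lemma mps_deriv_const_mult [simp]: "mps_deriv i (mps_const c * f) = mps_const c * mps_deriv i f"
  by (rule mps_eqI) (simp add: mps_coeff_deriv)

text \<open>Up to degree n the exponential agrees with its truncation \<open>E n\<close>, and
  differentiation shifts the truncation by exactly one: \<open>E (Suc n)\<close> has derivative f'
  times \<open>E n\<close>. The shift matches the fact that the derivative at l reads a coefficient
  of degree size l + 1.\<close>

lemma mps_deriv_exp:
  assumes "mps_coeff f {#} = 0"
  shows "mps_deriv i (mps_exp f) = mps_deriv i f * mps_exp f"
proof (rule mps_eqI)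
  fix l
  define E where "E n = (\<Sum>k\<le>n. mps_const (1 / fact k) * f ^ k)" for n
  have E: "mps_coeff (mps_exp f) k = mps_coeff (E n) k" if "size k \<le> n" for k n
    unfolding mps_exp_def E_def using that
    by (subst mps_coeff_suminf[of "{..n}"]) (auto simp: mps_coeff_power_eq_0[OF assms])
  have "mps_coeff (mps_deriv i (mps_exp f)) l = mps_coeff (mps_deriv i (E (Suc (size l)))) l"
    by (simp add: mps_coeff_deriv E[of _ "Suc (size l)"])
  also have "mps_deriv i (E (Suc n)) = mps_deriv i f * E n" for n
  proof (induction n)
    case 0
    show ?case by (simp add: E_def)
  next
    case (Suc n)
    have "mps_deriv i (E (Suc (Suc n))) = mps_deriv i f * E n +
       mps_const (1 / fact (Suc (Suc n))) * mps_deriv i (f ^ Suc (Suc n))"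
      by (simp add: E_def[of "Suc (Suc n)"] E_def[of "Suc n", symmetric] Suc.IH[symmetric] del: power_Suc)
         (simp add: E_def del: power_Suc)
    also have "mps_const (1 / fact (Suc (Suc n))) * mps_deriv i (f ^ Suc (Suc n)) =
      mps_deriv i f * (mps_const (1 / fact (Suc n)) * f ^ Suc n)"
    proof (rule mps_eqI)
      fix l
      have "mps_coeff (mps_const (1 / fact (Suc (Suc n))) * mps_deriv i (f ^ Suc (Suc n))) l =
        1 / fact (Suc (Suc n)) * (of_nat (Suc (Suc n)) * mps_coeff (f ^ Suc n * mps_deriv i f) l)"
        by (simp only: mps_coeff_const_mult mps_deriv_power mps_coeff_of_nat_mult)
      also have "\<dots> = 1 / fact (Suc n) * mps_coeff (f ^ Suc n * mps_deriv i f) l"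
        by (simp only: fact_Suc[of "Suc n"] of_nat_mult) (simp del: of_nat_Suc add: field_simps)
      also have "\<dots> = mps_coeff (mps_const (1 / fact (Suc n)) * (f ^ Suc n * mps_deriv i f)) l"
        by (simp only: mps_coeff_const_mult)
      finally show "mps_coeff (mps_const (1 / fact (Suc (Suc n))) * mps_deriv i (f ^ Suc (Suc n))) l =
        mps_coeff (mps_deriv i f * (mps_const (1 / fact (Suc n)) * f ^ Suc n)) l"
        by (simp only: ac_simps)
    qed
    finally show ?case
      by (simp add: E_def[of "Suc n"] E_def[of n, symmetric] algebra_simps del: power_Suc)
         (simp add: E_def algebra_simps)
  qed
  also have "mps_coeff (mps_deriv i f * E (size l)) l = mps_coeff (mps_deriv i f * mps_exp f) l"
    by (rule mps_coeff_mult_cong) (simp add: E)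
  finally show "mps_coeff (mps_deriv i (mps_exp f)) l = mps_coeff (mps_deriv i f * mps_exp f) l" .
qed

lemma mps_coeff_exp_0:
  assumes "mps_coeff f {#} = 0"
  shows "mps_coeff (mps_exp f) {#} = 1"
  unfolding mps_exp_def
  by (subst mps_coeff_suminf[of "{0}"]) (auto simp: mps_coeff_power_eq_0[OF assms] mps_coeff_1)

lemma mps_coeff_log_0:
  assumes "mps_coeff f {#} = 1"
  shows "mps_coeff (mps_log f) {#} = 0"
proof -
  have "mps_coeff (f - 1) {#} = 0" using assms by (simp add: mps_coeff_1)
  then show ?thesis unfolding mps_log_def
    by (subst mps_coeff_suminf[of "{}"]) (auto simp: mps_coeff_power_eq_0 simp del: power_Suc)
qed

text \<open>With g = f - 1, the derivative of the truncated logarithm is a truncated geometric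
  series in -g times g'. Multiplication by f telescopes it, and the remainder contains a power of g
  whose order exceeds the degree of l.\<close>

lemma mps_deriv_log:
  assumes "mps_coeff f {#} = 1"
  shows "f * mps_deriv i (mps_log f) = mps_deriv i f"
proof (rule mps_eqI)
  fix l
  define g where "g = f - 1"
  have g: "mps_coeff g {#} = 0" using assms by (simp add: g_def mps_coeff_1)
  have f: "f = 1 + g" by (simp add: g_def)
  define E where "E n = (\<Sum>k\<le>n. mps_const ((-1) ^ k / of_nat (Suc k)) * g ^ Suc k)" for n
  have E: "mps_coeff (mps_log f) k = mps_coeff (E n) k" if "size k \<le> Suc n" for k n
    unfolding mps_log_def E_def g_def[symmetric] using that
    by (subst mps_coeff_suminf[of "{..n}"]) (auto simp: mps_coeff_power_eq_0[OF g] simp del: power_Suc)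
  have dE: "mps_deriv i (E n) = (\<Sum>k\<le>n. (- g) ^ k) * mps_deriv i g" for n
  proof -
    have *: "mps_deriv i (mps_const ((-1) ^ k / of_nat (Suc k)) * g ^ Suc k) = (- g) ^ k * mps_deriv i g" for k
    proof (rule mps_eqI)
      fix l
      have "mps_coeff (mps_deriv i (mps_const ((-1) ^ k / of_nat (Suc k)) * g ^ Suc k)) l =
        (-1) ^ k / of_nat (Suc k) * (of_nat (Suc k) * mps_coeff (g ^ k * mps_deriv i g) l)"
        by (simp only: mps_coeff_const_mult mps_deriv_power mps_coeff_of_nat_mult mps_deriv_const_mult)
      also have "\<dots> = (-1) ^ k * mps_coeff (g ^ k * mps_deriv i g) l"
        by (simp del: of_nat_Suc)
      also have "\<dots> = mps_coeff ((- g) ^ k * mps_deriv i g) l"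
        by (cases "even k") (simp_all add: power_minus_odd)
      finally show "mps_coeff (mps_deriv i (mps_const ((-1) ^ k / of_nat (Suc k)) * g ^ Suc k)) l =
        mps_coeff ((- g) ^ k * mps_deriv i g) l" .
    qed
    show ?thesis unfolding E_def
    proof (induction n)
      case 0 then show ?case using *[of 0] by simp
    next
      case (Suc n)
      then show ?case by (simp only: sum.atMost_Suc mps_deriv_add * distrib_right)
    qed
  qed
  have tel: "f * (\<Sum>k\<le>n. (- g) ^ k) = 1 - (- g) ^ Suc n" for n
    unfolding f by (induction n) (auto simp: algebra_simps)
  have "mps_coeff (f * mps_deriv i (mps_log f)) l = mps_coeff (f * mps_deriv i (E (size l))) l"
    by (rule mps_coeff_mult_cong) (simp add: mps_coeff_deriv E[of _ "size l"])
  also have "f * mps_deriv i (E (size l)) = mps_deriv i g - mps_deriv i g * (- g) ^ Suc (size l)"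
    unfolding dE mult.assoc[symmetric] tel by (simp add: algebra_simps)
  also have "mps_coeff \<dots> l = mps_coeff (mps_deriv i g) l - mps_coeff (mps_deriv i g * 0) l"
    unfolding mps_coeff_diff
    by (rule arg_cong2[of _ _ _ _ "(-)", OF refl], rule mps_coeff_mult_cong, subst mps_coeff_power_eq_0)
      (use g in auto)
  finally show "mps_coeff (f * mps_deriv i (mps_log f)) l = mps_coeff (mps_deriv i f) l"
    by (simp add: f)
qed

section \<open>Restriction to rays\<close>

definition msets_below :: "nat \<Rightarrow> nat \<Rightarrow> nat multiset set" where
  "msets_below m k = {l. size l = k \<and> set_mset l \<subseteq> {..<m}}"

lemma finite_msets_below [simp]: "finite (msets_below m k)"
proof (rule finite_subset)
  show "msets_below m k \<subseteq> mset ` {xs. set xs \<subseteq> {..<m} \<and> length xs = k}"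
  proof
    fix l assume "l \<in> msets_below m k"
    moreover obtain xs where "mset xs = l" using ex_mset by blast
    ultimately show "l \<in> mset ` {xs. set xs \<subseteq> {..<m} \<and> length xs = k}"
      unfolding msets_below_def by (auto intro!: image_eqI[of _ _ xs])
  qed
qed (intro finite_imageI finite_lists_length_eq, simp)

lemma msets_below_0 [simp]: "msets_below m 0 = {{#}}"
  by (auto simp: msets_below_def)

text \<open>Substitution of t (a i) for the variables with index below m and of 0 for all others.
  Degrees become powers of t, so every coefficient is a finite sum and an arbitrary series can be
  restricted.\<close>

definition mps_ray :: "nat \<Rightarrow> (nat \<Rightarrow> 'a::comm_ring_1) \<Rightarrow> 'a mps \<Rightarrow> 'a fps" where
  "mps_ray m a f = Abs_fps (\<lambda>k. \<Sum>l\<in>msets_below m k. mps_coeff f l * (\<Prod>i\<in>#l. a i))"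

lemma mps_ray_nth: "fps_nth (mps_ray m a f) k = (\<Sum>l\<in>msets_below m k. mps_coeff f l * (\<Prod>i\<in>#l. a i))"
  by (simp add: mps_ray_def)

lemma mps_ray_cong:
  assumes "\<And>l. set_mset l \<subseteq> {..<m} \<Longrightarrow> mps_coeff f l = mps_coeff g l"
  shows "mps_ray m a f = mps_ray m a g"
  by (rule fps_ext) (auto simp: mps_ray_nth msets_below_def assms intro!: sum.cong)

lemma mps_ray_0 [simp]: "mps_ray m a 0 = 0"
  by (rule fps_ext) (simp add: mps_ray_nth)

lemma mps_ray_add: "mps_ray m a (f + g) = mps_ray m a f + mps_ray m a g"
  by (rule fps_ext) (simp add: mps_ray_nth distrib_right sum.distrib)

lemma mps_ray_sum: "mps_ray m a (sum f A) = (\<Sum>x\<in>A. mps_ray m a (f x))"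
  by (induction A rule: infinite_finite_induct) (auto simp: mps_ray_add)

lemma mps_ray_mult: "mps_ray m a (f * g) = mps_ray m a f * mps_ray m a g"
proof (rule fps_ext)
  fix k
  let ?p = "\<lambda>l. \<Prod>i\<in>#l. a i"
  have "fps_nth (mps_ray m a (f * g)) k =
    (\<Sum>l\<in>msets_below m k. \<Sum>j | j \<subseteq># l. mps_coeff f j * mps_coeff g (l - j) * ?p l)"
    by (simp add: mps_ray_nth mps_coeff_mult sum_distrib_right)
  also have "\<dots> = (\<Sum>(l, j) \<in> (SIGMA l:msets_below m k. {j. j \<subseteq># l}). mps_coeff f j * mps_coeff g (l - j) * ?p l)"
    by (rule sum.Sigma) (auto simp: finite_submultisets)
  also have "\<dots> = (\<Sum>(i, j, j') \<in> (SIGMA i:{0..k}. msets_below m i \<times> msets_below m (k - i)).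
       (mps_coeff f j * ?p j) * (mps_coeff g j' * ?p j'))"
    by (rule sum.reindex_bij_witness[where i = "\<lambda>(i, j, j'). (j + j', j)" and j = "\<lambda>(l, j). (size j, j, l - j)"])
      (fastforce simp: msets_below_def size_mset_mono size_Diff_submset mset_subset_eq_exists_conv mult_ac
         dest: in_diffD)+
  also have "\<dots> = (\<Sum>i=0..k. \<Sum>(j, j') \<in> msets_below m i \<times> msets_below m (k - i).
       (mps_coeff f j * ?p j) * (mps_coeff g j' * ?p j'))"
    by (rule sum.Sigma[symmetric]) auto
  also have "\<dots> = fps_nth (mps_ray m a f * mps_ray m a g) k"
    by (simp add: fps_mult_nth mps_ray_nth sum_product sum.cartesian_product)
  finally show "fps_nth (mps_ray m a (f * g)) k = fps_nth (mps_ray m a f * mps_ray m a g) k" .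
qed

lemma mps_ray_const: "mps_ray m a (mps_const c) = fps_const c"
proof (rule fps_ext)
  fix k
  show "fps_nth (mps_ray m a (mps_const c)) k = fps_nth (fps_const c) k"
    by (cases k) (auto simp: mps_ray_nth mps_coeff_const, auto simp: msets_below_def intro!: sum.neutral)
qed

lemma mps_ray_1 [simp]: "mps_ray m a 1 = 1"
  using mps_ray_const[of m a 1] by simp

lemma mps_ray_of_nat [simp]: "mps_ray m a (of_nat n) = of_nat n"
  by (simp add: of_nat_mps mps_ray_const fps_of_nat)

lemma mps_ray_power: "mps_ray m a (f ^ k) = mps_ray m a f ^ k"
  by (induction k) (auto simp: mps_ray_mult)

lemma mps_ray_X:
  assumes "i < m"
  shows "mps_ray m a (mps_X i) = fps_const (a i) * fps_X"
proof (rule fps_ext)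
  fix k
  have "(\<Sum>l\<in>msets_below m k. mps_coeff (mps_X i) l * (\<Prod>i\<in>#l. a i)) =
    (\<Sum>l\<in>(if k = 1 then {{#i#}} else {}). mps_coeff (mps_X i) l * (\<Prod>i\<in>#l. a i))"
    by (rule sum.mono_neutral_right) (use assms in \<open>auto simp: mps_X_def\<close>, auto simp: msets_below_def)
  then show "fps_nth (mps_ray m a (mps_X i)) k = fps_nth (fps_const (a i) * fps_X) k"
    by (auto simp: mps_ray_nth mps_X_def fps_X_def)
qed

text \<open>A monomial in the first m variables is divisible by no other variable, so only the first
  m terms survive.\<close>

lemma mps_ray_suminf_X:
  "mps_ray m a (mps_suminf (\<lambda>i. mps_X i * f i)) = fps_X * (\<Sum>i<m. fps_const (a i) * mps_ray m a (f i))"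
proof -
  have "mps_ray m a (mps_suminf (\<lambda>i. mps_X i * f i)) = mps_ray m a (\<Sum>i<m. mps_X i * f i)"
    by (rule mps_ray_cong) (auto simp: mps_coeff_suminf_X mps_coeff_X_mult sum.If_cases
      intro!: sum.mono_neutral_cong_left)
  also have "\<dots> = (\<Sum>i<m. fps_const (a i) * fps_X * mps_ray m a (f i))"
    by (simp add: mps_ray_sum mps_ray_mult mps_ray_X)
  finally show ?thesis by (simp add: sum_distrib_left mult_ac)
qed

text \<open>Euler's identity for homogeneous polynomials, degree by degree.\<close>

lemma fps_deriv_mps_ray:
  "fps_deriv (mps_ray m a f) = (\<Sum>i<m. fps_const (a i) * mps_ray m a (mps_deriv i f))"
proof (rule fps_ext)
  fix k
  let ?p = "\<lambda>l. \<Prod>i\<in>#l. a i"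
  have "fps_nth (fps_deriv (mps_ray m a f)) k =
     (\<Sum>l\<in>msets_below m (Suc k). of_nat (size l) * (mps_coeff f l * ?p l))"
    by (simp add: mps_ray_nth sum_distrib_left) (auto intro!: sum.cong simp: msets_below_def)
  also have "\<dots> = (\<Sum>l\<in>msets_below m (Suc k). \<Sum>i\<in>set_mset l. of_nat (count l i) * (mps_coeff f l * ?p l))"
    by (rule sum.cong) (auto simp: size_multiset_overloaded_eq sum_distrib_right)
  also have "\<dots> = (\<Sum>(l, i) \<in> (SIGMA l:msets_below m (Suc k). set_mset l). of_nat (count l i) * (mps_coeff f l * ?p l))"
    by (rule sum.Sigma) auto
  also have "\<dots> = (\<Sum>(i, l) \<in> {..<m} \<times> msets_below m k. a i * (mps_coeff (mps_deriv i f) l * ?p l))"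
    by (rule sum.reindex_bij_witness[where i = "\<lambda>(i, l). (add_mset i l, i)" and j = "\<lambda>(l, i). (i, l - {#i#})"])
      (auto simp: msets_below_def mps_coeff_deriv mult_ac size_Suc_Diff1 dest: in_diffD,
       auto dest!: multi_member_split)
  also have "\<dots> = (\<Sum>i<m. \<Sum>l\<in>msets_below m k. a i * (mps_coeff (mps_deriv i f) l * ?p l))"
    by (simp add: sum.cartesian_product)
  finally show "fps_nth (fps_deriv (mps_ray m a f)) k =
      fps_nth (\<Sum>i<m. fps_const (a i) * mps_ray m a (mps_deriv i f)) k"
    by (simp add: fps_sum_nth mps_ray_nth sum_distrib_left)
qed

text \<open>Induction on the set of variables: with the other variables fixed, the sum is a
  polynomial in the variable s with infinitely many roots, so its part of each degree in s vanishes
  separately.\<close>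

lemma multiset_polynomial_eq_0:
  fixes d :: "nat multiset \<Rightarrow> 'a::idom"
  assumes "finite S" "finite A" "\<And>l. l \<in> A \<Longrightarrow> set_mset l \<subseteq> S"
    and "\<And>i. i \<in> S \<Longrightarrow> infinite (I i)"
    and "\<And>a. (\<forall>i\<in>S. a i \<in> I i) \<Longrightarrow> (\<Sum>l\<in>A. d l * (\<Prod>i\<in>#l. a i)) = 0"
    and "l \<in> A"
  shows "d l = 0"
  using assms
proof (induction S arbitrary: A d l rule: finite_induct)
  case empty
  then have "A = {{#}}" by auto
  then show ?case using empty(4)[of undefined] empty(5) by simp
next
  case (insert s S)
  let ?n = "count l s"
  \<comment> \<open>The monomials with the same exponent of s as l, stripped of s;
    \<open>ins\<close> puts that power of s back.\<close>
  define A' where "A' = (\<lambda>l. filter_mset (\<lambda>i. i \<noteq> s) l) ` {l \<in> A. count l s = ?n}"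
  define ins where "ins l' = l' + replicate_mset ?n s" for l'
  have split: "l' = filter_mset (\<lambda>i. i \<noteq> s) l' + replicate_mset (count l' s) s" for l' :: "nat multiset"
    by (rule multiset_eqI) (auto simp: not_in_iff)
  have bij: "bij_betw (\<lambda>l. filter_mset (\<lambda>i. i \<noteq> s) l) {l \<in> A. count l s = ?n} A'"
    unfolding A'_def by (rule inj_on_imp_bij_betw) (auto intro!: inj_onI, metis split)
  have d_ins: "d (ins (filter_mset (\<lambda>i. i \<noteq> s) l')) = d l'" if "count l' s = ?n" for l'
    using split[of l'] that by (simp add: ins_def)
  have main: "(\<Sum>l'\<in>A'. d (ins l') * (\<Prod>i\<in>#l'. a i)) = 0" if a: "\<forall>i\<in>S. a i \<in> I i" for a
  proof -
    define q where "q l' = d l' * (\<Prod>i\<in>#filter_mset (\<lambda>i. i \<noteq> s) l'. a i)" for l'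
    define p where "p = (\<Sum>l'\<in>A. monom (q l') (count l' s))"
    have "poly p y = 0" if "y \<in> I s" for y
    proof -
      have "(\<Prod>i\<in>#l'. (a(s := y)) i) = (\<Prod>i\<in>#filter_mset (\<lambda>i. i \<noteq> s) l'. a i) * y ^ count l' s" for l'
      proof -
        have "(\<Prod>i\<in>#l'. (a(s := y)) i) =
          (\<Prod>i\<in>#filter_mset (\<lambda>i. i \<noteq> s) l'. (a(s := y)) i) * (\<Prod>i\<in>#replicate_mset (count l' s) s. (a(s := y)) i)"
          by (subst split[of l']) (simp only: image_mset_union prod_mset_Un)
        also have "(\<Prod>i\<in>#filter_mset (\<lambda>i. i \<noteq> s) l'. (a(s := y)) i) = (\<Prod>i\<in>#filter_mset (\<lambda>i. i \<noteq> s) l'. a i)"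
          by (rule arg_cong[of _ _ prod_mset], rule image_mset_cong) auto
        finally show ?thesis by simp
      qed
      moreover have "(\<Sum>l'\<in>A. d l' * (\<Prod>i\<in>#l'. (a(s := y)) i)) = 0"
        using a that insert.hyps by (intro insert.prems(4)) auto
      ultimately show ?thesis by (simp add: p_def poly_sum poly_monom q_def mult_ac)
    qed
    then have "I s \<subseteq> {y. poly p y = 0}" by auto
    then have "p = 0"
      using insert.prems(3)[of s] poly_roots_finite[of p] finite_subset by blast
    then have "coeff p ?n = 0" by simp
    then have "(\<Sum>l'\<in>{l'\<in>A. count l' s = ?n}. q l') = 0"
      using insert.prems(1) by (simp add: p_def coeff_sum coeff_monom sum.If_cases Int_def conj_commute)
    also have "(\<Sum>l'\<in>{l'\<in>A. count l' s = ?n}. q l') = (\<Sum>l'\<in>A'. d (ins l') * (\<Prod>i\<in>#l'. a i))"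
      by (subst sum.reindex_bij_betw[OF bij, symmetric]) (auto simp: q_def d_ins intro!: sum.cong)
    finally show ?thesis .
  qed
  have "d (ins (filter_mset (\<lambda>i. i \<noteq> s) l)) = 0"
  proof (rule insert.IH[of A' "\<lambda>l. d (ins l)"])
    show "finite A'" using insert.prems(1) by (simp add: A'_def)
    show "set_mset l \<subseteq> S" if "l \<in> A'" for l
      using that insert.prems(2) by (fastforce simp: A'_def)
    show "filter_mset (\<lambda>i. i \<noteq> s) l \<in> A'" using insert.prems(5) by (auto simp: A'_def)
  qed (use insert.prems main in auto)
  then show ?case using d_ins by simp
qed

section \<open>Extension of scalars from the rationals\<close>

lemma mps_coeff_map: "mps_coeff (mps_map \<phi> f) l = \<phi> (mps_coeff f l)"
  by (simp add: mps_map_def)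

lemma mps_map_of_rat_1 [simp]: "mps_map of_rat 1 = (1 :: 'a::field_char_0 mps)"
  by (rule mps_eqI) (simp add: mps_coeff_map mps_coeff_1)

lemma mps_map_of_rat_add [simp]:
  "mps_map of_rat (f + g) = (mps_map of_rat f + mps_map of_rat g :: 'a::field_char_0 mps)"
  by (rule mps_eqI) (simp add: mps_coeff_map of_rat_add)

lemma mps_map_of_rat_mult [simp]:
  "mps_map of_rat (f * g) = (mps_map of_rat f * mps_map of_rat g :: 'a::field_char_0 mps)"
  by (rule mps_eqI) (simp add: mps_coeff_map mps_coeff_mult of_rat_sum of_rat_mult)

lemma mps_map_of_rat_power [simp]:
  "mps_map of_rat (f ^ k) = (mps_map of_rat f ^ k :: 'a::field_char_0 mps)"
  by (induction k) auto

lemma mps_map_of_rat_of_nat [simp]: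
  "mps_map of_rat (of_nat k) = (of_nat k :: 'a::field_char_0 mps)"
  by (rule mps_eqI) (simp add: mps_coeff_map of_nat_mps mps_coeff_const)

lemma mps_map_of_rat_X [simp]: "mps_map of_rat (mps_X i) = (mps_X i :: 'a::field_char_0 mps)"
  by (rule mps_eqI) (simp add: mps_coeff_map mps_X_def)

lemma mps_map_of_rat_sum [simp]:
  "mps_map of_rat (sum f A) = (\<Sum>x\<in>A. mps_map of_rat (f x) :: 'a::field_char_0 mps)"
  by (rule mps_eqI) (simp add: mps_coeff_map of_rat_sum)

text \<open>Injectivity of \<open>of_rat\<close> leaves the set of contributing indices
  unchanged.\<close>

lemma mps_map_of_rat_suminf:
  "mps_map of_rat (mps_suminf f) = (mps_suminf (\<lambda>i. mps_map of_rat (f i)) :: 'a::field_char_0 mps)"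
  by (rule mps_eqI) (simp add: mps_coeff_map mps_suminf_def of_rat_sum)

section \<open>Gaussian integration by parts\<close>

lemma integrable_gaussian_poly:
  assumes "0 < (s::real)"
  shows "integrable lborel (\<lambda>t::real. (1 + \<bar>t\<bar>) ^ k * exp (- s * t\<^sup>2))"
proof -
  \<comment> \<open>The standard deviation for which the weight is a multiple of a normal density,
    so that its even moments are available.\<close>
  define \<sigma> where "\<sigma> = sqrt (1 / (2 * s))"
  have \<sigma>: "0 < \<sigma>" "\<sigma>\<^sup>2 = 1 / (2 * s)" using assms by (auto simp: \<sigma>_def)
  have nd: "exp (- s * t\<^sup>2) = sqrt (2 * pi * \<sigma>\<^sup>2) * normal_density 0 \<sigma> t" for t
    using \<sigma> assms by (simp add: normal_density_def)
  have int: "integrable lborel (\<lambda>t::real. t ^ (2 * k) * exp (- s * t\<^sup>2))" for k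
  proof -
    have "integrable lborel (\<lambda>t. sqrt (2 * pi * \<sigma>\<^sup>2) * (normal_density 0 \<sigma> t * (t - 0) ^ (2 * k)))"
      using normal_moment_even[OF \<sigma>(1), of 0 k] by (intro integrable_mult_right) (simp add: has_bochner_integral_iff)
    then show ?thesis unfolding nd by (simp add: mult_ac)
  qed
  have "integrable lborel (\<lambda>t::real. 4 ^ k * (t ^ (2 * 0) * exp (- s * t\<^sup>2)) + 4 ^ k * (t ^ (2 * k) * exp (- s * t\<^sup>2)))"
    by (intro Bochner_Integration.integrable_add integrable_mult_right int)
  then show ?thesis
  proof (rule Bochner_Integration.integrable_bound)
    show "AE t in lborel. norm ((1 + \<bar>t\<bar>) ^ k * exp (- s * t\<^sup>2)) \<le>
      norm (4 ^ k * (t ^ (2 * 0) * exp (- s * t\<^sup>2)) + 4 ^ k * (t ^ (2 * k) * exp (- s * t\<^sup>2)))"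
    proof (rule AE_I2)
      fix t :: real
      \<comment> \<open>Even powers suffice as majorants: the left side is bounded for |t| \<le> 1,
        and 1 + |t| is at most 4 t^2 otherwise.\<close>
      have "(1 + \<bar>t\<bar>) ^ k \<le> 4 ^ k * (1 + t ^ (2 * k))"
      proof (cases "\<bar>t\<bar> \<le> 1")
        case True
        then have "(1 + \<bar>t\<bar>) ^ k \<le> 4 ^ k" by (intro power_mono) auto
        also have "\<dots> \<le> 4 ^ k * (1 + t ^ (2 * k))" by (simp add: power_mult)
        finally show ?thesis .
      next
        case False
        then have "1 + \<bar>t\<bar> \<le> 4 * t\<^sup>2" using abs_le_square_iff[of 1 t] mult_mono[of 1 "\<bar>t\<bar>" "\<bar>t\<bar>" "\<bar>t\<bar>"]
          by (auto simp: power2_eq_square)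
        then have "(1 + \<bar>t\<bar>) ^ k \<le> (4 * t\<^sup>2) ^ k" by (intro power_mono) auto
        also have "\<dots> \<le> 4 ^ k * (1 + t ^ (2 * k))" by (simp add: power_mult_distrib algebra_simps flip: power_mult)
        finally show ?thesis .
      qed
      then have "(1 + \<bar>t\<bar>) ^ k * exp (- s * t\<^sup>2) \<le> 4 ^ k * (1 + t ^ (2 * k)) * exp (- s * t\<^sup>2)"
        by (intro mult_right_mono) auto
      then show "norm ((1 + \<bar>t\<bar>) ^ k * exp (- s * t\<^sup>2)) \<le>
        norm (4 ^ k * (t ^ (2 * 0) * exp (- s * t\<^sup>2)) + 4 ^ k * (t ^ (2 * k) * exp (- s * t\<^sup>2)))"
        by (simp add: algebra_simps)
    qed
  qed simp
qed

text \<open>The integrand is the derivative of the Gaussian times h. The polynomial bounds make it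
  integrable and make the boundary terms at both ends vanish.\<close>

lemma gaussian_integration_by_parts_1d:
  fixes h h' :: "real \<Rightarrow> complex"
  assumes s: "0 < (s::real)"
    and h: "\<And>t. (h has_vector_derivative h' t) (at t)"
    and h': "continuous_on UNIV h'"
    and bh: "\<And>t. norm (h t) \<le> C * (1 + \<bar>t\<bar>) ^ k"
    and bh': "\<And>t. norm (h' t) \<le> C * (1 + \<bar>t\<bar>) ^ k"
  shows "(\<integral>t. of_real (exp (- s * t\<^sup>2)) * (h' t - of_real (2 * s * t) * h t) \<partial>lborel) = 0"
proof -
  let ?e = "\<lambda>t. exp (- s * t\<^sup>2)"
  let ?F = "\<lambda>t. of_real (?e t) * h t"
  let ?f = "\<lambda>t. of_real (?e t) * (h' t - of_real (2 * s * t) * h t)"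
  have F: "(?F has_vector_derivative ?f t) (at t)" for t
    by (rule has_vector_derivative_eq_rhs,
        (rule has_vector_derivative_mult has_vector_derivative_of_real h derivative_eq_intros refl)+)
       (auto simp: has_real_derivative_iff_has_vector_derivative[symmetric] algebra_simps
         intro!: derivative_eq_intros)
  have hc: "continuous_on UNIV h" using h
    by (auto simp: continuous_on_eq_continuous_at has_vector_derivative_def intro: has_derivative_continuous)
  have fc: "continuous_on UNIV ?f" by (intro continuous_intros h' hc)
  have int: "integrable lborel ?f"
  proof (rule Bochner_Integration.integrable_bound)
    show "integrable lborel (\<lambda>t. (C + 2 * s * C) * ((1 + \<bar>t\<bar>) ^ Suc k * ?e t))"
      by (intro integrable_mult_right integrable_gaussian_poly s)
    show "?f \<in> borel_measurable lborel" using fc by (simp add: borel_measurable_continuous_onI)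
    show "AE t in lborel. norm (?f t) \<le> norm ((C + 2 * s * C) * ((1 + \<bar>t\<bar>) ^ Suc k * ?e t))"
    proof (rule AE_I2)
      fix t
      have C: "0 \<le> C" using order_trans[OF norm_ge_zero bh[of 0]] by simp
      have "norm (h' t - of_real (2 * s * t) * h t) \<le> norm (h' t) + norm (of_real (2 * s * t) * h t)"
        by (rule norm_triangle_ineq4)
      also have "\<dots> \<le> C * (1 + \<bar>t\<bar>) ^ k + 2 * s * \<bar>t\<bar> * (C * (1 + \<bar>t\<bar>) ^ k)"
        using s by (intro add_mono bh') (auto simp: norm_mult abs_mult intro!: mult_left_mono bh)
      also have "\<dots> \<le> (C + 2 * s * C) * ((1 + \<bar>t\<bar>) ^ Suc k)"
        using C s by (simp add: algebra_simps)
      finally show "norm (?f t) \<le> norm ((C + 2 * s * C) * ((1 + \<bar>t\<bar>) ^ Suc k * ?e t))"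
        using C s by (simp add: norm_mult abs_mult mult_ac)
    qed
  qed
  have lim: "(?F \<longlongrightarrow> 0) (at_infinity :: real filter)"
  proof (rule Lim_null_comparison)
    show "\<forall>\<^sub>F t in at_infinity. norm (?F t) \<le> C * ((1 + \<bar>t\<bar>) ^ k * ?e t)"
      using bh by (intro always_eventually allI) (simp add: norm_mult mult_ac)
    have "((\<lambda>t::real. (1 + t) ^ k * exp (- s * t\<^sup>2)) \<longlongrightarrow> 0) at_top"
      using s by real_asymp
    then have "((\<lambda>t. C * ((1 + \<bar>t\<bar>) ^ k * exp (- s * \<bar>t\<bar>\<^sup>2))) \<longlongrightarrow> C * 0) at_infinity"
      by (intro tendsto_mult tendsto_const) (rule filterlim_compose[OF _ filterlim_norm_at_top[where 'a=real], unfolded real_norm_def])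
    then show "((\<lambda>t. C * ((1 + \<bar>t\<bar>) ^ k * ?e t)) \<longlongrightarrow> 0) at_infinity" by simp
  qed
  have "(LBINT t=-\<infinity>..\<infinity>. ?f t) = 0 - 0"
  proof (rule interval_integral_FTC_integrable[of "-\<infinity>" \<infinity> ?F])
    show "isCont ?f t" for t using fc by (simp add: continuous_on_eq_continuous_at)
    show "set_integrable lborel (einterval (-\<infinity>) \<infinity>) ?f" using int by (simp add: set_integrable_def)
    show "((?F \<circ> real_of_ereal) \<longlongrightarrow> 0) (at_right (-\<infinity>))"
      using tendsto_mono[OF at_bot_le_at_infinity lim] by (simp add: ereal_tendsto_simps)
    show "((?F \<circ> real_of_ereal) \<longlongrightarrow> 0) (at_left \<infinity>)"
      using tendsto_mono[OF at_top_le_at_infinity lim] by (simp add: ereal_tendsto_simps)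
  qed (use F in auto)
  then show ?thesis by (simp add: interval_lebesgue_integral_def set_lebesgue_integral_def)
qed

section \<open>Polynomials in the entries of a Hermitian matrix\<close>

abbreviation herm_entry :: "nat \<Rightarrow> (nat \<times> nat \<Rightarrow> real) \<Rightarrow> nat \<Rightarrow> nat \<Rightarrow> complex" where
  "herm_entry N x k l \<equiv> hermitian_mat N x $$ (k, l)"

text \<open>\<open>herm_poly N f D\<close>: \<open>f\<close> is a polynomial in the matrix entries, and \<open>D i j\<close> is its
  derivative with respect to the \<open>(i, j)\<close> entry, all entries being treated as independent.\<close>

inductive herm_poly :: "nat \<Rightarrow> ((nat \<times> nat \<Rightarrow> real) \<Rightarrow> complex) \<Rightarrow>
    (nat \<Rightarrow> nat \<Rightarrow> (nat \<times> nat \<Rightarrow> real) \<Rightarrow> complex) \<Rightarrow> bool" for N where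
  const: "herm_poly N (\<lambda>x. c) (\<lambda>i j x. 0)"
| entry: "k < N \<Longrightarrow> l < N \<Longrightarrow>
    herm_poly N (\<lambda>x. herm_entry N x k l) (\<lambda>i j x. if i = k \<and> j = l then 1 else 0)"
| add: "herm_poly N f D \<Longrightarrow> herm_poly N g E \<Longrightarrow>
    herm_poly N (\<lambda>x. f x + g x) (\<lambda>i j x. D i j x + E i j x)"
| mult: "herm_poly N f D \<Longrightarrow> herm_poly N g E \<Longrightarrow>
    herm_poly N (\<lambda>x. f x * g x) (\<lambda>i j x. D i j x * g x + f x * E i j x)"

text \<open>Polynomial growth, measured by a majorant that factors over the coordinates:
  integrability against the Gaussian reduces to one variable, and the class is closed under sums and
  products.\<close>

definition herm_bounded :: "nat \<Rightarrow> ((nat \<times> nat \<Rightarrow> real) \<Rightarrow> complex) \<Rightarrow> bool" where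
  "herm_bounded N f \<longleftrightarrow> f \<in> borel_measurable (hermitian_lborel N) \<and>
     (\<exists>C k. \<forall>x. norm (f x) \<le> C * (\<Prod>p\<in>{..<N} \<times> {..<N}. 1 + \<bar>x p\<bar>) ^ k)"

lemma herm_prod_ge_1: "1 \<le> (\<Prod>p\<in>{..<N} \<times> {..<N}. 1 + \<bar>x p :: real\<bar>)"
  by (intro prod_ge_1) auto

lemma herm_bounded_const: "herm_bounded N (\<lambda>x. c)"
  unfolding herm_bounded_def by (intro conjI exI[of _ "norm c"] exI[of _ 0]) auto

lemma herm_bounded_add:
  assumes "herm_bounded N f" "herm_bounded N g"
  shows "herm_bounded N (\<lambda>x. f x + g x)"
proof -
  let ?P = "\<lambda>x. \<Prod>p\<in>{..<N} \<times> {..<N}. 1 + \<bar>x p :: real\<bar>"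
  obtain C k C' k' where b: "\<And>x. norm (f x) \<le> C * ?P x ^ k" "\<And>x. norm (g x) \<le> C' * ?P x ^ k'"
    using assms unfolding herm_bounded_def by blast
  have "norm (f x + g x) \<le> (\<bar>C\<bar> + \<bar>C'\<bar>) * ?P x ^ (k + k')" for x
  proof -
    have "?P x ^ k \<le> ?P x ^ (k + k')" "?P x ^ k' \<le> ?P x ^ (k + k')"
      by (intro power_increasing herm_prod_ge_1; simp)+
    moreover have "0 \<le> ?P x ^ k" "0 \<le> ?P x ^ k'"
      using herm_prod_ge_1[where N = N and x = x] by auto
    ultimately have "C * ?P x ^ k \<le> \<bar>C\<bar> * ?P x ^ (k + k')" "C' * ?P x ^ k' \<le> \<bar>C'\<bar> * ?P x ^ (k + k')"
      by (intro mult_mono; simp)+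
    then have "C * ?P x ^ k + C' * ?P x ^ k' \<le> (\<bar>C\<bar> + \<bar>C'\<bar>) * ?P x ^ (k + k')"
      by (simp add: algebra_simps)
    then show ?thesis using b[of x] norm_triangle_ineq[of "f x" "g x"] by linarith
  qed
  then show ?thesis using assms unfolding herm_bounded_def by (intro conjI borel_measurable_add) blast+
qed

lemma herm_bounded_mult:
  assumes "herm_bounded N f" "herm_bounded N g"
  shows "herm_bounded N (\<lambda>x. f x * g x)"
proof -
  let ?P = "\<lambda>x. \<Prod>p\<in>{..<N} \<times> {..<N}. 1 + \<bar>x p :: real\<bar>"
  obtain C k C' k' where b: "\<And>x. norm (f x) \<le> C * ?P x ^ k" "\<And>x. norm (g x) \<le> C' * ?P x ^ k'"
    using assms unfolding herm_bounded_def by blast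
  have "norm (f x * g x) \<le> (C * C') * ?P x ^ (k + k')" for x
    using mult_mono'[OF b(1)[of x] b(2)[of x]] by (simp add: norm_mult power_add mult_ac)
  then show ?thesis using assms unfolding herm_bounded_def by (intro conjI borel_measurable_times) blast+
qed

lemma herm_bounded_coord:
  assumes "p \<in> {..<N} \<times> {..<N}"
  shows "herm_bounded N (\<lambda>x. of_real (x p))"
  unfolding herm_bounded_def
proof (intro conjI exI allI)
  show "(\<lambda>x. complex_of_real (x p)) \<in> borel_measurable (hermitian_lborel N)"
    unfolding hermitian_lborel_def using assms by measurable
  fix x :: "nat \<times> nat \<Rightarrow> real"
  let ?P = "\<Prod>p\<in>{..<N} \<times> {..<N}. 1 + \<bar>x p\<bar>"
  have "?P = (1 + \<bar>x p\<bar>) * (\<Prod>p\<in>{..<N} \<times> {..<N} - {p}. 1 + \<bar>x p\<bar>)"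
    using assms by (intro prod.remove) auto
  moreover have "1 \<le> (\<Prod>p\<in>{..<N} \<times> {..<N} - {p}. 1 + \<bar>x p\<bar>)"
    by (intro prod_ge_1) auto
  ultimately have "1 + \<bar>x p\<bar> \<le> ?P" by (simp add: mult_le_cancel_left1)
  then show "norm (of_real (x p) :: complex) \<le> 1 * ?P ^ 1" by simp
qed

lemma herm_entry_eq:
  assumes "k < N" "l < N"
  shows "herm_entry N x k l =
    (if k = l then of_real (x (k, k))
     else if k < l then of_real (x (k, l)) + \<i> * of_real (x (l, k))
     else of_real (x (l, k)) - \<i> * of_real (x (k, l)))"
  using assms by (auto simp: hermitian_mat_def complex_eq_iff)

lemma herm_bounded_entry:
  assumes "k < N" "l < N"
  shows "herm_bounded N (\<lambda>x. herm_entry N x k l)"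
proof -
  have *: "herm_bounded N (\<lambda>x. of_real (x (i, j)))" if "i < N" "j < N" for i j
    using that by (intro herm_bounded_coord) auto
  have "herm_bounded N (\<lambda>x. of_real (x (k, l)) + \<i> * of_real (x (l, k)))"
    "herm_bounded N (\<lambda>x. of_real (x (l, k)) + (- \<i>) * of_real (x (k, l)))"
    by (intro herm_bounded_add herm_bounded_mult herm_bounded_const * assms)+
  then show ?thesis using * assms by (cases k l rule: linorder_cases) (simp_all add: herm_entry_eq)
qed

lemma herm_poly_bounded: "herm_poly N f D \<Longrightarrow> herm_bounded N f"
  by (induction rule: herm_poly.induct)
    (auto intro: herm_bounded_const herm_bounded_add herm_bounded_mult herm_bounded_entry)

lemma herm_poly_deriv_bounded: "herm_poly N f D \<Longrightarrow> herm_bounded N (D i j)"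
proof (induction rule: herm_poly.induct)
  case (mult f D g E)
  then show ?case by (intro herm_bounded_add herm_bounded_mult) (auto intro: herm_poly_bounded)
qed (auto intro: herm_bounded_const herm_bounded_add)

text \<open>The chain rule in real coordinates. A coordinate above the diagonal is the real part
  shared by two conjugate entries. A coordinate (i, j) below it is an imaginary part, entering the
  entry (j, i) with factor \<i> and the entry (i, j) with factor -\<i>.\<close>

definition herm_coord_deriv where
  "herm_coord_deriv D = (\<lambda>(i, j) x. if i = j then D i i x
     else if i < j then D i j x + D j i x else \<i> * (D j i x - D i j x :: complex))"

lemma herm_coord_deriv_entry:
  assumes "k < N" "l < N" "p \<in> {..<N} \<times> {..<N}"
  shows "((\<lambda>t. herm_entry N (x(p := t)) k l) has_vector_derivative
    herm_coord_deriv (\<lambda>i j x. if i = k \<and> j = l then 1 else 0) p (x(p := t))) (at t)"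
proof -
  have c: "(complex_of_real has_vector_derivative 1) (at t)"
    using has_vector_derivative_of_real[OF DERIV_ident] by simp
  obtain i j where p: "p = (i, j)" by force
  show ?thesis
    using assms unfolding p
    by (cases k l rule: linorder_cases)
      (auto simp: herm_entry_eq fun_upd_def herm_coord_deriv_def intro!: derivative_eq_intros c)
qed

lemma herm_poly_has_deriv:
  assumes "herm_poly N f D" "p \<in> {..<N} \<times> {..<N}"
  shows "((\<lambda>t. f (x(p := t))) has_vector_derivative herm_coord_deriv D p (x(p := t))) (at t)"
  using assms(1)
proof (induction arbitrary: t rule: herm_poly.induct)
  case (const c)
  then show ?case by (auto simp: herm_coord_deriv_def split: prod.split)
next
  case (entry k l)
  then show ?case using assms(2) by (intro herm_coord_deriv_entry)
next
  case (add f D g E)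
  show ?case
    by (rule has_vector_derivative_eq_rhs[OF has_vector_derivative_add[OF add.IH]])
      (auto simp: herm_coord_deriv_def algebra_simps split: prod.split)
next
  case (mult f D g E)
  show ?case
    by (rule has_vector_derivative_eq_rhs[OF has_vector_derivative_mult[OF mult.IH]])
      (auto simp: herm_coord_deriv_def algebra_simps split: prod.split)
qed

lemma herm_poly_continuous:
  assumes "herm_poly N f D" "p \<in> {..<N} \<times> {..<N}"
  shows "continuous_on UNIV (\<lambda>t. f (x(p := t)))"
  using herm_poly_has_deriv[OF assms]
  by (auto simp: continuous_on_eq_continuous_at has_vector_derivative_def intro: has_derivative_continuous)

lemma herm_poly_deriv_continuous:
  assumes "herm_poly N f D" "p \<in> {..<N} \<times> {..<N}"
  shows "continuous_on UNIV (\<lambda>t. D i j (x(p := t)))"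
  using assms(1)
proof (induction rule: herm_poly.induct)
  case (mult f D g E)
  then show ?case using assms(2)
    by (intro continuous_on_add continuous_on_mult herm_poly_continuous[of N f D] herm_poly_continuous[of N g E])
qed (auto intro: continuous_intros)

text \<open>The coefficients of the quadratic form N tr M^2 / 2: an off-diagonal coordinate enters
  tr M^2 through two entries and hence counts twice.\<close>

definition herm_weight :: "nat \<Rightarrow> nat \<times> nat \<Rightarrow> real" where
  "herm_weight N = (\<lambda>(i, j). if i = j then real N / 2 else real N)"

lemma gaussian_weight_eq:
  "gaussian_weight N (hermitian_mat N x) =
     of_real (\<Prod>p\<in>{..<N} \<times> {..<N}. exp (- herm_weight N p * (x p)\<^sup>2))"
proof -
  have dim: "dim_row (hermitian_mat N x) = N" "dim_col (hermitian_mat N x) = N"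
    by (simp_all add: hermitian_mat_def)
  define q where "q = (\<lambda>(i, j). if i = j then (x (i, i))\<^sup>2 else (x (i, j))\<^sup>2 + (x (j, i))\<^sup>2)"
  have "mat_trace (hermitian_mat N x ^\<^sub>m 2) = (\<Sum>i<N. \<Sum>j<N. herm_entry N x i j * herm_entry N x j i)"
    using dim by (simp add: mat_trace_def numeral_2_eq_2 scalar_prod_def atLeast0LessThan)
  also have "\<dots> = (\<Sum>p\<in>{..<N} \<times> {..<N}. of_real (q p))"
    unfolding sum.cartesian_product
    by (rule sum.cong) (auto simp: herm_entry_eq q_def complex_eq_iff power2_eq_square)
  also have "\<dots> = of_real (\<Sum>p\<in>{..<N} \<times> {..<N}. (if fst p = snd p then 1 else 2) * (x p)\<^sup>2)"
  proof -
    \<comment> \<open>\<open>q p\<close> contains the squares of both coordinates of a conjugate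
      pair, one stored at p and one at the transposed index; transposing the sum turns this into the
      factor 2.\<close>
    have "(\<Sum>p\<in>{..<N} \<times> {..<N}. (if fst p = snd p then 0 else (x (snd p, fst p))\<^sup>2)) =
      (\<Sum>p\<in>{..<N} \<times> {..<N}. (if fst p = snd p then 0 else (x p)\<^sup>2))"
      by (rule sum.reindex_bij_witness[where i = prod.swap and j = prod.swap]) auto
    moreover have "(\<Sum>p\<in>{..<N} \<times> {..<N}. q p) = (\<Sum>p\<in>{..<N} \<times> {..<N}. (x p)\<^sup>2) +
       (\<Sum>p\<in>{..<N} \<times> {..<N}. (if fst p = snd p then 0 else (x (snd p, fst p))\<^sup>2))"
      by (auto simp: q_def sum.distrib[symmetric] intro!: sum.cong)
    moreover have "(\<Sum>p\<in>{..<N} \<times> {..<N}. (if fst p = snd p then 1 else 2) * (x p)\<^sup>2) =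
       (\<Sum>p\<in>{..<N} \<times> {..<N}. (x p)\<^sup>2) + (\<Sum>p\<in>{..<N} \<times> {..<N}. (if fst p = snd p then 0 else (x p)\<^sup>2))"
      by (auto simp: sum.distrib[symmetric] intro!: sum.cong)
    ultimately show ?thesis by (simp flip: of_real_sum)
  qed
  finally have "- of_nat N * (mat_trace (hermitian_mat N x ^\<^sub>m 2) / 2) =
     of_real (\<Sum>p\<in>{..<N} \<times> {..<N}. - herm_weight N p * (x p)\<^sup>2)"
    by (auto simp: sum_divide_distrib sum_distrib_left sum_negf[symmetric] herm_weight_def
        complex_eq_iff split: prod.split intro!: sum.cong)
  then have "gaussian_weight N (hermitian_mat N x) =
      of_real (exp (\<Sum>p\<in>{..<N} \<times> {..<N}. - herm_weight N p * (x p)\<^sup>2))"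
    by (simp only: gaussian_weight_def exp_of_real)
  then show ?thesis by (simp add: exp_sum)
qed

interpretation lborel_product: product_sigma_finite "\<lambda>_. lborel :: real measure"
  by standard

lemma herm_weight_pos: "1 \<le> N \<Longrightarrow> 0 < herm_weight N p"
  by (auto simp: herm_weight_def split: prod.split)

lemma herm_bounded_integrable:
  assumes "1 \<le> N" "herm_bounded N f"
  shows "integrable (hermitian_lborel N) (\<lambda>x. gaussian_weight N (hermitian_mat N x) * f x)"
proof -
  obtain C k where b: "\<And>x. norm (f x) \<le> C * (\<Prod>p\<in>{..<N} \<times> {..<N}. 1 + \<bar>x p\<bar>) ^ k"
    and m: "f \<in> borel_measurable (hermitian_lborel N)"
    using assms unfolding herm_bounded_def by blast
  have "integrable (hermitian_lborel N)
      (\<lambda>x. C * (\<Prod>p\<in>{..<N} \<times> {..<N}. (1 + \<bar>x p\<bar>) ^ k * exp (- herm_weight N p * (x p)\<^sup>2)))"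
    unfolding hermitian_lborel_def
    by (intro integrable_mult_right lborel_product.product_integrable_prod integrable_gaussian_poly
      herm_weight_pos assms) auto
  then show ?thesis
  proof (rule Bochner_Integration.integrable_bound)
    have "(\<lambda>x. complex_of_real (\<Prod>p\<in>{..<N} \<times> {..<N}. exp (- herm_weight N p * (x p)\<^sup>2))) \<in> borel_measurable (hermitian_lborel N)"
      unfolding hermitian_lborel_def by measurable
    then show "(\<lambda>x. gaussian_weight N (hermitian_mat N x) * f x) \<in> borel_measurable (hermitian_lborel N)"
      unfolding gaussian_weight_eq by (intro borel_measurable_times m)
    show "AE x in hermitian_lborel N. norm (gaussian_weight N (hermitian_mat N x) * f x) \<le>
       norm (C * (\<Prod>p\<in>{..<N} \<times> {..<N}. (1 + \<bar>x p\<bar>) ^ k * exp (- herm_weight N p * (x p)\<^sup>2)))"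
    proof (rule AE_I2)
      fix x :: "nat \<times> nat \<Rightarrow> real"
      have "norm (gaussian_weight N (hermitian_mat N x) * f x) \<le>
        (\<Prod>p\<in>{..<N} \<times> {..<N}. exp (- herm_weight N p * (x p)\<^sup>2)) * (C * (\<Prod>p\<in>{..<N} \<times> {..<N}. 1 + \<bar>x p\<bar>) ^ k)"
        unfolding gaussian_weight_eq norm_mult norm_of_real
        by (intro mult_mono) (auto simp: b abs_prod prod_nonneg)
      also have "\<dots> = C * (\<Prod>p\<in>{..<N} \<times> {..<N}. (1 + \<bar>x p\<bar>) ^ k * exp (- herm_weight N p * (x p)\<^sup>2))"
        by (simp add: prod.distrib prod_power_distrib)
      finally show "norm (gaussian_weight N (hermitian_mat N x) * f x) \<le>
         norm (C * (\<Prod>p\<in>{..<N} \<times> {..<N}. (1 + \<bar>x p\<bar>) ^ k * exp (- herm_weight N p * (x p)\<^sup>2)))"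
        by simp
    qed
  qed
qed

definition herm_int :: "nat \<Rightarrow> ((nat \<times> nat \<Rightarrow> real) \<Rightarrow> complex) \<Rightarrow> complex" where
  "herm_int N f = (LINT x|hermitian_lborel N. gaussian_weight N (hermitian_mat N x) * f x)"

lemma herm_int_add:
  "1 \<le> N \<Longrightarrow> herm_bounded N f \<Longrightarrow> herm_bounded N g \<Longrightarrow>
    herm_int N (\<lambda>x. f x + g x) = herm_int N f + herm_int N g"
  unfolding herm_int_def distrib_left
  by (intro Bochner_Integration.integral_add herm_bounded_integrable)

lemma herm_int_cmult: "herm_int N (\<lambda>x. c * f x) = c * herm_int N f"
  unfolding herm_int_def by (simp add: mult.left_commute[of _ c])

lemma herm_bounded_sum:
  "(\<And>i. i \<in> A \<Longrightarrow> herm_bounded N (f i)) \<Longrightarrow> herm_bounded N (\<lambda>x. \<Sum>i\<in>A. f i x)"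
  by (induction A rule: infinite_finite_induct) (auto intro: herm_bounded_const herm_bounded_add)

lemma herm_int_sum:
  assumes "1 \<le> N" "\<And>i. i \<in> A \<Longrightarrow> herm_bounded N (f i)"
  shows "herm_int N (\<lambda>x. \<Sum>i\<in>A. f i x) = (\<Sum>i\<in>A. herm_int N (f i))"
  using assms unfolding herm_int_def sum_distrib_left
  by (intro Bochner_Integration.integral_sum herm_bounded_integrable)

lemma herm_coord_deriv_bounded:
  assumes "herm_poly N f D" "p \<in> {..<N} \<times> {..<N}"
  shows "herm_bounded N (herm_coord_deriv D p)"
proof -
  obtain i j where p: "p = (i, j)" by force
  have "herm_bounded N (\<lambda>x. \<i> * (D j i x + (-1) * D i j x))" "herm_bounded N (\<lambda>x. D i j x + D j i x)"
    by (intro herm_bounded_mult herm_bounded_add herm_bounded_const herm_poly_deriv_bounded[OF assms(1)])+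
  moreover have "herm_bounded N (\<lambda>x. D i i x)" for i using herm_poly_deriv_bounded[OF assms(1)] .
  ultimately show ?thesis by (cases i j rule: linorder_cases) (simp_all add: p herm_coord_deriv_def)
qed

text \<open>Both the Gaussian weight and the polynomial majorant factor over the coordinates, so
  Fubini isolates the coordinate p, and the inner integral is zero by the one-dimensional
  identity.\<close>

lemma herm_coord_integration_by_parts:
  fixes f :: "(nat \<times> nat \<Rightarrow> real) \<Rightarrow> complex"
  assumes N: "1 \<le> N" and f: "herm_poly N f D" and p: "p \<in> {..<N} \<times> {..<N}"
  shows "herm_int N (herm_coord_deriv D p) = 2 * herm_weight N p * herm_int N (\<lambda>x. of_real (x p) * f x)"
proof -
  define g where "g x = herm_coord_deriv D p x + of_real (- (2 * herm_weight N p)) * (of_real (x p) * f x)" for x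
  let ?I = "{..<N} \<times> {..<N}"
  have bx: "herm_bounded N (\<lambda>x. of_real (x p) * f x)"
    by (intro herm_bounded_mult herm_bounded_coord p herm_poly_bounded[OF f])
  have bd: "herm_bounded N (herm_coord_deriv D p)"
    by (rule herm_coord_deriv_bounded[OF f p])
  have bg: "herm_bounded N g"
    unfolding g_def by (intro herm_bounded_add bd herm_bounded_mult herm_bounded_const bx)
  obtain C k where Ck: "\<And>x. norm (f x) \<le> C * (\<Prod>p\<in>?I. 1 + \<bar>x p\<bar>) ^ k"
    using herm_poly_bounded[OF f] unfolding herm_bounded_def by blast
  obtain C' k' where Ck': "\<And>x. norm (herm_coord_deriv D p x) \<le> C' * (\<Prod>p\<in>?I. 1 + \<bar>x p\<bar>) ^ k'"
    using bd unfolding herm_bounded_def by blast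
  have I: "insert p (?I - {p}) = ?I" using p by auto
  have "herm_int N g = (LINT x|(\<Pi>\<^sub>M p\<in>insert p (?I - {p}). lborel). gaussian_weight N (hermitian_mat N x) * g x)"
    unfolding herm_int_def hermitian_lborel_def I ..
  also have "\<dots> = (LINT x|(\<Pi>\<^sub>M p\<in>?I - {p}. lborel). LINT t|lborel.
     gaussian_weight N (hermitian_mat N (x(p := t))) * g (x(p := t)))"
    by (rule lborel_product.product_integral_insert)
      (simp, simp, unfold I, use herm_bounded_integrable[OF N bg] in \<open>simp add: hermitian_lborel_def\<close>)
  also have "\<dots> = (LINT x|(\<Pi>\<^sub>M p\<in>?I - {p}. lborel :: real measure). 0)"
  proof (rule Bochner_Integration.integral_cong[OF refl])
    fix x :: "nat \<times> nat \<Rightarrow> real"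
    let ?s = "herm_weight N p"
    let ?c = "\<Prod>q\<in>?I - {p}. exp (- herm_weight N q * (x q)\<^sup>2)"
    let ?Q = "\<Prod>q\<in>?I - {p}. 1 + \<bar>x q\<bar>"
    have split: "(\<Prod>q\<in>?I. h q ((x(p := t)) q)) = h p t * (\<Prod>q\<in>?I - {p}. h q (x q))" for h :: "_ \<Rightarrow> _ \<Rightarrow> real" and t
      using p by (subst prod.remove[of _ p]) (auto intro!: prod.cong)
    have Q: "1 \<le> ?Q" by (intro prod_ge_1) auto
    have C: "0 \<le> C * 1" "0 \<le> C' * 1"
      using order_trans[OF norm_ge_zero Ck[of "\<lambda>_. 0"]] order_trans[OF norm_ge_zero Ck'[of "\<lambda>_. 0"]] by simp_all
    \<comment> \<open>With the other coordinates frozen the product majorant is (1 + |t|) times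
      \<open>?Q\<close>; \<open>B\<close> and the exponent k + k' bound the function and its
      derivative simultaneously.\<close>
    define B where "B = C * ?Q ^ k + C' * ?Q ^ k'"
    have "(LINT t|lborel. of_real (exp (- ?s * t\<^sup>2)) *
        (herm_coord_deriv D p (x(p := t)) - of_real (2 * ?s * t) * f (x(p := t)))) = 0"
    proof (rule gaussian_integration_by_parts_1d[of ?s _ _ B "k + k'"])
      show "0 < ?s" by (rule herm_weight_pos[OF N])
      show "((\<lambda>t. f (x(p := t))) has_vector_derivative herm_coord_deriv D p (x(p := t))) (at t)" for t
        by (rule herm_poly_has_deriv[OF f p])
      obtain i j where "p = (i, j)" by force
      then show "continuous_on UNIV (\<lambda>t. herm_coord_deriv D p (x(p := t)))"
        using herm_poly_deriv_continuous[OF f p]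
        by (cases i j rule: linorder_cases) (auto simp: herm_coord_deriv_def intro!: continuous_intros)
      fix t
      have P: "(\<Prod>q\<in>?I. 1 + \<bar>(x(p := t)) q\<bar>) = (1 + \<bar>t\<bar>) * ?Q"
        by (rule split)
      have "C * ((1 + \<bar>t\<bar>) * ?Q) ^ k \<le> B * (1 + \<bar>t\<bar>) ^ (k + k')"
        unfolding power_mult_distrib mult.left_commute[of C] mult.commute[of B]
        using C Q by (intro mult_mono[OF power_increasing]) (auto simp: B_def)
      then show "norm (f (x(p := t))) \<le> B * (1 + \<bar>t\<bar>) ^ (k + k')"
        using Ck[of "x(p := t)"] unfolding P by linarith
      have "C' * ((1 + \<bar>t\<bar>) * ?Q) ^ k' \<le> B * (1 + \<bar>t\<bar>) ^ (k + k')"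
        unfolding power_mult_distrib mult.left_commute[of C'] mult.commute[of B]
        using C Q by (intro mult_mono[OF power_increasing]) (auto simp: B_def)
      then show "norm (herm_coord_deriv D p (x(p := t))) \<le> B * (1 + \<bar>t\<bar>) ^ (k + k')"
        using Ck'[of "x(p := t)"] unfolding P by linarith
    qed
    then have "of_real ?c * (LINT t|lborel. of_real (exp (- ?s * t\<^sup>2)) *
        (herm_coord_deriv D p (x(p := t)) - of_real (2 * ?s * t) * f (x(p := t)))) = 0"
      by simp
    also have "of_real ?c * (LINT t|lborel. of_real (exp (- ?s * t\<^sup>2)) *
        (herm_coord_deriv D p (x(p := t)) - of_real (2 * ?s * t) * f (x(p := t)))) =
        (LINT t|lborel. gaussian_weight N (hermitian_mat N (x(p := t))) * g (x(p := t)))"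
      unfolding gaussian_weight_eq split[of "\<lambda>q y. exp (- herm_weight N q * y\<^sup>2)"]
      by (simp add: g_def mult_ac diff_conv_add_uminus flip: integral_mult_right_zero del: add_uminus_conv_diff)
    finally show "(LINT t|lborel. gaussian_weight N (hermitian_mat N (x(p := t))) * g (x(p := t))) = 0" .
  qed
  finally have "herm_int N g = 0" by simp
  moreover have "herm_int N g = herm_int N (herm_coord_deriv D p) +
      herm_int N (\<lambda>x. of_real (- (2 * herm_weight N p)) * (of_real (x p) * f x))"
    unfolding g_def by (intro herm_int_add N bd herm_bounded_mult[OF herm_bounded_const bx])
  ultimately have "herm_int N (herm_coord_deriv D p) +
      of_real (- (2 * herm_weight N p)) * herm_int N (\<lambda>x. of_real (x p) * f x) = 0"
    by (simp only: herm_int_cmult)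
  then show ?thesis by (simp add: mult.assoc add_eq_0_iff)
qed

text \<open>The derivative of tr M^2 / 2 in the entry (i, j) is the entry (j, i), which explains the
  transposed index. Off the diagonal the identity is a complex combination of those for the real and
  for the imaginary coordinate.\<close>

lemma herm_integration_by_parts:
  fixes f :: "(nat \<times> nat \<Rightarrow> real) \<Rightarrow> complex"
  assumes N: "1 \<le> N" and f: "herm_poly N f D" and ij: "i < N" "j < N"
  shows "of_nat N * herm_int N (\<lambda>x. herm_entry N x j i * f x) = herm_int N (D i j)"
proof -
  have bD: "herm_bounded N (D i j)" for i j by (rule herm_poly_deriv_bounded[OF f])
  have bx: "herm_bounded N (\<lambda>x. of_real (x p) * f x)" if "p \<in> {..<N} \<times> {..<N}" for p
    by (intro herm_bounded_mult herm_bounded_coord that herm_poly_bounded[OF f])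
  have lin: "herm_int N (\<lambda>x. (of_real (x p) + c * of_real (x q)) * f x) =
      herm_int N (\<lambda>x. x p * f x) + c * herm_int N (\<lambda>x. x q * f x)"
    if "p \<in> {..<N} \<times> {..<N}" "q \<in> {..<N} \<times> {..<N}" for p q c
    unfolding distrib_right mult.assoc
    by (subst herm_int_add) (auto simp only: herm_int_cmult intro!: N bx that herm_bounded_mult[OF herm_bounded_const])
  have off: "of_nat N * herm_int N (\<lambda>x. x (i, j) * f x) = (herm_int N (D i j) + herm_int N (D j i)) / 2"
    "of_nat N * herm_int N (\<lambda>x. x (j, i) * f x) = \<i> * (herm_int N (D i j) - herm_int N (D j i)) / 2"
    if "i < j" "j < N" for i j
  proof -
    have "herm_int N (\<lambda>x. D i j x + D j i x) = 2 * of_nat N * herm_int N (\<lambda>x. x (i, j) * f x)"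
      using herm_coord_integration_by_parts[OF N f, of "(i, j)"] that
      by (simp add: herm_coord_deriv_def herm_weight_def)
    then show "of_nat N * herm_int N (\<lambda>x. x (i, j) * f x) = (herm_int N (D i j) + herm_int N (D j i)) / 2"
      unfolding herm_int_add[OF N bD bD] by (simp add: field_simps)
    have "herm_int N (\<lambda>x. \<i> * (D i j x + (- 1) * D j i x)) = 2 * of_nat N * herm_int N (\<lambda>x. x (j, i) * f x)"
      using herm_coord_integration_by_parts[OF N f, of "(j, i)"] that
      by (simp add: herm_coord_deriv_def herm_weight_def)
    then show "of_nat N * herm_int N (\<lambda>x. x (j, i) * f x) = \<i> * (herm_int N (D i j) - herm_int N (D j i)) / 2"
      unfolding herm_int_cmult herm_int_add[OF N bD herm_bounded_mult[OF herm_bounded_const bD]] by simp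
  qed
  consider "i = j" | "i < j" | "j < i" by linarith
  then show ?thesis
  proof cases
    case 1
    then show ?thesis using herm_coord_integration_by_parts[OF N f, of "(i, j)"] ij
      by (simp add: herm_coord_deriv_def herm_weight_def herm_entry_eq)
  next
    case 2
    have "herm_int N (\<lambda>x. herm_entry N x j i * f x) =
      herm_int N (\<lambda>x. x (i, j) * f x) + (- \<i>) * herm_int N (\<lambda>x. x (j, i) * f x)"
      using lin[of "(i, j)" "(j, i)" "- \<i>"] 2 ij by (simp add: herm_entry_eq)
    then have "of_nat N * herm_int N (\<lambda>x. herm_entry N x j i * f x) =
      of_nat N * herm_int N (\<lambda>x. x (i, j) * f x) + (- \<i>) * (of_nat N * herm_int N (\<lambda>x. x (j, i) * f x))"
      by (simp only: distrib_left mult.left_commute)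
    then show ?thesis unfolding off[OF 2 ij(2)] by (simp add: field_simps)
  next
    case 3
    have "herm_int N (\<lambda>x. herm_entry N x j i * f x) =
      herm_int N (\<lambda>x. x (j, i) * f x) + \<i> * herm_int N (\<lambda>x. x (i, j) * f x)"
      using lin[of "(j, i)" "(i, j)" "\<i>"] 3 ij by (simp add: herm_entry_eq)
    then have "of_nat N * herm_int N (\<lambda>x. herm_entry N x j i * f x) =
      of_nat N * herm_int N (\<lambda>x. x (j, i) * f x) + \<i> * (of_nat N * herm_int N (\<lambda>x. x (i, j) * f x))"
      by (simp only: distrib_left mult.left_commute)
    then show ?thesis unfolding off[OF 3 ij(1)] by (simp add: field_simps)
  qed
qed

section \<open>Loop equations at finite N\<close>

text \<open>\<open>herm_poly\<close> determines the derivative as a function of all index pairs,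
  whereas matrix identities hold only for indices below N; equality is therefore asked for in that
  range alone.\<close>

definition herm_deriv where
  "herm_deriv N f D \<longleftrightarrow> (\<exists>D'. herm_poly N f D' \<and> (\<forall>i<N. \<forall>j<N. D' i j = D i j))"

lemma herm_deriv_const: "herm_deriv N (\<lambda>x. c) (\<lambda>i j x. 0)"
  unfolding herm_deriv_def by (auto intro: herm_poly.const)

lemma herm_deriv_entry:
  "k < N \<Longrightarrow> l < N \<Longrightarrow>
    herm_deriv N (\<lambda>x. herm_entry N x k l) (\<lambda>i j x. if i = k \<and> j = l then 1 else 0)"
  unfolding herm_deriv_def by (blast intro: herm_poly.entry)

lemma herm_deriv_cong:
  "herm_deriv N f D \<Longrightarrow> (\<And>x. f x = g x) \<Longrightarrow> (\<And>i j x. i < N \<Longrightarrow> j < N \<Longrightarrow> D i j x = E i j x) \<Longrightarrow> herm_deriv N g E"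
  unfolding herm_deriv_def by (metis ext)

lemma herm_deriv_add:
  assumes "herm_deriv N f D" "herm_deriv N g E"
  shows "herm_deriv N (\<lambda>x. f x + g x) (\<lambda>i j x. D i j x + E i j x)"
proof -
  obtain D' E' where *: "herm_poly N f D'" "herm_poly N g E'"
    "\<forall>i<N. \<forall>j<N. D' i j = D i j" "\<forall>i<N. \<forall>j<N. E' i j = E i j"
    using assms unfolding herm_deriv_def by blast
  show ?thesis unfolding herm_deriv_def
    by (rule exI, rule conjI[OF herm_poly.add[OF *(1,2)]]) (use * in auto)
qed

lemma herm_deriv_mult:
  assumes "herm_deriv N f D" "herm_deriv N g E"
  shows "herm_deriv N (\<lambda>x. f x * g x) (\<lambda>i j x. D i j x * g x + f x * E i j x)"
proof -
  obtain D' E' where *: "herm_poly N f D'" "herm_poly N g E'"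
    "\<forall>i<N. \<forall>j<N. D' i j = D i j" "\<forall>i<N. \<forall>j<N. E' i j = E i j"
    using assms unfolding herm_deriv_def by blast
  show ?thesis unfolding herm_deriv_def
    by (rule exI, rule conjI[OF herm_poly.mult[OF *(1,2)]]) (use * in auto)
qed

lemma herm_deriv_cmult:
  assumes "herm_deriv N f D"
  shows "herm_deriv N (\<lambda>x. c * f x) (\<lambda>i j x. c * D i j x)"
  by (rule herm_deriv_cong[OF herm_deriv_mult[OF herm_deriv_const assms]]) auto

lemma herm_deriv_sum:
  assumes "\<And>s. s \<in> A \<Longrightarrow> herm_deriv N (f s) (D s)"
  shows "herm_deriv N (\<lambda>x. \<Sum>s\<in>A. f s x) (\<lambda>i j x. \<Sum>s\<in>A. D s i j x)"
  using assms by (induction A rule: infinite_finite_induct) (auto intro: herm_deriv_const herm_deriv_add)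

lemma herm_deriv_bounded: "herm_deriv N f D \<Longrightarrow> herm_bounded N f"
  unfolding herm_deriv_def using herm_poly_bounded by blast

lemma herm_deriv_int:
  assumes "1 \<le> N" "herm_deriv N f D" "i < N" "j < N"
  shows "of_nat N * herm_int N (\<lambda>x. herm_entry N x j i * f x) = herm_int N (D i j)"
proof -
  obtain D' where D': "herm_poly N f D'" "D' i j = D i j"
    using assms(2-4) unfolding herm_deriv_def by blast
  show ?thesis using herm_integration_by_parts[OF assms(1) D'(1) assms(3,4)] unfolding D'(2) .
qed

section \<open>Powers, traces and the interaction\<close>

abbreviation pow_entry :: "nat \<Rightarrow> nat \<Rightarrow> nat \<Rightarrow> nat \<Rightarrow> (nat \<times> nat \<Rightarrow> real) \<Rightarrow> complex" where
  "pow_entry N n k l x \<equiv> (hermitian_mat N x ^\<^sub>m n) $$ (k, l)"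

abbreviation pow_trace :: "nat \<Rightarrow> nat \<Rightarrow> (nat \<times> nat \<Rightarrow> real) \<Rightarrow> complex" where
  "pow_trace N n x \<equiv> mat_trace (hermitian_mat N x ^\<^sub>m n)"

lemma hermitian_mat_carrier [simp]: "hermitian_mat N x \<in> carrier_mat N N"
  by (simp add: hermitian_mat_def)

lemma hermitian_mat_dim [simp]: "dim_row (hermitian_mat N x) = N" "dim_col (hermitian_mat N x) = N"
  using hermitian_mat_carrier by blast+

lemma pow_entry_0: "k < N \<Longrightarrow> l < N \<Longrightarrow> pow_entry N 0 k l x = (if k = l then 1 else 0)"
  by simp

lemma pow_entry_Suc:
  "k < N \<Longrightarrow> l < N \<Longrightarrow> pow_entry N (Suc n) k l x = (\<Sum>s<N. pow_entry N n k s x * herm_entry N x s l)"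
  by (simp add: scalar_prod_def atLeast0LessThan)

lemma pow_entry_add:
  "k < N \<Longrightarrow> l < N \<Longrightarrow> pow_entry N (m + n) k l x = (\<Sum>s<N. pow_entry N m k s x * pow_entry N n s l x)"
proof (induction n arbitrary: l)
  case 0
  have "(\<Sum>s<N. pow_entry N m k s x * pow_entry N 0 s l x) = (\<Sum>s\<in>{l}. pow_entry N m k s x)"
    using 0 by (intro sum.mono_neutral_cong_right) (auto simp: pow_entry_0)
  then show ?case by simp
next
  case (Suc n)
  have "pow_entry N (m + Suc n) k l x = (\<Sum>t<N. pow_entry N (m + n) k t x * herm_entry N x t l)"
    unfolding add_Suc_right using Suc.prems by (rule pow_entry_Suc)
  also have "\<dots> = (\<Sum>t<N. \<Sum>s<N. pow_entry N m k s x * pow_entry N n s t x * herm_entry N x t l)"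
    using Suc.prems Suc.IH by (simp add: sum_distrib_right)
  also have "\<dots> = (\<Sum>s<N. \<Sum>t<N. pow_entry N m k s x * pow_entry N n s t x * herm_entry N x t l)"
    by (rule sum.swap)
  also have "\<dots> = (\<Sum>s<N. pow_entry N m k s x * pow_entry N (Suc n) s l x)"
    using Suc.prems by (intro sum.cong refl, subst pow_entry_Suc) (auto simp: sum_distrib_left mult.assoc simp del: pow_mat.simps)
  finally show ?case .
qed

lemma pow_trace_eq: "pow_trace N n x = (\<Sum>k<N. pow_entry N n k k x)"
  by (simp add: mat_trace_def)

lemma pow_trace_add: "pow_trace N (m + n) x = (\<Sum>i<N. \<Sum>j<N. pow_entry N m i j x * pow_entry N n j i x)"
  unfolding pow_trace_eq by (intro sum.cong refl, rule pow_entry_add) auto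

lemma pow_trace_Suc: "pow_trace N (Suc n) x = (\<Sum>i<N. \<Sum>j<N. pow_entry N n i j x * herm_entry N x j i)"
  unfolding pow_trace_eq by (intro sum.cong refl, rule pow_entry_Suc) auto

lemma pow_entry_deriv:
  "k < N \<Longrightarrow> l < N \<Longrightarrow> herm_deriv N (pow_entry N n k l)
     (\<lambda>i j x. \<Sum>r<n. pow_entry N r k i x * pow_entry N (n - 1 - r) j l x)"
proof (induction n arbitrary: l)
  case 0
  then show ?case using herm_deriv_const by (simp add: pow_entry_0 del: pow_mat.simps)
next
  case (Suc n)
  have "herm_deriv N (\<lambda>x. \<Sum>s<N. pow_entry N n k s x * herm_entry N x s l)
    (\<lambda>i j x. \<Sum>s<N. (\<Sum>r<n. pow_entry N r k i x * pow_entry N (n - 1 - r) j s x) * herm_entry N x s l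
       + pow_entry N n k s x * (if i = s \<and> j = l then 1 else 0))"
    using Suc.prems by (intro herm_deriv_sum herm_deriv_mult Suc.IH herm_deriv_entry) auto
  then show ?case
  proof (rule herm_deriv_cong)
    fix x
    show "(\<Sum>s<N. pow_entry N n k s x * herm_entry N x s l) = pow_entry N (Suc n) k l x"
      using Suc.prems by (simp only: pow_entry_Suc)
    fix i j assume ij: "i < N" "j < N"
    have "(\<Sum>s<N. (\<Sum>r<n. pow_entry N r k i x * pow_entry N (n - 1 - r) j s x) * herm_entry N x s l) =
      (\<Sum>r<n. pow_entry N r k i x * (\<Sum>s<N. pow_entry N (n - 1 - r) j s x * herm_entry N x s l))"
      unfolding sum_distrib_left sum_distrib_right by (subst sum.swap) (simp only: mult.assoc)
    also have "\<dots> = (\<Sum>r<n. pow_entry N r k i x * pow_entry N (n - r) j l x)"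
    proof (rule sum.cong[OF refl])
      fix r assume "r \<in> {..<n}"
      then have "n - r = Suc (n - 1 - r)" by auto
      then show "pow_entry N r k i x * (\<Sum>s<N. pow_entry N (n - 1 - r) j s x * herm_entry N x s l) =
        pow_entry N r k i x * pow_entry N (n - r) j l x"
        using ij Suc.prems by (simp only: pow_entry_Suc)
    qed
    moreover have "(\<Sum>s<N. pow_entry N n k s x * (if i = s \<and> j = l then 1 else 0)) =
       pow_entry N n k i x * pow_entry N 0 j l x"
    proof -
      have "(\<Sum>s<N. pow_entry N n k s x * (if i = s \<and> j = l then 1 else 0)) =
        (\<Sum>s\<in>{i}. pow_entry N n k s x * (if i = s \<and> j = l then 1 else 0))"
        using ij by (intro sum.mono_neutral_right) auto
      then show ?thesis using ij Suc.prems by (simp add: pow_entry_0 del: pow_mat.simps)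
    qed
    ultimately show "(\<Sum>s<N. (\<Sum>r<n. pow_entry N r k i x * pow_entry N (n - 1 - r) j s x) * herm_entry N x s l
       + pow_entry N n k s x * (if i = s \<and> j = l then 1 else 0)) =
      (\<Sum>r<Suc n. pow_entry N r k i x * pow_entry N (Suc n - 1 - r) j l x)"
      by (simp add: sum.distrib del: pow_mat.simps)
  qed
qed

text \<open>By cyclicity of the trace, each of the n + 1 positions of the differentiated factor
  gives the same entry of M^n.\<close>

lemma pow_trace_deriv:
  "herm_deriv N (pow_trace N (Suc n)) (\<lambda>i j x. of_nat (Suc n) * pow_entry N n j i x)"
proof -
  have "herm_deriv N (\<lambda>x. \<Sum>k<N. pow_entry N (Suc n) k k x)
     (\<lambda>i j x. \<Sum>k<N. \<Sum>r<Suc n. pow_entry N r k i x * pow_entry N (Suc n - 1 - r) j k x)"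
    by (intro herm_deriv_sum pow_entry_deriv) auto
  then show ?thesis
  proof (rule herm_deriv_cong)
    fix i j x assume ij: "i < N" "j < N"
    have "(\<Sum>k<N. \<Sum>r<Suc n. pow_entry N r k i x * pow_entry N (Suc n - 1 - r) j k x) =
      (\<Sum>r<Suc n. \<Sum>k<N. pow_entry N (Suc n - 1 - r) j k x * pow_entry N r k i x)"
      by (subst sum.swap) (simp only: mult.commute)
    also have "\<dots> = (\<Sum>r<Suc n. pow_entry N (Suc n - 1 - r + r) j i x)"
      using ij by (simp only: pow_entry_add)
    also have "\<dots> = (\<Sum>r<Suc n. pow_entry N n j i x)"
      by (rule sum.cong) auto
    finally show "(\<Sum>k<N. \<Sum>r<Suc n. pow_entry N r k i x * pow_entry N (Suc n - 1 - r) j k x) =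
      of_nat (Suc n) * pow_entry N n j i x" by simp
  qed (simp only: pow_trace_eq)
qed

lemma pow_trace_herm_bounded: "herm_bounded N (pow_trace N n)"
proof (cases n)
  case 0
  have "herm_bounded N (\<lambda>x. of_nat N)" by (rule herm_bounded_const)
  then show ?thesis by (simp add: 0 pow_trace_eq pow_entry_0 cong: sum.cong_simp del: pow_mat.simps)
qed (use pow_trace_deriv herm_deriv_bounded in blast)

abbreviation int_coeff :: "nat \<Rightarrow> nat multiset \<Rightarrow> (nat \<times> nat \<Rightarrow> real) \<Rightarrow> complex" where
  "int_coeff N l x \<equiv> mps_coeff (interaction N (hermitian_mat N x)) l"

lemma int_coeff_empty: "int_coeff N {#} x = 1"
  unfolding interaction_def by (rule mps_coeff_exp_0) (simp add: mps_suminf_def mps_X_def mps_coeff_const)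

text \<open>The interaction is an exponential, so its derivative in one formal variable is a
  multiple of itself. Read coefficient by coefficient, this is a recursion on the multiset, which
  replaces an explicit multinomial formula.\<close>

lemma int_coeff_add_mset:
  "of_nat (Suc (count l p)) * int_coeff N (add_mset p l) x =
     of_nat N * pow_trace N (Suc p) x / of_nat (Suc p) * int_coeff N l x"
proof -
  define s where "s = mps_suminf (\<lambda>i. mps_const (pow_trace N (Suc i) x / of_nat (Suc i)) * mps_X i)"
  have s: "mps_coeff s l = (if size l = 1 then pow_trace N (Suc (the_elem (set_mset l))) x /
      of_nat (Suc (the_elem (set_mset l))) else 0)" for l
  proof -
    have "mps_coeff s l = (\<Sum>i\<in>set_mset l. (if l = {#i#} then pow_trace N (Suc i) x / of_nat (Suc i) else 0))"
      unfolding s_def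
      by (subst mps_coeff_suminf[of "set_mset l"]) (auto simp: mps_X_def intro!: sum.cong)
    then show ?thesis
      by (cases "\<exists>i. l = {#i#}")
        (auto simp del: pow_mat.simps One_nat_def dest: size_1_singleton_mset intro!: sum.neutral)
  qed
  have "mps_deriv p s = mps_const (pow_trace N (Suc p) x / of_nat (Suc p))"
    by (rule mps_eqI) (auto simp: mps_coeff_deriv s mps_coeff_const)
  moreover have "mps_deriv p (interaction N (hermitian_mat N x)) =
      mps_const (of_nat N) * mps_deriv p s * interaction N (hermitian_mat N x)"
    unfolding interaction_def s_def[symmetric] by (subst mps_deriv_exp) (auto simp: s)
  ultimately have "mps_coeff (mps_deriv p (interaction N (hermitian_mat N x))) l =
      mps_coeff (mps_const (of_nat N) * mps_const (pow_trace N (Suc p) x / of_nat (Suc p)) *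
        interaction N (hermitian_mat N x)) l"
    by simp
  then show ?thesis by (simp only: mps_coeff_deriv mult.assoc mps_coeff_const_mult) simp
qed

text \<open>The chain rule for the exponential, at the coefficient l: differentiating tr M^(p+1) /
  (p+1) in the entry (i, j) gives the (j, i) entry of M^p, and the variable in front of it removes p
  from l.\<close>

lemma int_coeff_deriv:
  "herm_deriv N (int_coeff N l)
     (\<lambda>i j x. \<Sum>p\<in>set_mset l. of_nat N * pow_entry N p j i x * int_coeff N (l - {#p#}) x)"
proof (induction l)
  case empty
  then show ?case by (simp add: int_coeff_empty herm_deriv_const)
next
  case (add q l)
  define \<alpha> where "\<alpha> x = of_nat N * pow_trace N (Suc q) x / of_nat (Suc q)" for x
  \<comment> \<open>The multiplicity of q after its insertion, by which the recursion for the
    coefficients divides.\<close>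
  define m where "m = (of_nat (Suc (count l q)) :: complex)"
  have m: "m \<noteq> 0" by (simp add: m_def del: of_nat_Suc)
  have step: "int_coeff N (add_mset q l) x = inverse m * (\<alpha> x * int_coeff N l x)" for x
    using int_coeff_add_mset[of l q N x] m by (simp add: m_def \<alpha>_def field_simps del: of_nat_Suc pow_mat.simps)
  have \<alpha>: "herm_deriv N \<alpha> (\<lambda>i j x. of_nat N * pow_entry N q j i x)"
    unfolding \<alpha>_def
    by (rule herm_deriv_cong[OF herm_deriv_cmult[OF pow_trace_deriv[of N q], where c = "of_nat N / of_nat (Suc q)"]])
      (simp_all del: of_nat_Suc pow_mat.simps)
  show ?case
  proof (rule herm_deriv_cong[OF herm_deriv_cmult[OF herm_deriv_mult[OF \<alpha> add.IH], where c = "inverse m"]])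
    fix i j x
    let ?d = "\<lambda>l p. of_nat N * pow_entry N p j i x * int_coeff N (l - {#p#}) x"
    have other: "\<alpha> x * ?d l p = m * ?d (add_mset q l) p" if "p \<in># l" "p \<noteq> q" for p
    proof -
      obtain l' where l': "l = add_mset p l'" using \<open>p \<in># l\<close> by (auto dest: multi_member_split)
      have "m * int_coeff N (add_mset q l') x = \<alpha> x * int_coeff N l' x"
        using int_coeff_add_mset[of l' q N x] \<open>p \<noteq> q\<close> by (simp add: m_def \<alpha>_def l' del: of_nat_Suc pow_mat.simps)
      then show ?thesis using \<open>p \<noteq> q\<close> by (simp add: l' mult_ac del: pow_mat.simps)
    qed
    \<comment> \<open>In l itself q has multiplicity m - 1, so this term reproduces m - 1 copies;
      the derivative of \<alpha> supplies the missing one, and then m cancels.\<close>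
    have self: "\<alpha> x * int_coeff N (l - {#q#}) x = (m - 1) * int_coeff N l x" if q: "q \<in># l"
    proof -
      obtain l' where l': "l = add_mset q l'" using q by (auto dest: multi_member_split)
      show ?thesis
        using int_coeff_add_mset[of l' q N x] by (simp add: m_def \<alpha>_def l' del: pow_mat.simps)
    qed
    have "\<alpha> x * (\<Sum>p\<in>set_mset l. ?d l p) = (\<Sum>p\<in>set_mset l - {q}. \<alpha> x * ?d l p) + (if q \<in># l then \<alpha> x * ?d l q else 0)"
      by (simp add: sum_distrib_left sum.remove[of "set_mset l" q] del: pow_mat.simps)
    also have "(\<Sum>p\<in>set_mset l - {q}. \<alpha> x * ?d l p) = m * (\<Sum>p\<in>set_mset l - {q}. ?d (add_mset q l) p)"
      unfolding sum_distrib_left by (intro sum.cong refl other) auto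
    also have "(if q \<in># l then \<alpha> x * ?d l q else 0) = (m - 1) * (of_nat N * pow_entry N q j i x * int_coeff N l x)"
    proof (cases "q \<in># l")
      case True
      then show ?thesis using self by (simp add: mult.left_commute del: pow_mat.simps)
    next
      case False
      then have "m = 1" by (simp add: m_def not_in_iff)
      then show ?thesis using False by simp
    qed
    finally have "of_nat N * pow_entry N q j i x * int_coeff N l x + \<alpha> x * (\<Sum>p\<in>set_mset l. ?d l p) =
      m * ((\<Sum>p\<in>set_mset l - {q}. ?d (add_mset q l) p) + of_nat N * pow_entry N q j i x * int_coeff N l x)"
      by (simp add: algebra_simps del: pow_mat.simps)
    also have "(\<Sum>p\<in>set_mset l - {q}. ?d (add_mset q l) p) + of_nat N * pow_entry N q j i x * int_coeff N l x =
       (\<Sum>p\<in>set_mset (add_mset q l). ?d (add_mset q l) p)"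
      by (subst sum.remove[of _ q]) (auto intro!: sum.cong simp: add.commute simp del: pow_mat.simps)
    finally show "inverse m * (of_nat N * pow_entry N q j i x * int_coeff N l x + \<alpha> x * (\<Sum>p\<in>set_mset l. ?d l p)) =
       (\<Sum>p\<in>set_mset (add_mset q l). ?d (add_mset q l) p)"
      using m by (simp del: pow_mat.simps)
  qed (simp only: step)
qed

lemma int_coeff_bounded: "herm_bounded N (int_coeff N l)"
  using int_coeff_deriv herm_deriv_bounded by blast

text \<open>Integration by parts applied to the (i, j) entry of M^n times a coefficient of the
  interaction, summed over i and j. Differentiating the power cuts one trace into two;
  differentiating the interaction merges two traces into one.\<close>

lemma schwinger_dyson:
  assumes N: "1 \<le> N"
  shows "of_nat N * herm_int N (\<lambda>x. pow_trace N (Suc n) x * int_coeff N l x) =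
    (\<Sum>k<n. herm_int N (\<lambda>x. pow_trace N k x * pow_trace N (n - 1 - k) x * int_coeff N l x)) +
    (\<Sum>p\<in>set_mset l. of_nat N * herm_int N (\<lambda>x. pow_trace N (n + p) x * int_coeff N (l - {#p#}) x))"
proof -
  let ?D = "\<lambda>i j x. (\<Sum>r<n. pow_entry N r i i x * pow_entry N (n - 1 - r) j j x) * int_coeff N l x
      + pow_entry N n i j x * (\<Sum>p\<in>set_mset l. of_nat N * pow_entry N p j i x * int_coeff N (l - {#p#}) x)"
  have bt: "herm_bounded N (\<lambda>x. pow_trace N k x)" for k using pow_trace_herm_bounded by simp
  have bc: "herm_bounded N (\<lambda>x. int_coeff N l x)" for l using int_coeff_bounded by simp
  have be: "herm_bounded N (\<lambda>x. pow_entry N n i j x)" if "i < N" "j < N" for n i j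
    using pow_entry_deriv[OF that] herm_deriv_bounded by blast
  have bD: "herm_bounded N (\<lambda>x. ?D i j x)" if "i < N" "j < N" for i j
    using that by (intro herm_bounded_add herm_bounded_mult herm_bounded_sum be bc herm_bounded_const)
  have "herm_int N (\<lambda>x. pow_trace N (Suc n) x * int_coeff N l x) =
     herm_int N (\<lambda>x. \<Sum>i<N. \<Sum>j<N. herm_entry N x j i * (pow_entry N n i j x * int_coeff N l x))"
    by (simp only: pow_trace_Suc sum_distrib_right) (simp only: mult_ac)
  also have "\<dots> = (\<Sum>i<N. \<Sum>j<N. herm_int N (\<lambda>x. herm_entry N x j i * (pow_entry N n i j x * int_coeff N l x)))"
    by (subst herm_int_sum[OF N], (intro herm_bounded_sum herm_bounded_mult be bc herm_bounded_entry; simp),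
        intro sum.cong refl herm_int_sum[OF N] herm_bounded_mult be bc herm_bounded_entry) auto
  finally have "of_nat N * herm_int N (\<lambda>x. pow_trace N (Suc n) x * int_coeff N l x) =
     (\<Sum>i<N. \<Sum>j<N. of_nat N * herm_int N (\<lambda>x. herm_entry N x j i * (pow_entry N n i j x * int_coeff N l x)))"
    by (simp only: sum_distrib_left)
  also have "\<dots> = (\<Sum>i<N. \<Sum>j<N. herm_int N (?D i j))"
  proof (intro sum.cong refl)
    fix i j assume ij: "i \<in> {..<N}" "j \<in> {..<N}"
    then have "herm_deriv N (\<lambda>x. pow_entry N n i j x * int_coeff N l x)
      (\<lambda>i' j' x. (\<Sum>r<n. pow_entry N r i i' x * pow_entry N (n - 1 - r) j' j x) * int_coeff N l x
      + pow_entry N n i j x * (\<Sum>p\<in>set_mset l. of_nat N * pow_entry N p j' i' x * int_coeff N (l - {#p#}) x))"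
      by (intro herm_deriv_mult pow_entry_deriv int_coeff_deriv) auto
    from herm_deriv_int[OF N this, of i j] ij
    show "of_nat N * herm_int N (\<lambda>x. herm_entry N x j i * (pow_entry N n i j x * int_coeff N l x)) = herm_int N (?D i j)"
      by simp
  qed
  also have "\<dots> = herm_int N (\<lambda>x. \<Sum>i<N. \<Sum>j<N. ?D i j x)"
    by (subst herm_int_sum[OF N], (intro herm_bounded_sum bD; simp),
        intro sum.cong refl herm_int_sum[OF N, symmetric] bD) auto
  also have "(\<lambda>x. \<Sum>i<N. \<Sum>j<N. ?D i j x) = (\<lambda>x. (\<Sum>k<n. pow_trace N k x * pow_trace N (n - 1 - k) x * int_coeff N l x) +
     (\<Sum>p\<in>set_mset l. of_nat N * (pow_trace N (n + p) x * int_coeff N (l - {#p#}) x)))"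
  proof
    fix x
    have "(\<Sum>i<N. \<Sum>j<N. (\<Sum>r<n. pow_entry N r i i x * pow_entry N (n - 1 - r) j j x) * int_coeff N l x) =
       (\<Sum>i<N. \<Sum>r<n. \<Sum>j<N. pow_entry N r i i x * pow_entry N (n - 1 - r) j j x * int_coeff N l x)"
      unfolding sum_distrib_right by (intro sum.cong refl sum.swap)
    also have "\<dots> = (\<Sum>r<n. \<Sum>i<N. \<Sum>j<N. pow_entry N r i i x * pow_entry N (n - 1 - r) j j x * int_coeff N l x)"
      by (rule sum.swap)
    also have "\<dots> = (\<Sum>k<n. pow_trace N k x * pow_trace N (n - 1 - k) x * int_coeff N l x)"
      by (simp only: pow_trace_eq sum_product) (simp only: sum_distrib_right)
    finally have 1: "(\<Sum>i<N. \<Sum>j<N. (\<Sum>r<n. pow_entry N r i i x * pow_entry N (n - 1 - r) j j x) * int_coeff N l x) =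
      (\<Sum>k<n. pow_trace N k x * pow_trace N (n - 1 - k) x * int_coeff N l x)" .
    have "(\<Sum>i<N. \<Sum>j<N. pow_entry N n i j x * (\<Sum>p\<in>set_mset l. of_nat N * pow_entry N p j i x * int_coeff N (l - {#p#}) x)) =
      (\<Sum>i<N. \<Sum>p\<in>set_mset l. \<Sum>j<N. pow_entry N n i j x * (of_nat N * pow_entry N p j i x * int_coeff N (l - {#p#}) x))"
      unfolding sum_distrib_left by (intro sum.cong refl sum.swap)
    also have "\<dots> = (\<Sum>p\<in>set_mset l. \<Sum>i<N. \<Sum>j<N. pow_entry N n i j x * (of_nat N * pow_entry N p j i x * int_coeff N (l - {#p#}) x))"
      by (rule sum.swap)
    also have "\<dots> = (\<Sum>p\<in>set_mset l. of_nat N * (pow_trace N (n + p) x * int_coeff N (l - {#p#}) x))"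
      by (simp only: pow_trace_add sum_distrib_left sum_distrib_right mult_ac)
    finally show "(\<Sum>i<N. \<Sum>j<N. ?D i j x) = (\<Sum>k<n. pow_trace N k x * pow_trace N (n - 1 - k) x * int_coeff N l x) +
     (\<Sum>p\<in>set_mset l. of_nat N * (pow_trace N (n + p) x * int_coeff N (l - {#p#}) x))"
      using 1 by (simp only: sum.distrib)
  qed
  also have "herm_int N \<dots> =
    (\<Sum>k<n. herm_int N (\<lambda>x. pow_trace N k x * pow_trace N (n - 1 - k) x * int_coeff N l x)) +
    (\<Sum>p\<in>set_mset l. of_nat N * herm_int N (\<lambda>x. pow_trace N (n + p) x * int_coeff N (l - {#p#}) x))"
    by (subst herm_int_add[OF N], (intro herm_bounded_sum herm_bounded_mult bt bc herm_bounded_const)+,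
        subst herm_int_sum[OF N], (intro herm_bounded_mult bt bc), subst herm_int_sum[OF N],
        (intro herm_bounded_mult bt bc herm_bounded_const), simp only: herm_int_cmult)
  finally show ?thesis .
qed

section \<open>Correlators as derivatives of the partition function\<close>

definition herm_mean :: "nat \<Rightarrow> ((nat \<times> nat \<Rightarrow> real) \<Rightarrow> complex) \<Rightarrow> complex" where
  "herm_mean N f = herm_int N f / herm_int N (\<lambda>x. 1)"

lemma herm_int_1_nonzero:
  assumes "1 \<le> N"
  shows "herm_int N (\<lambda>x. 1) \<noteq> 0"
proof -
  have int: "integrable lborel (\<lambda>t. exp (- herm_weight N p * t\<^sup>2))" for p
    using integrable_gaussian_poly[of "herm_weight N p" 0] herm_weight_pos[OF assms] by simp
  have "0 < (LINT t|lborel. exp (- herm_weight N p * t\<^sup>2))" for p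
  proof -
    have "(LINT t|lborel. exp (- herm_weight N p * t\<^sup>2)) \<noteq> 0"
      by (subst integral_nonneg_eq_0_iff_AE[OF int]) (simp_all add: eventually_False ae_filter_eq_bot_iff)
    moreover have "0 \<le> (LINT t|lborel. exp (- herm_weight N p * t\<^sup>2))"
      by (rule integral_nonneg_AE) simp
    ultimately show ?thesis by linarith
  qed
  then have "0 < (\<Prod>p\<in>{..<N} \<times> {..<N}. LINT t|lborel. exp (- herm_weight N p * t\<^sup>2))"
    by (intro prod_pos) auto
  also have "\<dots> = (LINT x|hermitian_lborel N. (\<Prod>p\<in>{..<N} \<times> {..<N}. exp (- herm_weight N p * (x p)\<^sup>2)))"
    unfolding hermitian_lborel_def
    by (rule lborel_product.product_integral_prod[symmetric]) (use int in auto)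
  finally have "of_real (LINT x|hermitian_lborel N. (\<Prod>p\<in>{..<N} \<times> {..<N}. exp (- herm_weight N p * (x p)\<^sup>2))) \<noteq> (0 :: complex)"
    by simp
  then show ?thesis
    by (simp only: herm_int_def gaussian_weight_eq mult_1_right integral_complex_of_real) simp
qed

lemma partition_function_coeff:
  "mps_coeff (partition_function N) l = herm_mean N (\<lambda>x. int_coeff N l x)"
  by (simp add: partition_function_def herm_mean_def herm_int_def)

text \<open>Means are taken in the Gaussian ensemble with the interaction as a formal weight, so
  both families of series still contain the factor \<open>partition_function N\<close>.\<close>

definition moment_mps :: "nat \<Rightarrow> nat \<Rightarrow> complex mps" where
  "moment_mps N n = Mps (\<lambda>l. herm_mean N (\<lambda>x. pow_trace N n x * int_coeff N l x) / of_nat N)"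

definition moment2_mps :: "nat \<Rightarrow> nat \<Rightarrow> nat \<Rightarrow> complex mps" where
  "moment2_mps N k n = Mps (\<lambda>l. herm_mean N (\<lambda>x. pow_trace N k x * pow_trace N n x * int_coeff N l x) / of_nat N ^ 2)"

lemma herm_mean_cmult: "herm_mean N (\<lambda>x. c * f x) = c * herm_mean N f"
  by (simp add: herm_mean_def herm_int_cmult)

lemma moment_mps_schwinger_dyson:
  assumes N: "1 \<le> N"
  shows "moment_mps N (Suc n) = (\<Sum>k<n. moment2_mps N k (n - 1 - k)) +
    mps_suminf (\<lambda>p. mps_X p * moment_mps N (n + p))"
proof (rule mps_eqI)
  fix l
  have "of_nat N * herm_mean N (\<lambda>x. pow_trace N (Suc n) x * int_coeff N l x) =
    (\<Sum>k<n. herm_mean N (\<lambda>x. pow_trace N k x * pow_trace N (n - 1 - k) x * int_coeff N l x)) +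
    (\<Sum>p\<in>set_mset l. of_nat N * herm_mean N (\<lambda>x. pow_trace N (n + p) x * int_coeff N (l - {#p#}) x))"
    unfolding herm_mean_def times_divide_eq_right schwinger_dyson[OF N] add_divide_distrib sum_divide_distrib ..
  then have "of_nat N * herm_mean N (\<lambda>x. pow_trace N (Suc n) x * int_coeff N l x) / of_nat N ^ 2 =
    (\<Sum>k<n. herm_mean N (\<lambda>x. pow_trace N k x * pow_trace N (n - 1 - k) x * int_coeff N l x) / of_nat N ^ 2) +
    (\<Sum>p\<in>set_mset l. of_nat N * herm_mean N (\<lambda>x. pow_trace N (n + p) x * int_coeff N (l - {#p#}) x) / of_nat N ^ 2)"
    by (simp only: add_divide_distrib sum_divide_distrib)
  moreover have "of_nat N * z / of_nat N ^ 2 = z / of_nat N" for z :: complex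
    using N by (simp add: power2_eq_square)
  ultimately show "mps_coeff (moment_mps N (Suc n)) l =
     mps_coeff ((\<Sum>k<n. moment2_mps N k (n - 1 - k)) + mps_suminf (\<lambda>p. mps_X p * moment_mps N (n + p))) l"
    by (simp only: mps_coeff_add mps_coeff_sum mps_coeff_suminf_X moment_mps_def moment2_mps_def mps_coeff_Mps)
qed

lemma pow_trace_0: "pow_trace N 0 x = of_nat N"
  by (simp add: pow_trace_eq pow_entry_0 cong: sum.cong_simp del: pow_mat.simps)

lemma moment_mps_0:
  assumes N: "1 \<le> N"
  shows "moment_mps N 0 = partition_function N"
  using N by (intro mps_eqI) (simp add: moment_mps_def partition_function_coeff pow_trace_0 herm_mean_cmult del: pow_mat.simps)

lemma moment2_mps_0:
  assumes N: "1 \<le> N"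
  shows "moment2_mps N 0 n = moment_mps N n" "moment2_mps N n 0 = moment_mps N n"
  using N by (auto intro!: mps_eqI simp: moment_mps_def moment2_mps_def pow_trace_0 herm_mean_cmult mult.assoc
      mult.left_commute[of _ "of_nat N"] power2_eq_square simp del: pow_mat.simps)

text \<open>A derivative in the n-th variable brings down N tr M^(n+1) / (n+1), so traces can be
  inserted by differentiating.\<close>

lemma moment_mps_Suc:
  assumes N: "1 \<le> N"
  shows "moment_mps N (Suc n) = mps_const (of_nat (Suc n) / of_nat N ^ 2) * mps_deriv n (partition_function N)"
proof (rule mps_eqI)
  fix l
  have "of_nat (Suc (count l n)) * mps_coeff (partition_function N) (add_mset n l) =
     herm_mean N (\<lambda>x. of_nat (Suc (count l n)) * int_coeff N (add_mset n l) x)"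
    by (simp only: partition_function_coeff herm_mean_cmult)
  also have "\<dots> = herm_mean N (\<lambda>x. of_nat N / of_nat (Suc n) * (pow_trace N (Suc n) x * int_coeff N l x))"
    by (simp only: int_coeff_add_mset) (simp only: mult_ac times_divide_eq_left times_divide_eq_right)
  also have "\<dots> = of_nat N / of_nat (Suc n) * herm_mean N (\<lambda>x. pow_trace N (Suc n) x * int_coeff N l x)"
    by (rule herm_mean_cmult)
  finally show "mps_coeff (moment_mps N (Suc n)) l =
      mps_coeff (mps_const (of_nat (Suc n) / of_nat N ^ 2) * mps_deriv n (partition_function N)) l"
    using N by (simp add: moment_mps_def mps_coeff_deriv power2_eq_square del: of_nat_Suc pow_mat.simps)
qed

lemma moment2_mps_Suc:
  assumes N: "1 \<le> N"
  shows "moment2_mps N (Suc k) (Suc n) = mps_const (of_nat (Suc k) * of_nat (Suc n) / of_nat N ^ 4) *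
    mps_deriv k (mps_deriv n (partition_function N))"
proof (rule mps_eqI)
  fix l
  let ?m = "of_nat (Suc (count (add_mset k l) n)) * of_nat (Suc (count l k)) :: complex"
  have 1: "?m * int_coeff N (add_mset n (add_mset k l)) x =
      of_nat N ^ 2 / (of_nat (Suc k) * of_nat (Suc n)) * (pow_trace N (Suc k) x * pow_trace N (Suc n) x * int_coeff N l x)" for x
  proof -
    have "?m * int_coeff N (add_mset n (add_mset k l)) x =
      of_nat N * pow_trace N (Suc n) x / of_nat (Suc n) * (of_nat (Suc (count l k)) * int_coeff N (add_mset k l) x)"
      using int_coeff_add_mset[of "add_mset k l" n N x] by (simp only: mult.left_commute mult.assoc)
    then show ?thesis unfolding int_coeff_add_mset
      by (simp only: power2_eq_square mult_ac times_divide_eq_left times_divide_eq_right divide_divide_eq_left)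
  qed
  have "?m * mps_coeff (partition_function N) (add_mset n (add_mset k l)) =
     herm_mean N (\<lambda>x. ?m * int_coeff N (add_mset n (add_mset k l)) x)"
    by (simp only: partition_function_coeff herm_mean_cmult)
  also have "\<dots> = of_nat N ^ 2 / (of_nat (Suc k) * of_nat (Suc n)) *
     herm_mean N (\<lambda>x. pow_trace N (Suc k) x * pow_trace N (Suc n) x * int_coeff N l x)"
    unfolding 1 by (rule herm_mean_cmult)
  finally have "herm_mean N (\<lambda>x. pow_trace N (Suc k) x * pow_trace N (Suc n) x * int_coeff N l x) =
     of_nat (Suc k) * of_nat (Suc n) / of_nat N ^ 2 * (?m * mps_coeff (partition_function N) (add_mset n (add_mset k l)))"
    using N by (simp add: field_simps del: of_nat_Suc pow_mat.simps)
  then have "herm_mean N (\<lambda>x. pow_trace N (Suc k) x * pow_trace N (Suc n) x * int_coeff N l x) / of_nat N ^ 2 =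
     of_nat (Suc k) * of_nat (Suc n) / of_nat N ^ 2 * (?m * mps_coeff (partition_function N) (add_mset n (add_mset k l))) / of_nat N ^ 2"
    by (simp only:)
  also have "\<dots> = of_nat (Suc k) * of_nat (Suc n) / of_nat N ^ 4 * (?m * mps_coeff (partition_function N) (add_mset n (add_mset k l)))"
    by (simp add: power2_eq_square power4_eq_xxxx mult.assoc del: of_nat_Suc)
  finally show "mps_coeff (moment2_mps N (Suc k) (Suc n)) l =
      mps_coeff (mps_const (of_nat (Suc k) * of_nat (Suc n) / of_nat N ^ 4) * mps_deriv k (mps_deriv n (partition_function N))) l"
    unfolding moment2_mps_def mps_coeff_Mps mps_coeff_const_mult mps_coeff_deriv by (simp only: mult_ac)
qed

lemma partition_function_const_term: "1 \<le> N \<Longrightarrow> mps_coeff (partition_function N) {#} = 1"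
  by (simp add: partition_function_coeff int_coeff_empty herm_mean_def herm_int_1_nonzero)

text \<open>A series with constant term 1 can be cancelled: at l, the divisor {#} contributes the
  coefficient of g itself, and all other divisors involve g in smaller degree.\<close>

lemma mps_mult_eq_0:
  fixes f g :: "'a::comm_ring_1 mps"
  assumes f: "mps_coeff f {#} = 1" and fg: "f * g = 0"
  shows "g = 0"
proof (rule mps_eqI)
  fix l
  show "mps_coeff g l = mps_coeff 0 l"
  proof (induction "size l" arbitrary: l rule: less_induct)
    case less
    have "mps_coeff f k * mps_coeff g (l - k) = 0" if "k \<subseteq># l" "k \<noteq> {#}" for k
    proof -
      have "size (l - k) < size l"
        using that by (metis size_Diff_submset diff_less nonempty_has_size size_mset_mono less_le_trans)
      then show ?thesis using less by simp
    qed
    then have "mps_coeff (f * g) l = (\<Sum>k\<in>{{#}}. mps_coeff f k * mps_coeff g (l - k))"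
      unfolding mps_coeff_mult by (intro sum.mono_neutral_right) (auto simp: finite_submultisets)
    then show ?case using f fg by simp
  qed
qed

lemma mps_mult_suminf_X:
  "f * mps_suminf (\<lambda>i. mps_X i * g i) = mps_suminf (\<lambda>i. mps_X i * (f * g i))"
proof (rule mps_eqI)
  fix l
  have "mps_coeff (f * mps_suminf (\<lambda>i. mps_X i * g i)) l = mps_coeff (f * (\<Sum>i\<in>set_mset l. mps_X i * g i)) l"
    unfolding mps_coeff_mult
  proof (intro sum.cong refl arg_cong2[of _ _ _ _ "(*)"])
    fix k assume "k \<in> {k. k \<subseteq># l}"
    have "mps_coeff (mps_suminf (\<lambda>i. mps_X i * g i)) (l - k) =
        (\<Sum>i\<in>set_mset (l - k). mps_coeff (mps_X i * g i) (l - k))"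
      by (simp add: mps_coeff_suminf_X mps_coeff_X_mult)
    also have "\<dots> = mps_coeff (\<Sum>i\<in>set_mset l. mps_X i * g i) (l - k)"
      unfolding mps_coeff_sum
      by (rule sum.mono_neutral_left) (auto simp: mps_coeff_X_mult dest: in_diffD)
    finally show "mps_coeff (mps_suminf (\<lambda>i. mps_X i * g i)) (l - k) = mps_coeff (\<Sum>i\<in>set_mset l. mps_X i * g i) (l - k)" .
  qed
  also have "f * (\<Sum>i\<in>set_mset l. mps_X i * g i) = (\<Sum>i\<in>set_mset l. mps_X i * (f * g i))"
    by (simp add: sum_distrib_left mult.left_commute)
  also have "mps_coeff \<dots> l = mps_coeff (mps_suminf (\<lambda>i. mps_X i * (f * g i))) l"
    by (simp add: mps_coeff_suminf_X mps_coeff_X_mult)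
  finally show "mps_coeff (f * mps_suminf (\<lambda>i. mps_X i * g i)) l = mps_coeff (mps_suminf (\<lambda>i. mps_X i * (f * g i))) l" .
qed

lemma mps_const_mult: "mps_const a * mps_const b = mps_const (a * b :: 'a::comm_ring_1)"
  by (rule mps_eqI) (simp add: mps_coeff_const)

section \<open>From the partition function to the free energy\<close>

definition free_energy :: "nat \<Rightarrow> complex mps" where
  "free_energy N = mps_log (partition_function N)"

text \<open>For L = log Z / N^2 this is the mean of tr M^n / N under the interacting weight; the
  value at n = 0 is the normalised trace of the identity. With L as a parameter the same expression
  passes to the planar limit.\<close>

fun norm_moment :: "complex mps \<Rightarrow> nat \<Rightarrow> complex mps" where
  "norm_moment L 0 = 1"
| "norm_moment L (Suc n) = mps_const (of_nat (Suc n)) * mps_deriv n L"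

text \<open>The covariance of two traces under the interacting weight, divided by N^2. It is zero
  when one of the traces is the constant tr M^0.\<close>

definition connected_moment :: "nat \<Rightarrow> nat \<Rightarrow> nat \<Rightarrow> complex mps" where
  "connected_moment N k n = (if k = 0 \<or> n = 0 then 0 else
     mps_const (of_nat k * of_nat n / of_nat N ^ 4) * mps_deriv (k - 1) (mps_deriv (n - 1) (free_energy N)))"

text \<open>With Z = exp F, a second derivative of Z is Z (F' F' + F''): the first part is a product
  of one-trace moments, the second a connected correlator. Every term then contains Z, which is
  cancelled.\<close>

lemma loop_equation_finite_N:
  assumes N: "1 \<le> N"
  defines "L \<equiv> mps_const (1 / of_nat N ^ 2) * free_energy N"
  shows "norm_moment L (Suc n) =
     (\<Sum>k<n. norm_moment L k * norm_moment L (n - 1 - k) + connected_moment N k (n - 1 - k)) +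
     mps_suminf (\<lambda>p. mps_X p * norm_moment L (n + p))"
proof -
  let ?Z = "partition_function N"
  have Z0: "mps_coeff ?Z {#} = 1" by (rule partition_function_const_term[OF N])
  have dZ: "mps_deriv i ?Z = ?Z * mps_deriv i (free_energy N)" for i
    unfolding free_energy_def using mps_deriv_log[OF Z0] by simp
  have mom: "moment_mps N n = ?Z * norm_moment L n" for n
    by (cases n) (auto simp: moment_mps_0[OF N] moment_mps_Suc[OF N] dZ L_def intro!: mps_eqI
       simp: mult.left_commute[of ?Z] simp del: of_nat_Suc)
  have mom2: "moment2_mps N k n = ?Z * (norm_moment L k * norm_moment L n + connected_moment N k n)" for k n
  proof (cases "k = 0 \<or> n = 0")
    case True
    then show ?thesis by (auto simp: moment2_mps_0[OF N] mom connected_moment_def)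
  next
    case False
    then obtain k' n' where kn: "k = Suc k'" "n = Suc n'" by (auto simp: gr0_conv_Suc)
    have c: "mps_const (of_nat (Suc k') * of_nat (Suc n') / of_nat N ^ 4 :: complex) =
        mps_const (of_nat (Suc k')) * mps_const (1 / of_nat N ^ 2) * (mps_const (of_nat (Suc n')) * mps_const (1 / of_nat N ^ 2))"
      by (simp add: mps_const_mult power2_eq_square power4_eq_xxxx mult_ac del: of_nat_Suc)
    have "moment2_mps N k n = mps_const (of_nat (Suc k') * of_nat (Suc n') / of_nat N ^ 4) *
       (?Z * mps_deriv k' (free_energy N) * mps_deriv n' (free_energy N) + ?Z * mps_deriv k' (mps_deriv n' (free_energy N)))"
      unfolding kn moment2_mps_Suc[OF N] by (simp only: dZ mps_deriv_mult)
    moreover have "connected_moment N k n = mps_const (of_nat (Suc k') * of_nat (Suc n') / of_nat N ^ 4) *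
        mps_deriv k' (mps_deriv n' (free_energy N))"
      by (simp add: kn connected_moment_def del: of_nat_Suc)
    moreover have "norm_moment L k * norm_moment L n = mps_const (of_nat (Suc k') * of_nat (Suc n') / of_nat N ^ 4) *
        (mps_deriv k' (free_energy N) * mps_deriv n' (free_energy N))"
      unfolding kn norm_moment.simps L_def mps_deriv_const_mult c by (simp only: mult_ac)
    ultimately show ?thesis by (simp only: distrib_left mult_ac)
  qed
  define G where "G = (\<Sum>k<n. norm_moment L k * norm_moment L (n - 1 - k) + connected_moment N k (n - 1 - k)) +
     mps_suminf (\<lambda>p. mps_X p * norm_moment L (n + p))"
  have "?Z * G = ?Z * (\<Sum>k<n. norm_moment L k * norm_moment L (n - 1 - k) + connected_moment N k (n - 1 - k)) +
     ?Z * mps_suminf (\<lambda>p. mps_X p * norm_moment L (n + p))"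
    unfolding G_def by (rule distrib_left)
  also have "\<dots> = moment_mps N (Suc n)"
    unfolding moment_mps_schwinger_dyson[OF N] mps_mult_suminf_X sum_distrib_left by (simp only: mom mom2)
  finally have "?Z * (norm_moment L (Suc n) - G) = 0"
    by (simp only: mom right_diff_distrib) simp
  then have "norm_moment L (Suc n) - G = 0"
    by (rule mps_mult_eq_0[OF Z0])
  then show ?thesis by (simp add: G_def)
qed

section \<open>Passage to the planar limit\<close>

lemma genus_expansion_tendsto:
  assumes "genus_expansion F"
  shows "(\<lambda>N. mps_coeff (mps_const (1 / of_nat N ^ 2) * free_energy N) l)
    \<longlonglongrightarrow> mps_coeff (mps_map of_rat (F 0)) l"
proof -
  define G where "G = {g. mps_coeff (F g) l \<noteq> 0}"
  have fin: "finite G" and exp: "\<And>N. 1 \<le> N \<Longrightarrow> mps_coeff (free_energy N) l =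
      (\<Sum>g\<in>G. of_nat N powi (2 - 2 * int g) * of_rat (mps_coeff (F g) l))"
    using assms unfolding genus_expansion_def G_def free_energy_def by auto
  \<comment> \<open>After division by N^2 the genus g carries N^(-2 g), so only g = 0
    survives.\<close>
  have tm: "(\<lambda>N. inverse (of_nat N :: complex) ^ (2 * g)) \<longlonglongrightarrow> (if g = 0 then 1 else 0)" for g
  proof (cases "g = 0")
    case False
    have "(\<lambda>N. inverse (of_nat N :: complex) ^ (2 * g)) \<longlonglongrightarrow> 0 ^ (2 * g)"
      by (intro tendsto_power lim_inverse_n)
    then show ?thesis using False by (simp add: power_0_left)
  qed simp
  have "(\<lambda>N. \<Sum>g\<in>G. inverse (of_nat N :: complex) ^ (2 * g) * of_rat (mps_coeff (F g) l))
    \<longlonglongrightarrow> (\<Sum>g\<in>G. (if g = 0 then 1 else 0) * of_rat (mps_coeff (F g) l))"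
    by (intro tendsto_sum tendsto_mult tm tendsto_const)
  also have "(\<Sum>g\<in>G. (if g = 0 then 1 else 0) * of_rat (mps_coeff (F g) l)) =
      (\<Sum>g\<in>{0}. of_rat (mps_coeff (F g) l) :: complex)"
    using fin by (intro sum.mono_neutral_cong) (auto simp: G_def)
  finally have lim: "(\<lambda>N. \<Sum>g\<in>G. inverse (of_nat N :: complex) ^ (2 * g) * of_rat (mps_coeff (F g) l))
    \<longlonglongrightarrow> mps_coeff (mps_map of_rat (F 0)) l" by (simp add: mps_coeff_map)
  show ?thesis
  proof (rule Lim_transform_eventually[OF lim])
    show "\<forall>\<^sub>F N in sequentially. (\<Sum>g\<in>G. inverse (of_nat N :: complex) ^ (2 * g) * of_rat (mps_coeff (F g) l)) =
       mps_coeff (mps_const (1 / of_nat N ^ 2) * free_energy N) l"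
      using eventually_ge_at_top[of 1]
    proof eventually_elim
      case (elim N)
      have "(of_nat N :: complex) powi (2 - 2 * int g) / of_nat N ^ 2 = inverse (of_nat N) ^ (2 * g)" for g
      proof -
        have "(of_nat N :: complex) powi (2 - 2 * int g) = of_nat N powi 2 / of_nat N powi int (2 * g)"
          using elim by (simp add: power_int_diff)
        then show ?thesis using elim unfolding power_int_of_nat by (simp add: divide_inverse power_inverse)
      qed
      then show ?case unfolding mps_coeff_const_mult exp[OF elim] sum_distrib_left
        by (intro sum.cong refl) (simp add: field_simps)
    qed
  qed
qed

lemma genus_expansion_const_term:
  assumes "genus_expansion F"
  shows "mps_coeff (F 0) {#} = 0"
proof -
  have "\<forall>\<^sub>F N in sequentially. 0 = mps_coeff (mps_const (1 / of_nat N ^ 2) * free_energy N) {#}"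
    using eventually_ge_at_top[of 1]
    by eventually_elim (simp add: free_energy_def mps_coeff_log_0 partition_function_const_term)
  then have "(\<lambda>N. mps_coeff (mps_const (1 / of_nat N ^ 2) * free_energy N) {#}) \<longlonglongrightarrow> 0"
    by (rule Lim_transform_eventually[OF tendsto_const])
  with genus_expansion_tendsto[OF assms, of "{#}"] have "mps_coeff (mps_map of_rat (F 0)) {#} = (0 :: complex)"
    using LIMSEQ_unique by blast
  then show ?thesis by (simp add: mps_coeff_map)
qed

text \<open>The connected two-trace correlators are second derivatives of \<open>free_energy\<close>, hence
  \<open>O(N\<^sup>2)\<close> by the genus expansion; after division by \<open>N\<^sup>4\<close> they drop out, so that
  the equation closes on the one-trace moments.\<close>

lemma planar_loop_equation:
  assumes F: "genus_expansion F"
  defines "L \<equiv> mps_map of_rat (F 0)"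
  shows "norm_moment L (Suc n) = (\<Sum>k<n. norm_moment L k * norm_moment L (n - 1 - k)) +
     mps_suminf (\<lambda>p. mps_X p * norm_moment L (n + p))"
proof (rule mps_eqI)
  fix l
  define LN where "LN N = mps_const (1 / of_nat N ^ 2) * free_energy N" for N
  have L: "(\<lambda>N. mps_coeff (LN N) l) \<longlonglongrightarrow> mps_coeff L l" for l
    unfolding LN_def L_def by (rule genus_expansion_tendsto[OF F])
  have nm: "(\<lambda>N. mps_coeff (norm_moment (LN N) n) l) \<longlonglongrightarrow> mps_coeff (norm_moment L n) l" for n l
    by (cases n) (simp_all add: mps_coeff_deriv tendsto_mult L del: of_nat_Suc)
  have conn: "(\<lambda>N. mps_coeff (connected_moment N k n) l) \<longlonglongrightarrow> 0" for k n l
  proof (cases "k = 0 \<or> n = 0")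
    case True
    then show ?thesis by (auto simp: connected_moment_def)
  next
    case False
    define m where "m = of_nat k * of_nat n * (of_nat (Suc (count l (k - 1))) *
       of_nat (Suc (count (add_mset (k - 1) l) (n - 1))) :: complex)"
    define l' where "l' = add_mset (n - 1) (add_mset (k - 1) l)"
    have "(\<lambda>N. m * inverse (of_nat N) ^ 2 * mps_coeff (LN N) l') \<longlonglongrightarrow> m * 0 ^ 2 * mps_coeff L l'"
      by (intro tendsto_mult tendsto_const tendsto_power lim_inverse_n L)
    moreover have "m * inverse (of_nat N) ^ 2 * mps_coeff (LN N) l' = mps_coeff (connected_moment N k n) l" for N
    proof -
      have "inverse (of_nat N) ^ 2 * (1 / of_nat N ^ 2) = (1 / of_nat N ^ 4 :: complex)"
        by (simp add: power2_eq_square power4_eq_xxxx divide_inverse)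
      then have "m * inverse (of_nat N) ^ 2 * mps_coeff (LN N) l' = m / of_nat N ^ 4 * mps_coeff (free_energy N) l'"
        unfolding LN_def mps_coeff_const_mult mult.assoc by (simp only: mult.assoc[symmetric]) simp
      moreover have "mps_coeff (connected_moment N k n) l = m / of_nat N ^ 4 * mps_coeff (free_energy N) l'"
        using False unfolding connected_moment_def if_not_P[OF False] mps_coeff_const_mult mps_coeff_deriv
        by (simp only: m_def l'_def mult_ac times_divide_eq_left times_divide_eq_right)
      ultimately show ?thesis by simp
    qed
    ultimately show ?thesis by simp
  qed
  let ?R = "\<lambda>N. mps_coeff ((\<Sum>k<n. norm_moment (LN N) k * norm_moment (LN N) (n - 1 - k) + connected_moment N k (n - 1 - k)) +
     mps_suminf (\<lambda>p. mps_X p * norm_moment (LN N) (n + p))) l"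
  have "?R \<longlonglongrightarrow> (\<Sum>k<n. (\<Sum>j | j \<subseteq># l. mps_coeff (norm_moment L k) j * mps_coeff (norm_moment L (n - 1 - k)) (l - j)) + 0) +
     (\<Sum>p\<in>set_mset l. mps_coeff (norm_moment L (n + p)) (l - {#p#}))"
    unfolding mps_coeff_add mps_coeff_sum mps_coeff_mult mps_coeff_suminf_X
    by (intro tendsto_add tendsto_sum tendsto_mult nm conn)
  moreover have "\<forall>\<^sub>F N in sequentially. ?R N = mps_coeff (norm_moment (LN N) (Suc n)) l"
    using eventually_ge_at_top[of 1]
    by eventually_elim (simp only: LN_def loop_equation_finite_N)
  ultimately have "(\<lambda>N. mps_coeff (norm_moment (LN N) (Suc n)) l) \<longlonglongrightarrow>
     (\<Sum>k<n. (\<Sum>j | j \<subseteq># l. mps_coeff (norm_moment L k) j * mps_coeff (norm_moment L (n - 1 - k)) (l - j)) + 0) +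
     (\<Sum>p\<in>set_mset l. mps_coeff (norm_moment L (n + p)) (l - {#p#}))"
    by (rule Lim_transform_eventually)
  from LIMSEQ_unique[OF nm this] show "mps_coeff (norm_moment L (Suc n)) l = mps_coeff ((\<Sum>k<n. norm_moment L k * norm_moment L (n - 1 - k)) +
     mps_suminf (\<lambda>p. mps_X p * norm_moment L (n + p))) l"
    by (simp only: mps_coeff_add mps_coeff_sum mps_coeff_mult mps_coeff_suminf_X add_0_right)
qed

section \<open>The logarithmic energy\<close>

text \<open>The derivative in u of ln ((x^2 + u^2) / (1 + u^2)) / 2. Its integral over u > 0 is -ln
  |x|; the subtracted term, independent of x, makes the integral converge at infinity.\<close>

definition log_kernel :: "real \<Rightarrow> real \<Rightarrow> real" where
  "log_kernel x u = (if 0 < u then u / (x\<^sup>2 + u\<^sup>2) - u / (1 + u\<^sup>2) else 0)"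

lemma log_kernel_measurable [measurable]:
  "(\<lambda>(x, u). log_kernel x u) \<in> borel_measurable (borel \<Otimes>\<^sub>M borel)"
  unfolding log_kernel_def by measurable

lemma log_kernel_integral:
  assumes x: "x \<noteq> 0"
  shows "(\<integral>\<^sup>+u. ennreal \<bar>log_kernel x u\<bar> \<partial>lborel) = ennreal \<bar>ln \<bar>x\<bar>\<bar>"
    and "has_bochner_integral lborel (log_kernel x) (- ln \<bar>x\<bar>)"
proof -
  \<comment> \<open>For fixed x the kernel has a constant sign in u, positive or negative according
    to whether |x| is below or above 1. Multiplication by this sign makes the nonnegative integral
    applicable and identifies the integral of the absolute value as well.\<close>
  define s :: real where "s = (if \<bar>x\<bar> \<le> 1 then 1 else -1)"
  have x2: "0 < x\<^sup>2" using x by simp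
  have sx: "0 \<le> s * (1 - x\<^sup>2)"
    using abs_square_le_1[of x] by (auto simp: s_def)
  have dec: "u / (x\<^sup>2 + u\<^sup>2) - u / (1 + u\<^sup>2) = u * (1 - x\<^sup>2) / ((x\<^sup>2 + u\<^sup>2) * (1 + u\<^sup>2))" for u
  proof -
    have "x\<^sup>2 + u\<^sup>2 \<noteq> 0" "1 + u\<^sup>2 \<noteq> 0" using x2 zero_le_power2[of u] by linarith+
    then show ?thesis by (simp add: field_simps)
  qed
  have nonneg: "0 \<le> s * (u / (x\<^sup>2 + u\<^sup>2) - u / (1 + u\<^sup>2))" if "0 \<le> u" for u
  proof -
    have "s * (u / (x\<^sup>2 + u\<^sup>2) - u / (1 + u\<^sup>2)) = u * (s * (1 - x\<^sup>2)) / ((x\<^sup>2 + u\<^sup>2) * (1 + u\<^sup>2))"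
      unfolding dec by simp
    also have "0 \<le> \<dots>" by (intro divide_nonneg_nonneg mult_nonneg_nonneg[OF that sx]) auto
    finally show ?thesis .
  qed
  have "(\<integral>\<^sup>+u. ennreal (s * (u / (x\<^sup>2 + u\<^sup>2) - u / (1 + u\<^sup>2))) * indicator {0..} u \<partial>lborel) =
     0 - s * (1/2 * ln ((x\<^sup>2 + 0\<^sup>2) / (1 + 0\<^sup>2)))"
  proof (rule nn_integral_FTC_atLeast[where F = "\<lambda>u. s * (1/2 * ln ((x\<^sup>2 + u\<^sup>2) / (1 + u\<^sup>2)))"])
    fix u :: real
    have p: "0 < x\<^sup>2 + u\<^sup>2" "0 < 1 + u\<^sup>2" using x2 zero_le_power2[of u] by linarith+
    have "((\<lambda>u. s * (1/2 * (ln (x\<^sup>2 + u\<^sup>2) - ln (1 + u\<^sup>2)))) has_real_derivative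
        s * (1/2 * (2 * u / (x\<^sup>2 + u\<^sup>2) - 2 * u / (1 + u\<^sup>2)))) (at u)"
      using p by (auto intro!: derivative_eq_intros)
    also have "s * (1/2 * (2 * u / (x\<^sup>2 + u\<^sup>2) - 2 * u / (1 + u\<^sup>2))) = s * (u / (x\<^sup>2 + u\<^sup>2) - u / (1 + u\<^sup>2))"
      by (simp add: right_diff_distrib)
    finally have "((\<lambda>u. s * (1/2 * (ln (x\<^sup>2 + u\<^sup>2) - ln (1 + u\<^sup>2)))) has_real_derivative
        s * (u / (x\<^sup>2 + u\<^sup>2) - u / (1 + u\<^sup>2))) (at u)" .
    moreover have "ln (x\<^sup>2 + u\<^sup>2) - ln (1 + u\<^sup>2) = ln ((x\<^sup>2 + u\<^sup>2) / (1 + u\<^sup>2))" for u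
      using add_pos_nonneg[OF x2 zero_le_power2[of u]] add_pos_nonneg[of 1 "u\<^sup>2"]
      by (simp add: ln_div)
    ultimately show "DERIV (\<lambda>u. s * (1/2 * ln ((x\<^sup>2 + u\<^sup>2) / (1 + u\<^sup>2)))) u :> s * (u / (x\<^sup>2 + u\<^sup>2) - u / (1 + u\<^sup>2))"
      by simp
  next
    show "((\<lambda>u. s * (1/2 * ln ((x\<^sup>2 + u\<^sup>2) / (1 + u\<^sup>2)))) \<longlongrightarrow> 0) at_top"
    proof -
      have "((\<lambda>u. (c + u\<^sup>2) / (1 + u\<^sup>2)) \<longlongrightarrow> 1) at_top" for c :: real by real_asymp
      from tendsto_ln[OF this] have "((\<lambda>u. ln ((x\<^sup>2 + u\<^sup>2) / (1 + u\<^sup>2))) \<longlongrightarrow> ln 1) at_top" by simp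
      then show ?thesis by (intro tendsto_mult_right_zero) simp
    qed
  qed (use nonneg in auto)
  also have "0 - s * (1/2 * ln ((x\<^sup>2 + 0\<^sup>2) / (1 + 0\<^sup>2))) = - s * ln \<bar>x\<bar>"
  proof -
    have "ln (x\<^sup>2) = 2 * ln \<bar>x\<bar>"
      unfolding power2_abs[of x, symmetric] using x by (subst ln_realpow) auto
    then show ?thesis by simp
  qed
  finally have nn: "(\<integral>\<^sup>+u. ennreal (s * log_kernel x u) \<partial>lborel) = ennreal (- s * ln \<bar>x\<bar>)"
    by (subst nn_integral_cong[where v = "\<lambda>u. ennreal (s * (u / (x\<^sup>2 + u\<^sup>2) - u / (1 + u\<^sup>2))) * indicator {0..} u"])
      (auto simp: log_kernel_def indicator_def)
  have s: "s = 1 \<or> s = -1" "0 \<le> - s * ln \<bar>x\<bar>"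
    using x by (auto simp: s_def ln_le_zero_iff ln_ge_zero_iff)
  have nonneg': "0 \<le> s * log_kernel x u" for u using nonneg[of u] by (auto simp: log_kernel_def)
  have "has_bochner_integral lborel (\<lambda>u. s * log_kernel x u) (- s * ln \<bar>x\<bar>)"
  proof (rule has_bochner_integral_nn_integral)
    show "(\<lambda>u. s * log_kernel x u) \<in> borel_measurable lborel" unfolding log_kernel_def by measurable
  qed (use nonneg' s(2) nn in simp_all)
  then have "has_bochner_integral lborel (\<lambda>u. s * (s * log_kernel x u)) (s * (- s * ln \<bar>x\<bar>))"
    by (rule has_bochner_integral_mult_right)
  moreover have "s * (s * y) = y" for y using s(1) by auto
  ultimately show "has_bochner_integral lborel (log_kernel x) (- ln \<bar>x\<bar>)" by simp
  have "\<bar>log_kernel x u\<bar> = s * log_kernel x u" for u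
    using nonneg'[of u] s(1) by auto
  moreover have "\<bar>ln \<bar>x\<bar>\<bar> = - s * ln \<bar>x\<bar>" using s by auto
  ultimately show "(\<integral>\<^sup>+u. ennreal \<bar>log_kernel x u\<bar> \<partial>lborel) = ennreal \<bar>ln \<bar>x\<bar>\<bar>"
    using nn by simp
qed

text \<open>Because the kernel has constant sign in u, its absolute integral is exactly |ln |x||, so
  integrability of the logarithm is precisely what Fubini's theorem asks for.\<close>

lemma log_kernel_Fubini:
  assumes M: "prob_space M" and [measurable]: "g \<in> borel_measurable M"
    and nz: "AE p in M. g p \<noteq> 0" and int: "integrable M (\<lambda>p. ln \<bar>g p\<bar>)"
  shows "integrable lborel (\<lambda>u. \<integral>p. log_kernel (g p) u \<partial>M)"
    and "(\<integral>u. (\<integral>p. log_kernel (g p) u \<partial>M) \<partial>lborel) = - (\<integral>p. ln \<bar>g p\<bar> \<partial>M)"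
proof -
  interpret M: prob_space M by fact
  interpret P: pair_sigma_finite M lborel ..
  have meas [measurable]: "(\<lambda>(p, u). log_kernel (g p) u) \<in> borel_measurable (M \<Otimes>\<^sub>M lborel)"
    using measurable_compose[OF _ log_kernel_measurable, of "\<lambda>(p, u). (g p, u)" "M \<Otimes>\<^sub>M lborel"]
    by (simp add: split_beta' measurable_Pair)
  have "(\<integral>\<^sup>+z. ennreal (norm (case z of (p, u) \<Rightarrow> log_kernel (g p) u)) \<partial>(M \<Otimes>\<^sub>M lborel)) =
    (\<integral>\<^sup>+p. \<integral>\<^sup>+u. ennreal \<bar>log_kernel (g p) u\<bar> \<partial>lborel \<partial>M)"
    using lborel.nn_integral_fst[of "\<lambda>z. ennreal (norm (case z of (p, u) \<Rightarrow> log_kernel (g p) u))" M] meas by simp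
  also have "\<dots> = (\<integral>\<^sup>+p. ennreal \<bar>ln \<bar>g p\<bar>\<bar> \<partial>M)"
    by (rule nn_integral_cong_AE) (use nz in \<open>auto simp: log_kernel_integral\<close>)
  also have "\<dots> < \<infinity>" using int by (simp add: integrable_iff_bounded)
  finally have I: "integrable (M \<Otimes>\<^sub>M lborel) (\<lambda>(p, u). log_kernel (g p) u)"
    unfolding integrable_iff_bounded using meas by (auto simp: split_beta')
  show "integrable lborel (\<lambda>u. \<integral>p. log_kernel (g p) u \<partial>M)"
    using P.integrable_snd[OF I] .
  have "(\<integral>u. (\<integral>p. log_kernel (g p) u \<partial>M) \<partial>lborel) = (\<integral>p. (\<integral>u. log_kernel (g p) u \<partial>lborel) \<partial>M)"
    using P.Fubini_integral[OF I] by simp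
  also have "\<dots> = (\<integral>p. - ln \<bar>g p\<bar> \<partial>M)"
    by (rule integral_cong_AE)
      (use nz log_kernel_integral(2) has_bochner_integral_integral_eq in \<open>auto elim!: eventually_mono intro!: borel_measurable_uminus\<close>)
  finally show "(\<integral>u. (\<integral>p. log_kernel (g p) u \<partial>M) \<partial>lborel) = - (\<integral>p. ln \<bar>g p\<bar> \<partial>M)" by simp
qed

lemma laplace_cos:
  assumes u: "0 < (u::real)"
  shows "has_bochner_integral lborel (\<lambda>\<xi>. indicator {0..} \<xi> * (exp (- u * \<xi>) * cos (a * \<xi>))) (u / (a\<^sup>2 + u\<^sup>2))"
proof -
  let ?f = "\<lambda>\<xi>. exp (- u * \<xi>) * cos (a * \<xi>)"
  let ?F = "\<lambda>\<xi>. exp (- u * \<xi>) * (a * sin (a * \<xi>) - u * cos (a * \<xi>)) / (a\<^sup>2 + u\<^sup>2)"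
  have p: "a\<^sup>2 + u\<^sup>2 \<noteq> 0" using u zero_le_power2[of a] by (metis add_nonneg_pos less_irrefl zero_less_power)
  have dom: "integrable lborel (\<lambda>\<xi>. indicator {0..} \<xi> * exp (- u * \<xi>))"
  proof -
    have "(\<integral>\<^sup>+\<xi>. ennreal (exp (- u * \<xi>)) * indicator {0..} \<xi> \<partial>lborel) = 0 - (- exp (- u * 0) / u)"
    proof (rule nn_integral_FTC_atLeast)
      show "DERIV (\<lambda>\<xi>. - exp (- u * \<xi>) / u) \<xi> :> exp (- u * \<xi>)" for \<xi>
        using u by (auto intro!: derivative_eq_intros)
      show "((\<lambda>\<xi>. - exp (- u * \<xi>) / u) \<longlongrightarrow> 0) at_top" using u by real_asymp
    qed auto
    moreover have "(\<integral>\<^sup>+\<xi>. ennreal (norm (indicator {0..} \<xi> * exp (- u * \<xi>))) \<partial>lborel) =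
       (\<integral>\<^sup>+\<xi>. ennreal (exp (- u * \<xi>)) * indicator {0..} \<xi> \<partial>lborel)"
      by (rule nn_integral_cong) (auto simp: indicator_def)
    ultimately show ?thesis by (intro integrableI_bounded) auto
  qed
  have int: "integrable lborel (\<lambda>\<xi>. indicator {0..} \<xi> * ?f \<xi>)"
    by (rule Bochner_Integration.integrable_bound[OF dom])
      (auto simp: indicator_def abs_mult mult_left_le intro!: AE_I2)
  have "(LBINT \<xi>=ereal 0..\<infinity>. ?f \<xi>) = 0 - ?F 0"
  proof (rule interval_integral_FTC_integrable)
    show "(?F has_vector_derivative ?f \<xi>) (at \<xi>)" for \<xi>
    proof -
      have "(?F has_real_derivative (- u * exp (- u * \<xi>) * (a * sin (a * \<xi>) - u * cos (a * \<xi>)) +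
          exp (- u * \<xi>) * (a * (cos (a * \<xi>) * a) + u * (sin (a * \<xi>) * a))) / (a\<^sup>2 + u\<^sup>2)) (at \<xi>)"
        using p by (auto intro!: derivative_eq_intros simp: mult.commute)
      also have "- u * exp (- u * \<xi>) * (a * sin (a * \<xi>) - u * cos (a * \<xi>)) +
          exp (- u * \<xi>) * (a * (cos (a * \<xi>) * a) + u * (sin (a * \<xi>) * a)) = ?f \<xi> * (a\<^sup>2 + u\<^sup>2)"
        by (simp add: algebra_simps power2_eq_square)
      finally show ?thesis
        by (simp only: nonzero_mult_div_cancel_right[OF p] has_real_derivative_iff_has_vector_derivative)
    qed
    have "set_integrable lborel {0..} ?f" using int by (simp add: set_integrable_def)
    then show "set_integrable lborel (einterval (ereal 0) \<infinity>) ?f"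
      by (rule set_integrable_subset) (auto simp: einterval_def)
    have "(?F \<longlongrightarrow> ?F 0) (at_right 0)"
      by (intro tendsto_intros) (use p in auto)
    then show "((?F \<circ> real_of_ereal) \<longlongrightarrow> ?F 0) (at_right (ereal 0))"
      by (simp add: ereal_tendsto_simps)
    have "(?F \<longlongrightarrow> 0) at_top"
    proof (rule Lim_null_comparison)
      show "\<forall>\<^sub>F \<xi> in at_top. norm (?F \<xi>) \<le> exp (- u * \<xi>) * ((\<bar>a\<bar> + \<bar>u\<bar>) / (a\<^sup>2 + u\<^sup>2))"
      proof (rule always_eventually, rule allI)
        fix \<xi>
        have "\<bar>a * sin (a * \<xi>) - u * cos (a * \<xi>)\<bar> \<le> \<bar>a * sin (a * \<xi>)\<bar> + \<bar>u * cos (a * \<xi>)\<bar>"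
          by (rule abs_triangle_ineq4)
        also have "\<dots> \<le> \<bar>a\<bar> + \<bar>u\<bar>" by (auto simp: abs_mult intro!: add_mono mult_left_le)
        finally show "norm (?F \<xi>) \<le> exp (- u * \<xi>) * ((\<bar>a\<bar> + \<bar>u\<bar>) / (a\<^sup>2 + u\<^sup>2))"
          by (simp add: abs_mult divide_right_mono)
      qed
      have "((\<lambda>\<xi>. exp (- u * \<xi>)) \<longlongrightarrow> 0) at_top" using u by real_asymp
      then show "((\<lambda>\<xi>. exp (- u * \<xi>) * ((\<bar>a\<bar> + \<bar>u\<bar>) / (a\<^sup>2 + u\<^sup>2))) \<longlongrightarrow> 0) at_top"
        by (rule tendsto_mult_left_zero)
    qed
    then show "((?F \<circ> real_of_ereal) \<longlongrightarrow> 0) (at_left \<infinity>)" by (simp add: ereal_tendsto_simps)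
  qed (auto intro!: continuous_intros)
  then have "(LBINT \<xi>=ereal 0..\<infinity>. ?f \<xi>) = u / (a\<^sup>2 + u\<^sup>2)" by simp
  moreover have "(LBINT \<xi>=ereal 0..\<infinity>. ?f \<xi>) = (LBINT \<xi>. indicator {0..} \<xi> * ?f \<xi>)"
    unfolding interval_lebesgue_integral_def set_lebesgue_integral_def
    by (simp, rule integral_cong_AE) (auto simp: indicator_def einterval_def intro!: eventually_mono[OF AE_lborel_singleton[of 0]])
  ultimately show ?thesis using int by (simp add: has_bochner_integral_iff)
qed

lemma real_distribution_sets: "real_distribution \<mu> \<Longrightarrow> sets \<mu> = sets borel"
  by (simp add: real_distribution.events_eq_borel)

lemma char_Re_Im:
  assumes "real_distribution \<mu>"
  shows "Re (char \<mu> t) = (\<integral>x. cos (t * x) \<partial>\<mu>)" "Im (char \<mu> t) = (\<integral>x. sin (t * x) \<partial>\<mu>)"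
proof -
  interpret real_distribution \<mu> by fact
  have int: "complex_integrable \<mu> (\<lambda>x. iexp (t * x))"
    using integrable_iexp[of "\<lambda>x. complex_of_real (t * x)"] by simp
  have "(\<integral>x. cos (t * x) \<partial>\<mu>) = (\<integral>x. Re (iexp (t * x)) \<partial>\<mu>)"
    by (intro Bochner_Integration.integral_cong refl) (simp add: Re_exp)
  also have "\<dots> = Re (char \<mu> t)" unfolding char_def by (rule integral_Re[OF int])
  finally show "Re (char \<mu> t) = (\<integral>x. cos (t * x) \<partial>\<mu>)" by (rule sym)
  have "(\<integral>x. sin (t * x) \<partial>\<mu>) = (\<integral>x. Im (iexp (t * x)) \<partial>\<mu>)"
    by (intro Bochner_Integration.integral_cong refl) (simp add: Im_exp)
  also have "\<dots> = Im (char \<mu> t)" unfolding char_def by (rule integral_Im[OF int])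
  finally show "Im (char \<mu> t) = (\<integral>x. sin (t * x) \<partial>\<mu>)" by (rule sym)
qed

lemma bounded_integrable:
  fixes f :: "'a \<Rightarrow> real"
  assumes "prob_space M" "f \<in> borel_measurable M" "\<And>x. \<bar>f x\<bar> \<le> B"
  shows "integrable M f"
proof -
  interpret prob_space M by fact
  show ?thesis by (rule integrable_const_bound[where B = B]) (use assms in auto)
qed

text \<open>The Cauchy kernel is the Laplace transform of a cosine, and the addition formula for cos
  ((x - y) \<xi>) separates x from y, so the double integral becomes one over products of
  characteristic functions.\<close>

lemma cauchy_kernel_char:
  assumes \<mu>: "real_distribution \<mu>" and \<nu>: "real_distribution \<nu>" and u: "0 < u"
  shows "has_bochner_integral lborel
     (\<lambda>\<xi>. indicator {0..} \<xi> * exp (- u * \<xi>) *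
        (Re (char \<mu> \<xi>) * Re (char \<nu> \<xi>) + Im (char \<mu> \<xi>) * Im (char \<nu> \<xi>)))
     (\<integral>p. u / ((fst p - snd p)\<^sup>2 + u\<^sup>2) \<partial>(\<mu> \<Otimes>\<^sub>M \<nu>))"
proof -
  interpret \<mu>: real_distribution \<mu> by fact
  interpret \<nu>: real_distribution \<nu> by fact
  interpret \<mu>\<nu>: pair_prob_space \<mu> \<nu> ..
  interpret P: pair_sigma_finite "\<mu> \<Otimes>\<^sub>M \<nu>" lborel ..
  have [measurable]: "fst \<in> borel_measurable (\<mu> \<Otimes>\<^sub>M \<nu>)" "snd \<in> borel_measurable (\<mu> \<Otimes>\<^sub>M \<nu>)"
    using measurable_fst[of \<mu> \<nu>] measurable_snd[of \<mu> \<nu>] by (simp_all cong: measurable_cong_sets)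
  define F where "F p \<xi> = indicator {0..} \<xi> * (exp (- u * \<xi>) * cos ((fst p - snd p) * \<xi>))" for p :: "real \<times> real" and \<xi>
  let ?f = "case_prod F"
  have lc: "has_bochner_integral lborel (F p) (u / ((fst p - snd p)\<^sup>2 + u\<^sup>2))" for p
    unfolding F_def by (rule laplace_cos[OF u])
  have meas: "?f \<in> borel_measurable ((\<mu> \<Otimes>\<^sub>M \<nu>) \<Otimes>\<^sub>M lborel)" unfolding F_def by measurable
  have fin: "(\<integral>\<^sup>+z. ennreal (norm (?f z)) \<partial>((\<mu> \<Otimes>\<^sub>M \<nu>) \<Otimes>\<^sub>M lborel)) < \<infinity>"
  proof -
    have "(\<integral>\<^sup>+z. ennreal (norm (?f z)) \<partial>((\<mu> \<Otimes>\<^sub>M \<nu>) \<Otimes>\<^sub>M lborel)) =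
       (\<integral>\<^sup>+p. \<integral>\<^sup>+\<xi>. ennreal (norm (F p \<xi>)) \<partial>lborel \<partial>(\<mu> \<Otimes>\<^sub>M \<nu>))"
      using lborel.nn_integral_fst[of "\<lambda>z. ennreal (norm (?f z))" "\<mu> \<Otimes>\<^sub>M \<nu>"] meas by simp
    also have "\<dots> \<le> (\<integral>\<^sup>+p. \<integral>\<^sup>+\<xi>. ennreal (norm (F (0, 0) \<xi>)) \<partial>lborel \<partial>(\<mu> \<Otimes>\<^sub>M \<nu>))"
      by (intro nn_integral_mono) (auto simp: F_def indicator_def abs_mult mult_left_le intro!: ennreal_leI)
    also have "\<dots> < \<infinity>"
      using lc[of "(0, 0)"] \<mu>\<nu>.emeasure_space_1
      by (simp add: has_bochner_integral_iff integrable_iff_bounded)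
    finally show ?thesis .
  qed
  have I: "integrable ((\<mu> \<Otimes>\<^sub>M \<nu>) \<Otimes>\<^sub>M lborel) ?f"
    using meas fin by (intro integrableI_bounded)
  have inner: "(\<integral>p. F p \<xi> \<partial>(\<mu> \<Otimes>\<^sub>M \<nu>)) = indicator {0..} \<xi> * exp (- u * \<xi>) *
        (Re (char \<mu> \<xi>) * Re (char \<nu> \<xi>) + Im (char \<mu> \<xi>) * Im (char \<nu> \<xi>))" for \<xi>
  proof -
    have i1: "integrable (\<mu> \<Otimes>\<^sub>M \<nu>) (\<lambda>p. cos (\<xi> * fst p) * cos (\<xi> * snd p))"
      "integrable (\<mu> \<Otimes>\<^sub>M \<nu>) (\<lambda>p. sin (\<xi> * fst p) * sin (\<xi> * snd p))"
      by (rule bounded_integrable[OF \<mu>\<nu>.prob_space_axioms, where B = 1]; simp add: abs_mult mult_le_one)+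
    have "(\<integral>p. cos (\<xi> * fst p) * cos (\<xi> * snd p) \<partial>(\<mu> \<Otimes>\<^sub>M \<nu>)) = Re (char \<mu> \<xi>) * Re (char \<nu> \<xi>)"
      unfolding char_Re_Im[OF \<mu>] char_Re_Im[OF \<nu>]
      using \<mu>\<nu>.integral_fst'[OF i1(1)] by simp
    moreover have "(\<integral>p. sin (\<xi> * fst p) * sin (\<xi> * snd p) \<partial>(\<mu> \<Otimes>\<^sub>M \<nu>)) = Im (char \<mu> \<xi>) * Im (char \<nu> \<xi>)"
      unfolding char_Re_Im[OF \<mu>] char_Re_Im[OF \<nu>]
      using \<mu>\<nu>.integral_fst'[OF i1(2)] by simp
    moreover have "(\<integral>p. cos ((fst p - snd p) * \<xi>) \<partial>(\<mu> \<Otimes>\<^sub>M \<nu>)) =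
        (\<integral>p. cos (\<xi> * fst p) * cos (\<xi> * snd p) + sin (\<xi> * fst p) * sin (\<xi> * snd p) \<partial>(\<mu> \<Otimes>\<^sub>M \<nu>))"
      by (intro Bochner_Integration.integral_cong refl) (subst cos_diff[symmetric], simp add: algebra_simps)
    ultimately have "(\<integral>p. cos ((fst p - snd p) * \<xi>) \<partial>(\<mu> \<Otimes>\<^sub>M \<nu>)) =
       Re (char \<mu> \<xi>) * Re (char \<nu> \<xi>) + Im (char \<mu> \<xi>) * Im (char \<nu> \<xi>)"
      using i1 by simp
    then show ?thesis by (simp add: F_def mult.assoc)
  qed
  have eq: "(\<integral>p. \<integral>\<xi>. F p \<xi> \<partial>lborel \<partial>(\<mu> \<Otimes>\<^sub>M \<nu>)) = (\<integral>p. u / ((fst p - snd p)\<^sup>2 + u\<^sup>2) \<partial>(\<mu> \<Otimes>\<^sub>M \<nu>))"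
    using has_bochner_integral_integral_eq[OF lc] by simp
  have int: "integrable lborel (\<lambda>\<xi>. \<integral>p. F p \<xi> \<partial>(\<mu> \<Otimes>\<^sub>M \<nu>))"
    by (rule P.integrable_snd[OF I])
  have fub: "(\<integral>\<xi>. \<integral>p. F p \<xi> \<partial>(\<mu> \<Otimes>\<^sub>M \<nu>) \<partial>lborel) = (\<integral>p. \<integral>\<xi>. F p \<xi> \<partial>lborel \<partial>(\<mu> \<Otimes>\<^sub>M \<nu>))"
    by (rule P.Fubini_integral[OF I])
  show ?thesis
    unfolding has_bochner_integral_iff using int[unfolded inner] trans[OF fub eq, unfolded inner] by blast
qed

lemma has_bochner_integral_nonneg:
  fixes f :: "'a \<Rightarrow> real"
  assumes "has_bochner_integral M f x" "\<And>y. 0 \<le> f y"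
  shows "0 \<le> x"
  using assms by (auto simp: has_bochner_integral_iff intro!: Bochner_Integration.integral_nonneg)

lemma has_bochner_integral_0_imp_AE_0:
  fixes f :: "'a \<Rightarrow> real"
  assumes "has_bochner_integral M f 0" "AE x in M. 0 \<le> f x"
  shows "AE x in M. f x = 0"
  using assms integral_nonneg_eq_0_iff_AE[of M f] by (auto simp: has_bochner_integral_iff)

text \<open>The logarithmic kernel is conditionally positive definite: by the two representations above
  the left-hand side is $\int_0^\infty\int_0^\infty e^{-u\xi}|\hat\mu-\hat\nu|^2(\xi)\,d\xi\,du$.\<close>

lemma log_energy_positive:
  assumes \<mu>: "real_distribution \<mu>" and \<nu>: "real_distribution \<nu>"
    and nz: "AE p in \<mu> \<Otimes>\<^sub>M \<mu>. fst p \<noteq> snd p" "AE p in \<mu> \<Otimes>\<^sub>M \<nu>. fst p \<noteq> snd p"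
      "AE p in \<nu> \<Otimes>\<^sub>M \<nu>. fst p \<noteq> snd p"
    and int: "integrable (\<mu> \<Otimes>\<^sub>M \<mu>) (\<lambda>p. ln \<bar>fst p - snd p\<bar>)" "integrable (\<mu> \<Otimes>\<^sub>M \<nu>) (\<lambda>p. ln \<bar>fst p - snd p\<bar>)"
      "integrable (\<nu> \<Otimes>\<^sub>M \<nu>) (\<lambda>p. ln \<bar>fst p - snd p\<bar>)"
  defines "D \<equiv> 2 * (\<integral>p. ln \<bar>fst p - snd p\<bar> \<partial>(\<mu> \<Otimes>\<^sub>M \<nu>)) - (\<integral>p. ln \<bar>fst p - snd p\<bar> \<partial>(\<mu> \<Otimes>\<^sub>M \<mu>))
     - (\<integral>p. ln \<bar>fst p - snd p\<bar> \<partial>(\<nu> \<Otimes>\<^sub>M \<nu>))"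
  shows "0 \<le> D" and "D = 0 \<Longrightarrow> \<mu> = \<nu>"
proof -
  interpret \<mu>: real_distribution \<mu> by fact
  interpret \<nu>: real_distribution \<nu> by fact
  define k where "k = (\<lambda>(M1::real measure) (M2::real measure) u. \<integral>p. log_kernel (fst p - snd p) u \<partial>(M1 \<Otimes>\<^sub>M M2))"
  define c where "c = (\<lambda>(M1::real measure) (M2::real measure) u. \<integral>p. u / ((fst p - snd p)\<^sup>2 + u\<^sup>2) \<partial>(M1 \<Otimes>\<^sub>M M2))"
  define J where "J u = k \<mu> \<mu> u + k \<nu> \<nu> u - 2 * k \<mu> \<nu> u" for u
  define Q where "Q \<xi> = (Re (char \<mu> \<xi>) - Re (char \<nu> \<xi>))\<^sup>2 + (Im (char \<mu> \<xi>) - Im (char \<nu> \<xi>))\<^sup>2" for \<xi>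
  \<comment> \<open>The term u / (1 + u^2) is the same for all pairs of probability measures, so it
    cancels in the combination \<open>J\<close> with weights 1, 1, -2.\<close>
  have kc: "k M1 M2 u = c M1 M2 u - u / (1 + u\<^sup>2)"
    if "real_distribution M1" "real_distribution M2" "0 < u" for M1 M2 u
  proof -
    interpret M1: real_distribution M1 by fact
    interpret M2: real_distribution M2 by fact
    interpret MM: pair_prob_space M1 M2 ..
    have [measurable]: "fst \<in> borel_measurable (M1 \<Otimes>\<^sub>M M2)" "snd \<in> borel_measurable (M1 \<Otimes>\<^sub>M M2)"
      using measurable_fst[of M1 M2] measurable_snd[of M1 M2] by (simp_all cong: measurable_cong_sets)
    have "integrable (M1 \<Otimes>\<^sub>M M2) (\<lambda>p. u / ((fst p - snd p)\<^sup>2 + u\<^sup>2))"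
    proof (rule bounded_integrable[OF MM.prob_space_axioms])
      fix p :: "real \<times> real"
      have "u / ((fst p - snd p)\<^sup>2 + u\<^sup>2) \<le> u / u\<^sup>2"
        using \<open>0 < u\<close> by (intro divide_left_mono mult_pos_pos) (auto simp: add_nonneg_pos)
      then show "\<bar>u / ((fst p - snd p)\<^sup>2 + u\<^sup>2)\<bar> \<le> u / u\<^sup>2" using \<open>0 < u\<close> by simp
    qed simp
    then show ?thesis using \<open>0 < u\<close> by (simp add: k_def c_def log_kernel_def MM.prob_space)
  qed
  have k: "has_bochner_integral lborel (k M1 M2) (- (\<integral>p. ln \<bar>fst p - snd p\<bar> \<partial>(M1 \<Otimes>\<^sub>M M2)))"
    if "real_distribution M1" "real_distribution M2"
      "AE p in M1 \<Otimes>\<^sub>M M2. fst p \<noteq> snd p" "integrable (M1 \<Otimes>\<^sub>M M2) (\<lambda>p. ln \<bar>fst p - snd p\<bar>)" for M1 M2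
  proof -
    interpret M1: real_distribution M1 by fact
    interpret M2: real_distribution M2 by fact
    interpret MM: pair_prob_space M1 M2 ..
    have [measurable]: "fst \<in> borel_measurable (M1 \<Otimes>\<^sub>M M2)" "snd \<in> borel_measurable (M1 \<Otimes>\<^sub>M M2)"
      using measurable_fst[of M1 M2] measurable_snd[of M1 M2] by (simp_all cong: measurable_cong_sets)
    show ?thesis unfolding has_bochner_integral_iff k_def
      using log_kernel_Fubini[OF MM.prob_space_axioms, of "\<lambda>p. fst p - snd p"] that by simp
  qed
  have J_int: "has_bochner_integral lborel J D"
  proof -
    have "has_bochner_integral lborel J ((- (\<integral>p. ln \<bar>fst p - snd p\<bar> \<partial>(\<mu> \<Otimes>\<^sub>M \<mu>))) +
        (- (\<integral>p. ln \<bar>fst p - snd p\<bar> \<partial>(\<nu> \<Otimes>\<^sub>M \<nu>))) - 2 * (- (\<integral>p. ln \<bar>fst p - snd p\<bar> \<partial>(\<mu> \<Otimes>\<^sub>M \<nu>))))"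
      unfolding J_def
      by (intro has_bochner_integral_diff has_bochner_integral_add has_bochner_integral_mult_right k \<mu> \<nu> nz int)
    then show ?thesis by (simp add: D_def algebra_simps)
  qed
  have Q: "has_bochner_integral lborel (\<lambda>\<xi>. indicator {0..} \<xi> * exp (- u * \<xi>) * Q \<xi>) (J u)" if u: "0 < u" for u
  proof -
    have "has_bochner_integral lborel (\<lambda>\<xi>.
        indicator {0..} \<xi> * exp (- u * \<xi>) * (Re (char \<mu> \<xi>) * Re (char \<mu> \<xi>) + Im (char \<mu> \<xi>) * Im (char \<mu> \<xi>)) +
        indicator {0..} \<xi> * exp (- u * \<xi>) * (Re (char \<nu> \<xi>) * Re (char \<nu> \<xi>) + Im (char \<nu> \<xi>) * Im (char \<nu> \<xi>)) -
        2 * (indicator {0..} \<xi> * exp (- u * \<xi>) * (Re (char \<mu> \<xi>) * Re (char \<nu> \<xi>) + Im (char \<mu> \<xi>) * Im (char \<nu> \<xi>))))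
      (c \<mu> \<mu> u + c \<nu> \<nu> u - 2 * c \<mu> \<nu> u)"
      unfolding c_def
      by (intro has_bochner_integral_diff has_bochner_integral_add has_bochner_integral_mult_right cauchy_kernel_char \<mu> \<nu> u)
    moreover have "c \<mu> \<mu> u + c \<nu> \<nu> u - 2 * c \<mu> \<nu> u = J u"
      by (simp add: J_def kc \<mu> \<nu> u)
    moreover have "indicator {0..} \<xi> * exp (- u * \<xi>) * (Re (char \<mu> \<xi>) * Re (char \<mu> \<xi>) + Im (char \<mu> \<xi>) * Im (char \<mu> \<xi>)) +
        indicator {0..} \<xi> * exp (- u * \<xi>) * (Re (char \<nu> \<xi>) * Re (char \<nu> \<xi>) + Im (char \<nu> \<xi>) * Im (char \<nu> \<xi>)) -
        2 * (indicator {0..} \<xi> * exp (- u * \<xi>) * (Re (char \<mu> \<xi>) * Re (char \<nu> \<xi>) + Im (char \<mu> \<xi>) * Im (char \<nu> \<xi>))) =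
        indicator {0..} \<xi> * exp (- u * \<xi>) * Q \<xi>" for \<xi> :: real
      by (simp add: Q_def power2_eq_square algebra_simps)
    ultimately show ?thesis by simp
  qed
  have Q_nonneg: "0 \<le> indicator {0..} \<xi> * exp (- u * \<xi>) * Q \<xi>" for \<xi> u :: real by (simp add: Q_def)
  have J_nonneg: "0 \<le> J u" for u
  proof (cases "0 < u")
    case True
    then show ?thesis using has_bochner_integral_nonneg[OF Q] Q_nonneg by blast
  next
    case False
    then show ?thesis by (simp add: J_def k_def log_kernel_def)
  qed
  then show "0 \<le> D" by (rule has_bochner_integral_nonneg[OF J_int])
  assume "D = 0"
  then have "AE u in lborel. J u = 0"
    using has_bochner_integral_0_imp_AE_0[of lborel J] J_int J_nonneg by simp
  \<comment> \<open>A single u is enough: the factor exp (-u \<xi>) is positive, so J u = 0 forces Q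
    to vanish almost everywhere on the half-line, hence on all of \<xi> > 0 by continuity.\<close>
  then obtain u where u: "0 < u" "J u = 0"
  proof -
    have "\<not> (AE u in lborel. \<not> (0 < u \<and> u < (1::real)))"
    proof
      assume "AE u in lborel. \<not> (0 < u \<and> u < (1::real))"
      then have "emeasure lborel {0<..<1::real} = 0"
        by (subst (asm) AE_iff_measurable[of "{0<..<1}"]) auto
      then show False by simp
    qed
    then have "\<exists>u. 0 < u \<and> J u = 0"
      using \<open>AE u in lborel. J u = 0\<close> by (metis (mono_tags, lifting) eventually_mono)
    then show ?thesis using that by blast
  qed
  have "AE \<xi> in lborel. indicator {0..} \<xi> * exp (- u * \<xi>) * Q \<xi> = 0"
    using has_bochner_integral_0_imp_AE_0[OF Q[OF u(1), unfolded u(2)]] Q_nonneg by simp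
  then have AE: "AE \<xi> in lborel. 0 \<le> \<xi> \<longrightarrow> Q \<xi> = 0"
    by (rule eventually_mono) (auto simp: indicator_def)
  have cont: "isCont Q \<xi>" for \<xi>
    unfolding Q_def by (intro continuous_intros isCont_Re isCont_Im \<mu>.isCont_char \<nu>.isCont_char)
  have pos: "Q \<xi> = 0" if "0 < \<xi>" for \<xi>
  proof (rule ccontr)
    assume "Q \<xi> \<noteq> 0"
    then have "\<forall>\<^sub>F \<eta> in nhds \<xi>. Q \<eta> \<noteq> 0"
      using cont[of \<xi>] by (metis isCont_def tendsto_at_iff_tendsto_nhds tendsto_imp_eventually_ne)
    moreover have "\<forall>\<^sub>F \<eta> in nhds \<xi>. 0 < \<eta>" using that by (rule order_tendstoD(1)[OF filterlim_ident])
    ultimately have "\<forall>\<^sub>F \<eta> in nhds \<xi>. 0 < \<eta> \<and> Q \<eta> \<noteq> 0" by (rule eventually_conj[rotated])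
    then obtain e where e: "0 < e" "\<And>\<eta>. dist \<eta> \<xi> < e \<Longrightarrow> 0 < \<eta> \<and> Q \<eta> \<noteq> 0"
      unfolding eventually_nhds_metric by blast
    have "AE \<eta> in lborel. \<not> (\<xi> < \<eta> \<and> \<eta> < \<xi> + e)"
    proof (rule eventually_mono[OF AE])
      fix \<eta> assume "0 \<le> \<eta> \<longrightarrow> Q \<eta> = 0"
      then show "\<not> (\<xi> < \<eta> \<and> \<eta> < \<xi> + e)" using e(2)[of \<eta>] that by (auto simp: dist_real_def)
    qed
    then have "emeasure lborel {\<xi><..<\<xi> + e} = 0"
      by (subst (asm) AE_iff_measurable[of "{\<xi><..<\<xi> + e}"]) auto
    then show False using e(1) by simp
  qed
  have eq_pos: "char \<mu> \<xi> = char \<nu> \<xi>" if "0 < \<xi>" for \<xi>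
    using pos[OF that] by (auto simp: Q_def sum_power2_eq_zero_iff complex_eq_iff)
  \<comment> \<open>The real part is even and the imaginary part odd in the frequency, so positive
    frequencies determine the negative ones.\<close>
  have "char \<mu> \<xi> = char \<nu> \<xi>" for \<xi>
  proof -
    consider "\<xi> = 0" | "0 < \<xi>" | "0 < - \<xi>" by linarith
    then show ?thesis
    proof cases
      case 1
      then show ?thesis by (simp add: \<mu>.char_zero \<nu>.char_zero)
    next
      case 3
      then have *: "char \<mu> (- \<xi>) = char \<nu> (- \<xi>)" by (rule eq_pos)
      show ?thesis
        using arg_cong[OF *, of Re] arg_cong[OF *, of Im]
        by (simp add: complex_eq_iff char_Re_Im \<mu> \<nu>)
    qed (rule eq_pos)
  qed
  then show "\<mu> = \<nu>" by (intro Levy_uniqueness \<mu> \<nu> ext)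
qed

section \<open>Finite energy and the Euler-Lagrange conditions\<close>

lemma ereal_integral_eq:
  assumes g: "integrable M g" and f: "AE x in M. f x = ereal (g x)"
  shows "ereal_integral M f = ereal (\<integral>x. g x \<partial>M)"
proof -
  have 1: "(\<integral>\<^sup>+x. e2ennreal (f x) \<partial>M) = (\<integral>\<^sup>+x. ennreal (g x) \<partial>M)"
    by (rule nn_integral_cong_AE) (use f in \<open>auto elim!: eventually_mono simp: ennreal.abs_eq\<close>)
  have 2: "(\<integral>\<^sup>+x. e2ennreal (- f x) \<partial>M) = (\<integral>\<^sup>+x. ennreal (- g x) \<partial>M)"
    by (rule nn_integral_cong_AE) (use f in \<open>auto elim!: eventually_mono simp: ennreal.abs_eq\<close>)
  have fin: "(\<integral>\<^sup>+x. ennreal (g x) \<partial>M) \<noteq> \<infinity>" "(\<integral>\<^sup>+x. ennreal (- g x) \<partial>M) \<noteq> \<infinity>"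
    using g by (auto simp: real_integrable_def)
  have e: "enn2ereal x = ereal (enn2real x)" if "x \<noteq> \<infinity>" for x
    using that by (cases x) (auto simp: enn2real_ennreal)
  show ?thesis unfolding ereal_integral_def 1 2 e[OF fin(1)] e[OF fin(2)] real_lebesgue_integral_def[OF g] by simp
qed

lemma fst_snd_measurable:
  assumes "sets (M1 :: real measure) = sets borel" "sets (M2 :: real measure) = sets borel"
  shows "fst \<in> borel_measurable (M1 \<Otimes>\<^sub>M M2)" "snd \<in> borel_measurable (M1 \<Otimes>\<^sub>M M2)"
  using measurable_fst[of M1 M2] measurable_snd[of M1 M2] assms by (simp_all cong: measurable_cong_sets)

lemma log_energy_eq:
  assumes "integrable \<nu> V" "AE p in \<nu> \<Otimes>\<^sub>M \<nu>. fst p \<noteq> snd p"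
    "integrable (\<nu> \<Otimes>\<^sub>M \<nu>) (\<lambda>p. ln \<bar>fst p - snd p\<bar>)"
  shows "log_energy V \<nu> = ereal ((\<integral>x. V x \<partial>\<nu>) - (\<integral>p. ln \<bar>fst p - snd p\<bar> \<partial>(\<nu> \<Otimes>\<^sub>M \<nu>)))"
proof -
  have "ereal_integral \<nu> (\<lambda>x. ereal (V x)) = ereal (\<integral>x. V x \<partial>\<nu>)"
    by (rule ereal_integral_eq) (use assms in auto)
  moreover have "ereal_integral (\<nu> \<Otimes>\<^sub>M \<nu>) (\<lambda>(x, y). log_abs (x - y)) = ereal (\<integral>p. ln \<bar>fst p - snd p\<bar> \<partial>(\<nu> \<Otimes>\<^sub>M \<nu>))"
    by (rule ereal_integral_eq[OF assms(3)])
      (use assms(2) in \<open>auto elim!: eventually_mono simp: log_abs_def\<close>)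
  ultimately show ?thesis by (simp add: log_energy_def)
qed

text \<open>Bounds the positive part of the kernel by a sum of functions of one variable, since |x -
  y| is at most (1 + |x|) (1 + |y|).\<close>

lemma ln_abs_diff_le: "x \<noteq> y \<Longrightarrow> ln \<bar>x - y :: real\<bar> \<le> ln (1 + \<bar>x\<bar>) + ln (1 + \<bar>y\<bar>)"
proof -
  assume "x \<noteq> y"
  have "\<bar>x - y\<bar> \<le> \<bar>x\<bar> + \<bar>y\<bar>" by (rule abs_triangle_ineq4)
  also have "\<dots> \<le> (1 + \<bar>x\<bar>) * (1 + \<bar>y\<bar>)" by (simp add: algebra_simps)
  finally have "ln \<bar>x - y\<bar> \<le> ln ((1 + \<bar>x\<bar>) * (1 + \<bar>y\<bar>))" using \<open>x \<noteq> y\<close> by (intro ln_mono) auto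
  moreover have "0 < 1 + \<bar>x\<bar>" "0 < 1 + \<bar>y\<bar>" by auto
  ultimately show ?thesis by (simp only: ln_mult_pos)
qed

lemma integrable_fst_snd:
  fixes f :: "real \<Rightarrow> real"
  assumes "prob_space M1" "prob_space M2" "f \<in> borel_measurable borel"
    "sets M1 = sets borel" "sets M2 = sets borel"
  shows "integrable M1 f \<Longrightarrow> integrable (M1 \<Otimes>\<^sub>M M2) (\<lambda>p. f (fst p))"
    and "integrable M2 f \<Longrightarrow> integrable (M1 \<Otimes>\<^sub>M M2) (\<lambda>p. f (snd p))"
proof -
  interpret M1: prob_space M1 by fact
  interpret M2: prob_space M2 by fact
  interpret P: pair_prob_space M1 M2 ..
  note [measurable] = fst_snd_measurable[OF assms(4,5)] assms(3)
  { assume i: "integrable M1 f"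
    have "(\<integral>\<^sup>+p. ennreal (norm (f (fst p))) \<partial>(M1 \<Otimes>\<^sub>M M2)) = (\<integral>\<^sup>+x. ennreal (norm (f x)) \<partial>M1)"
      using M2.nn_integral_fst[of "\<lambda>p. ennreal (norm (f (fst p)))" M1] M2.emeasure_space_1 by simp
    then show "integrable (M1 \<Otimes>\<^sub>M M2) (\<lambda>p. f (fst p))"
      using i by (intro integrableI_bounded) (auto simp: integrable_iff_bounded) }
  { assume i: "integrable M2 f"
    have "(\<integral>\<^sup>+p. ennreal (norm (f (snd p))) \<partial>(M1 \<Otimes>\<^sub>M M2)) = (\<integral>\<^sup>+x. ennreal (norm (f x)) \<partial>M2)"
      using M2.nn_integral_fst[of "\<lambda>p. ennreal (norm (f (snd p)))" M1] M1.emeasure_space_1 by simp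
    then show "integrable (M1 \<Otimes>\<^sub>M M2) (\<lambda>p. f (snd p))"
      using i by (intro integrableI_bounded) (auto simp: integrable_iff_bounded) }
qed

text \<open>The growth of V bounds ln (1 + |x|) by V, so the positive part of the logarithmic kernel
  has finite integral as soon as V has. An infinite negative part would then make the energy
  infinite.\<close>

lemma log_energy_finite:
  assumes \<nu>: "real_distribution \<nu>" and V [measurable]: "V \<in> borel_measurable borel"
    and growth: "\<And>x. a * ln (1 + \<bar>x\<bar>) - C \<le> V x" and a: "0 < a"
    and fin: "log_energy V \<nu> \<noteq> \<infinity>"
  shows "integrable \<nu> V" "integrable \<nu> (\<lambda>x. ln (1 + \<bar>x\<bar>))" "AE p in \<nu> \<Otimes>\<^sub>M \<nu>. fst p \<noteq> snd p"
    "integrable (\<nu> \<Otimes>\<^sub>M \<nu>) (\<lambda>p. ln \<bar>fst p - snd p\<bar>)"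
proof -
  interpret real_distribution \<nu> by fact
  interpret P: pair_prob_space \<nu> \<nu> ..
  note [measurable] = fst_snd_measurable[OF real_distribution_sets[OF \<nu>] real_distribution_sets[OF \<nu>]]
  have Vm [measurable]: "V \<in> borel_measurable \<nu>" by simp
  have lb: "- C \<le> V x" for x using growth[of x] a by (smt (verit) ln_ge_zero mult_nonneg_nonneg abs_ge_zero)
  have neg: "(\<integral>\<^sup>+x. ennreal (- V x) \<partial>\<nu>) \<noteq> \<infinity>"
  proof -
    have "(\<integral>\<^sup>+x. ennreal (- V x) \<partial>\<nu>) \<le> (\<integral>\<^sup>+x. ennreal C \<partial>\<nu>)"
      by (intro nn_integral_mono ennreal_leI) (use lb in \<open>simp add: minus_le_iff\<close>)
    also have "\<dots> < \<infinity>" using emeasure_space_1 by simp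
    finally show ?thesis by simp
  qed
  \<comment> \<open>An infinite integral of V gives infinite energy whatever the logarithmic term
    is, because \<infinity> - \<infinity> = \<infinity>.\<close>
  have pos: "(\<integral>\<^sup>+x. ennreal (V x) \<partial>\<nu>) \<noteq> \<infinity>"
  proof
    assume "(\<integral>\<^sup>+x. ennreal (V x) \<partial>\<nu>) = \<infinity>"
    then have "ereal_integral \<nu> (\<lambda>x. ereal (V x)) = \<infinity>"
      using neg unfolding ereal_integral_def
      by (cases "\<integral>\<^sup>+x. ennreal (- V x) \<partial>\<nu>") (auto simp: ennreal.abs_eq[symmetric] top_ereal_def)
    then show False using fin by (simp add: log_energy_def)
  qed
  show Vint: "integrable \<nu> V" using pos neg by (simp add: real_integrable_def)
  have "integrable \<nu> (\<lambda>x. (V x + C) / a)" using Vint by simp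
  then show lnint: "integrable \<nu> (\<lambda>x. ln (1 + \<bar>x\<bar>))"
  proof (rule Bochner_Integration.integrable_bound)
    show "AE x in \<nu>. norm (ln (1 + \<bar>x\<bar>)) \<le> norm ((V x + C) / a)"
    proof (rule AE_I2)
      fix x
      have "ln (1 + \<bar>x\<bar>) \<le> (V x + C) / a" using growth[of x] a by (simp add: field_simps)
      moreover have "0 \<le> ln (1 + \<bar>x\<bar>)" by (rule ln_ge_zero) simp
      ultimately show "norm (ln (1 + \<bar>x\<bar>)) \<le> norm ((V x + C) / a)"
        unfolding real_norm_def by linarith
    qed
  qed simp
  have log_abs_m [measurable]: "log_abs \<in> borel_measurable borel" unfolding log_abs_def by measurable
  let ?k = "\<lambda>p. log_abs (fst p - snd p)"
  have sum_int: "integrable (\<nu> \<Otimes>\<^sub>M \<nu>) (\<lambda>p. ln (1 + \<bar>fst p\<bar>) + ln (1 + \<bar>snd p\<bar>))"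
    by (intro Bochner_Integration.integrable_add integrable_fst_snd[where f = "\<lambda>x. ln (1 + \<bar>x\<bar>)"]
      prob_space_axioms lnint real_distribution_sets \<nu>) measurable
  have kpos: "(\<integral>\<^sup>+p. e2ennreal (?k p) \<partial>(\<nu> \<Otimes>\<^sub>M \<nu>)) \<noteq> \<infinity>"
  proof -
    have "(\<integral>\<^sup>+p. e2ennreal (?k p) \<partial>(\<nu> \<Otimes>\<^sub>M \<nu>)) \<le> (\<integral>\<^sup>+p. ennreal (ln (1 + \<bar>fst p\<bar>) + ln (1 + \<bar>snd p\<bar>)) \<partial>(\<nu> \<Otimes>\<^sub>M \<nu>))"
    proof (rule nn_integral_mono)
      fix p :: "real \<times> real"
      show "e2ennreal (?k p) \<le> ennreal (ln (1 + \<bar>fst p\<bar>) + ln (1 + \<bar>snd p\<bar>))"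
        using ln_abs_diff_le[of "fst p" "snd p"]
        by (auto simp: log_abs_def ennreal.abs_eq[symmetric] e2ennreal_neg intro!: ennreal_leI simp del: ennreal_plus)
    qed
    also have "\<dots> < \<infinity>" using sum_int by (simp add: real_integrable_def less_top)
    finally show ?thesis by simp
  qed
  have kneg: "(\<integral>\<^sup>+p. e2ennreal (- ?k p) \<partial>(\<nu> \<Otimes>\<^sub>M \<nu>)) \<noteq> \<infinity>"
  proof
    assume "(\<integral>\<^sup>+p. e2ennreal (- ?k p) \<partial>(\<nu> \<Otimes>\<^sub>M \<nu>)) = \<infinity>"
    then have "ereal_integral (\<nu> \<Otimes>\<^sub>M \<nu>) ?k = - \<infinity>"
      using kpos unfolding ereal_integral_def
      by (cases "\<integral>\<^sup>+p. e2ennreal (?k p) \<partial>(\<nu> \<Otimes>\<^sub>M \<nu>)") (auto simp: top_ereal_def)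
    moreover have "ereal_integral \<nu> (\<lambda>x. ereal (V x)) = ereal (\<integral>x. V x \<partial>\<nu>)"
      by (rule ereal_integral_eq) (use Vint in auto)
    ultimately show False using fin by (simp add: log_energy_def case_prod_beta')
  qed
  \<comment> \<open>\<open>log_abs\<close> is infinite on the diagonal, so finiteness of the
    integral forces the diagonal to be a null set; off it \<open>log_abs\<close> and
    \<open>ln\<close> agree.\<close>
  have "AE p in \<nu> \<Otimes>\<^sub>M \<nu>. e2ennreal (- ?k p) \<noteq> \<infinity>"
    by (rule nn_integral_PInf_AE[OF _ kneg]) measurable
  then show AE: "AE p in \<nu> \<Otimes>\<^sub>M \<nu>. fst p \<noteq> snd p"
    by (rule eventually_mono) (auto simp: log_abs_def)
  have "(\<integral>\<^sup>+p. ennreal (ln \<bar>fst p - snd p\<bar>) \<partial>(\<nu> \<Otimes>\<^sub>M \<nu>)) = (\<integral>\<^sup>+p. e2ennreal (?k p) \<partial>(\<nu> \<Otimes>\<^sub>M \<nu>))"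
    "(\<integral>\<^sup>+p. ennreal (- ln \<bar>fst p - snd p\<bar>) \<partial>(\<nu> \<Otimes>\<^sub>M \<nu>)) = (\<integral>\<^sup>+p. e2ennreal (- ?k p) \<partial>(\<nu> \<Otimes>\<^sub>M \<nu>))"
    by (rule nn_integral_cong_AE, rule eventually_mono[OF AE], simp add: log_abs_def ennreal.abs_eq)+
  then show "integrable (\<nu> \<Otimes>\<^sub>M \<nu>) (\<lambda>p. ln \<bar>fst p - snd p\<bar>)"
    using kpos kneg by (simp add: real_integrable_def)
qed

text \<open>On the support of \<mu> the kernel is at most ln (1 + |x|) plus a constant. Since |l|
  \<le> 2 M - l whenever l \<le> M and M is nonnegative, the absolute integral over y is bounded by
  2 ln (1 + |x|) plus a constant, through the lower bound on U; this is integrable for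
  \<nu>.\<close>

lemma log_potential_Fubini:
  assumes \<mu>: "real_distribution \<mu>" and \<nu>: "real_distribution \<nu>"
    and U: "\<And>x. has_bochner_integral \<mu> (\<lambda>y. ln \<bar>x - y\<bar>) (U x)"
    and atom: "\<And>x. AE y in \<mu>. x \<noteq> y"
    and bdd: "AE y in \<mu>. \<bar>y\<bar> \<le> B" and lower: "\<And>x. c \<le> U x"
    and ln_int: "integrable \<nu> (\<lambda>x. ln (1 + \<bar>x\<bar>))"
  shows "AE p in \<nu> \<Otimes>\<^sub>M \<mu>. fst p \<noteq> snd p"
    "integrable (\<nu> \<Otimes>\<^sub>M \<mu>) (\<lambda>p. ln \<bar>fst p - snd p\<bar>)"
    "has_bochner_integral \<nu> U (\<integral>p. ln \<bar>fst p - snd p\<bar> \<partial>(\<nu> \<Otimes>\<^sub>M \<mu>))"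
proof -
  interpret \<mu>: real_distribution \<mu> by fact
  interpret \<nu>: real_distribution \<nu> by fact
  interpret P: pair_prob_space \<nu> \<mu> ..
  note [measurable] = fst_snd_measurable[OF real_distribution_sets[OF \<nu>] real_distribution_sets[OF \<mu>]]
  show AE: "AE p in \<nu> \<Otimes>\<^sub>M \<mu>. fst p \<noteq> snd p"
  proof (rule P.AE_pair_measure)
    show "{p \<in> space (\<nu> \<Otimes>\<^sub>M \<mu>). fst p \<noteq> snd p} \<in> sets (\<nu> \<Otimes>\<^sub>M \<mu>)" by measurable
  qed (use atom in simp)
  have lnB: "AE y in \<mu>. ln (1 + \<bar>y\<bar>) \<le> ln (1 + \<bar>B\<bar>)"
    using bdd by (rule eventually_mono) (auto intro!: ln_mono)
  have abs_le: "(\<integral>\<^sup>+y. ennreal \<bar>ln \<bar>x - y\<bar>\<bar> \<partial>\<mu>) \<le> ennreal (2 * ln (1 + \<bar>x\<bar>) + (2 * ln (1 + \<bar>B\<bar>) + \<bar>c\<bar>))" for x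
  proof -
    have i: "integrable \<mu> (\<lambda>y. ln \<bar>x - y\<bar>)" and e: "(\<integral>y. ln \<bar>x - y\<bar> \<partial>\<mu>) = U x"
      using U[of x] by (auto simp: has_bochner_integral_iff)
    have "(\<integral>\<^sup>+y. ennreal \<bar>ln \<bar>x - y\<bar>\<bar> \<partial>\<mu>) = ennreal (\<integral>y. \<bar>ln \<bar>x - y\<bar>\<bar> \<partial>\<mu>)"
      by (rule nn_integral_eq_integral) (use i in auto)
    also have "(\<integral>y. \<bar>ln \<bar>x - y\<bar>\<bar> \<partial>\<mu>) \<le> (\<integral>y. 2 * (ln (1 + \<bar>x\<bar>) + ln (1 + \<bar>B\<bar>)) - ln \<bar>x - y\<bar> \<partial>\<mu>)"
    proof (rule integral_mono_AE)
      show "AE y in \<mu>. \<bar>ln \<bar>x - y\<bar>\<bar> \<le> 2 * (ln (1 + \<bar>x\<bar>) + ln (1 + \<bar>B\<bar>)) - ln \<bar>x - y\<bar>"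
        using lnB atom[of x]
      proof eventually_elim
        case (elim y)
        have "ln \<bar>x - y\<bar> \<le> ln (1 + \<bar>x\<bar>) + ln (1 + \<bar>B\<bar>)" using ln_abs_diff_le[of x y] elim by linarith
        moreover have "0 \<le> ln (1 + \<bar>x\<bar>)" "0 \<le> ln (1 + \<bar>B\<bar>)" by (auto intro!: ln_ge_zero)
        moreover have "\<bar>l\<bar> \<le> 2 * (r + s) - l" if "l \<le> r + s" "0 \<le> r" "0 \<le> s" for l r s :: real
          using that by (cases "0 \<le> l") simp_all
        ultimately show ?case by blast
      qed
    qed (use i in auto)
    also have "\<dots> = 2 * (ln (1 + \<bar>x\<bar>) + ln (1 + \<bar>B\<bar>)) - U x"
      using i e \<mu>.prob_space by simp
    also have "\<dots> \<le> 2 * ln (1 + \<bar>x\<bar>) + (2 * ln (1 + \<bar>B\<bar>) + \<bar>c\<bar>)" using lower[of x] by simp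
    finally show ?thesis by (simp add: ennreal_leI)
  qed
  have "(\<integral>\<^sup>+p. ennreal (norm (ln \<bar>fst p - snd p\<bar>)) \<partial>(\<nu> \<Otimes>\<^sub>M \<mu>)) = (\<integral>\<^sup>+x. \<integral>\<^sup>+y. ennreal \<bar>ln \<bar>x - y\<bar>\<bar> \<partial>\<mu> \<partial>\<nu>)"
    using \<mu>.nn_integral_fst[of "\<lambda>p. ennreal (norm (ln \<bar>fst p - snd p\<bar>))" \<nu>] by simp
  also have "\<dots> \<le> (\<integral>\<^sup>+x. ennreal (2 * ln (1 + \<bar>x\<bar>) + (2 * ln (1 + \<bar>B\<bar>) + \<bar>c\<bar>)) \<partial>\<nu>)"
    by (intro nn_integral_mono abs_le)
  also have "\<dots> < \<infinity>"
  proof -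
    have "integrable \<nu> (\<lambda>x. 2 * ln (1 + \<bar>x\<bar>) + (2 * ln (1 + \<bar>B\<bar>) + \<bar>c\<bar>))" using ln_int by simp
    then show ?thesis by (simp add: real_integrable_def less_top)
  qed
  finally show I: "integrable (\<nu> \<Otimes>\<^sub>M \<mu>) (\<lambda>p. ln \<bar>fst p - snd p\<bar>)"
    by (intro integrableI_bounded) auto
  have U_eq: "U x = (\<integral>y. ln \<bar>x - y\<bar> \<partial>\<mu>)" for x
    using has_bochner_integral_integral_eq[OF U[of x]] by simp
  show "has_bochner_integral \<nu> U (\<integral>p. ln \<bar>fst p - snd p\<bar> \<partial>(\<nu> \<Otimes>\<^sub>M \<mu>))"
    unfolding has_bochner_integral_iff U_eq
    using P.integrable_fst'[OF I] P.integral_fst'[OF I] by simp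
qed

text \<open>The energy of a competitor \<nu> exceeds that of \<mu> by (\<integral> (V - 2 U) d\<nu>
  - d) plus the quantity \<open>D\<close> of \<open>log_energy_positive\<close>. Both are
  nonnegative, and vanishing of the second forces \<nu> = \<mu>. Integrating V - 2 U = d against
  \<mu> expresses the double logarithmic integral by \<integral> V d\<mu> and d.\<close>

lemma Euler_Lagrange_equilibrium:
  assumes \<mu>: "real_distribution \<mu>" and V [measurable]: "V \<in> borel_measurable borel"
    and growth: "\<And>x. a * ln (1 + \<bar>x\<bar>) - C \<le> V x" and a: "0 < a"
    and U: "\<And>x. has_bochner_integral \<mu> (\<lambda>y. ln \<bar>x - y\<bar>) (U x)"
    and atom: "\<And>x. AE y in \<mu>. x \<noteq> y"
    and bdd: "AE y in \<mu>. \<bar>y\<bar> \<le> B" and lower: "\<And>x. c \<le> U x"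
    and EL_le: "\<And>x. d \<le> V x - 2 * U x" and EL_eq: "AE x in \<mu>. V x - 2 * U x = d"
    and Vint: "integrable \<mu> V"
  shows "equilibrium_measure V = \<mu>"
    and "min_energy V = ereal ((\<integral>x. V x \<partial>\<mu>) / 2 + d / 2)"
    and "min_energy V = log_energy V \<mu>"
proof -
  interpret \<mu>: real_distribution \<mu> by fact
  let ?L = "\<lambda>M1 M2. \<integral>p. ln \<bar>fst p - snd p\<bar> \<partial>(M1 \<Otimes>\<^sub>M M2)"
  have lnm: "integrable \<mu> (\<lambda>x. ln (1 + \<bar>x\<bar>))"
  proof (rule \<mu>.integrable_const_bound[where B = "ln (1 + \<bar>B\<bar>)"])
    show "AE x in \<mu>. norm (ln (1 + \<bar>x\<bar>)) \<le> ln (1 + \<bar>B\<bar>)"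
      using bdd by (rule eventually_mono) (auto intro!: ln_mono)
  qed simp
  note mm = log_potential_Fubini[OF \<mu> \<mu> U atom bdd lower lnm]
  have E\<mu>: "log_energy V \<mu> = ereal ((\<integral>x. V x \<partial>\<mu>) - ?L \<mu> \<mu>)"
    by (rule log_energy_eq[OF Vint mm(1,2)])
  have d: "(\<integral>x. V x \<partial>\<mu>) - 2 * ?L \<mu> \<mu> = d"
  proof -
    have "(\<integral>x. V x \<partial>\<mu>) - 2 * ?L \<mu> \<mu> = (\<integral>x. V x - 2 * U x \<partial>\<mu>)"
      using mm(3) Vint by (simp add: has_bochner_integral_iff)
    also have "\<dots> = (\<integral>x. d \<partial>\<mu>)"
      using EL_eq mm(3) Vint by (intro integral_cong_AE) (auto simp: has_bochner_integral_iff)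
    finally show ?thesis using \<mu>.prob_space by simp
  qed
  have main: "log_energy V \<mu> \<le> log_energy V \<nu> \<and> (log_energy V \<nu> = log_energy V \<mu> \<longrightarrow> \<nu> = \<mu>)"
    if \<nu>: "real_distribution \<nu>" for \<nu>
  proof (cases "log_energy V \<nu> = \<infinity>")
    case True
    then show ?thesis by (simp add: E\<mu>)
  next
    case False
    interpret \<nu>: real_distribution \<nu> by fact
    note fin = log_energy_finite[OF \<nu> V growth a False]
    note nm = log_potential_Fubini[OF \<mu> \<nu> U atom bdd lower fin(2)]
    have E\<nu>: "log_energy V \<nu> = ereal ((\<integral>x. V x \<partial>\<nu>) - ?L \<nu> \<nu>)"
      by (rule log_energy_eq[OF fin(1,3,4)])
    have "d = (\<integral>x. d \<partial>\<nu>)" using \<nu>.prob_space by simp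
    also have "\<dots> \<le> (\<integral>x. V x - 2 * U x \<partial>\<nu>)"
      using nm(3) fin(1) by (intro integral_mono EL_le) (auto simp: has_bochner_integral_iff)
    also have "\<dots> = (\<integral>x. V x \<partial>\<nu>) - 2 * ?L \<nu> \<mu>"
      using nm(3) fin(1) by (simp add: has_bochner_integral_iff)
    finally have "d \<le> (\<integral>x. V x \<partial>\<nu>) - 2 * ?L \<nu> \<mu>" .
    moreover note log_energy_positive[OF \<nu> \<mu> fin(3) nm(1) mm(1) fin(4) nm(2) mm(2)]
    ultimately show ?thesis unfolding E\<mu> E\<nu> using d by auto
  qed
  have min: "min_energy V = log_energy V \<mu>"
    unfolding min_energy_def using main \<mu> by (intro antisym INF_lower INF_greatest) auto
  show "min_energy V = log_energy V \<mu>" by (rule min)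
  show "equilibrium_measure V = \<mu>"
    unfolding equilibrium_measure_def min using main \<mu> by (intro the_equality) auto
  show "min_energy V = ereal ((\<integral>x. V x \<partial>\<mu>) / 2 + d / 2)"
    unfolding min E\<mu> using d by (simp add: field_simps)
qed

section \<open>The arcsine measure\<close>

text \<open>The uniform law of an angle \<theta>. Then 2 cos \<theta> has the arcsine law on
  [-2, 2], and Chebyshev orthogonality becomes orthogonality of cosines.\<close>

definition circle_measure :: "real measure" where
  "circle_measure = uniform_measure lborel {0..2 * pi}"

abbreviation circle_mean :: "(real \<Rightarrow> 'a::{banach, second_countable_topology}) \<Rightarrow> 'a" where
  "circle_mean f \<equiv> integral\<^sup>L circle_measure f"

lemma prob_space_circle: "prob_space circle_measure"
  unfolding circle_measure_def by (rule prob_space_uniform_measure) auto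

interpretation circle: prob_space circle_measure
  by (rule prob_space_circle)

lemma sets_circle [measurable_cong, simp]: "sets circle_measure = sets borel"
  by (simp add: circle_measure_def)

lemma space_circle [simp]: "space circle_measure = UNIV"
  by (simp add: circle_measure_def)

lemma measurable_circle [simp]: "measurable circle_measure N = measurable borel N"
  by (rule measurable_cong_sets) auto

lemma AE_circle_iff: "(AE \<theta> in circle_measure. P \<theta>) \<longleftrightarrow> (AE \<theta> in lborel. 0 \<le> \<theta> \<and> \<theta> \<le> 2 * pi \<longrightarrow> P \<theta>)"
  unfolding circle_measure_def by (subst AE_uniform_measure) auto

lemma circle_mean_eq:
  fixes f :: "real \<Rightarrow> real"
  assumes "f \<in> borel_measurable borel"
  shows "circle_mean f = (LBINT \<theta>. f \<theta> * indicator {0..2 * pi} \<theta>) / (2 * pi)"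
proof -
  have eq: "circle_measure = density lborel (\<lambda>\<theta>. ennreal (indicator {0..2 * pi} \<theta> / (2 * pi)))"
    unfolding circle_measure_def uniform_measure_def
    by (rule arg_cong[where f = "density lborel"])
      (auto simp: fun_eq_iff indicator_def ennreal_1[symmetric] divide_ennreal simp del: ennreal_1)
  have "circle_mean f = (LBINT \<theta>. (indicator {0..2 * pi} \<theta> / (2 * pi)) *\<^sub>R f \<theta>)"
    unfolding eq by (rule integral_density) (use assms in auto)
  also have "\<dots> = (LBINT \<theta>. (f \<theta> * indicator {0..2 * pi} \<theta>) / (2 * pi))"
    by (intro Bochner_Integration.integral_cong refl) (simp add: mult.commute)
  finally show ?thesis by simp
qed

lemma circle_integrable_continuous:
  fixes f :: "real \<Rightarrow> real"
  assumes "continuous_on UNIV f"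
  shows "integrable circle_measure f"
proof -
  have "compact (f ` {0..2 * pi})"
    by (intro compact_continuous_image continuous_on_subset[OF assms]) auto
  then obtain B where B: "\<And>y. y \<in> f ` {0..2 * pi} \<Longrightarrow> norm y \<le> B"
    using compact_imp_bounded bounded_iff by metis
  show ?thesis
  proof (rule circle.integrable_const_bound[where B = B])
    show "AE \<theta> in circle_measure. norm (f \<theta>) \<le> B"
      unfolding AE_circle_iff using B by auto
  qed (use assms in \<open>simp add: borel_measurable_continuous_onI\<close>)
qed

lemma circle_mean_cos: "circle_mean (\<lambda>\<theta>. cos (of_int k * \<theta>)) = (if k = 0 then 1 else 0)"
proof (cases "k = 0")
  case True
  then show ?thesis using circle.prob_space by simp
next
  case False
  have "(LBINT \<theta>. cos (of_int k * \<theta>) * indicator {0..2 * pi} \<theta>) =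
      sin (of_int k * (2 * pi)) / of_int k - sin (of_int k * 0) / of_int k"
    by (rule has_bochner_integral_integral_eq, rule has_bochner_integral_FTC_Icc_real)
      (use False in \<open>auto intro!: derivative_eq_intros\<close>)
  then show ?thesis using False sin_int_2pin[of k]
    by (subst circle_mean_eq) (auto simp: mult_ac)
qed

lemma circle_mean_sin: "circle_mean (\<lambda>\<theta>. sin (of_int k * \<theta>)) = 0"
proof (cases "k = 0")
  case False
  have "(LBINT \<theta>. sin (of_int k * \<theta>) * indicator {0..2 * pi} \<theta>) =
      (- cos (of_int k * (2 * pi))) / of_int k - (- cos (of_int k * 0)) / of_int k"
    by (rule has_bochner_integral_integral_eq, rule has_bochner_integral_FTC_Icc_real)
      (use False in \<open>auto intro!: derivative_eq_intros\<close>)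
  then show ?thesis using False cos_int_2pin[of k]
    by (subst circle_mean_eq) (auto simp: mult_ac)
qed simp

lemma circle_mean_cos_cos:
  "circle_mean (\<lambda>\<theta>. cos (real k * \<theta>) * cos (real n * \<theta>)) = (if k = n then if n = 0 then 1 else 1 / 2 else 0)"
proof -
  have "circle_mean (\<lambda>\<theta>. cos (real k * \<theta>) * cos (real n * \<theta>)) =
      circle_mean (\<lambda>\<theta>. (cos (of_int (int k - int n) * \<theta>) + cos (of_int (int k + int n) * \<theta>)) / 2)"
    by (intro Bochner_Integration.integral_cong refl) (simp add: cos_times_cos left_diff_distrib distrib_right)
  also have "\<dots> = (circle_mean (\<lambda>\<theta>. cos (of_int (int k - int n) * \<theta>)) + circle_mean (\<lambda>\<theta>. cos (of_int (int k + int n) * \<theta>))) / 2"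
    by (simp del: of_int_diff of_int_add add: circle_integrable_continuous continuous_intros)
  finally show ?thesis unfolding circle_mean_cos by auto
qed

lemma circle_mean_sin_cos:
  "circle_mean (\<lambda>\<theta>. sin (real k * \<theta>) * cos (real n * \<theta>)) = 0"
proof -
  have "circle_mean (\<lambda>\<theta>. sin (real k * \<theta>) * cos (real n * \<theta>)) =
      circle_mean (\<lambda>\<theta>. (sin (of_int (int k + int n) * \<theta>) + sin (of_int (int k - int n) * \<theta>)) / 2)"
    by (intro Bochner_Integration.integral_cong refl) (simp add: sin_times_cos left_diff_distrib distrib_right)
  also have "\<dots> = (circle_mean (\<lambda>\<theta>. sin (of_int (int k + int n) * \<theta>)) + circle_mean (\<lambda>\<theta>. sin (of_int (int k - int n) * \<theta>))) / 2"
    by (simp del: of_int_diff of_int_add add: circle_integrable_continuous continuous_intros)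
  finally show ?thesis unfolding circle_mean_sin by simp
qed

lemma AE_circle_cos_neq: "AE \<theta> in circle_measure. cos \<theta> \<noteq> x"
proof -
  have "cos \<theta> \<noteq> x" if "0 \<le> \<theta>" "\<theta> \<le> 2 * pi" "\<theta> \<noteq> arccos x" "\<theta> \<noteq> 2 * pi - arccos x" for \<theta>
  proof
    assume x: "cos \<theta> = x"
    show False
    proof (cases "\<theta> \<le> pi")
      case True
      then show False using that x arccos_cos[of \<theta>] by simp
    next
      case False
      then show False using that x arccos_cos[of "2 * pi - \<theta>"] cos_diff[of "2 * pi" \<theta>] by auto
    qed
  qed
  moreover have "AE \<theta> in lborel. \<theta> \<noteq> arccos x \<and> \<theta> \<noteq> 2 * pi - arccos x"
    by (intro eventually_conj AE_lborel_singleton)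
  ultimately show ?thesis
    unfolding AE_circle_iff by - (erule eventually_mono, blast)
qed

lemma ln_norm_one_minus_sums:
  assumes "norm z < 1"
  shows "(\<lambda>k. - Re (z ^ Suc k) / real (Suc k)) sums ln (norm (1 - z))"
proof -
  have "(\<lambda>n. (-1) ^ Suc n / of_nat n * (- z) ^ n) sums Ln (1 + - z)"
    by (rule Ln_series) (use assms in simp)
  from sums_Re[OF this] have "(\<lambda>n. Re ((-1) ^ Suc n / of_nat n * (- z) ^ n)) sums Re (Ln (1 - z))"
    by (simp only: diff_conv_add_uminus)
  moreover have "Re ((-1) ^ Suc n / of_nat n * (- z) ^ n) = - Re (z ^ n) / real n" for n
  proof -
    have "(-1) ^ Suc n * (- z) ^ n = - (z ^ n)" by (cases "even n") simp_all
    then have "(-1) ^ Suc n / of_nat n * (- z) ^ n = - (z ^ n) / of_nat n"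
      by (simp only: times_divide_eq_left)
    then show ?thesis by (simp only: Re_divide_of_nat uminus_complex.sel)
  qed
  ultimately have "(\<lambda>n. - Re (z ^ n) / real n) sums Re (Ln (1 - z))" by (simp only:)
  moreover have "1 - z \<noteq> 0" using assms by auto
  ultimately have "(\<lambda>n. - Re (z ^ n) / real n) sums ln (norm (1 - z))" by simp
  then show ?thesis by (subst sums_Suc_iff) simp
qed

lemma circle_mean_power_cos:
  assumes "0 < k"
  shows "circle_mean (\<lambda>\<theta>. Re ((w * cis \<theta>) ^ k) * cos (real n * \<theta>)) = (if k = n then Re (w ^ n) / 2 else 0)"
proof -
  have "circle_mean (\<lambda>\<theta>. Re ((w * cis \<theta>) ^ k) * cos (real n * \<theta>)) =
    circle_mean (\<lambda>\<theta>. Re (w ^ k) * (cos (real k * \<theta>) * cos (real n * \<theta>)) - Im (w ^ k) * (sin (real k * \<theta>) * cos (real n * \<theta>)))"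
    by (intro Bochner_Integration.integral_cong refl) (simp add: power_mult_distrib Complex.DeMoivre algebra_simps)
  also have "\<dots> = Re (w ^ k) * circle_mean (\<lambda>\<theta>. cos (real k * \<theta>) * cos (real n * \<theta>)) -
      Im (w ^ k) * circle_mean (\<lambda>\<theta>. sin (real k * \<theta>) * cos (real n * \<theta>))"
    by (subst Bochner_Integration.integral_diff) (auto intro!: circle_integrable_continuous continuous_intros)
  finally show ?thesis using assms by (simp add: circle_mean_cos_cos circle_mean_sin_cos)
qed

text \<open>Inside the disc the series of the logarithm is dominated by a geometric series, so it
  can be integrated term by term, and orthogonality retains the single term of frequency n.\<close>

lemma circle_mean_log_inside:
  assumes w: "norm w < 1"
  shows "circle_mean (\<lambda>\<theta>. ln (norm (1 - w * cis \<theta>)) * cos (real n * \<theta>)) =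
    (if n = 0 then 0 else - Re (w ^ n) / (2 * real n))"
proof -
  let ?f = "\<lambda>k \<theta>. - Re ((w * cis \<theta>) ^ Suc k) / real (Suc k) * cos (real n * \<theta>)"
  have bound: "\<bar>?f k \<theta>\<bar> \<le> norm w ^ Suc k" for k \<theta>
  proof -
    have "\<bar>Re ((w * cis \<theta>) ^ Suc k)\<bar> \<le> norm w ^ Suc k"
      using abs_Re_le_cmod[of "(w * cis \<theta>) ^ Suc k"] by (simp add: norm_mult norm_power)
    moreover have "\<bar>?f k \<theta>\<bar> \<le> \<bar>Re ((w * cis \<theta>) ^ Suc k)\<bar>"
    proof -
      have "\<bar>?f k \<theta>\<bar> = \<bar>Re ((w * cis \<theta>) ^ Suc k)\<bar> * (\<bar>cos (real n * \<theta>)\<bar> / real (Suc k))"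
        by (simp add: abs_mult abs_divide del: power_Suc of_nat_Suc)
      also have "\<dots> \<le> \<bar>Re ((w * cis \<theta>) ^ Suc k)\<bar> * 1"
        by (intro mult_left_mono) (auto simp: divide_le_eq order_trans[OF abs_cos_le_one])
      finally show ?thesis by simp
    qed
    ultimately show ?thesis by linarith
  qed
  have summ: "summable (\<lambda>k. norm w ^ Suc k)"
    using w by (simp add: summable_geometric summable_mult)
  have cont: "continuous_on UNIV (?f k)" for k
    by (intro continuous_intros) auto
  have int: "integrable circle_measure (?f k)" for k
    by (rule circle_integrable_continuous[OF cont])
  have eq: "(\<Sum>k. ?f k \<theta>) = ln (norm (1 - w * cis \<theta>)) * cos (real n * \<theta>)" for \<theta>
    using sums_mult2[OF ln_norm_one_minus_sums[of "w * cis \<theta>"], of "cos (real n * \<theta>)"] w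
    by (simp add: norm_mult sums_iff del: power_Suc)
  have "(\<lambda>k. circle_mean (?f k)) sums circle_mean (\<lambda>\<theta>. \<Sum>k. ?f k \<theta>)"
  proof (rule sums_integral[OF int])
    show "AE \<theta> in circle_measure. summable (\<lambda>k. norm (?f k \<theta>))"
      using bound by (intro AE_I2 summable_comparison_test[OF _ summ]) auto
    show "summable (\<lambda>k. \<integral>\<theta>. norm (?f k \<theta>) \<partial>circle_measure)"
    proof (rule summable_comparison_test[OF _ summ], intro exI allI impI)
      fix k
      have "(\<integral>\<theta>. norm (?f k \<theta>) \<partial>circle_measure) \<le> (\<integral>\<theta>. norm w ^ Suc k \<partial>circle_measure)"
      proof (rule integral_mono[OF integrable_norm[OF int]])
        fix \<theta>
        show "norm (?f k \<theta>) \<le> norm w ^ Suc k" using bound[of \<theta> k] unfolding real_norm_def .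
      qed simp
      then show "norm (\<integral>\<theta>. norm (?f k \<theta>) \<partial>circle_measure) \<le> norm w ^ Suc k"
        using circle.prob_space by (simp del: power_Suc)
    qed
  qed
  moreover have "circle_mean (?f k) = (if Suc k = n then - Re (w ^ n) / (2 * real n) else 0)" for k
  proof -
    have "circle_mean (?f k) = circle_mean (\<lambda>\<theta>. (- 1 / real (Suc k)) * (Re ((w * cis \<theta>) ^ Suc k) * cos (real n * \<theta>)))"
      by (intro Bochner_Integration.integral_cong refl) (simp del: power_Suc)
    also have "\<dots> = (- 1 / real (Suc k)) * circle_mean (\<lambda>\<theta>. Re ((w * cis \<theta>) ^ Suc k) * cos (real n * \<theta>))"
      by simp
    finally show ?thesis by (simp add: circle_mean_power_cos del: power_Suc of_nat_Suc)
  qed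
  ultimately have S: "(\<lambda>k. if Suc k = n then - Re (w ^ n) / (2 * real n) else 0) sums
      circle_mean (\<lambda>\<theta>. ln (norm (1 - w * cis \<theta>)) * cos (real n * \<theta>))"
    by (simp only: eq)
  show ?thesis
  proof (cases n)
    case 0
    then show ?thesis using sums_unique2[OF S] sums_zero by fastforce
  next
    case (Suc m)
    have "(\<lambda>k. if k = m then - Re (w ^ n) / (2 * real n) else 0) sums (- Re (w ^ n) / (2 * real n))"
      by (rule sums_single)
    then show ?thesis using sums_unique2[OF S] Suc by simp
  qed
qed

text \<open>The case |w| = 1 matters, since it corresponds to the points of the cut, but there the
  logarithm is singular. It is reached along radii: the approximants are at most ln 2, Fatou's lemma
  gives integrability of the limit, and dominated convergence carries the formula over.\<close>

lemma circle_mean_log: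
  assumes w: "norm w \<le> 1"
  shows "has_bochner_integral circle_measure (\<lambda>\<theta>. ln (norm (1 - w * cis \<theta>)) * cos (real n * \<theta>))
    (if n = 0 then 0 else - Re (w ^ n) / (2 * real n))"
proof -
  \<comment> \<open>Radii strictly between 0 and 1 that tend to 1; the shift by 2 keeps them
    positive.\<close>
  define r where "r m = 1 - 1 / real (m + 2)" for m
  have r: "0 < r m" "r m < 1" for m by (auto simp: r_def)
  have r_lim: "r \<longlonglongrightarrow> 1" unfolding r_def by real_asymp
  let ?f = "\<lambda>\<theta>. ln (norm (1 - w * cis \<theta>))"
  let ?fm = "\<lambda>m \<theta>. ln (norm (1 - of_real (r m) * w * cis \<theta>))"
  have cont_cis: "continuous_on UNIV cis" by (intro continuous_intros)
  then have [measurable]: "cis \<in> borel_measurable borel" by (rule borel_measurable_continuous_onI)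
  have wm: "norm (of_real (r m) * w) < 1" for m
  proof -
    have "norm (of_real (r m) * w) \<le> r m * 1" using w r[of m] by (auto simp: norm_mult intro!: mult_left_mono)
    then show ?thesis using r[of m] by simp
  qed
  have zm: "norm (of_real (r m) * w * cis \<theta>) < 1" for m \<theta>
    using wm[of m] by (simp add: norm_mult)
  have pos_m: "0 < norm (1 - of_real (r m) * w * cis \<theta>)" for m \<theta>
    using zm[of m \<theta>] by (metis norm_one less_irrefl right_minus_eq zero_less_norm_iff)
  have AE_ne: "AE \<theta> in circle_measure. 1 - w * cis \<theta> \<noteq> 0"
  proof -
    have "1 - w * cis \<theta> \<noteq> 0" if "cos \<theta> \<noteq> Re w" for \<theta>
    proof
      assume "1 - w * cis \<theta> = 0"
      then have "w * (cis \<theta> * cis (- \<theta>)) = cis (- \<theta>)" by (simp add: mult.assoc[symmetric])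
      then have "w = cis (- \<theta>)" by (simp add: cis_mult)
      then show False using that by simp
    qed
    then show ?thesis using AE_circle_cos_neq[of "Re w"] by (auto elim!: eventually_mono)
  qed
  have upper: "?fm m \<theta> \<le> ln 2" for m \<theta>
  proof -
    have "norm (1 - of_real (r m) * w * cis \<theta>) \<le> 2"
      using norm_triangle_ineq4[of 1 "of_real (r m) * w * cis \<theta>"] zm[of m \<theta>] by simp
    then show ?thesis using pos_m[of m \<theta>] by (intro ln_mono) auto
  qed
  have conv: "(\<lambda>m. ?fm m \<theta>) \<longlonglongrightarrow> ?f \<theta>" if "1 - w * cis \<theta> \<noteq> 0" for \<theta>
  proof -
    have "(\<lambda>m. 1 - of_real (r m) * w * cis \<theta>) \<longlonglongrightarrow> 1 - of_real 1 * w * cis \<theta>"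
      by (intro tendsto_intros r_lim)
    then show ?thesis using that by (intro tendsto_ln tendsto_norm) auto
  qed
  \<comment> \<open>For |z| \<le> 1 and 0 < r < 1 one has |1 - z| \<le> 2 |1 - r z|, because |z - r
    z| \<le> 1 - r |z| \<le> |1 - r z|. This is the lower half of the dominating bound.\<close>
  have lower: "?f \<theta> - ln 2 \<le> ?fm m \<theta>" if "1 - w * cis \<theta> \<noteq> 0" for m \<theta>
  proof -
    let ?z = "w * cis \<theta>"
    have z: "norm ?z \<le> 1" using w by (simp add: norm_mult)
    have "norm (1 - ?z) \<le> norm (1 - of_real (r m) * ?z) + norm (of_real (r m) * ?z - ?z)"
      using norm_triangle_ineq[of "1 - of_real (r m) * ?z" "of_real (r m) * ?z - ?z"] by simp
    also have "norm (of_real (r m) * ?z - ?z) = (1 - r m) * norm ?z"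
    proof -
      have "of_real (r m) * ?z - ?z = - (of_real (1 - r m) * ?z)" by (simp add: algebra_simps)
      then show ?thesis using r[of m] by (simp only: norm_minus_cancel norm_mult norm_of_real)
    qed
    also have "(1 - r m) * norm ?z \<le> 1 - r m * norm ?z" using z by (simp add: algebra_simps)
    also have "1 - r m * norm ?z \<le> norm (1 - of_real (r m) * ?z)"
      using norm_triangle_ineq2[of 1 "of_real (r m) * ?z"] r[of m] by (simp add: norm_mult)
    finally have "norm (1 - ?z) / 2 \<le> norm (1 - of_real (r m) * w * cis \<theta>)" by (simp add: mult.assoc)
    then have "ln (norm (1 - ?z) / 2) \<le> ?fm m \<theta>" using that by (intro ln_mono) auto
    then show ?thesis using that by (simp add: ln_div)
  qed
  have mean_m: "circle_mean (\<lambda>\<theta>. ?fm m \<theta> * cos (real n * \<theta>)) = (if n = 0 then 0 else - Re ((of_real (r m) * w) ^ n) / (2 * real n))" for m n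
    using circle_mean_log_inside[OF wm[of m], of n] .
  have cont_m: "continuous_on UNIV (?fm m)" for m
    using pos_m by (intro continuous_intros) auto
  have int_m: "integrable circle_measure (?fm m)" for m
    by (rule circle_integrable_continuous[OF cont_m])
  \<comment> \<open>The approximants have mean 0, by the case n = 0, so this integral does not
    depend on m: the uniform bound for Fatou's lemma.\<close>
  have nn_m: "(\<integral>\<^sup>+\<theta>. ennreal (ln 2 - ?fm m \<theta>) \<partial>circle_measure) = ennreal (ln 2)" for m
  proof -
    have "(\<integral>\<^sup>+\<theta>. ennreal (ln 2 - ?fm m \<theta>) \<partial>circle_measure) = ennreal (circle_mean (\<lambda>\<theta>. ln 2 - ?fm m \<theta>))"
      using int_m[of m] upper[of m] by (intro nn_integral_eq_integral) auto
    also have "circle_mean (\<lambda>\<theta>. ln 2 - ?fm m \<theta>) = ln 2"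
      using int_m[of m] mean_m[of m 0] circle.prob_space by simp
    finally show ?thesis .
  qed
  have upper': "?f \<theta> \<le> ln 2" if "1 - w * cis \<theta> \<noteq> 0" for \<theta>
    by (rule LIMSEQ_le_const2[OF conv[OF that]]) (use upper in auto)
  have "(\<integral>\<^sup>+\<theta>. ennreal (ln 2 - ?f \<theta>) \<partial>circle_measure) = (\<integral>\<^sup>+\<theta>. liminf (\<lambda>m. ennreal (ln 2 - ?fm m \<theta>)) \<partial>circle_measure)"
  proof (rule nn_integral_cong_AE, use AE_ne in eventually_elim)
    case (elim \<theta>)
    have "(\<lambda>m. ennreal (ln 2 - ?fm m \<theta>)) \<longlonglongrightarrow> ennreal (ln 2 - ?f \<theta>)"
      by (intro tendsto_ennrealI tendsto_diff tendsto_const conv elim)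
    then show ?case by (intro lim_imp_Liminf[symmetric]) auto
  qed
  also have "\<dots> \<le> liminf (\<lambda>m. \<integral>\<^sup>+\<theta>. ennreal (ln 2 - ?fm m \<theta>) \<partial>circle_measure)"
    by (rule nn_integral_liminf) measurable
  also have "\<dots> = ennreal (ln 2)" unfolding nn_m by (simp add: Liminf_const)
  finally have fin: "(\<integral>\<^sup>+\<theta>. ennreal (ln 2 - ?f \<theta>) \<partial>circle_measure) < \<infinity>"
    using le_less_trans ennreal_less_top by (metis infinity_ennreal_def)
  have "integrable circle_measure (\<lambda>\<theta>. ln 2 - ?f \<theta>)"
  proof (rule integrableI_bounded)
    have "(\<integral>\<^sup>+\<theta>. ennreal (norm (ln 2 - ?f \<theta>)) \<partial>circle_measure) = (\<integral>\<^sup>+\<theta>. ennreal (ln 2 - ?f \<theta>) \<partial>circle_measure)"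
      by (rule nn_integral_cong_AE, use AE_ne in eventually_elim) (use upper' in auto)
    then show "(\<integral>\<^sup>+\<theta>. ennreal (norm (ln 2 - ?f \<theta>)) \<partial>circle_measure) < \<infinity>" using fin by simp
  qed measurable
  from Bochner_Integration.integrable_diff[OF circle.integrable_const[of "ln 2"] this]
  have int: "integrable circle_measure ?f" by simp
  have *: "integrable circle_measure (\<lambda>\<theta>. ?f \<theta> * cos (real n * \<theta>))"
    "(\<lambda>m. circle_mean (\<lambda>\<theta>. ?fm m \<theta> * cos (real n * \<theta>))) \<longlonglongrightarrow> circle_mean (\<lambda>\<theta>. ?f \<theta> * cos (real n * \<theta>))"
  proof -
    have 1: "(\<lambda>\<theta>. ?f \<theta> * cos (real n * \<theta>)) \<in> borel_measurable circle_measure" by measurable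
    have 2: "(\<lambda>\<theta>. ?fm m \<theta> * cos (real n * \<theta>)) \<in> borel_measurable circle_measure" for m by measurable
    have 3: "integrable circle_measure (\<lambda>\<theta>. \<bar>?f \<theta>\<bar> + 2 * ln 2)" using int by simp
    have 4: "AE \<theta> in circle_measure. (\<lambda>m. ?fm m \<theta> * cos (real n * \<theta>)) \<longlonglongrightarrow> ?f \<theta> * cos (real n * \<theta>)"
      using AE_ne by eventually_elim (intro tendsto_mult tendsto_const conv)
    have 5: "AE \<theta> in circle_measure. norm (?fm m \<theta> * cos (real n * \<theta>)) \<le> \<bar>?f \<theta>\<bar> + 2 * ln 2" for m
      using AE_ne
    proof eventually_elim
      case (elim \<theta>)
      have "\<bar>x\<bar> \<le> \<bar>y\<bar> + 2 * l" if "y - l \<le> x" "x \<le> l" "0 \<le> l" for x y l :: real using that by (auto simp: abs_if)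
      from this[OF lower[OF elim] upper, of m] have "\<bar>?fm m \<theta>\<bar> \<le> \<bar>?f \<theta>\<bar> + 2 * ln 2" by simp
      moreover have "norm (?fm m \<theta> * cos (real n * \<theta>)) \<le> \<bar>?fm m \<theta>\<bar>"
        by (auto simp: abs_mult intro!: mult_left_le)
      ultimately show ?case by linarith
    qed
    note dc = integrable_dominated_convergence[OF 1 2 3 4 5] integral_dominated_convergence[OF 1 2 3 4 5]
    show "integrable circle_measure (\<lambda>\<theta>. ?f \<theta> * cos (real n * \<theta>))"
      "(\<lambda>m. circle_mean (\<lambda>\<theta>. ?fm m \<theta> * cos (real n * \<theta>))) \<longlonglongrightarrow> circle_mean (\<lambda>\<theta>. ?f \<theta> * cos (real n * \<theta>))"
      by (fact dc)+
  qed
  have rw: "(\<lambda>m. of_real (r m) * w) \<longlonglongrightarrow> of_real 1 * w"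
    by (intro tendsto_intros r_lim)
  have "(\<lambda>m. if n = 0 then 0 else - Re ((of_real (r m) * w) ^ n) / (2 * real n)) \<longlonglongrightarrow>
      (if n = 0 then 0 else - Re ((of_real 1 * w) ^ n) / (2 * real n))"
  proof (cases "n = 0")
    case False
    then show ?thesis unfolding if_not_P[OF False] by (intro tendsto_intros rw) simp
  qed simp
  from LIMSEQ_unique[OF *(2)[unfolded mean_m] this]
  show ?thesis unfolding has_bochner_integral_iff using *(1) by simp
qed

section \<open>Equilibrium measures of polynomial potentials\<close>

text \<open>Chebyshev polynomials in the normalisation $T_n(z + 1/z) = z^n + z^{-n}$,
  $U_n(z + 1/z) = (z^n - z^{-n}) / (z - 1/z)$.\<close>

fun cheb_T :: "nat \<Rightarrow> real \<Rightarrow> real" where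
  "cheb_T 0 w = 2"
| "cheb_T (Suc 0) w = w"
| "cheb_T (Suc (Suc n)) w = w * cheb_T (Suc n) w - cheb_T n w"

fun cheb_U :: "nat \<Rightarrow> real \<Rightarrow> real" where
  "cheb_U 0 w = 0"
| "cheb_U (Suc 0) w = 1"
| "cheb_U (Suc (Suc n)) w = w * cheb_U (Suc n) w - cheb_U n w"

text \<open>The divided difference of \<open>cheb_T n\<close> between w and y, written as a
  polynomial so that w = y is no special case. Its arcsine mean in y is
  \<open>cheb_U n w\<close>.\<close>

fun cheb_K :: "nat \<Rightarrow> real \<Rightarrow> real \<Rightarrow> real" where
  "cheb_K 0 w y = 0"
| "cheb_K (Suc 0) w y = 1"
| "cheb_K (Suc (Suc n)) w y = w * cheb_K (Suc n) w y + cheb_T (Suc n) y - cheb_K n w y"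

lemma cheb_T_complex:
  assumes "of_real w = z + 1 / z" "z \<noteq> (0 :: complex)"
  shows "of_real (cheb_T n w) = z ^ n + (1 / z) ^ n"
proof (induction n rule: cheb_T.induct[of "\<lambda>n _. of_real (cheb_T n w) = z ^ n + (1 / z) ^ n" for w])
  case (3 n w')
  define u where "u = 1 / z"
  have zu: "z * u = 1" using assms(2) by (simp add: u_def)
  have "of_real (cheb_T (Suc (Suc n)) w) = (z + u) * (z ^ Suc n + u ^ Suc n) - (z ^ n + u ^ n)"
    using 3 assms(1) by (simp add: u_def)
  also have "\<dots> = z ^ Suc (Suc n) + u ^ Suc (Suc n) + (z * u - 1) * (z ^ n + u ^ n)"
    by (simp add: algebra_simps)
  also have "\<dots> = z ^ Suc (Suc n) + u ^ Suc (Suc n)" unfolding zu by simp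
  finally show ?case unfolding u_def .
qed (use assms in auto)

lemma cheb_T_real:
  assumes "s \<noteq> (0 :: real)"
  shows "cheb_T n (s + 1 / s) = s ^ n + (1 / s) ^ n"
proof -
  have "complex_of_real (cheb_T n (s + 1 / s)) = of_real s ^ n + (1 / of_real s) ^ n"
    using assms by (intro cheb_T_complex) auto
  also have "\<dots> = of_real (s ^ n + (1 / s) ^ n)" by simp
  finally show ?thesis by (simp only: of_real_eq_iff)
qed

lemma cheb_T_cos: "cheb_T n (2 * cos \<theta>) = 2 * cos (real n * \<theta>)"
proof -
  have inv: "1 / cis \<theta> = cis (- \<theta>)" by (simp add: divide_inverse)
  have "of_real (cheb_T n (2 * cos \<theta>)) = cis \<theta> ^ n + (1 / cis \<theta>) ^ n"
    by (rule cheb_T_complex) (simp add: inv complex_eq_iff, simp)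
  also have "\<dots> = of_real (2 * cos (real n * \<theta>))"
    unfolding inv Complex.DeMoivre by (simp add: complex_eq_iff)
  finally show ?thesis by (simp only: of_real_eq_iff)
qed

lemma cheb_T_eq_U: "cheb_T (Suc n) w = cheb_U (Suc (Suc n)) w - cheb_U n w"
proof (induction n w rule: cheb_T.induct)
  case (3 n w)
  have "cheb_T (Suc (Suc (Suc n))) w = w * (cheb_U (Suc (Suc (Suc n))) w - cheb_U (Suc n) w) - (cheb_U (Suc (Suc n)) w - cheb_U n w)"
    by (simp only: cheb_T.simps(3)[of "Suc n"] 3)
  also have "\<dots> = cheb_U (Suc (Suc (Suc (Suc n)))) w - cheb_U (Suc (Suc n)) w"
    by (simp only: cheb_U.simps(3)[of "Suc (Suc n)"] cheb_U.simps(3)[of n]) (simp only: algebra_simps)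
  finally show ?case .
qed (auto simp: algebra_simps)

lemma cheb_U_mult: "(w\<^sup>2 - 4) * cheb_U (Suc n) w = cheb_T (Suc (Suc n)) w - cheb_T n w"
proof (induction n w rule: cheb_T.induct)
  case (3 n w)
  have "(w\<^sup>2 - 4) * cheb_U (Suc (Suc (Suc n))) w = w * ((w\<^sup>2 - 4) * cheb_U (Suc (Suc n)) w) - (w\<^sup>2 - 4) * cheb_U (Suc n) w"
    by (simp only: cheb_U.simps(3)) (simp only: algebra_simps)
  also have "\<dots> = w * (cheb_T (Suc (Suc (Suc n))) w - cheb_T (Suc n) w) - (cheb_T (Suc (Suc n)) w - cheb_T n w)"
    by (simp only: 3)
  also have "\<dots> = cheb_T (Suc (Suc (Suc (Suc n)))) w - cheb_T (Suc (Suc n)) w"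
    by (simp only: cheb_T.simps(3)) (simp only: algebra_simps)
  finally show ?case .
qed (auto simp: algebra_simps power2_eq_square)

lemma cheb_T_has_deriv: "(cheb_T n has_real_derivative real n * cheb_U n w) (at w)"
proof (induction n w rule: cheb_T.induct)
  case (1 w)
  then show ?case by simp
next
  case (2 w)
  have "cheb_T (Suc 0) = (\<lambda>w. w)" by (simp add: fun_eq_iff)
  then show ?case by simp
next
  case (3 n w)
  have eq: "cheb_T (Suc (Suc n)) = (\<lambda>w. w * cheb_T (Suc n) w - cheb_T n w)" by (simp add: fun_eq_iff)
  have "((\<lambda>w. w * cheb_T (Suc n) w - cheb_T n w) has_real_derivative
      1 * cheb_T (Suc n) w + real (Suc n) * cheb_U (Suc n) w * w - real n * cheb_U n w) (at w)"
    by (intro DERIV_diff DERIV_mult DERIV_ident 3)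
  also have "1 * cheb_T (Suc n) w + real (Suc n) * cheb_U (Suc n) w * w - real n * cheb_U n w =
      real (Suc (Suc n)) * cheb_U (Suc (Suc n)) w"
    by (simp add: cheb_T_eq_U algebra_simps del: cheb_T.simps)
  finally show ?case unfolding eq .
qed

lemma cheb_K_mult: "(w - y) * cheb_K n w y = cheb_T n w - cheb_T n y"
proof (induction n w y rule: cheb_K.induct)
  case (3 n w y)
  have "(w - y) * cheb_K (Suc (Suc n)) w y =
      w * ((w - y) * cheb_K (Suc n) w y) + (w - y) * cheb_T (Suc n) y - (w - y) * cheb_K n w y"
    by (simp only: cheb_K.simps(3)) (simp only: algebra_simps)
  also have "\<dots> = cheb_T (Suc (Suc n)) w - cheb_T (Suc (Suc n)) y"
    unfolding 3 by (simp only: cheb_T.simps(3)) (simp only: algebra_simps)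
  finally show ?case .
qed auto

lemma cheb_K_continuous: "continuous_on A (\<lambda>\<theta>. cheb_K n w (2 * cos \<theta>))"
proof (induction n w "0::real" rule: cheb_K.induct)
  case (3 n w)
  have "continuous_on A (\<lambda>\<theta>. cheb_T (Suc n) (2 * cos \<theta>))"
    unfolding cheb_T_cos by (intro continuous_intros)
  then show ?case unfolding cheb_K.simps by (intro continuous_intros 3)
qed auto

lemma circle_mean_cheb_T: "circle_mean (\<lambda>\<theta>. cheb_T n (2 * cos \<theta>)) = (if n = 0 then 2 else 0)"
  using circle_mean_cos[of "int n"] circle.prob_space by (auto simp: cheb_T_cos)

lemma circle_mean_cheb_K: "circle_mean (\<lambda>\<theta>. cheb_K n w (2 * cos \<theta>)) = cheb_U n w"
proof (induction n w "0::real" rule: cheb_K.induct)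
  case (3 n w)
  have i: "integrable circle_measure (\<lambda>\<theta>. cheb_K n w (2 * cos \<theta>))" for n
    by (rule circle_integrable_continuous[OF cheb_K_continuous])
  have t: "integrable circle_measure (\<lambda>\<theta>. cheb_T n (2 * cos \<theta>))" for n
    unfolding cheb_T_cos by (rule circle_integrable_continuous) (intro continuous_intros)
  have "circle_mean (\<lambda>\<theta>. cheb_K (Suc (Suc n)) w (2 * cos \<theta>)) =
     w * circle_mean (\<lambda>\<theta>. cheb_K (Suc n) w (2 * cos \<theta>)) + circle_mean (\<lambda>\<theta>. cheb_T (Suc n) (2 * cos \<theta>))
      - circle_mean (\<lambda>\<theta>. cheb_K n w (2 * cos \<theta>))"
    unfolding cheb_K.simps using i t
    by (subst Bochner_Integration.integral_diff Bochner_Integration.integral_add;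
        (intro Bochner_Integration.integrable_add integrable_mult_right)?; simp)+
  then show ?case using 3 by (simp add: circle_mean_cheb_T del: cheb_T.simps)
qed (use circle.prob_space in auto)

lemma AE_circle_2cos_neq: "AE \<theta> in circle_measure. w \<noteq> 2 * cos \<theta>"
  using AE_circle_cos_neq[of "w / 2"] by (rule eventually_mono) auto

lemma real_inverse_Joukowski:
  assumes "2 < \<bar>w :: real\<bar>"
  obtains s where "s \<noteq> 0" "\<bar>s\<bar> < 1" "w = s + 1 / s"
proof -
  have pos: "\<exists>s. 0 < s \<and> s < 1 \<and> w = s + 1 / s" if "2 < w" for w :: real
  proof -
    define q where "q = sqrt (w\<^sup>2 - 4)"
    have "2\<^sup>2 < w\<^sup>2" using that by (intro power_strict_mono) auto
    then have q: "0 < q" "q\<^sup>2 = w\<^sup>2 - 4" by (auto simp: q_def)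
    have "q < w" using q that by (intro power2_less_imp_less[of q w]) auto
    define s where "s = (w - q) / 2"
    have "0 < s" using \<open>q < w\<close> by (simp add: s_def)
    have prod: "s * ((w + q) / 2) = 1" using q(2) by (simp add: s_def field_simps power2_eq_square)
    have "1 / s = s * ((w + q) / 2) / s" unfolding prod ..
    also have "\<dots> = (w + q) / 2" using \<open>0 < s\<close> by simp
    finally have "1 / s = (w + q) / 2" .
    moreover have "w = s + (w + q) / 2" by (simp add: s_def field_simps)
    ultimately have "w = s + 1 / s" by (simp only:)
    moreover have "s < 1"
    proof (rule ccontr)
      assume "\<not> s < 1"
      moreover have "s < (w + q) / 2" using q(1) by (simp add: s_def)
      ultimately have "1 * 1 < s * ((w + q) / 2)" by (intro mult_le_less_imp_less) auto
      then show False using prod by simp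
    qed
    ultimately show ?thesis using \<open>0 < s\<close> by blast
  qed
  show ?thesis
  proof (cases "2 < w")
    case True
    then obtain s where s: "0 < s" "s < 1" "w = s + 1 / s" using pos[of w] by blast
    show ?thesis by (rule that[of s]) (use s in auto)
  next
    case False
    then have "2 < - w" using assms by linarith
    then obtain s where s: "0 < s" "s < 1" "- w = s + 1 / s" using pos[of "- w"] by blast
    show ?thesis by (rule that[of "- s"]) (use s in auto)
  qed
qed

text \<open>The candidate cut [b - 2c, b + 2c] is parametrised by w = 2 cos \<theta>. The factor 1/2
  in \<open>V_expand\<close> makes v n the n-th cosine coefficient of V there.
  \<open>mean_V'\<close> and \<open>mean_V'_cos\<close> are the two endpoint equations, and
  \<open>V'_mono\<close> is strong convexity with modulus \<delta>.\<close>

locale equilibrium_data =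
  fixes V V' :: "real \<Rightarrow> real" and b c \<delta> :: real and v :: "nat \<Rightarrow> real" and M :: nat
  assumes c_pos: "0 < c" and \<delta>_pos: "0 < \<delta>"
    and V_deriv: "\<And>x. (V has_real_derivative V' x) (at x)"
    and V_expand: "\<And>w. V (b + c * w) = v 0 + (\<Sum>n=1..M. v n * cheb_T n w) / 2"
    and V'_mono: "\<And>x y. x \<noteq> y \<Longrightarrow> \<delta> \<le> (V' x - V' y) / (x - y)"
    and mean_V': "circle_mean (\<lambda>\<theta>. V' (b + c * (2 * cos \<theta>))) = 0"
    and mean_V'_cos: "circle_mean (\<lambda>\<theta>. V' (b + c * (2 * cos \<theta>)) * (2 * cos \<theta>)) = 2 / c"
    and growth: "\<exists>C. \<forall>x. ln (1 + \<bar>x\<bar>) - C \<le> V x"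
begin

text \<open>\<open>G (2 * cos \<theta>)\<close> will be the density of the equilibrium measure with
  respect to the uniform law of \<theta>. It is found mode by mode: the logarithmic potential of cos
  (n \<theta>) is -1/n times itself on the cut, so the term v n cos (n \<theta>) / 2 of V / 2
  requires the coefficient -n v n / 2.\<close>

definition G :: "real \<Rightarrow> real" where
  "G w = 1 - (\<Sum>n=1..M. real n * v n * cheb_T n w) / 4"

lemma V'_eq: "c * V' (b + c * w) = (\<Sum>n=1..M. real n * v n * cheb_U n w) / 2"
proof (rule DERIV_unique)
  show "((\<lambda>w. V (b + c * w)) has_real_derivative c * V' (b + c * w)) (at w)"
    by (rule DERIV_cong, rule DERIV_chain2[OF V_deriv]) (auto intro!: derivative_eq_intros)
  show "((\<lambda>w. V (b + c * w)) has_real_derivative (\<Sum>n=1..M. real n * v n * cheb_U n w) / 2) (at w)"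
    unfolding V_expand
    by (rule DERIV_cong, (rule DERIV_add DERIV_const DERIV_cdivide DERIV_sum DERIV_cmult cheb_T_has_deriv)+)
       (simp add: mult_ac)
qed

lemma V'_circle_continuous: "continuous_on UNIV (\<lambda>\<theta>. V' (b + c * (2 * cos \<theta>)))"
proof -
  have U: "continuous_on UNIV (cheb_U n)" for n
  proof (induction n rule: cheb_U.induct[of "\<lambda>n _. continuous_on UNIV (cheb_U n)"])
    case (3 n w)
    have "cheb_U (Suc (Suc n)) = (\<lambda>w. w * cheb_U (Suc n) w - cheb_U n w)" by (simp add: fun_eq_iff)
    then show ?case by (simp only:) (intro continuous_intros 3)
  next
    case (1 w)
    have "cheb_U 0 = (\<lambda>w. 0)" by (simp add: fun_eq_iff)
    then show ?case by simp
  next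
    case (2 w)
    have "cheb_U (Suc 0) = (\<lambda>w. 1)" by (simp add: fun_eq_iff)
    then show ?case by simp
  qed
  have "V' (b + c * (2 * cos \<theta>)) = (\<Sum>n=1..M. real n * v n * cheb_U n (2 * cos \<theta>)) / 2 / c" for \<theta>
    using V'_eq[of "2 * cos \<theta>"] c_pos by (simp add: field_simps)
  moreover have "continuous_on UNIV (\<lambda>\<theta>. cheb_U n (2 * cos \<theta>))" for n
    by (rule continuous_on_compose2[OF U]) (auto intro!: continuous_intros)
  ultimately show ?thesis using c_pos by (simp only:) (intro continuous_intros, auto)
qed

text \<open>$G(w) = \frac{4 - w^2}{2}\,\int\frac{f'(w) - f'(y)}{w - y}$ with $f(w) = V(b + cw)$ and $y$
  distributed by the arcsine law; the two moment conditions on $V'$ remove the other terms.\<close>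

lemma G_eq:
  obtains P where "integrable circle_measure P" "G w = circle_mean P"
    "AE \<theta> in circle_measure. P \<theta> = (4 - w\<^sup>2) / 2 * (c\<^sup>2 * ((V' (b + c * w) - V' (b + c * (2 * cos \<theta>))) / ((b + c * w) - (b + c * (2 * cos \<theta>)))))"
proof -
  \<comment> \<open>With f(w) = V (b + c w), \<open>K\<close> is half the divided difference between
    w and y of (y^2 - 4) f'(y), written in Chebyshev polynomials, and has mean 1 - G w.
    \<open>H\<close> has mean 1 by the two endpoint equations and is the correction after which only
    a divided difference of f' remains.\<close>
  define K where "K \<theta> = (\<Sum>n=1..M. real n * v n * (cheb_K (Suc n) w (2 * cos \<theta>) - cheb_K (n - 1) w (2 * cos \<theta>))) / 4" for \<theta>
  define H where "H \<theta> = (w + 2 * cos \<theta>) * (c * V' (b + c * (2 * cos \<theta>))) / 2" for \<theta>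
  have cK: "continuous_on UNIV K" unfolding K_def by (intro continuous_intros cheb_K_continuous) auto
  have cH: "continuous_on UNIV H" unfolding H_def by (intro continuous_intros V'_circle_continuous) auto
  note iK = circle_integrable_continuous[OF cK] and iH = circle_integrable_continuous[OF cH]
  have "circle_mean H = circle_mean (\<lambda>\<theta>. w * c / 2 * V' (b + c * (2 * cos \<theta>)) + c / 2 * (V' (b + c * (2 * cos \<theta>)) * (2 * cos \<theta>)))"
    unfolding H_def by (intro Bochner_Integration.integral_cong refl) (simp add: field_simps)
  also have "\<dots> = w * c / 2 * circle_mean (\<lambda>\<theta>. V' (b + c * (2 * cos \<theta>))) + c / 2 * circle_mean (\<lambda>\<theta>. V' (b + c * (2 * cos \<theta>)) * (2 * cos \<theta>))"
  proof -
    have 1: "integrable circle_measure (\<lambda>\<theta>. V' (b + c * (2 * cos \<theta>)))"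
      by (rule circle_integrable_continuous[OF V'_circle_continuous])
    have 2: "integrable circle_measure (\<lambda>\<theta>. V' (b + c * (2 * cos \<theta>)) * (2 * cos \<theta>))"
      by (rule circle_integrable_continuous) (intro continuous_intros V'_circle_continuous)
    show ?thesis
      by (subst Bochner_Integration.integral_add[OF integrable_mult_right[OF 1] integrable_mult_right[OF 2]])
        (simp only: integral_mult_right_zero)
  qed
  also have "\<dots> = 1" using c_pos by (simp add: mean_V' mean_V'_cos)
  finally have mH: "circle_mean H = 1" .
  have "circle_mean K = (\<Sum>n=1..M. real n * v n * (cheb_U (Suc n) w - cheb_U (n - 1) w)) / 4"
  proof -
    have "circle_mean (\<lambda>\<theta>. real n * v n * (cheb_K (Suc n) w (2 * cos \<theta>) - cheb_K (n - 1) w (2 * cos \<theta>))) =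
      real n * v n * (cheb_U (Suc n) w - cheb_U (n - 1) w)" for n
      unfolding integral_mult_right_zero
      by (subst Bochner_Integration.integral_diff)
        (simp_all only: circle_integrable_continuous[OF cheb_K_continuous] circle_mean_cheb_K)
    moreover have "integrable circle_measure (\<lambda>\<theta>. real n * v n * (cheb_K (Suc n) w (2 * cos \<theta>) - cheb_K (n - 1) w (2 * cos \<theta>)))" for n
      by (intro integrable_mult_right Bochner_Integration.integrable_diff circle_integrable_continuous cheb_K_continuous)
    ultimately show ?thesis
      unfolding K_def integral_divide_zero by (subst Bochner_Integration.integral_sum) (simp_all only:)
  qed
  also have "\<dots> = 1 - G w"
  proof -
    have "cheb_U (Suc n) w - cheb_U (n - 1) w = cheb_T n w" if "n \<in> {1..M}" for n
      using that cheb_T_eq_U[of "n - 1" w] by (cases n) auto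
    then show ?thesis unfolding G_def by simp
  qed
  finally have mK: "circle_mean K = 1 - G w" .
  show ?thesis
  proof (rule that[of "\<lambda>\<theta>. H \<theta> - K \<theta>"])
    show "integrable circle_measure (\<lambda>\<theta>. H \<theta> - K \<theta>)" using iK iH by (rule Bochner_Integration.integrable_diff[rotated])
    show "G w = circle_mean (\<lambda>\<theta>. H \<theta> - K \<theta>)" using iK iH mK mH by simp
    show "AE \<theta> in circle_measure. H \<theta> - K \<theta> = (4 - w\<^sup>2) / 2 * (c\<^sup>2 * ((V' (b + c * w) - V' (b + c * (2 * cos \<theta>))) / ((b + c * w) - (b + c * (2 * cos \<theta>)))))"
      using AE_circle_2cos_neq[of w]
    proof eventually_elim
      case (elim \<theta>)
      define y where "y = 2 * cos \<theta>"
      define p q where "p = c * V' (b + c * w)" and "q = c * V' (b + c * y)"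
      have ne: "w - y \<noteq> 0" using elim by (simp add: y_def)
      have "(w - y) * (cheb_K (Suc n) w y - cheb_K (n - 1) w y) = (w\<^sup>2 - 4) * cheb_U n w - (y\<^sup>2 - 4) * cheb_U n y"
        if "n \<in> {1..M}" for n
      proof -
        obtain m where m: "n = Suc m" using \<open>n \<in> {1..M}\<close> by (cases n) auto
        show ?thesis unfolding m right_diff_distrib[of "w - y"] cheb_K_mult cheb_U_mult by simp
      qed
      then have "(w - y) * (real n * v n * (cheb_K (Suc n) w y - cheb_K (n - 1) w y)) =
          real n * v n * ((w\<^sup>2 - 4) * cheb_U n w - (y\<^sup>2 - 4) * cheb_U n y)" if "n \<in> {1..M}" for n
        using that by (simp only: mult.left_commute[of "w - y"])
      then have "(w - y) * K \<theta> = (\<Sum>n=1..M. real n * v n * ((w\<^sup>2 - 4) * cheb_U n w - (y\<^sup>2 - 4) * cheb_U n y)) / 4"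
        unfolding K_def y_def[symmetric] times_divide_eq_right sum_distrib_left
        by (intro arg_cong2[of _ _ _ _ "(/)"] sum.cong refl)
      also have "(\<Sum>n=1..M. real n * v n * ((w\<^sup>2 - 4) * cheb_U n w - (y\<^sup>2 - 4) * cheb_U n y)) =
        (w\<^sup>2 - 4) * (\<Sum>n=1..M. real n * v n * cheb_U n w) - (y\<^sup>2 - 4) * (\<Sum>n=1..M. real n * v n * cheb_U n y)"
        unfolding right_diff_distrib[of "real _ * _"] sum_subtractf sum_distrib_left by (simp only: mult_ac)
      also have "\<dots> / 4 = ((w\<^sup>2 - 4) * p - (y\<^sup>2 - 4) * q) / 2"
        unfolding p_def q_def V'_eq by (simp add: diff_divide_distrib)
      finally have K: "(w - y) * K \<theta> = ((w\<^sup>2 - 4) * p - (y\<^sup>2 - 4) * q) / 2" .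
      have "(w - y) * (H \<theta> - K \<theta>) = (w - y) * ((w + y) * q / 2) - ((w\<^sup>2 - 4) * p - (y\<^sup>2 - 4) * q) / 2"
        unfolding right_diff_distrib K by (simp add: H_def y_def[symmetric] q_def)
      also have "\<dots> = (4 - w\<^sup>2) / 2 * (p - q)"
        by (simp add: field_simps power2_eq_square)
      finally have HK: "H \<theta> - K \<theta> = (4 - w\<^sup>2) / 2 * ((p - q) / (w - y))"
        using ne by (simp add: field_simps)
      have "(b + c * w) - (b + c * y) = c * (w - y)" by (simp add: algebra_simps)
      then have "c\<^sup>2 * ((V' (b + c * w) - V' (b + c * y)) / ((b + c * w) - (b + c * y))) = (p - q) / (w - y)"
        using c_pos ne by (simp add: p_def q_def field_simps power2_eq_square)
      then show ?case unfolding y_def[symmetric] HK by simp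
    qed
  qed
qed

text \<open>By \<open>G_eq\<close>, G w is (4 - w^2) / 2 times c^2 times a mean of divided
  differences of V', each at least \<delta>. So G is positive inside the cut, as a density must be,
  and nonpositive outside, which will give the one-sided Euler-Lagrange inequality there.\<close>

lemma G_inside:
  assumes "\<bar>w\<bar> \<le> 2"
  shows "(4 - w\<^sup>2) / 2 * (c\<^sup>2 * \<delta>) \<le> G w"
proof -
  obtain P where P: "integrable circle_measure P" "G w = circle_mean P"
    "AE \<theta> in circle_measure. P \<theta> = (4 - w\<^sup>2) / 2 * (c\<^sup>2 * ((V' (b + c * w) - V' (b + c * (2 * cos \<theta>))) / ((b + c * w) - (b + c * (2 * cos \<theta>)))))"
    by (rule G_eq)
  have w: "0 \<le> 4 - w\<^sup>2" using assms power_mono[of "\<bar>w\<bar>" 2 2] by simp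
  have "circle_mean (\<lambda>\<theta>. (4 - w\<^sup>2) / 2 * (c\<^sup>2 * \<delta>)) \<le> circle_mean P"
  proof (rule integral_mono_AE)
    show "AE \<theta> in circle_measure. (4 - w\<^sup>2) / 2 * (c\<^sup>2 * \<delta>) \<le> P \<theta>"
      using P(3) AE_circle_2cos_neq[of w]
    proof eventually_elim
      case (elim \<theta>)
      show ?case unfolding elim(1)
        using w elim(2) c_pos by (intro mult_left_mono V'_mono) auto
    qed
  qed (use P in auto)
  then show ?thesis using circle.prob_space P(2) by simp
qed

lemma G_outside:
  assumes "2 \<le> \<bar>w\<bar>"
  shows "G w \<le> 0"
proof -
  obtain P where P: "integrable circle_measure P" "G w = circle_mean P"
    "AE \<theta> in circle_measure. P \<theta> = (4 - w\<^sup>2) / 2 * (c\<^sup>2 * ((V' (b + c * w) - V' (b + c * (2 * cos \<theta>))) / ((b + c * w) - (b + c * (2 * cos \<theta>)))))"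
    by (rule G_eq)
  have w: "4 - w\<^sup>2 \<le> 0" using assms power_mono[of 2 "\<bar>w\<bar>" 2] by simp
  have "circle_mean P \<le> circle_mean (\<lambda>\<theta>. 0)"
  proof (rule integral_mono_AE)
    show "AE \<theta> in circle_measure. P \<theta> \<le> 0"
      using P(3) AE_circle_2cos_neq[of w]
    proof eventually_elim
      case (elim \<theta>)
      have "0 \<le> c\<^sup>2 * ((V' (b + c * w) - V' (b + c * (2 * cos \<theta>))) / ((b + c * w) - (b + c * (2 * cos \<theta>))))"
        using elim(2) c_pos \<delta>_pos by (intro mult_nonneg_nonneg order_trans[OF _ V'_mono]) auto
      then show ?case unfolding elim(1) using w by (intro mult_nonpos_nonneg) auto
    qed
  qed (use P in auto)
  then show ?thesis using P(2) by simp
qed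

lemma G_cos: "G (2 * cos \<theta>) = 1 - (\<Sum>n=1..M. real n * v n * cos (real n * \<theta>)) / 2"
proof -
  have "(\<Sum>n=1..M. real n * v n * cheb_T n (2 * cos \<theta>)) = 2 * (\<Sum>n=1..M. real n * v n * cos (real n * \<theta>))"
    unfolding cheb_T_cos sum_distrib_left by (simp only: mult_ac)
  then show ?thesis by (simp add: G_def)
qed

lemma G_cos_nonneg: "0 \<le> G (2 * cos \<theta>)"
proof -
  have "(2 * cos \<theta>)\<^sup>2 \<le> 4" using abs_cos_le_one[of \<theta>] abs_square_le_1[of "cos \<theta>"] by (simp add: power_mult_distrib)
  then have "0 \<le> (4 - (2 * cos \<theta>)\<^sup>2) / 2 * (c\<^sup>2 * \<delta>)" using \<delta>_pos by (intro mult_nonneg_nonneg) auto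
  also have "\<dots> \<le> G (2 * cos \<theta>)" by (rule G_inside) (simp add: abs_mult)
  finally show ?thesis .
qed

lemma G_cos_pos: "AE \<theta> in circle_measure. 0 < G (2 * cos \<theta>)"
  using AE_circle_cos_neq[of 1] AE_circle_cos_neq[of "-1"]
proof eventually_elim
  case (elim \<theta>)
  have "(cos \<theta>)\<^sup>2 \<noteq> 1" using elim by (auto simp: power2_eq_1_iff)
  moreover have "(cos \<theta>)\<^sup>2 \<le> 1" using abs_square_le_1[of "cos \<theta>"] by simp
  ultimately have "0 < (4 - (2 * cos \<theta>)\<^sup>2) / 2 * (c\<^sup>2 * \<delta>)"
    using \<delta>_pos c_pos by (intro mult_pos_pos) (auto simp: power_mult_distrib)
  also have "\<dots> \<le> G (2 * cos \<theta>)" by (rule G_inside) (simp add: abs_mult)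
  finally show ?case .
qed

lemma G_cos_continuous: "continuous_on UNIV (\<lambda>\<theta>. G (2 * cos \<theta>))"
  unfolding G_cos by (intro continuous_intros) auto

lemma G_cos_mean: "circle_mean (\<lambda>\<theta>. G (2 * cos \<theta>)) = 1"
proof -
  have i: "integrable circle_measure (\<lambda>\<theta>. real n * v n * cos (real n * \<theta>))" for n
    by (rule circle_integrable_continuous) (intro continuous_intros)
  have "circle_mean (\<lambda>\<theta>. \<Sum>n=1..M. real n * v n * cos (real n * \<theta>)) = (\<Sum>n=1..M. real n * v n * circle_mean (\<lambda>\<theta>. cos (real n * \<theta>)))"
    by (subst Bochner_Integration.integral_sum[OF i]) simp
  also have "\<dots> = 0" using circle_mean_cos[of "int n" for n] by (intro sum.neutral) auto
  finally have "circle_mean (\<lambda>\<theta>. (\<Sum>n=1..M. real n * v n * cos (real n * \<theta>)) / 2) = 0" by simp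
  moreover have "integrable circle_measure (\<lambda>\<theta>. (\<Sum>n=1..M. real n * v n * cos (real n * \<theta>)) / 2)"
    by (intro integrable_divide_zero Bochner_Integration.integrable_sum i)
  ultimately show ?thesis unfolding G_cos using circle.prob_space by simp
qed

end

text \<open>The factorisation \<zeta> (w - 2 cos \<theta>) = (1 - \<zeta> e^(i \<theta>)) (1 -
  \<zeta> e^(-i \<theta>)). The second factor is replaced by its conjugate, which has the same
  modulus, so that both have the form treated by \<open>circle_mean_log\<close>.\<close>

lemma ln_Joukowski:
  assumes \<zeta>: "\<zeta> \<noteq> 0" and w: "of_real w = \<zeta> + 1 / \<zeta>" and ne: "w \<noteq> 2 * cos \<theta>"
  shows "ln \<bar>w - 2 * cos \<theta>\<bar> = ln (norm (1 - \<zeta> * cis \<theta>)) + ln (norm (1 - cnj \<zeta> * cis \<theta>)) - ln (norm \<zeta>)"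
proof -
  have prod: "(1 - \<zeta> * cis \<theta>) * (1 - \<zeta> * cis (- \<theta>)) = \<zeta> * of_real (w - 2 * cos \<theta>)"
  proof -
    have "(1 - \<zeta> * cis \<theta>) * (1 - \<zeta> * cis (- \<theta>)) = 1 - \<zeta> * (cis \<theta> + cis (- \<theta>)) + \<zeta> * \<zeta> * (cis \<theta> * cis (- \<theta>))"
      by (simp add: algebra_simps)
    also have "cis \<theta> + cis (- \<theta>) = of_real (2 * cos \<theta>)" by (simp add: complex_eq_iff)
    also have "cis \<theta> * cis (- \<theta>) = 1" by (simp add: cis_mult)
    also have "1 - \<zeta> * of_real (2 * cos \<theta>) + \<zeta> * \<zeta> * 1 = \<zeta> * (\<zeta> + 1 / \<zeta>) - \<zeta> * of_real (2 * cos \<theta>)"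
      using \<zeta> by (simp add: distrib_left)
    finally show ?thesis unfolding w[symmetric] of_real_diff right_diff_distrib .
  qed
  have cn: "norm (1 - \<zeta> * cis (- \<theta>)) = norm (1 - cnj \<zeta> * cis \<theta>)"
  proof -
    have "cnj (1 - \<zeta> * cis (- \<theta>)) = 1 - cnj \<zeta> * cis \<theta>" by (simp add: cis_cnj)
    then show ?thesis by (metis complex_mod_cnj)
  qed
  have "norm ((1 - \<zeta> * cis \<theta>) * (1 - \<zeta> * cis (- \<theta>))) = norm \<zeta> * \<bar>w - 2 * cos \<theta>\<bar>"
    unfolding prod norm_mult norm_of_real ..
  then have eq: "norm (1 - \<zeta> * cis \<theta>) * norm (1 - cnj \<zeta> * cis \<theta>) = norm \<zeta> * \<bar>w - 2 * cos \<theta>\<bar>"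
    unfolding norm_mult cn .
  have pos: "0 < norm \<zeta>" "0 < \<bar>w - 2 * cos \<theta>\<bar>" using \<zeta> ne by auto
  then have "0 < norm (1 - \<zeta> * cis \<theta>) * norm (1 - cnj \<zeta> * cis \<theta>)" unfolding eq by simp
  then have pos': "0 < norm (1 - \<zeta> * cis \<theta>)" "0 < norm (1 - cnj \<zeta> * cis \<theta>)"
    by (auto simp: zero_less_mult_iff)
  have "ln (norm (1 - \<zeta> * cis \<theta>)) + ln (norm (1 - cnj \<zeta> * cis \<theta>)) = ln (norm \<zeta>) + ln \<bar>w - 2 * cos \<theta>\<bar>"
    using arg_cong[OF eq, of ln] pos pos' by (simp only: ln_mult_pos)
  then show ?thesis by simp
qed

lemma ln_sqr: "x \<noteq> 0 \<Longrightarrow> ln (x\<^sup>2) = 2 * ln \<bar>x :: real\<bar>"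
proof -
  assume "x \<noteq> 0"
  then have "ln (\<bar>x\<bar>\<^sup>2) = 2 * ln \<bar>x\<bar>" by (subst ln_realpow) auto
  then show ?thesis by simp
qed

section \<open>The logarithmic potential of the candidate measure\<close>

context equilibrium_data
begin

text \<open>Meant for w = \<zeta> + 1/\<zeta> with |\<zeta>| \<le> 1. Points of the cut have
  |\<zeta>| = 1, where the sum is half the cosine expansion of V without its mean; real points
  outside have real \<zeta> in the open disc.\<close>

definition log_pot :: "complex \<Rightarrow> real" where
  "log_pot \<zeta> = - ln (norm \<zeta>) + (\<Sum>n=1..M. v n * Re (\<zeta> ^ n)) / 2"

text \<open>\<open>ln_Joukowski\<close> splits the kernel into two logarithms, whose cosine
  coefficients are known from \<open>circle_mean_log\<close>, and the constant -ln |\<zeta>|, which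
  is multiplied by the total mass 1 of the density.\<close>

lemma circle_log_potential:
  assumes \<zeta>: "\<zeta> \<noteq> 0" "norm \<zeta> \<le> 1" and w: "of_real w = \<zeta> + 1 / \<zeta>"
  shows "has_bochner_integral circle_measure (\<lambda>\<theta>. G (2 * cos \<theta>) * ln \<bar>w - 2 * cos \<theta>\<bar>) (log_pot \<zeta>)"
proof -
  let ?L = "\<lambda>\<zeta> \<theta>. ln (norm (1 - \<zeta> * cis \<theta>))"
  let ?g = "\<lambda>n \<zeta> \<theta>. ?L \<zeta> \<theta> * cos (real n * \<theta>)"
  have L: "has_bochner_integral circle_measure (\<lambda>\<theta>. ?g 0 \<zeta> \<theta> - (\<Sum>n=1..M. real n * v n * ?g n \<zeta> \<theta>) / 2)
      (0 - (\<Sum>n=1..M. real n * v n * (- Re (\<zeta> ^ n) / (2 * real n))) / 2)"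
    if "norm \<zeta> \<le> 1" for \<zeta>
  proof (intro has_bochner_integral_diff has_bochner_integral_divide_zero has_bochner_integral_sum has_bochner_integral_mult_right)
    show "has_bochner_integral circle_measure (?g 0 \<zeta>) 0" using circle_mean_log[OF that, of 0] by simp
    show "has_bochner_integral circle_measure (?g n \<zeta>) (- Re (\<zeta> ^ n) / (2 * real n))" if "n \<in> {1..M}" for n
      using circle_mean_log[OF \<open>norm \<zeta> \<le> 1\<close>, of n] that by simp
  qed
  have "has_bochner_integral circle_measure
     (\<lambda>\<theta>. (?g 0 \<zeta> \<theta> - (\<Sum>n=1..M. real n * v n * ?g n \<zeta> \<theta>) / 2) + (?g 0 (cnj \<zeta>) \<theta> - (\<Sum>n=1..M. real n * v n * ?g n (cnj \<zeta>) \<theta>) / 2)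
        - ln (norm \<zeta>) * G (2 * cos \<theta>))
     ((0 - (\<Sum>n=1..M. real n * v n * (- Re (\<zeta> ^ n) / (2 * real n))) / 2) +
      (0 - (\<Sum>n=1..M. real n * v n * (- Re (cnj \<zeta> ^ n) / (2 * real n))) / 2) - ln (norm \<zeta>) * 1)"
  proof (rule has_bochner_integral_diff[OF has_bochner_integral_add[OF L L] has_bochner_integral_mult_right])
    show "has_bochner_integral circle_measure (\<lambda>\<theta>. G (2 * cos \<theta>)) 1"
      unfolding has_bochner_integral_iff
      using G_cos_mean circle_integrable_continuous[OF G_cos_continuous] by simp
  qed (use \<zeta> in simp_all)
  also have "(0 - (\<Sum>n=1..M. real n * v n * (- Re (\<zeta> ^ n) / (2 * real n))) / 2) +
      (0 - (\<Sum>n=1..M. real n * v n * (- Re (cnj \<zeta> ^ n) / (2 * real n))) / 2) - ln (norm \<zeta>) * 1 = log_pot \<zeta>"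
  proof -
    have "(\<Sum>n=1..M. real n * v n * (- Re (\<zeta> ^ n) / (2 * real n))) = - (\<Sum>n=1..M. v n * Re (\<zeta> ^ n)) / 2"
      unfolding sum_negf[symmetric] sum_divide_distrib by (intro sum.cong) auto
    moreover have "Re (cnj \<zeta> ^ n) = Re (\<zeta> ^ n)" for n by (metis complex_cnj_power cnj.sel(1))
    ultimately show ?thesis by (simp add: log_pot_def)
  qed
  finally have I: "has_bochner_integral circle_measure
     (\<lambda>\<theta>. (?g 0 \<zeta> \<theta> - (\<Sum>n=1..M. real n * v n * ?g n \<zeta> \<theta>) / 2) + (?g 0 (cnj \<zeta>) \<theta> - (\<Sum>n=1..M. real n * v n * ?g n (cnj \<zeta>) \<theta>) / 2)
        - ln (norm \<zeta>) * G (2 * cos \<theta>)) (log_pot \<zeta>)" .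
  have [measurable]: "cis \<in> borel_measurable borel"
    by (rule borel_measurable_continuous_onI) (intro continuous_intros)
  have [measurable]: "(\<lambda>\<theta>. G (2 * cos \<theta>)) \<in> borel_measurable borel"
    by (rule borel_measurable_continuous_onI[OF G_cos_continuous])
  show ?thesis
  proof (rule has_bochner_integral_cong_AE[THEN iffD1, OF _ _ _ I])
    show "AE \<theta> in circle_measure. (?g 0 \<zeta> \<theta> - (\<Sum>n=1..M. real n * v n * ?g n \<zeta> \<theta>) / 2) + (?g 0 (cnj \<zeta>) \<theta> - (\<Sum>n=1..M. real n * v n * ?g n (cnj \<zeta>) \<theta>) / 2)
        - ln (norm \<zeta>) * G (2 * cos \<theta>) = G (2 * cos \<theta>) * ln \<bar>w - 2 * cos \<theta>\<bar>"
      using AE_circle_2cos_neq[of w]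
    proof eventually_elim
      case (elim \<theta>)
      have L: "?g 0 \<zeta> \<theta> - (\<Sum>n=1..M. real n * v n * ?g n \<zeta> \<theta>) / 2 = G (2 * cos \<theta>) * ?L \<zeta> \<theta>" for \<zeta>
      proof -
        have "(\<Sum>n=1..M. real n * v n * ?g n \<zeta> \<theta>) = (\<Sum>n=1..M. real n * v n * cos (real n * \<theta>)) * ?L \<zeta> \<theta>"
          unfolding sum_distrib_right by (simp only: mult_ac)
        then show ?thesis unfolding G_cos by (simp add: left_diff_distrib)
      qed
      show ?case unfolding L ln_Joukowski[OF \<zeta>(1) w elim] by (simp only: algebra_simps)
    qed
  qed measurable
qed

definition eq_measure :: "real measure" where
  "eq_measure = distr (density circle_measure (\<lambda>\<theta>. ennreal (G (2 * cos \<theta>)))) borel (\<lambda>\<theta>. b + c * (2 * cos \<theta>))"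

lemma G_cos_measurable [measurable]: "(\<lambda>\<theta>. G (2 * cos \<theta>)) \<in> borel_measurable borel"
  by (rule borel_measurable_continuous_onI[OF G_cos_continuous])

lemma eq_measure_has_integral:
  fixes f :: "real \<Rightarrow> real"
  assumes "f \<in> borel_measurable borel"
  shows "has_bochner_integral eq_measure f x \<longleftrightarrow>
    has_bochner_integral circle_measure (\<lambda>\<theta>. G (2 * cos \<theta>) * f (b + c * (2 * cos \<theta>))) x"
  unfolding has_bochner_integral_iff eq_measure_def
  using assms G_cos_nonneg
  by (simp add: integrable_distr_eq integral_distr integrable_density integral_density)

lemma AE_eq_measure:
  assumes "{x. P x} \<in> sets borel"
  shows "(AE x in eq_measure. P x) \<longleftrightarrow> (AE \<theta> in circle_measure. P (b + c * (2 * cos \<theta>)))"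
proof -
  have "(AE x in eq_measure. P x) \<longleftrightarrow> (AE \<theta> in density circle_measure (\<lambda>\<theta>. ennreal (G (2 * cos \<theta>))). P (b + c * (2 * cos \<theta>)))"
    unfolding eq_measure_def by (rule AE_distr_iff) (use assms in auto)
  also have "\<dots> \<longleftrightarrow> (AE \<theta> in circle_measure. 0 < ennreal (G (2 * cos \<theta>)) \<longrightarrow> P (b + c * (2 * cos \<theta>)))"
    by (rule AE_density) auto
  also have "\<dots> \<longleftrightarrow> (AE \<theta> in circle_measure. P (b + c * (2 * cos \<theta>)))"
  proof
    assume "AE \<theta> in circle_measure. 0 < ennreal (G (2 * cos \<theta>)) \<longrightarrow> P (b + c * (2 * cos \<theta>))"
    then show "AE \<theta> in circle_measure. P (b + c * (2 * cos \<theta>))"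
      using G_cos_pos by eventually_elim simp
  qed (auto elim: eventually_mono)
  finally show ?thesis .
qed

lemma real_distribution_eq_measure: "real_distribution eq_measure"
proof -
  have "emeasure (density circle_measure (\<lambda>\<theta>. ennreal (G (2 * cos \<theta>)))) UNIV = 1"
  proof -
    have "emeasure (density circle_measure (\<lambda>\<theta>. ennreal (G (2 * cos \<theta>)))) UNIV = (\<integral>\<^sup>+\<theta>. ennreal (G (2 * cos \<theta>)) \<partial>circle_measure)"
      by (subst emeasure_density) auto
    also have "\<dots> = ennreal (circle_mean (\<lambda>\<theta>. G (2 * cos \<theta>)))"
      by (rule nn_integral_eq_integral)
        (use circle_integrable_continuous[OF G_cos_continuous] G_cos_nonneg in auto)
    finally show ?thesis by (simp add: G_cos_mean)
  qed
  then have "prob_space (density circle_measure (\<lambda>\<theta>. ennreal (G (2 * cos \<theta>))))"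
    by (intro prob_spaceI) simp
  then have "prob_space eq_measure"
    unfolding eq_measure_def by (rule prob_space.prob_space_distr) simp
  then show ?thesis
    by (simp add: real_distribution_def real_distribution_axioms_def eq_measure_def)
qed

sublocale eq_measure: real_distribution eq_measure
  by (rule real_distribution_eq_measure)

lemma AE_eq_measure_support: "AE x in eq_measure. x \<in> {b - 2 * c..b + 2 * c}"
proof (subst AE_eq_measure)
  have "b - 2 * c \<le> b + c * (2 * cos \<theta>)" "b + c * (2 * cos \<theta>) \<le> b + 2 * c" for \<theta>
    using mult_left_mono[OF cos_ge_minus_one[of \<theta>], of "2 * c"] mult_left_mono[OF cos_le_one[of \<theta>], of "2 * c"] c_pos
    by (auto simp: mult_ac)
  then show "AE \<theta> in circle_measure. b + c * (2 * cos \<theta>) \<in> {b - 2 * c..b + 2 * c}" by simp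
qed auto

lemma eq_measure_support: "measure_support eq_measure = {b - 2 * c..b + 2 * c}"
proof (intro equalityI subsetI)
  fix x assume x: "x \<in> measure_support eq_measure"
  show "x \<in> {b - 2 * c..b + 2 * c}"
  proof (rule ccontr)
    assume "x \<notin> {b - 2 * c..b + 2 * c}"
    then have "0 < emeasure eq_measure (- {b - 2 * c..b + 2 * c})"
      using x by (auto simp: measure_support_def open_Compl)
    moreover have "emeasure eq_measure (- {b - 2 * c..b + 2 * c}) = 0"
      by (rule AE_iff_measurable[THEN iffD1, OF _ _ AE_eq_measure_support]) auto
    ultimately show False by simp
  qed
next
  fix x assume x: "x \<in> {b - 2 * c..b + 2 * c}"
  show "x \<in> measure_support eq_measure"
    unfolding measure_support_def
  proof (intro CollectI allI impI, rule ccontr)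
    fix A assume A: "open A \<and> x \<in> A" and "\<not> 0 < emeasure eq_measure A"
    then have "emeasure eq_measure A = 0" by simp
    then have "AE y in eq_measure. y \<notin> A"
      using A by (subst AE_iff_measurable[of A]) auto
    then have AE: "AE \<theta> in circle_measure. b + c * (2 * cos \<theta>) \<notin> A"
      using A by (subst (asm) AE_eq_measure) (auto simp: Collect_neg_eq open_Compl)
    define q where "q = (x - b) / (2 * c)"
    have q: "- 1 \<le> q" "q \<le> 1" using x c_pos by (auto simp: q_def field_simps)
    define \<theta>\<^sub>0 where "\<theta>\<^sub>0 = arccos q"
    have \<theta>\<^sub>0: "0 \<le> \<theta>\<^sub>0" "\<theta>\<^sub>0 \<le> pi" "cos \<theta>\<^sub>0 = q"
      using q by (auto simp: \<theta>\<^sub>0_def arccos_lbound arccos_ubound)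
    have "c * (2 * q) = x - b" using c_pos by (simp add: q_def)
    then have "\<theta>\<^sub>0 \<in> (\<lambda>\<theta>. b + c * (2 * cos \<theta>)) -` A" using A by (simp add: \<theta>\<^sub>0)
    moreover have "open ((\<lambda>\<theta>. b + c * (2 * cos \<theta>)) -` A)"
      using A by (intro open_vimage) (auto intro!: continuous_intros)
    ultimately obtain e where e: "0 < e" "\<And>\<theta>. dist \<theta> \<theta>\<^sub>0 < e \<Longrightarrow> \<theta> \<in> (\<lambda>\<theta>. b + c * (2 * cos \<theta>)) -` A"
      unfolding open_dist by blast
    \<comment> \<open>Since \<open>\<theta>\<^sub>0\<close> \<le> pi, a right neighbourhood of
      length at most pi stays inside [0, 2 pi], where null sets of the circle measure are Lebesgue
      null sets.\<close>
    have "AE \<theta> in lborel. \<not> (\<theta>\<^sub>0 < \<theta> \<and> \<theta> < \<theta>\<^sub>0 + min e pi)"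
      using AE[unfolded AE_circle_iff]
    proof eventually_elim
      case (elim \<theta>)
      show ?case
      proof
        assume \<theta>: "\<theta>\<^sub>0 < \<theta> \<and> \<theta> < \<theta>\<^sub>0 + min e pi"
        have "min e pi \<le> e" "min e pi \<le> pi" by auto
        then have "dist \<theta> \<theta>\<^sub>0 < e" "0 \<le> \<theta>" "\<theta> \<le> 2 * pi"
          using \<theta> \<theta>\<^sub>0 by (auto simp: dist_real_def abs_less_iff)
        then show False using elim e(2) by blast
      qed
    qed
    then have "emeasure lborel {\<theta>\<^sub>0<..<\<theta>\<^sub>0 + min e pi} = 0"
      by (subst (asm) AE_iff_measurable[of "{\<theta>\<^sub>0<..<\<theta>\<^sub>0 + min e pi}"]) auto
    then show False using e(1) by (simp add: min_def split: if_splits)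
  qed
qed

text \<open>The constant value of V - 2 U on the cut: the mean v 0 comes from the Chebyshev
  expansion, the term -2 ln c from rescaling the cut to [-2, 2].\<close>

definition robin :: real where
  "robin = v 0 - 2 * ln c"

text \<open>On the cut \<zeta> is on the unit circle and the oscillating terms of V and 2 U cancel
  one by one. Off the cut \<zeta> = s is real and the excess over \<open>robin\<close> is a function
  E of s that vanishes at 1 and -1, that is, at the endpoints; its derivative is governed by the
  sign of G outside the cut, and monotonicity up to the endpoint makes E s nonnegative.\<close>

lemma eq_measure_log_potential:
  obtains U where "has_bochner_integral eq_measure (\<lambda>y. ln \<bar>x - y\<bar>) U"
    "ln c - (\<Sum>n=1..M. \<bar>v n\<bar>) / 2 \<le> U" "robin \<le> V x - 2 * U"
    "x \<in> {b - 2 * c..b + 2 * c} \<Longrightarrow> V x - 2 * U = robin"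
proof -
  define w where "w = (x - b) / c"
  have x: "x = b + c * w" using c_pos by (simp add: w_def)
  have scale: "has_bochner_integral eq_measure (\<lambda>y. ln \<bar>x - y\<bar>) (ln c + log_pot \<zeta>)"
    if "\<zeta> \<noteq> 0" "norm \<zeta> \<le> 1" "of_real w = \<zeta> + 1 / \<zeta>" for \<zeta>
  proof -
    have m: "(\<lambda>y. ln \<bar>x - y\<bar>) \<in> borel_measurable borel" by measurable
    have "has_bochner_integral circle_measure (\<lambda>\<theta>. G (2 * cos \<theta>)) 1"
      unfolding has_bochner_integral_iff
      using G_cos_mean circle_integrable_continuous[OF G_cos_continuous] by simp
    note I = has_bochner_integral_add[OF has_bochner_integral_mult_left[OF this, of "ln c"] circle_log_potential[OF that]]
    have "has_bochner_integral circle_measure (\<lambda>\<theta>. G (2 * cos \<theta>) * ln \<bar>x - (b + c * (2 * cos \<theta>))\<bar>) (1 * ln c + log_pot \<zeta>)"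
    proof (rule has_bochner_integral_cong_AE[THEN iffD1, OF _ _ _ I])
      show "AE \<theta> in circle_measure. G (2 * cos \<theta>) * ln c + G (2 * cos \<theta>) * ln \<bar>w - 2 * cos \<theta>\<bar> = G (2 * cos \<theta>) * ln \<bar>x - (b + c * (2 * cos \<theta>))\<bar>"
        using AE_circle_2cos_neq[of w]
      proof eventually_elim
        case (elim \<theta>)
        have "x - (b + c * (2 * cos \<theta>)) = c * (w - 2 * cos \<theta>)" unfolding x by (simp add: algebra_simps)
        then have "\<bar>x - (b + c * (2 * cos \<theta>))\<bar> = c * \<bar>w - 2 * cos \<theta>\<bar>" using c_pos by (simp add: abs_mult)
        then show ?case using elim c_pos by (simp add: ln_mult_pos distrib_left)
      qed
    qed measurable
    then show ?thesis unfolding eq_measure_has_integral[OF m] by simp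
  qed
  have lower: "ln c - (\<Sum>n=1..M. \<bar>v n\<bar>) / 2 \<le> ln c + log_pot \<zeta>" if "\<zeta> \<noteq> 0" "norm \<zeta> \<le> 1" for \<zeta>
  proof -
    have "ln (norm \<zeta>) \<le> 0" using that by simp
    moreover have "- (\<Sum>n=1..M. \<bar>v n\<bar>) \<le> (\<Sum>n=1..M. v n * Re (\<zeta> ^ n))"
      unfolding sum_negf[symmetric]
    proof (rule sum_mono)
      fix n
      have "\<bar>v n * Re (\<zeta> ^ n)\<bar> \<le> \<bar>v n\<bar> * norm \<zeta> ^ n"
        using abs_Re_le_cmod[of "\<zeta> ^ n"] by (simp add: abs_mult norm_power mult_left_mono)
      also have "\<dots> \<le> \<bar>v n\<bar> * 1" using that by (intro mult_left_mono power_le_one) auto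
      finally show "- \<bar>v n\<bar> \<le> v n * Re (\<zeta> ^ n)" by (simp add: abs_le_iff)
    qed
    ultimately show ?thesis by (simp add: log_pot_def)
  qed
  show thesis
  proof (cases "\<bar>w\<bar> \<le> 2")
    case True
    define \<theta>\<^sub>0 where "\<theta>\<^sub>0 = arccos (w / 2)"
    have w: "w = 2 * cos \<theta>\<^sub>0" using True by (simp add: \<theta>\<^sub>0_def)
    have \<zeta>: "cis \<theta>\<^sub>0 \<noteq> 0" "norm (cis \<theta>\<^sub>0) \<le> 1" "of_real w = cis \<theta>\<^sub>0 + 1 / cis \<theta>\<^sub>0"
      by (simp, simp, simp add: w divide_inverse complex_eq_iff)
    have "V x - 2 * (ln c + log_pot (cis \<theta>\<^sub>0)) = robin"
      unfolding x V_expand w cheb_T_cos by (simp add: log_pot_def robin_def Complex.DeMoivre sum_distrib_left mult_ac flip: sum_divide_distrib)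
    then show thesis using scale[OF \<zeta>] lower[OF \<zeta>(1,2)] by (intro that) auto
  next
    case False
    then obtain s where s: "s \<noteq> 0" "\<bar>s\<bar> < 1" "w = s + 1 / s" using real_inverse_Joukowski[of w] by (metis not_le)
    have \<zeta>: "complex_of_real s \<noteq> 0" "norm (complex_of_real s) \<le> 1" "of_real w = complex_of_real s + 1 / of_real s"
      using s by auto
    \<comment> \<open>The excess in the uniformising variable r: the two components of the
      complement of the cut are 0 < r < 1 and -1 < r < 0. The argument r^2 makes the logarithm
      smooth on both.\<close>
    define E where "E r = ln (r\<^sup>2) + (\<Sum>n=1..M. v n * ((1 / r) ^ n - r ^ n)) / 2" for r :: real
    have DE: "V x - 2 * (ln c + log_pot (complex_of_real s)) = robin + E s"
    proof -
      have "(\<Sum>n=1..M. v n * cheb_T n w) = (\<Sum>n=1..M. v n * ((1 / s) ^ n - s ^ n)) + 2 * (\<Sum>n=1..M. v n * s ^ n)"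
        unfolding s(3) cheb_T_real[OF s(1)] sum_distrib_left sum.distrib[symmetric]
        by (intro sum.cong refl) (simp add: algebra_simps)
      moreover have "log_pot (complex_of_real s) = - ln \<bar>s\<bar> + (\<Sum>n=1..M. v n * s ^ n) / 2"
        by (simp add: log_pot_def flip: of_real_power)
      ultimately show ?thesis unfolding x V_expand robin_def E_def
        by (simp only: ln_sqr[OF s(1)]) (simp add: add_divide_distrib)
    qed
    have E_deriv: "(E has_real_derivative 2 / r * G (r + 1 / r)) (at r)" if r: "r \<noteq> 0" for r
    proof -
      have d1: "((\<lambda>r. ln (r\<^sup>2)) has_real_derivative 2 / r) (at r)"
      proof -
        have "0 < r\<^sup>2" using r by simp
        then have "((\<lambda>r. ln (r\<^sup>2)) has_real_derivative 2 * r / r\<^sup>2) (at r)"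
          by (auto intro!: derivative_eq_intros)
        then show ?thesis using r by (simp add: power2_eq_square)
      qed
      have d2: "((\<lambda>r. (1 / r) ^ n - r ^ n) has_real_derivative - (real n / r) * cheb_T n (r + 1 / r)) (at r)" for n
      proof -
        have "((\<lambda>r. (1 / r) ^ n - r ^ n) has_real_derivative real n * (1 / r) ^ (n - 1) * (- 1 / r\<^sup>2) - real n * r ^ (n - 1)) (at r)"
          using r by (auto intro!: derivative_eq_intros simp: power2_eq_square)
        also have "real n * (1 / r) ^ (n - 1) * (- 1 / r\<^sup>2) - real n * r ^ (n - 1) = - (real n / r) * cheb_T n (r + 1 / r)"
          unfolding cheb_T_real[OF r] using r by (cases n) (simp_all add: field_simps power2_eq_square)
        finally show ?thesis .
      qed
      have "(E has_real_derivative 2 / r + (\<Sum>n=1..M. v n * (- (real n / r) * cheb_T n (r + 1 / r))) / 2) (at r)"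
        unfolding E_def by (intro DERIV_add d1 DERIV_cdivide DERIV_sum DERIV_cmult d2)
      also have "2 / r + (\<Sum>n=1..M. v n * (- (real n / r) * cheb_T n (r + 1 / r))) / 2 = 2 / r * G (r + 1 / r)"
      proof -
        have "(\<Sum>n=1..M. v n * (- (real n / r) * cheb_T n (r + 1 / r))) = - (1 / r) * (\<Sum>n=1..M. real n * v n * cheb_T n (r + 1 / r))"
          unfolding sum_distrib_left by (intro sum.cong refl) simp
        then show ?thesis by (simp only: G_def) (simp add: right_diff_distrib)
      qed
      finally show ?thesis .
    qed
    have G_le: "G (r + 1 / r) \<le> 0" if "r \<noteq> 0" for r
    proof (rule G_outside)
      have "(\<bar>r\<bar> - 1)\<^sup>2 \<ge> 0" by simp
      then have "2 * \<bar>r\<bar> \<le> r * r + 1" by (simp add: power2_eq_square algebra_simps)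
      moreover have "\<bar>r + 1 / r\<bar> = (r * r + 1) / \<bar>r\<bar>"
      proof -
        have "r + 1 / r = (r * r + 1) / r" using that by (simp add: field_simps)
        then show ?thesis by (simp add: abs_divide)
      qed
      ultimately show "2 \<le> \<bar>r + 1 / r\<bar>" using that by (simp add: pos_le_divide_eq)
    qed
    have "0 \<le> E s"
    proof (cases "0 < s")
      case True
      have "E 1 \<le> E s"
      proof (rule DERIV_nonpos_imp_nonincreasing[of s 1 E])
        fix r assume "s \<le> r" "r \<le> 1"
        then show "\<exists>y. (E has_real_derivative y) (at r) \<and> y \<le> 0"
          using True by (intro exI[of _ "2 / r * G (r + 1 / r)"] conjI E_deriv mult_nonneg_nonpos G_le) auto
      qed (use s in auto)
      moreover have "E 1 = 0" by (simp add: E_def)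
      ultimately show ?thesis by simp
    next
      case False
      have "E (- 1) \<le> E s"
      proof (rule DERIV_nonneg_imp_nondecreasing[of "- 1" s E])
        fix r assume "- 1 \<le> r" "r \<le> s"
        then show "\<exists>y. (E has_real_derivative y) (at r) \<and> 0 \<le> y"
          using False s by (intro exI[of _ "2 / r * G (r + 1 / r)"] conjI E_deriv mult_nonpos_nonpos G_le)
            (auto simp: divide_le_0_iff)
      qed (use s in auto)
      moreover have "E (- 1) = 0" by (simp add: E_def)
      ultimately show ?thesis by simp
    qed
    moreover have "x \<notin> {b - 2 * c..b + 2 * c}"
    proof
      assume "x \<in> {b - 2 * c..b + 2 * c}"
      then have "\<bar>c * w\<bar> \<le> c * 2" unfolding x by (simp add: abs_le_iff)
      then show False using False c_pos by (simp add: abs_mult)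
    qed
    ultimately show thesis using scale[OF \<zeta>] lower[OF \<zeta>(1,2)] DE by (intro that) auto
  qed
qed

lemma eq_measure_no_atoms: "AE y in eq_measure. x \<noteq> y"
proof (subst AE_eq_measure)
  show "AE \<theta> in circle_measure. x \<noteq> b + c * (2 * cos \<theta>)"
    using AE_circle_2cos_neq[of "(x - b) / c"] by eventually_elim (use c_pos in auto)
qed auto

lemma V_measurable [measurable]: "V \<in> borel_measurable borel"
  using V_deriv DERIV_isCont by (blast intro: borel_measurable_continuous_onI continuous_at_imp_continuous_on)

lemma eq_measure_integrable:
  assumes "continuous_on UNIV (f :: real \<Rightarrow> real)"
  shows "integrable eq_measure f"
proof -
  have "compact (f ` {b - 2 * c..b + 2 * c})"
    by (intro compact_continuous_image continuous_on_subset[OF assms]) auto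
  then obtain B where B: "\<And>y. y \<in> f ` {b - 2 * c..b + 2 * c} \<Longrightarrow> norm y \<le> B"
    using compact_imp_bounded bounded_iff by metis
  show ?thesis
  proof (rule eq_measure.integrable_const_bound[where B = B])
    show "AE x in eq_measure. norm (f x) \<le> B"
      using AE_eq_measure_support by eventually_elim (use B in auto)
    show "f \<in> borel_measurable eq_measure"
      using borel_measurable_continuous_onI[OF assms] by simp
  qed
qed

lemma V_integrable: "integrable eq_measure V"
  using V_deriv DERIV_isCont by (blast intro: eq_measure_integrable continuous_at_imp_continuous_on)

lemma equilibrium:
  shows "equilibrium_measure V = eq_measure"
    and "min_energy V = ereal ((\<integral>x. V x \<partial>eq_measure) / 2 + robin / 2)"
    and "AE p in eq_measure \<Otimes>\<^sub>M eq_measure. fst p \<noteq> snd p"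
    and "integrable (eq_measure \<Otimes>\<^sub>M eq_measure) (\<lambda>p. ln \<bar>fst p - snd p\<bar>)"
    and "min_energy V = log_energy V eq_measure"
proof -
  obtain C where C: "\<And>x. 1 * ln (1 + \<bar>x\<bar>) - C \<le> V x" using growth by auto
  define U where "U x = (\<integral>y. ln \<bar>x - y\<bar> \<partial>eq_measure)" for x
  have U: "has_bochner_integral eq_measure (\<lambda>y. ln \<bar>x - y\<bar>) (U x) \<and>
    ln c - (\<Sum>n=1..M. \<bar>v n\<bar>) / 2 \<le> U x \<and> robin \<le> V x - 2 * U x \<and>
    (x \<in> {b - 2 * c..b + 2 * c} \<longrightarrow> V x - 2 * U x = robin)" for x
  proof (rule eq_measure_log_potential[of x])
    fix u assume u: "has_bochner_integral eq_measure (\<lambda>y. ln \<bar>x - y\<bar>) u"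
      "ln c - (\<Sum>n=1..M. \<bar>v n\<bar>) / 2 \<le> u" "robin \<le> V x - 2 * u"
      "x \<in> {b - 2 * c..b + 2 * c} \<Longrightarrow> V x - 2 * u = robin"
    have "U x = u" unfolding U_def by (rule has_bochner_integral_integral_eq[OF u(1)])
    then show ?thesis using u by simp
  qed
  have U1: "has_bochner_integral eq_measure (\<lambda>y. ln \<bar>x - y\<bar>) (U x)"
    and U2: "ln c - (\<Sum>n=1..M. \<bar>v n\<bar>) / 2 \<le> U x" and U3: "robin \<le> V x - 2 * U x" for x
    using U by auto
  have EL: "AE x in eq_measure. V x - 2 * U x = robin"
    using AE_eq_measure_support by eventually_elim (use U in blast)
  have bdd: "AE x in eq_measure. \<bar>x\<bar> \<le> \<bar>b\<bar> + 2 * c"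
    using AE_eq_measure_support by eventually_elim (auto simp: abs_le_iff)
  note EL_thm = Euler_Lagrange_equilibrium[where a = 1 and V = V and \<mu> = eq_measure and U = U and C = C
      and B = "\<bar>b\<bar> + 2 * c" and c = "ln c - (\<Sum>n=1..M. \<bar>v n\<bar>) / 2" and d = robin]
  show "equilibrium_measure V = eq_measure"
    by (rule EL_thm(1)) (rule real_distribution_eq_measure V_measurable C U1
      eq_measure_no_atoms bdd U2 U3 EL V_integrable | simp)+
  show "min_energy V = ereal ((\<integral>x. V x \<partial>eq_measure) / 2 + robin / 2)"
    by (rule EL_thm(2)) (rule real_distribution_eq_measure V_measurable C U1
      eq_measure_no_atoms bdd U2 U3 EL V_integrable | simp)+
  show "min_energy V = log_energy V eq_measure"
    by (rule EL_thm(3)) (rule real_distribution_eq_measure V_measurable C U1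
      eq_measure_no_atoms bdd U2 U3 EL V_integrable | simp)+
  have lnint: "integrable eq_measure (\<lambda>x. ln (1 + \<bar>x\<bar>))"
    by (rule eq_measure_integrable) (intro continuous_intros, auto)
  note mm = log_potential_Fubini[where U = U, OF real_distribution_eq_measure real_distribution_eq_measure U1
    eq_measure_no_atoms bdd U2 lnint]
  show "AE p in eq_measure \<Otimes>\<^sub>M eq_measure. fst p \<noteq> snd p" by (rule mm(1))
  show "integrable (eq_measure \<Otimes>\<^sub>M eq_measure) (\<lambda>p. ln \<bar>fst p - snd p\<bar>)" by (rule mm(2))
qed

end

section \<open>Moments, comparison of energies and the loop equation\<close>

lemma eq_0_if_quadratic_bound:
  fixes A C e :: real
  assumes "0 < e" "\<And>\<epsilon>. \<bar>\<epsilon>\<bar> \<le> e \<Longrightarrow> 0 \<le> \<epsilon> * A + C * \<epsilon>\<^sup>2"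
  shows "A = 0"
proof (rule ccontr)
  assume A: "A \<noteq> 0"
  \<comment> \<open>Small enough that the quadratic term is smaller than the linear one, which is
    made negative by moving against the sign of A.\<close>
  define \<eta> where "\<eta> = min e (\<bar>A\<bar> / (2 * (\<bar>C\<bar> + 1)))"
  have \<eta>: "0 < \<eta>" "\<eta> \<le> e" "\<eta> \<le> \<bar>A\<bar> / (2 * (\<bar>C\<bar> + 1))" using assms(1) A by (auto simp: \<eta>_def)
  have "0 \<le> (- sgn A * \<eta>) * A + C * (- sgn A * \<eta>)\<^sup>2"
    by (rule assms(2)) (use \<eta> A in \<open>auto simp: abs_mult\<close>)
  also have "(- sgn A * \<eta>)\<^sup>2 = \<eta>\<^sup>2" using A by (simp add: power_mult_distrib sgn_if)
  also have "(- sgn A * \<eta>) * A = - (\<bar>A\<bar> * \<eta>)" using A by (auto simp: sgn_if abs_if)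
  finally have "\<bar>A\<bar> * \<eta> \<le> C * \<eta> * \<eta>" by (simp add: power2_eq_square)
  then have "\<bar>A\<bar> \<le> C * \<eta>" using \<eta>(1) by (simp add: mult_le_cancel_right)
  also have "\<dots> \<le> \<bar>C\<bar> * (\<bar>A\<bar> / (2 * (\<bar>C\<bar> + 1)))" using \<eta> by (intro mult_mono) auto
  also have "\<dots> < \<bar>A\<bar>"
  proof -
    have "\<bar>C\<bar> / (2 * (\<bar>C\<bar> + 1)) < 1" by (simp add: divide_less_eq)
    then have "\<bar>A\<bar> * (\<bar>C\<bar> / (2 * (\<bar>C\<bar> + 1))) < \<bar>A\<bar> * 1" using A by (intro mult_strict_left_mono) auto
    then show ?thesis by (simp add: mult.commute)
  qed
  finally show False by simp
qed

context equilibrium_data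
begin

definition moment :: "nat \<Rightarrow> real" where
  "moment k = (\<integral>x. x ^ k \<partial>eq_measure)"

lemma moment_0: "moment 0 = 1"
  using eq_measure.prob_space by (simp add: moment_def)

lemma moment_bound: "\<bar>moment k\<bar> \<le> (\<bar>b\<bar> + 2 * c) ^ k"
proof -
  have "integrable eq_measure (\<lambda>x. x ^ k)" by (intro eq_measure_integrable continuous_intros)
  then have "\<bar>moment k\<bar> \<le> (\<integral>x. \<bar>x ^ k\<bar> \<partial>eq_measure)"
    unfolding moment_def using integral_norm_bound[of eq_measure "\<lambda>x. x ^ k"] by simp
  also have "\<dots> \<le> (\<integral>x. (\<bar>b\<bar> + 2 * c) ^ k \<partial>eq_measure)"
  proof (rule integral_mono_AE)
    show "integrable eq_measure (\<lambda>x. \<bar>x ^ k\<bar>)" by (intro eq_measure_integrable continuous_intros)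
    show "AE x in eq_measure. \<bar>x ^ k\<bar> \<le> (\<bar>b\<bar> + 2 * c) ^ k"
      using AE_eq_measure_support
    proof eventually_elim
      case (elim x)
      then have "\<bar>x\<bar> \<le> \<bar>b\<bar> + 2 * c" by (auto simp: abs_le_iff)
      then show ?case unfolding power_abs by (intro power_mono) auto
    qed
  qed simp
  finally show ?thesis using eq_measure.prob_space by simp
qed

text \<open>Frees the Robin constant from the Chebyshev coefficients, so that the minimal energy can
  be stated outside the locale and evaluated for the undeformed potential.\<close>

lemma v_0_eq: "v 0 = circle_mean (\<lambda>\<theta>. V (b + c * (2 * cos \<theta>)))"
proof -
  have i: "integrable circle_measure (\<lambda>\<theta>. v n * cheb_T n (2 * cos \<theta>))" for n
    unfolding cheb_T_cos by (rule circle_integrable_continuous) (intro continuous_intros)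
  have "circle_mean (\<lambda>\<theta>. \<Sum>n=1..M. v n * cheb_T n (2 * cos \<theta>)) = (\<Sum>n=1..M. v n * circle_mean (\<lambda>\<theta>. cheb_T n (2 * cos \<theta>)))"
    by (subst Bochner_Integration.integral_sum[OF i]) simp
  also have "\<dots> = 0" by (intro sum.neutral) (auto simp: circle_mean_cheb_T)
  finally have "circle_mean (\<lambda>\<theta>. (\<Sum>n=1..M. v n * cheb_T n (2 * cos \<theta>)) / 2) = 0" by simp
  moreover have "integrable circle_measure (\<lambda>\<theta>. (\<Sum>n=1..M. v n * cheb_T n (2 * cos \<theta>)) / 2)"
    by (intro integrable_divide_zero Bochner_Integration.integrable_sum i)
  ultimately show ?thesis unfolding V_expand using circle.prob_space by simp
qed

text \<open>The equilibrium measure of \<open>V\<close> is a competitor for \<open>W\<close>.\<close>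

lemma min_energy_le:
  assumes "continuous_on UNIV W"
  shows "min_energy W \<le> min_energy V + ereal (\<integral>x. W x - V x \<partial>eq_measure)"
proof -
  have W: "integrable eq_measure W" by (rule eq_measure_integrable[OF assms])
  have "min_energy W \<le> log_energy W eq_measure"
    unfolding min_energy_def by (rule INF_lower) (simp add: real_distribution_eq_measure)
  also have "log_energy W eq_measure = log_energy V eq_measure + ereal (\<integral>x. W x - V x \<partial>eq_measure)"
    unfolding log_energy_eq[OF W equilibrium(3,4)] log_energy_eq[OF V_integrable equilibrium(3,4)]
    using W V_integrable by simp
  finally show ?thesis unfolding equilibrium(5) .
qed

text \<open>First variation of the energy along the deformation $x \mapsto x + \epsilon x^n$.\<close>

lemma loop_equation:
  assumes V'': "\<And>x. (V' has_real_derivative V'' x) (at x)" and V''_cont: "continuous_on UNIV V''"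
  shows "(\<integral>x. V' x * x ^ n \<partial>eq_measure) = (\<Sum>k<n. moment k * moment (n - 1 - k))"
proof -
  interpret P: pair_prob_space eq_measure eq_measure ..
  let ?PP = "eq_measure \<Otimes>\<^sub>M eq_measure"
  have sets_eq: "sets eq_measure = sets borel" by (simp add: eq_measure_def)
  note fs [measurable] = fst_snd_measurable[OF sets_eq sets_eq]
  have V'_cont: "continuous_on UNIV V'"
    using V'' DERIV_isCont by (blast intro: continuous_at_imp_continuous_on)
  have V_cont: "continuous_on UNIV V"
    using V_deriv DERIV_isCont by (blast intro: continuous_at_imp_continuous_on)
  define B where "B = \<bar>b\<bar> + 2 * c + 1"
  have B: "1 \<le> B" using c_pos by (simp add: B_def)
  have bdd: "AE x in eq_measure. \<bar>x\<bar> \<le> B"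
    using AE_eq_measure_support by eventually_elim (auto simp: abs_le_iff B_def)
  have bdd2: "AE p in ?PP. \<bar>fst p\<bar> \<le> B \<and> \<bar>snd p\<bar> \<le> B"
  proof (rule P.AE_pair_measure)
    show "{p \<in> space ?PP. \<bar>fst p\<bar> \<le> B \<and> \<bar>snd p\<bar> \<le> B} \<in> sets ?PP" by measurable
    show "AE x in eq_measure. AE y in eq_measure. \<bar>fst (x, y)\<bar> \<le> B \<and> \<bar>snd (x, y)\<bar> \<le> B"
      using bdd
    proof eventually_elim
      case (elim x)
      show ?case using bdd by eventually_elim (use elim in simp)
    qed
  qed
  \<comment> \<open>The divided difference of x^n, so that T x - T y = (x - y) (1 + \<epsilon> q).
    Its double mean is the right-hand side of the loop equation.\<close>
  define q where "q p = (\<Sum>k<n. fst p ^ k * snd p ^ (n - 1 - k))" for p :: "real \<times> real"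
  define Q where "Q = real n * B ^ (2 * n)"
  have Q: "0 \<le> Q" using B by (simp add: Q_def)
  have q_le: "\<bar>q p\<bar> \<le> Q" if "\<bar>fst p\<bar> \<le> B" "\<bar>snd p\<bar> \<le> B" for p
  proof -
    have "\<bar>q p\<bar> \<le> (\<Sum>k<n. \<bar>fst p ^ k * snd p ^ (n - 1 - k)\<bar>)" unfolding q_def by (rule sum_abs)
    also have "\<dots> \<le> (\<Sum>k<n. B ^ (2 * n))"
    proof (rule sum_mono)
      fix k assume k: "k \<in> {..<n}"
      have "\<bar>fst p\<bar> ^ k \<le> B ^ n" "\<bar>snd p\<bar> ^ (n - 1 - k) \<le> B ^ n"
        using that B k by (auto intro!: order_trans[OF power_mono power_increasing])
      then have "\<bar>fst p\<bar> ^ k * \<bar>snd p\<bar> ^ (n - 1 - k) \<le> B ^ n * B ^ n"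
        using B by (intro mult_mono) auto
      then show "\<bar>fst p ^ k * snd p ^ (n - 1 - k)\<bar> \<le> B ^ (2 * n)"
        by (simp add: abs_mult power_abs mult_2 power_add)
    qed
    finally show ?thesis by (simp add: Q_def)
  qed
  have q_m [measurable]: "q \<in> borel_measurable ?PP" unfolding q_def by measurable
  have q_int: "integrable ?PP q"
  proof (rule P.integrable_const_bound[where B = Q])
    show "AE p in ?PP. norm (q p) \<le> Q" using bdd2 by eventually_elim (use q_le in simp)
  qed measurable
  have q_mean: "(\<integral>p. q p \<partial>?PP) = (\<Sum>k<n. moment k * moment (n - 1 - k))"
  proof -
    have i: "integrable ?PP (\<lambda>p. fst p ^ k * snd p ^ j)" for k j
    proof (rule P.integrable_const_bound[where B = "B ^ k * B ^ j"])
      show "AE p in ?PP. norm (fst p ^ k * snd p ^ j) \<le> B ^ k * B ^ j"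
        using bdd2
      proof eventually_elim
        case (elim p)
        then show ?case using B unfolding real_norm_def abs_mult power_abs
          by (intro mult_mono power_mono) auto
      qed
    qed measurable
    have "(\<integral>p. fst p ^ k * snd p ^ j \<partial>?PP) = moment k * moment j" for k j
      unfolding moment_def using P.integral_fst'[OF i[of k j]] by simp
    then show ?thesis unfolding q_def by (subst Bochner_Integration.integral_sum[OF i]) simp
  qed
  \<comment> \<open>As |\<epsilon>| \<le> 1, a point of [-B, B] moves by at most B^n; the interval
    contains all deformed points and all intermediate points of the Taylor formula.\<close>
  obtain D where D: "\<And>x. \<bar>x\<bar> \<le> 2 * B ^ n + B \<Longrightarrow> \<bar>V'' x\<bar> \<le> D"
  proof -
    have "compact (V'' ` {- (2 * B ^ n + B)..2 * B ^ n + B})"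
      by (intro compact_continuous_image continuous_on_subset[OF V''_cont]) auto
    then obtain D where "\<And>y. y \<in> V'' ` {- (2 * B ^ n + B)..2 * B ^ n + B} \<Longrightarrow> norm y \<le> D"
      using compact_imp_bounded bounded_iff by metis
    then show thesis by (intro that[of D]) (auto simp: abs_le_iff)
  qed
  define D' where "D' = \<bar>D\<bar> * (B ^ n)\<^sup>2"
  have Vn_int: "integrable eq_measure (\<lambda>x. V' x * x ^ n)"
    by (intro eq_measure_integrable continuous_intros V'_cont)
  \<comment> \<open>Small enough for |\<epsilon> q| \<le> 1/2 over [-B, B]: then 1 + \<epsilon> q is
    positive, T is injective there, and the quadratic estimate for ln (1 + x) applies.\<close>
  define e where "e = min 1 (1 / (2 * Q + 2))"
  have e: "0 < e" "e \<le> 1" "e \<le> 1 / (2 * Q + 2)" using Q by (auto simp: e_def)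
  have "(\<integral>x. V' x * x ^ n \<partial>eq_measure) - (\<integral>p. q p \<partial>?PP) = 0"
  proof (rule eq_0_if_quadratic_bound[OF e(1), where C = "D' + 2 * Q\<^sup>2"])
    fix \<epsilon> :: real assume \<epsilon>: "\<bar>\<epsilon>\<bar> \<le> e"
    define T where "T x = x + \<epsilon> * x ^ n" for x :: real
    have T_cont: "continuous_on UNIV T" unfolding T_def by (intro continuous_intros)
    have Tm [measurable]: "T \<in> borel_measurable borel" by (rule borel_measurable_continuous_onI[OF T_cont])
    have VT_le: "V (T x) \<le> V x + \<epsilon> * (V' x * x ^ n) + D' * \<epsilon>\<^sup>2" if x: "\<bar>x\<bar> \<le> B" for x
    proof (cases "T x = x")
      case True
      then have "\<epsilon> * x ^ n = 0" by (simp add: T_def)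
      then have z: "\<epsilon> * (V' x * x ^ n) = 0" by auto
      show ?thesis unfolding True z by (simp add: D'_def)
    next
      case False
      have xn: "\<bar>x ^ n\<bar> \<le> B ^ n" unfolding power_abs using x by (intro power_mono) auto
      define h where "h = \<epsilon> * x ^ n"
      have "\<bar>h\<bar> \<le> 1 * B ^ n"
        unfolding h_def abs_mult using \<epsilon> e(2) xn by (intro mult_mono) auto
      define l u where "l = min x (T x)" and "u = max x (T x)"
      have "\<exists>t. (if T x < x then T x < t \<and> t < x else x < t \<and> t < T x) \<and>
        V (T x) = (\<Sum>m<2. (if m = 0 then V else if m = 1 then V' else V'') x / fact m * (T x - x) ^ m) +
          (if (2::nat) = 0 then V else if (2::nat) = 1 then V' else V'') t / fact 2 * (T x - x) ^ 2"
        by (rule Taylor[where a = l and b = u]) (auto simp: l_def u_def V_deriv V'' less_2_cases_iff False)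
      then obtain t where t: "if T x < x then T x < t \<and> t < x else x < t \<and> t < T x"
        "V (T x) = V x + V' x * h + V'' t / 2 * h\<^sup>2"
        by (auto simp: numeral_2_eq_2 T_def h_def)
      have "\<bar>t\<bar> \<le> 2 * B ^ n + B"
        using t(1) x \<open>\<bar>h\<bar> \<le> 1 * B ^ n\<close> unfolding T_def h_def[symmetric]
        by (auto split: if_splits simp: abs_le_iff)
      then have "V'' t \<le> 2 * \<bar>D\<bar>" using D[of t] by (auto simp: abs_le_iff)
      then have "V'' t / 2 * h\<^sup>2 \<le> \<bar>D\<bar> * h\<^sup>2" by (intro mult_right_mono) auto
      moreover have "h\<^sup>2 \<le> (B ^ n)\<^sup>2 * \<epsilon>\<^sup>2"
        unfolding h_def power_mult_distrib using xn by (subst mult.commute, intro mult_right_mono) (auto simp: abs_le_square_iff[symmetric])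
      then have "\<bar>D\<bar> * h\<^sup>2 \<le> \<bar>D\<bar> * ((B ^ n)\<^sup>2 * \<epsilon>\<^sup>2)" by (rule mult_left_mono) simp
      ultimately have "V'' t / 2 * h\<^sup>2 \<le> D' * \<epsilon>\<^sup>2" by (simp add: D'_def mult.assoc)
      moreover have "V' x * h = \<epsilon> * (V' x * x ^ n)" by (simp add: h_def)
      ultimately show ?thesis unfolding t(2) by linarith
    qed
    have \<epsilon>Q: "\<bar>\<epsilon> * q p\<bar> \<le> 1 / 2" "(\<epsilon> * q p)\<^sup>2 \<le> Q\<^sup>2 * \<epsilon>\<^sup>2" if "\<bar>fst p\<bar> \<le> B \<and> \<bar>snd p\<bar> \<le> B" for p
    proof -
      have "\<bar>\<epsilon> * q p\<bar> \<le> e * Q" unfolding abs_mult using \<epsilon> q_le[of p] that e(1) by (intro mult_mono) auto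
      also have "\<dots> \<le> 1 / (2 * Q + 2) * Q" using e Q by (intro mult_right_mono) auto
      also have "\<dots> \<le> 1 / 2" using Q by (simp add: divide_le_eq)
      finally show "\<bar>\<epsilon> * q p\<bar> \<le> 1 / 2" .
      show "(\<epsilon> * q p)\<^sup>2 \<le> Q\<^sup>2 * \<epsilon>\<^sup>2"
        unfolding power_mult_distrib using q_le[of p] that Q
        by (subst mult.commute, intro mult_right_mono) (auto simp: abs_le_square_iff[symmetric])
    qed
    have Tdiff: "T x - T y = (x - y) * (1 + \<epsilon> * q (x, y))" for x y
    proof -
      have "x ^ n - y ^ n = (x - y) * q (x, y)"
        unfolding q_def using power_diff_sumr2[of x n y] by (simp add: mult.commute)
      moreover have "T x - T y = (x - y) + \<epsilon> * (x ^ n - y ^ n)" by (simp add: T_def algebra_simps)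
      ultimately show ?thesis by (simp only:) (simp add: algebra_simps)
    qed
    define \<nu> where "\<nu> = distr eq_measure borel T"
    have \<nu>: "real_distribution \<nu>"
      unfolding \<nu>_def real_distribution_def real_distribution_axioms_def
      by (auto intro!: eq_measure.prob_space_distr)
    interpret \<nu>: real_distribution \<nu> by fact
    have pair: "\<nu> \<Otimes>\<^sub>M \<nu> = distr ?PP (borel \<Otimes>\<^sub>M borel) (\<lambda>(x, y). (T x, T y))"
      unfolding \<nu>_def by (rule pair_measure_distr) (use \<nu>.sigma_finite_measure_axioms in \<open>auto simp: \<nu>_def\<close>)
    have m2 [measurable]: "(\<lambda>(x, y). (T x, T y)) \<in> ?PP \<rightarrow>\<^sub>M borel \<Otimes>\<^sub>M borel"
      by (simp add: split_beta')
    have good: "AE p in ?PP. fst p \<noteq> snd p \<and> \<bar>fst p\<bar> \<le> B \<and> \<bar>snd p\<bar> \<le> B"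
      using equilibrium(3) bdd2 by eventually_elim simp
    have ln_eq: "AE p in ?PP. ln \<bar>T (fst p) - T (snd p)\<bar> = ln \<bar>fst p - snd p\<bar> + ln (1 + \<epsilon> * q p)"
      using good
    proof eventually_elim
      case (elim p)
      then have "0 < 1 + \<epsilon> * q p" using \<epsilon>Q(1)[of p] by (auto simp: abs_le_iff)
      then show ?case using elim by (simp add: Tdiff abs_mult ln_mult_pos)
    qed
    have ln1_int: "integrable ?PP (\<lambda>p. ln (1 + \<epsilon> * q p))"
    proof (rule P.integrable_const_bound[where B = 1])
      show "AE p in ?PP. norm (ln (1 + \<epsilon> * q p)) \<le> 1"
        using good
      proof eventually_elim
        case (elim p)
        have s: "\<bar>\<epsilon> * q p\<bar> \<le> 1 / 2" using elim \<epsilon>Q by blast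
        have "(\<epsilon> * q p)\<^sup>2 \<le> (1 / 2)\<^sup>2" using s by (simp only: abs_le_square_iff[symmetric] abs_divide abs_one abs_numeral)
        then have "\<bar>ln (1 + \<epsilon> * q p) - \<epsilon> * q p\<bar> \<le> 1 / 2"
          using abs_ln_one_plus_x_minus_x_bound[OF s] by (simp add: power2_eq_square)
        then show "norm (ln (1 + \<epsilon> * q p)) \<le> 1"
          using abs_triangle_ineq[of "ln (1 + \<epsilon> * q p) - \<epsilon> * q p" "\<epsilon> * q p"] s by simp
      qed
    qed measurable
    have T_ln: "has_bochner_integral ?PP (\<lambda>p. ln \<bar>T (fst p) - T (snd p)\<bar>)
      ((\<integral>p. ln \<bar>fst p - snd p\<bar> \<partial>?PP) + (\<integral>p. ln (1 + \<epsilon> * q p) \<partial>?PP))"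
    proof (subst has_bochner_integral_cong_AE[OF _ _ ln_eq])
      show "has_bochner_integral ?PP (\<lambda>p. ln \<bar>fst p - snd p\<bar> + ln (1 + \<epsilon> * q p))
        ((\<integral>p. ln \<bar>fst p - snd p\<bar> \<partial>?PP) + (\<integral>p. ln (1 + \<epsilon> * q p) \<partial>?PP))"
        using equilibrium(4) ln1_int by (simp add: has_bochner_integral_iff)
    qed measurable
    have VT_int: "integrable eq_measure (\<lambda>x. V (T x))"
      by (rule eq_measure_integrable) (auto intro: continuous_on_compose2[OF V_cont T_cont])
    have E\<nu>: "log_energy V \<nu> = ereal ((\<integral>x. V (T x) \<partial>eq_measure) -
       ((\<integral>p. ln \<bar>fst p - snd p\<bar> \<partial>?PP) + (\<integral>p. ln (1 + \<epsilon> * q p) \<partial>?PP)))"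
    proof -
      have lnm: "(\<lambda>p. ln \<bar>fst p - snd p\<bar>) \<in> borel_measurable (borel \<Otimes>\<^sub>M (borel :: real measure))" by measurable
      have 1: "integrable \<nu> V" unfolding \<nu>_def using VT_int by (subst integrable_distr_eq) auto
      have 2: "AE p in \<nu> \<Otimes>\<^sub>M \<nu>. fst p \<noteq> snd p"
        unfolding pair
      proof (subst AE_distr_iff)
        show "AE p in ?PP. fst (case p of (x, y) \<Rightarrow> (T x, T y)) \<noteq> snd (case p of (x, y) \<Rightarrow> (T x, T y))"
          using good
        proof eventually_elim
          case (elim p)
          then have "0 < 1 + \<epsilon> * q p" using \<epsilon>Q(1)[of p] by (auto simp: abs_le_iff)
          then have "T (fst p) - T (snd p) \<noteq> 0" using elim by (simp add: Tdiff)
          then show ?case by (simp add: split_beta')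
        qed
      qed measurable
      have 3: "integrable (\<nu> \<Otimes>\<^sub>M \<nu>) (\<lambda>p. ln \<bar>fst p - snd p\<bar>)"
        "(\<integral>p. ln \<bar>fst p - snd p\<bar> \<partial>(\<nu> \<Otimes>\<^sub>M \<nu>)) = (\<integral>p. ln \<bar>fst p - snd p\<bar> \<partial>?PP) + (\<integral>p. ln (1 + \<epsilon> * q p) \<partial>?PP)"
        using T_ln unfolding pair integrable_distr_eq[OF m2 lnm] integral_distr[OF m2 lnm]
        by (simp_all add: split_beta' has_bochner_integral_iff)
      have 4: "(\<integral>x. V x \<partial>\<nu>) = (\<integral>x. V (T x) \<partial>eq_measure)"
        unfolding \<nu>_def by (rule integral_distr) auto
      show ?thesis unfolding log_energy_eq[OF 1 2 3(1)] 3(2) 4 ..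
    qed
    \<comment> \<open>The logarithmic integrals of the measure and of its deformation differ only by
      the mean of ln (1 + \<epsilon> q), so in the comparison the common part cancels.\<close>
    have "min_energy V \<le> log_energy V \<nu>"
      unfolding min_energy_def by (rule INF_lower) (simp add: \<nu>)
    then have le: "(\<integral>x. V x \<partial>eq_measure) \<le> (\<integral>x. V (T x) \<partial>eq_measure) - (\<integral>p. ln (1 + \<epsilon> * q p) \<partial>?PP)"
      unfolding equilibrium(5) E\<nu> log_energy_eq[OF V_integrable equilibrium(3,4)] by simp
    have "(\<integral>x. V (T x) \<partial>eq_measure) \<le> (\<integral>x. V x + \<epsilon> * (V' x * x ^ n) + D' * \<epsilon>\<^sup>2 \<partial>eq_measure)"
    proof (rule integral_mono_AE[OF VT_int])
      show "AE x in eq_measure. V (T x) \<le> V x + \<epsilon> * (V' x * x ^ n) + D' * \<epsilon>\<^sup>2"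
        using bdd by eventually_elim (rule VT_le)
    qed (use V_integrable Vn_int in simp)
    also have "\<dots> = (\<integral>x. V x \<partial>eq_measure) + \<epsilon> * (\<integral>x. V' x * x ^ n \<partial>eq_measure) + D' * \<epsilon>\<^sup>2"
      using V_integrable Vn_int eq_measure.prob_space by simp
    finally have VT: "(\<integral>x. V (T x) \<partial>eq_measure) \<le> (\<integral>x. V x \<partial>eq_measure) + \<epsilon> * (\<integral>x. V' x * x ^ n \<partial>eq_measure) + D' * \<epsilon>\<^sup>2" .
    have "(\<integral>p. \<epsilon> * q p - 2 * (Q\<^sup>2 * \<epsilon>\<^sup>2) \<partial>?PP) \<le> (\<integral>p. ln (1 + \<epsilon> * q p) \<partial>?PP)"
    proof (rule integral_mono_AE[OF _ ln1_int])
      show "AE p in ?PP. \<epsilon> * q p - 2 * (Q\<^sup>2 * \<epsilon>\<^sup>2) \<le> ln (1 + \<epsilon> * q p)"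
        using good
      proof eventually_elim
        case (elim p)
        then have "\<bar>ln (1 + \<epsilon> * q p) - \<epsilon> * q p\<bar> \<le> 2 * (\<epsilon> * q p)\<^sup>2"
          using \<epsilon>Q(1) by (intro abs_ln_one_plus_x_minus_x_bound) blast
        moreover have "(\<epsilon> * q p)\<^sup>2 \<le> Q\<^sup>2 * \<epsilon>\<^sup>2" using elim \<epsilon>Q(2) by blast
        ultimately show ?case unfolding abs_le_iff by linarith
      qed
    qed (use q_int in simp)
    then have "\<epsilon> * (\<integral>p. q p \<partial>?PP) - 2 * (Q\<^sup>2 * \<epsilon>\<^sup>2) \<le> (\<integral>p. ln (1 + \<epsilon> * q p) \<partial>?PP)"
      using q_int P.prob_space by simp
    then show "0 \<le> \<epsilon> * ((\<integral>x. V' x * x ^ n \<partial>eq_measure) - (\<integral>p. q p \<partial>?PP)) + (D' + 2 * Q\<^sup>2) * \<epsilon>\<^sup>2"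
      using le VT by (simp add: algebra_simps)
  qed
  then show ?thesis using q_mean by simp
qed

end

section \<open>Existence of Chebyshev expansions of polynomials\<close>

definition cheb_span :: "(real \<Rightarrow> real) \<Rightarrow> bool" where
  "cheb_span f \<longleftrightarrow> (\<exists>M u. \<forall>w. f w = (\<Sum>n\<le>M. u n * cheb_T n w))"

lemma cheb_span_add:
  assumes "cheb_span f" "cheb_span g"
  shows "cheb_span (\<lambda>w. f w + g w)"
proof -
  obtain M u M' u' where f: "\<And>w. f w = (\<Sum>n\<le>M. u n * cheb_T n w)" and g: "\<And>w. g w = (\<Sum>n\<le>M'. u' n * cheb_T n w)"
    using assms unfolding cheb_span_def by metis
  have pad: "(\<Sum>n\<le>M. u n * cheb_T n w) = (\<Sum>n\<le>max M M'. (if n \<le> M then u n else 0) * cheb_T n w)" for M M' u w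
    by (rule sum.mono_neutral_cong_left) auto
  have "f w + g w = (\<Sum>n\<le>max M M'. ((if n \<le> M then u n else 0) + (if n \<le> M' then u' n else 0)) * cheb_T n w)" for w
    unfolding f g pad[where M = M and M' = M' and u = u] pad[where M = M' and M' = M and u = u']
      max.commute[of M' M] distrib_right sum.distrib ..
  then show ?thesis unfolding cheb_span_def by (intro exI allI)
qed

lemma cheb_span_cmult:
  assumes "cheb_span f"
  shows "cheb_span (\<lambda>w. r * f w)"
proof -
  obtain M u where f: "\<And>w. f w = (\<Sum>n\<le>M. u n * cheb_T n w)"
    using assms unfolding cheb_span_def by metis
  have "\<forall>w. r * f w = (\<Sum>n\<le>M. (r * u n) * cheb_T n w)"
    unfolding f sum_distrib_left by (simp add: mult.assoc)
  then show ?thesis unfolding cheb_span_def by (intro exI)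
qed

lemma cheb_span_T: "cheb_span (cheb_T k)"
proof -
  have "cheb_T k w = (\<Sum>n\<le>k. (if n = k then 1 else 0) * cheb_T n w)" for w
    by (simp add: if_distrib[where f = "\<lambda>x. x * _"] cong: if_cong)
  then show ?thesis unfolding cheb_span_def by (rule_tac exI[of _ k], rule_tac exI[of _ "\<lambda>n. if n = k then 1 else 0"]) blast
qed

lemma cheb_span_const: "cheb_span (\<lambda>w. r)"
  using cheb_span_cmult[OF cheb_span_T[of 0], of "r / 2"] by simp

lemma cheb_span_sum: "(\<And>i. i \<in> A \<Longrightarrow> cheb_span (f i)) \<Longrightarrow> cheb_span (\<lambda>w. \<Sum>i\<in>A. f i w)"
  by (induction A rule: infinite_finite_induct) (auto intro: cheb_span_const cheb_span_add)

lemma cheb_span_mult_arg: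
  assumes "cheb_span f"
  shows "cheb_span (\<lambda>w. w * f w)"
proof -
  obtain M u where f: "\<And>w. f w = (\<Sum>n\<le>M. u n * cheb_T n w)"
    using assms unfolding cheb_span_def by metis
  have "cheb_span (\<lambda>w. w * cheb_T n w)" for n
  proof (cases n)
    case 0
    then show ?thesis using cheb_span_cmult[OF cheb_span_T[of "Suc 0"], of 2] by (simp add: mult.commute)
  next
    case (Suc k)
    then show ?thesis using cheb_span_add[OF cheb_span_T[of "Suc (Suc k)"] cheb_span_T[of k]] by simp
  qed
  then have "cheb_span (\<lambda>w. \<Sum>n\<le>M. u n * (w * cheb_T n w))"
    by (intro cheb_span_sum cheb_span_cmult)
  then show ?thesis unfolding f sum_distrib_left by (simp add: mult.left_commute)
qed

lemma cheb_span_power: "cheb_span (\<lambda>w. (b + c * w) ^ k)"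
proof (induction k)
  case (Suc k)
  have "cheb_span (\<lambda>w. b * (b + c * w) ^ k + c * (w * (b + c * w) ^ k))"
    by (intro cheb_span_add cheb_span_cmult cheb_span_mult_arg Suc)
  then show ?case by (simp add: algebra_simps)
qed (simp add: cheb_span_const)

lemma cheb_span_expand:
  assumes "cheb_span f"
  obtains v M where "\<And>w. f w = v 0 + (\<Sum>n=1..M. v n * cheb_T n w) / 2"
proof -
  obtain M u where f: "\<And>w. f w = (\<Sum>n\<le>M. u n * cheb_T n w)"
    using assms unfolding cheb_span_def by metis
  \<comment> \<open>\<open>cheb_T 0\<close> is 2, so the constant term is 2 u 0; with the factor 1/2
    in front of the sum, v = 2 u serves every index, including 0.\<close>
  have "f w = 2 * u 0 + (\<Sum>n=1..M. 2 * u n * cheb_T n w) / 2" for w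
  proof -
    have "(\<Sum>n=1..M. 2 * u n * cheb_T n w) / 2 = (\<Sum>n=1..M. u n * cheb_T n w)"
      unfolding sum_divide_distrib by (rule sum.cong) auto
    moreover have "(\<Sum>n\<le>M. u n * cheb_T n w) = u 0 * cheb_T 0 w + (\<Sum>n=1..M. u n * cheb_T n w)"
      using sum.atLeast_Suc_atMost[of 0 M "\<lambda>n. u n * cheb_T n w"] by (simp add: atMost_atLeast0)
    ultimately show ?thesis unfolding f by simp
  qed
  then show thesis by (intro that[of "\<lambda>n. 2 * u n" M]) auto
qed

section \<open>Arcsine moments and the algebraic system\<close>

lemma circle_mean_2cos_power:
  "circle_mean (\<lambda>\<theta>. (2 * cos \<theta>) ^ k) = (if even k then real (k choose (k div 2)) else 0)"
proof -
  have "(2 * cos \<theta>) ^ k = (\<Sum>i\<le>k. real (k choose i) * cos (of_int (2 * int i - int k) * \<theta>))" for \<theta>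
  proof -
    have "cis \<theta> + cis (- \<theta>) = complex_of_real (2 * cos \<theta>)" by (simp add: complex_eq_iff)
    then have "complex_of_real ((2 * cos \<theta>) ^ k) = (cis \<theta> + cis (- \<theta>)) ^ k"
      by (simp only: of_real_power)
    also have "\<dots> = (\<Sum>i\<le>k. of_nat (k choose i) * cis \<theta> ^ i * cis (- \<theta>) ^ (k - i))"
      by (rule binomial_ring)
    also have "\<dots> = (\<Sum>i\<le>k. of_nat (k choose i) * cis (of_int (2 * int i - int k) * \<theta>))"
    proof (rule sum.cong[OF refl])
      fix i assume "i \<in> {..k}"
      then have "real (k - i) = real k - real i" by (simp add: of_nat_diff)
      then have "real i * \<theta> + real (k - i) * - \<theta> = of_int (2 * int i - int k) * \<theta>"
        by (simp add: left_diff_distrib)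
      then show "of_nat (k choose i) * cis \<theta> ^ i * cis (- \<theta>) ^ (k - i) =
        of_nat (k choose i) * cis (of_int (2 * int i - int k) * \<theta>)"
        by (simp only: Complex.DeMoivre mult.assoc cis_mult)
    qed
    finally have "Re (complex_of_real ((2 * cos \<theta>) ^ k)) = Re (\<Sum>i\<le>k. of_nat (k choose i) * cis (of_int (2 * int i - int k) * \<theta>))"
      by (simp only:)
    then show ?thesis by (simp only: Re_sum Re_complex_of_real) simp
  qed
  then have "circle_mean (\<lambda>\<theta>. (2 * cos \<theta>) ^ k) = circle_mean (\<lambda>\<theta>. \<Sum>i\<le>k. real (k choose i) * cos (of_int (2 * int i - int k) * \<theta>))"
    by (simp only:)
  also have "\<dots> = (\<Sum>i\<le>k. real (k choose i) * circle_mean (\<lambda>\<theta>. cos (of_int (2 * int i - int k) * \<theta>)))"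
    by (subst Bochner_Integration.integral_sum)
      (intro circle_integrable_continuous continuous_intros, simp only: integral_mult_right_zero)
  also have "\<dots> = (\<Sum>i\<le>k. if even k \<and> i = k div 2 then real (k choose i) else 0)"
  proof -
    have "(2 * int i - int k = 0) \<longleftrightarrow> even k \<and> i = k div 2" for i by presburger
    then show ?thesis unfolding circle_mean_cos by (intro sum.cong refl) simp
  qed
  also have "\<dots> = (if even k then real (k choose (k div 2)) else 0)"
    by (auto simp: sum.delta)
  finally show ?thesis .
qed

lemma circle_mean_binomial:
  "circle_mean (\<lambda>\<theta>. (b + c * (2 * cos \<theta>)) ^ n * (2 * cos \<theta>) ^ d) =
    (\<Sum>l\<le>n. real (n choose l) * b ^ (n - l) * c ^ l * circle_mean (\<lambda>\<theta>. (2 * cos \<theta>) ^ (l + d)))"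
proof -
  have "(b + c * (2 * cos \<theta>)) ^ n * (2 * cos \<theta>) ^ d = (\<Sum>l\<le>n. real (n choose l) * b ^ (n - l) * c ^ l * (2 * cos \<theta>) ^ (l + d))" for \<theta>
    unfolding add.commute[of b] binomial_ring sum_distrib_right
    by (intro sum.cong refl) (simp add: power_mult_distrib power_add mult_ac)
  then have "circle_mean (\<lambda>\<theta>. (b + c * (2 * cos \<theta>)) ^ n * (2 * cos \<theta>) ^ d) =
    circle_mean (\<lambda>\<theta>. \<Sum>l\<le>n. real (n choose l) * b ^ (n - l) * c ^ l * (2 * cos \<theta>) ^ (l + d))"
    by (simp only:)
  also have "\<dots> = (\<Sum>l\<le>n. real (n choose l) * b ^ (n - l) * c ^ l * circle_mean (\<lambda>\<theta>. (2 * cos \<theta>) ^ (l + d)))"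
    by (subst Bochner_Integration.integral_sum)
      (intro circle_integrable_continuous continuous_intros, simp only: integral_mult_right_zero)
  finally show ?thesis .
qed

text \<open>The coefficients of \<open>a i\<close> in the two equations, with n = i + 1. They are
  stated over any commutative ring, since they are used for real and complex numbers, for series in
  t and for series in all variables.\<close>

definition sys_R :: "nat \<Rightarrow> 'a::comm_ring_1 \<Rightarrow> 'a \<Rightarrow> 'a" where
  "sys_R i R S = (\<Sum>j=1..Suc i. of_nat ((i choose (j - 1)) * (Suc i - j choose j)) * R ^ j * S ^ (Suc i - 2 * j))"

definition sys_S :: "nat \<Rightarrow> 'a::comm_ring_1 \<Rightarrow> 'a \<Rightarrow> 'a" where
  "sys_S i R S = (\<Sum>j=0..Suc i. of_nat ((i choose (2 * j)) * (2 * j choose j)) * R ^ j * S ^ (i - 2 * j))"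

text \<open>The origin of the second equation: in the binomial expansion of (b + 2c cos \<theta>)^i
  only the even powers 2 j of the cosine have a nonzero mean, the central binomial coefficient.
  Terms with 2 j > i vanish with their binomial coefficient.\<close>

lemma circle_mean_sys_S:
  "circle_mean (\<lambda>\<theta>. (b + c * (2 * cos \<theta>)) ^ i) = sys_S i (c\<^sup>2) b"
proof -
  let ?f = "\<lambda>l. real (i choose l) * b ^ (i - l) * c ^ l * (if even l then real (l choose (l div 2)) else 0)"
  have "circle_mean (\<lambda>\<theta>. (b + c * (2 * cos \<theta>)) ^ i) = (\<Sum>l\<le>i. ?f l)"
    using circle_mean_binomial[of b c i 0] by (simp only: circle_mean_2cos_power add_0_right power_0 mult_1_right)
  also have "\<dots> = (\<Sum>l\<in>(\<lambda>j. 2 * j) ` {0..Suc i}. ?f l)"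
  proof (rule sum.mono_neutral_cong)
    show "?f l = 0" if "l \<in> {..i} - (\<lambda>j. 2 * j) ` {0..Suc i}" for l
      using that by (auto elim!: evenE)
  qed (auto simp: binomial_eq_0)
  also have "\<dots> = (\<Sum>j=0..Suc i. ?f (2 * j))"
    by (rule sum.reindex_cong[of "\<lambda>j. 2 * j"]) (auto simp: inj_on_def)
  also have "\<dots> = sys_S i (c\<^sup>2) b"
    unfolding sys_S_def by (intro sum.cong refl) (simp add: mult_ac flip: power_mult)
  finally show ?thesis .
qed

text \<open>Reconciles the coefficient produced by the arcsine mean with the one in the system: half
  of the central coefficient 2j choose j is 2j - 1 choose j - 1, and nested choices may be made in
  either order.\<close>

lemma choose_identity:
  assumes "1 \<le> j"
  shows "real (i choose (2 * j - 1)) * real (2 * j choose j) = 2 * real ((i choose (j - 1)) * (Suc i - j choose j))"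
proof (cases "2 * j - 1 \<le> i")
  case True
  have "2 * j choose j = 2 * (2 * j - 1 choose (j - 1))"
  proof -
    obtain k where k: "j = Suc k" using assms by (cases j) auto
    have "2 * j choose j = (2 * k + 1 choose k) + (2 * k + 1 choose Suc k)" by (simp add: k)
    moreover have "2 * k + 1 choose Suc k = 2 * k + 1 choose k"
      using binomial_symmetric[of "Suc k" "2 * k + 1"] by simp
    ultimately show ?thesis by (simp add: k)
  qed
  moreover have "(i choose (2 * j - 1)) * (2 * j - 1 choose (j - 1)) = (i choose (j - 1)) * (i - (j - 1) choose (2 * j - 1 - (j - 1)))"
    by (rule choose_mult) (use True assms in auto)
  moreover have "i - (j - 1) = Suc i - j" "2 * j - 1 - (j - 1) = j" using assms True by auto
  ultimately have "(i choose (2 * j - 1)) * (2 * j choose j) = 2 * ((i choose (j - 1)) * (Suc i - j choose j))"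
    by (simp add: mult.left_commute)
  then show ?thesis by (metis of_nat_mult of_nat_numeral)
next
  case False
  then have "i choose (2 * j - 1) = 0" "Suc i - j choose j = 0" by (auto simp: binomial_eq_0)
  then show ?thesis by (simp only: of_nat_0 mult_zero_left mult_zero_right)
qed

text \<open>Here only odd powers l = 2 j - 1 contribute, because of the additional cosine. The
  factor c in front turns c^(2j-1) into (c^2)^j, so that the mean becomes a polynomial in c^2 and
  b.\<close>

lemma circle_mean_sys_R:
  "c * circle_mean (\<lambda>\<theta>. (b + c * (2 * cos \<theta>)) ^ i * (2 * cos \<theta>)) = 2 * sys_R i (c\<^sup>2) b"
proof -
  let ?f = "\<lambda>l. real (i choose l) * b ^ (i - l) * c ^ l * (if even (l + 1) then real (l + 1 choose ((l + 1) div 2)) else 0)"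
  have "circle_mean (\<lambda>\<theta>. (b + c * (2 * cos \<theta>)) ^ i * (2 * cos \<theta>)) = (\<Sum>l\<le>i. ?f l)"
    using circle_mean_binomial[of b c i 1] by (simp only: circle_mean_2cos_power power_one_right)
  also have "\<dots> = (\<Sum>l\<in>(\<lambda>j. 2 * j - 1) ` {1..Suc i}. ?f l)"
  proof (rule sum.mono_neutral_cong)
    show "?f l = 0" if l: "l \<in> {..i} - (\<lambda>j. 2 * j - 1) ` {1..Suc i}" for l
    proof -
      have "\<not> even (l + 1)"
      proof
        assume "even (l + 1)"
        then obtain j where "l + 1 = 2 * j" by (elim evenE)
        then have "l = 2 * j - 1" "j \<in> {1..Suc i}" using l by auto
        then show False using l by blast
      qed
      then show ?thesis by simp
    qed
  qed (auto simp: binomial_eq_0)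
  also have "\<dots> = (\<Sum>j=1..Suc i. ?f (2 * j - 1))"
    by (rule sum.reindex_cong[of "\<lambda>j. 2 * j - 1"]) (auto simp: inj_on_def)
  finally have "c * circle_mean (\<lambda>\<theta>. (b + c * (2 * cos \<theta>)) ^ i * (2 * cos \<theta>)) = (\<Sum>j=1..Suc i. c * ?f (2 * j - 1))"
    by (simp only: sum_distrib_left)
  also have "\<dots> = (\<Sum>j=1..Suc i. 2 * (of_nat ((i choose (j - 1)) * (Suc i - j choose j)) * (c\<^sup>2) ^ j * b ^ (Suc i - 2 * j)))"
  proof (rule sum.cong[OF refl])
    fix j assume j: "j \<in> {1..Suc i}"
    then have "2 * j - 1 + 1 = 2 * j" "i - (2 * j - 1) = Suc i - 2 * j" by auto
    moreover have "c * c ^ (2 * j - 1) = (c\<^sup>2) ^ j"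
    proof -
      have "c * c ^ (2 * j - 1) = c ^ (2 * j - 1 + 1)" by simp
      then show ?thesis using \<open>2 * j - 1 + 1 = 2 * j\<close> by (simp only: power_mult)
    qed
    ultimately have "c * ?f (2 * j - 1) = (real (i choose (2 * j - 1)) * real (2 * j choose j)) * b ^ (Suc i - 2 * j) * (c\<^sup>2) ^ j"
      by (simp only: even_mult_iff even_numeral simp_thms if_True) (simp add: mult_ac)
    also have "\<dots> = 2 * (of_nat ((i choose (j - 1)) * (Suc i - j choose j)) * (c\<^sup>2) ^ j * b ^ (Suc i - 2 * j))"
      using j by (subst choose_identity) (simp_all only: atLeastAtMost_iff mult_ac)
    finally show "c * ?f (2 * j - 1) = 2 * (of_nat ((i choose (j - 1)) * (Suc i - j choose j)) * (c\<^sup>2) ^ j * b ^ (Suc i - 2 * j))" .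
  qed
  finally show ?thesis unfolding sys_R_def sum_distrib_left .
qed

section \<open>Strongly convex polynomial potentials\<close>

definition pot :: "nat \<Rightarrow> (nat \<Rightarrow> real) \<Rightarrow> real \<Rightarrow> real" where
  "pot m a x = x\<^sup>2 / 2 - (\<Sum>i<m. a i * x ^ Suc i / real (Suc i))"

definition pot' :: "nat \<Rightarrow> (nat \<Rightarrow> real) \<Rightarrow> real \<Rightarrow> real" where
  "pot' m a x = x - (\<Sum>i<m. a i * x ^ i)"

definition pot'' :: "nat \<Rightarrow> (nat \<Rightarrow> real) \<Rightarrow> real \<Rightarrow> real" where
  "pot'' m a x = 1 - (\<Sum>i<m. a i * (real i * x ^ (i - 1)))"

lemma potential_eq_pot:
  assumes "\<And>i. m \<le> i \<Longrightarrow> a i = 0"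
  shows "potential a = pot m a" "summable (\<lambda>i. a i * x ^ Suc i / real (Suc i))"
proof -
  have s: "(\<lambda>i. a i * x ^ Suc i / real (Suc i)) sums (\<Sum>i<m. a i * x ^ Suc i / real (Suc i))" for x
    by (rule sums_finite) (use assms in auto)
  show "potential a = pot m a"
  proof
    fix x
    show "potential a x = pot m a x" unfolding potential_def pot_def sums_unique[OF s[of x], symmetric] ..
  qed
  show "summable (\<lambda>i. a i * x ^ Suc i / real (Suc i))" using s sums_summable by blast
qed

lemma pot_deriv: "(pot m a has_real_derivative pot' m a x) (at x)"
proof -
  have d: "((\<lambda>x. a i * x ^ Suc i / real (Suc i)) has_real_derivative a i * x ^ i) (at x)" for i
  proof -
    have "((\<lambda>x. a i * x ^ Suc i / real (Suc i)) has_real_derivative a i * (real (Suc i) * x ^ i) / real (Suc i)) (at x)"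
      by (intro DERIV_cdivide DERIV_cmult) (use DERIV_pow[of "Suc i" x] in simp)
    then show ?thesis by (simp del: of_nat_Suc)
  qed
  have "((\<lambda>x. x\<^sup>2 / 2 - (\<Sum>i<m. a i * x ^ Suc i / real (Suc i))) has_real_derivative x - (\<Sum>i<m. a i * x ^ i)) (at x)"
    by (intro DERIV_diff DERIV_sum d) (auto intro!: derivative_eq_intros)
  then show ?thesis unfolding pot_def pot'_def .
qed

lemma pot'_deriv: "(pot' m a has_real_derivative pot'' m a x) (at x)"
proof -
  have "((\<lambda>x. x - (\<Sum>i<m. a i * x ^ i)) has_real_derivative 1 - (\<Sum>i<m. a i * (real i * x ^ (i - 1)))) (at x)"
    by (intro DERIV_diff DERIV_sum DERIV_cmult DERIV_ident) (use DERIV_pow in simp)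
  then show ?thesis unfolding pot'_def pot''_def .
qed

lemma pot''_continuous: "continuous_on UNIV (pot'' m a)"
proof -
  have "pot'' m a = (\<lambda>x. 1 - (\<Sum>i<m. a i * (real i * x ^ (i - 1))))" by (simp add: pot''_def fun_eq_iff)
  then show ?thesis by (simp only:) (intro continuous_intros)
qed

lemma pot_continuous: "continuous_on A (pot m a)"
  using pot_deriv DERIV_isCont by (blast intro: continuous_at_imp_continuous_on)

lemma pot_lower_bound:
  assumes "\<And>x. 1 / 2 \<le> pot'' m a x"
  shows "pot m a 0 + pot' m a 0 * x + x\<^sup>2 / 4 \<le> pot m a x"
proof (cases "x = 0")
  case False
  have "\<exists>t. (if x < 0 then x < t \<and> t < 0 else 0 < t \<and> t < x) \<and>
    pot m a x = (\<Sum>k<2. (if k = 0 then pot m a else if k = 1 then pot' m a else pot'' m a) 0 / fact k * (x - 0) ^ k) +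
      (if (2::nat) = 0 then pot m a else if (2::nat) = 1 then pot' m a else pot'' m a) t / fact 2 * (x - 0) ^ 2"
    by (rule Taylor[where a = "min 0 x" and b = "max 0 x"]) (auto simp: pot_deriv pot'_deriv less_2_cases_iff False)
  then obtain t where "pot m a x = pot m a 0 + pot' m a 0 * x + pot'' m a t / 2 * x\<^sup>2"
    by (auto simp: numeral_2_eq_2)
  moreover have "1 / 2 / 2 * x\<^sup>2 \<le> pot'' m a t / 2 * x\<^sup>2"
    using assms[of t] by (intro mult_right_mono) auto
  ultimately show ?thesis by simp
qed simp

lemma pot_growth:
  assumes "\<And>x. 1 / 2 \<le> pot'' m a x"
  shows "\<exists>C. \<forall>x. \<bar>x\<bar> - C \<le> pot m a x"
proof (intro exI allI)
  fix x :: real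
  \<comment> \<open>Completing the square with this s leaves a slope of at least 1 in |x| after the
    linear term of the Taylor bound has been absorbed.\<close>
  define s where "s = \<bar>pot' m a 0\<bar> + 1"
  have "0 \<le> (\<bar>x\<bar> / 2 - s)\<^sup>2" by simp
  then have "s * \<bar>x\<bar> - s\<^sup>2 \<le> x\<^sup>2 / 4" by (simp add: power2_eq_square algebra_simps)
  moreover have "- (\<bar>pot' m a 0\<bar> * \<bar>x\<bar>) \<le> pot' m a 0 * x"
    unfolding abs_mult[symmetric] by simp
  ultimately have "\<bar>x\<bar> - s\<^sup>2 \<le> pot' m a 0 * x + x\<^sup>2 / 4"
    unfolding s_def distrib_right by linarith
  then show "\<bar>x\<bar> - (s\<^sup>2 - pot m a 0) \<le> pot m a x"
    using pot_lower_bound[OF assms, of x] by simp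
qed

lemma pot_admissible:
  assumes "\<And>x. 1 / 2 \<le> pot'' m a x"
  shows "admissible (pot m a)"
  unfolding admissible_def
proof (intro conjI exI)
  show "lower_semicontinuous (pot m a)"
    unfolding lower_semicontinuous_def
  proof (intro allI impI)
    fix x y assume "y < pot m a x"
    moreover have "(pot m a \<longlongrightarrow> pot m a x) (nhds x)"
      using DERIV_isCont[OF pot_deriv[of m a x]] by (simp add: isCont_def tendsto_at_iff_tendsto_nhds)
    ultimately show "\<forall>\<^sub>F z in nhds x. y < pot m a z" by (rule order_tendstoD(1)[rotated])
  qed
  define s where "s = \<bar>pot' m a 0\<bar>"
  define p where "p = pot m a 0"
  \<comment> \<open>The quadratic lower bound dominates the logarithm, so the limit L in
    \<open>admissible\<close> is infinite.\<close>
  have "filterlim (\<lambda>y. (p - s * y + y\<^sup>2 / 4) / (2 * ln y)) at_top at_top" by real_asymp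
  then have "filterlim (\<lambda>x. (p - s * \<bar>x\<bar> + \<bar>x\<bar>\<^sup>2 / 4) / (2 * ln \<bar>x\<bar>)) at_top at_infinity"
    by (rule filterlim_compose[OF _ filterlim_norm_at_top[where 'a = real, unfolded real_norm_def]])
  then have "filterlim (\<lambda>x. pot m a x / (2 * ln \<bar>x\<bar>)) at_top at_infinity"
  proof (rule filterlim_at_top_mono)
    have "\<forall>\<^sub>F x in at_infinity. 1 < \<bar>x :: real\<bar>"
      using eventually_at_infinity[of "\<lambda>x. 1 < \<bar>x :: real\<bar>"] by (auto intro!: exI[of _ 2])
    then show "\<forall>\<^sub>F x in at_infinity. (p - s * \<bar>x\<bar> + \<bar>x\<bar>\<^sup>2 / 4) / (2 * ln \<bar>x\<bar>) \<le> pot m a x / (2 * ln \<bar>x\<bar>)"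
    proof eventually_elim
      case (elim x)
      have "- (s * \<bar>x\<bar>) \<le> pot' m a 0 * x"
        unfolding s_def abs_mult[symmetric] by simp
      then have "p - s * \<bar>x\<bar> + \<bar>x\<bar>\<^sup>2 / 4 \<le> pot m a x"
        using pot_lower_bound[OF assms, of x] by (simp add: p_def)
      then show ?case using elim by (intro divide_right_mono) auto
    qed
  qed
  then show "((\<lambda>x. ereal (pot m a x / (2 * ln \<bar>x\<bar>))) \<longlongrightarrow> \<infinity>) at_infinity"
    by (simp add: tendsto_PInfty_eq_at_top)
qed simp

lemma has_cut_unique:
  assumes "has_cut V b c"
  shows "(THE c. \<exists>b. has_cut V b c) = c" "(THE b. \<exists>c. has_cut V b c) = b"
proof -
  have u: "b' = b \<and> c' = c" if "has_cut V b' c'" for b' c'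
  proof -
    have "{b - 2 * c..b + 2 * c} = {b' - 2 * c'..b' + 2 * c'}" "0 < c" "0 < c'"
      using assms that by (auto simp: has_cut_def)
    then have "b - 2 * c = b' - 2 * c'" "b + 2 * c = b' + 2 * c'" by (auto simp: Icc_eq_Icc)
    then show ?thesis by simp
  qed
  show "(THE c. \<exists>b. has_cut V b c) = c" by (rule the_equality) (use assms u in blast)+
  show "(THE b. \<exists>c. has_cut V b c) = b" by (rule the_equality) (use assms u in blast)+
qed

text \<open>Shows that the two endpoint equations of the locale are exactly the two equations of the
  algebraic system, with R = c^2 and S = b.\<close>

lemma circle_mean_pot':
  "circle_mean (\<lambda>\<theta>. pot' m a (b + c * (2 * cos \<theta>))) = b - (\<Sum>i<m. a i * sys_S i (c\<^sup>2) b)"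
  "c * circle_mean (\<lambda>\<theta>. pot' m a (b + c * (2 * cos \<theta>)) * (2 * cos \<theta>)) = 2 * (c\<^sup>2 - (\<Sum>i<m. a i * sys_R i (c\<^sup>2) b))"
proof -
  let ?y = "\<lambda>\<theta>. b + c * (2 * cos \<theta>)"
  have i1: "integrable circle_measure (\<lambda>\<theta>. a i * ?y \<theta> ^ i)" for i
    by (rule circle_integrable_continuous) (intro continuous_intros)
  have i2: "integrable circle_measure (\<lambda>\<theta>. a i * (?y \<theta> ^ i * (2 * cos \<theta>)))" for i
    by (rule circle_integrable_continuous) (intro continuous_intros)
  have j1: "integrable circle_measure ?y" "integrable circle_measure (\<lambda>\<theta>. ?y \<theta> * (2 * cos \<theta>))"
    by (rule circle_integrable_continuous; intro continuous_intros)+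
  have m1: "circle_mean ?y = b"
  proof -
    have "circle_mean ?y = circle_mean (\<lambda>\<theta>. b + c * (2 * cos \<theta>) ^ 1)" by simp
    also have "\<dots> = b + c * circle_mean (\<lambda>\<theta>. (2 * cos \<theta>) ^ 1)"
      using circle.prob_space
      by (subst Bochner_Integration.integral_add) (auto intro!: circle_integrable_continuous continuous_intros)
    finally show ?thesis by (simp only: circle_mean_2cos_power) simp
  qed
  have m2: "circle_mean (\<lambda>\<theta>. ?y \<theta> * (2 * cos \<theta>)) = 2 * c"
  proof -
    have "circle_mean (\<lambda>\<theta>. ?y \<theta> * (2 * cos \<theta>)) = circle_mean (\<lambda>\<theta>. b * (2 * cos \<theta>) ^ 1 + c * (2 * cos \<theta>) ^ 2)"
      by (intro Bochner_Integration.integral_cong refl) (simp add: distrib_right power2_eq_square)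
    also have "\<dots> = b * circle_mean (\<lambda>\<theta>. (2 * cos \<theta>) ^ 1) + c * circle_mean (\<lambda>\<theta>. (2 * cos \<theta>) ^ 2)"
      by (subst Bochner_Integration.integral_add)
        (intro circle_integrable_continuous continuous_intros, intro circle_integrable_continuous continuous_intros,
         simp only: integral_mult_right_zero)
    finally show ?thesis by (simp only: circle_mean_2cos_power) (simp add: numeral_2_eq_2)
  qed
  have "circle_mean (\<lambda>\<theta>. pot' m a (?y \<theta>)) = circle_mean ?y - (\<Sum>i<m. a i * circle_mean (\<lambda>\<theta>. ?y \<theta> ^ i))"
    unfolding pot'_def
    by (subst Bochner_Integration.integral_diff[OF j1(1) Bochner_Integration.integrable_sum[OF i1]],
        subst Bochner_Integration.integral_sum[OF i1]) (simp only: integral_mult_right_zero)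
  then show "circle_mean (\<lambda>\<theta>. pot' m a (?y \<theta>)) = b - (\<Sum>i<m. a i * sys_S i (c\<^sup>2) b)"
    by (simp only: m1 circle_mean_sys_S)
  have "circle_mean (\<lambda>\<theta>. pot' m a (?y \<theta>) * (2 * cos \<theta>)) =
      circle_mean (\<lambda>\<theta>. ?y \<theta> * (2 * cos \<theta>) - (\<Sum>i<m. a i * (?y \<theta> ^ i * (2 * cos \<theta>))))"
    unfolding pot'_def left_diff_distrib sum_distrib_right by (simp only: mult.assoc)
  also have "\<dots> = circle_mean (\<lambda>\<theta>. ?y \<theta> * (2 * cos \<theta>)) - (\<Sum>i<m. a i * circle_mean (\<lambda>\<theta>. ?y \<theta> ^ i * (2 * cos \<theta>)))"
    by (subst Bochner_Integration.integral_diff[OF j1(2) Bochner_Integration.integrable_sum[OF i2]],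
        subst Bochner_Integration.integral_sum[OF i2]) (simp only: integral_mult_right_zero)
  finally have eq: "circle_mean (\<lambda>\<theta>. pot' m a (?y \<theta>) * (2 * cos \<theta>)) =
      circle_mean (\<lambda>\<theta>. ?y \<theta> * (2 * cos \<theta>)) - (\<Sum>i<m. a i * circle_mean (\<lambda>\<theta>. ?y \<theta> ^ i * (2 * cos \<theta>)))" .
  have "c * circle_mean (\<lambda>\<theta>. pot' m a (?y \<theta>) * (2 * cos \<theta>)) =
      c * (2 * c) - (\<Sum>i<m. a i * (c * circle_mean (\<lambda>\<theta>. ?y \<theta> ^ i * (2 * cos \<theta>))))"
    unfolding eq m2 by (simp only: right_diff_distrib sum_distrib_left mult.left_commute[of c])
  then show "c * circle_mean (\<lambda>\<theta>. pot' m a (?y \<theta>) * (2 * cos \<theta>)) = 2 * (c\<^sup>2 - (\<Sum>i<m. a i * sys_R i (c\<^sup>2) b))"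
    unfolding circle_mean_sys_R
    by (simp add: right_diff_distrib sum_distrib_left power2_eq_square mult.left_commute)
qed

lemma pot'_increasing:
  assumes conv: "\<And>x. 1 / 2 \<le> pot'' m a x" and "x \<noteq> y"
  shows "1 / 2 \<le> (pot' m a x - pot' m a y) / (x - y)"
proof -
  have *: "1 / 2 \<le> (pot' m a x - pot' m a y) / (x - y)" if yx: "y < x" for x y
  proof -
    obtain z where "pot' m a x - pot' m a y = (x - y) * pot'' m a z"
      using MVT2[OF yx, where f = "pot' m a" and f' = "pot'' m a"] pot'_deriv by blast
    then show ?thesis using yx conv[of z] by simp
  qed
  show ?thesis
  proof (cases "y < x")
    case False
    then have "1 / 2 \<le> (pot' m a y - pot' m a x) / (y - x)" using * \<open>x \<noteq> y\<close> by simp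
    also have "\<dots> = (pot' m a x - pot' m a y) / (x - y)" by (metis minus_diff_eq minus_divide_divide)
    finally show ?thesis .
  qed (rule *)
qed

text \<open>Carries the facts about the equilibrium measure out of the locale; \<open>mom\<close>
  are its moments. The formula for \<open>planar_F\<close> serves to evaluate it at the Gaussian
  potential. In the last inequality the minimizer for a competes for a', which yields a supporting
  line of the concave minimal energy.\<close>

lemma equilibrium_polynomial:
  fixes a :: "nat \<Rightarrow> real"
  assumes supp: "\<And>i. m \<le> i \<Longrightarrow> a i = 0"
    and conv: "\<And>x. 1 / 2 \<le> pot'' m a x"
    and Rpos: "0 < R" and eqR: "R = 1 + (\<Sum>i<m. a i * sys_R i R S)" and eqS: "S = (\<Sum>i<m. a i * sys_S i R S)"
  obtains mom where
    "a \<in> one_cut_seqs" "planar_R a = R" "planar_S a = S" "mom 0 = 1"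
    "\<And>k. \<bar>mom k\<bar> \<le> (\<bar>S\<bar> + 2 * sqrt R) ^ k"
    "\<And>n. mom (Suc n) = (\<Sum>k<n. mom k * mom (n - 1 - k)) + (\<Sum>i<m. a i * mom (n + i))"
    "min_energy (potential a) = ereal (3 / 4 - planar_F a)"
    "planar_F a = 3 / 4 - ((mom 2 / 2 - (\<Sum>i<m. a i * mom (Suc i) / real (Suc i))) / 2 +
       circle_mean (\<lambda>\<theta>. pot m a (S + sqrt R * (2 * cos \<theta>))) / 2 - ln (sqrt R))"
    "\<And>a'. (\<And>i. m \<le> i \<Longrightarrow> a' i = 0) \<Longrightarrow>
      min_energy (potential a') \<le> min_energy (potential a) + ereal (- (\<Sum>i<m. (a' i - a i) * mom (Suc i) / real (Suc i)))"
proof -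
  define V where "V = pot m a"
  define c where "c = sqrt R"
  have c: "0 < c" "c\<^sup>2 = R" using Rpos by (auto simp: c_def)
  have Vp: "potential a = V" unfolding V_def by (rule potential_eq_pot[OF supp])
  \<comment> \<open>The Chebyshev coefficients are obtained by existence alone; all conclusions are
    stated free of them.\<close>
  have "cheb_span (\<lambda>w. (1 / 2) * (S + c * w) ^ 2 + (\<Sum>i<m. (- (a i / real (Suc i))) * (S + c * w) ^ Suc i))"
    by (intro cheb_span_add cheb_span_cmult cheb_span_sum cheb_span_power)
  moreover have "(1 / 2) * (S + c * w) ^ 2 + (\<Sum>i<m. (- (a i / real (Suc i))) * (S + c * w) ^ Suc i) = V (S + c * w)" for w
    by (simp add: V_def pot_def sum_negf del: power_Suc of_nat_Suc)
  ultimately have "cheb_span (\<lambda>w. V (S + c * w))" by (simp only:)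
  then obtain v M where expand: "\<And>w. V (S + c * w) = v 0 + (\<Sum>n=1..M. v n * cheb_T n w) / 2"
    by (rule cheb_span_expand) blast
  obtain C where C: "\<And>x. \<bar>x\<bar> - C \<le> V x" unfolding V_def using pot_growth[OF conv] by blast
  interpret E: equilibrium_data V "pot' m a" S c "1 / 2" v M
  proof
    show "0 < c" by (rule c)
    show "(V has_real_derivative pot' m a x) (at x)" for x unfolding V_def by (rule pot_deriv)
    show "V (S + c * w) = v 0 + (\<Sum>n=1..M. v n * cheb_T n w) / 2" for w by (rule expand)
    show "1 / 2 \<le> (pot' m a x - pot' m a y) / (x - y)" if "x \<noteq> y" for x y
      by (rule pot'_increasing[OF conv that])
    show "circle_mean (\<lambda>\<theta>. pot' m a (S + c * (2 * cos \<theta>))) = 0"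
      unfolding circle_mean_pot' c using eqS by simp
    show "circle_mean (\<lambda>\<theta>. pot' m a (S + c * (2 * cos \<theta>)) * (2 * cos \<theta>)) = 2 / c"
    proof -
      have "c * circle_mean (\<lambda>\<theta>. pot' m a (S + c * (2 * cos \<theta>)) * (2 * cos \<theta>)) = 2"
        unfolding circle_mean_pot' c using eqR by simp
      then show ?thesis using c(1) by (simp add: eq_divide_eq mult.commute)
    qed
    show "\<exists>C. \<forall>x. ln (1 + \<bar>x\<bar>) - C \<le> V x"
    proof (intro exI allI)
      fix x
      show "ln (1 + \<bar>x\<bar>) - C \<le> V x" using C[of x] ln_add_one_self_le_self[of "\<bar>x\<bar>"] by simp
    qed
  qed simp
  let ?\<mu> = "E.eq_measure"
  have pw: "integrable ?\<mu> (\<lambda>x. x ^ k)" for k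
    by (rule E.eq_measure_integrable) (intro continuous_intros)
  have cut: "has_cut V S c"
    unfolding has_cut_def E.equilibrium(1) E.eq_measure_support using c by simp
  have min: "min_energy V = ereal ((\<integral>x. V x \<partial>?\<mu>) / 2 + E.robin / 2)" by (rule E.equilibrium(2))
  have F: "planar_F a = 3 / 4 - ((\<integral>x. V x \<partial>?\<mu>) / 2 + E.robin / 2)"
    by (simp add: planar_F_def Vp min)
  have VI: "(\<integral>x. pot m a' x \<partial>?\<mu>) = E.moment 2 / 2 - (\<Sum>i<m. a' i * E.moment (Suc i) / real (Suc i))" for a'
  proof -
    have "(\<integral>x. pot m a' x \<partial>?\<mu>) = (\<integral>x. x ^ 2 / 2 - (\<Sum>i<m. a' i / real (Suc i) * x ^ Suc i) \<partial>?\<mu>)"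
      by (simp add: pot_def mult.commute del: power_Suc of_nat_Suc)
    also have "\<dots> = (\<integral>x. x ^ 2 / 2 \<partial>?\<mu>) - (\<integral>x. (\<Sum>i<m. a' i / real (Suc i) * x ^ Suc i) \<partial>?\<mu>)"
      by (intro Bochner_Integration.integral_diff integrable_divide_zero Bochner_Integration.integrable_sum
        integrable_mult_right pw)
    also have "(\<integral>x. (\<Sum>i<m. a' i / real (Suc i) * x ^ Suc i) \<partial>?\<mu>) = (\<Sum>i<m. a' i / real (Suc i) * E.moment (Suc i))"
      unfolding E.moment_def
      by (subst Bochner_Integration.integral_sum) (intro integrable_mult_right pw, simp only: integral_mult_right_zero)
    finally show ?thesis by (simp add: E.moment_def del: power_Suc of_nat_Suc)
  qed
  show thesis
  proof (rule that[of E.moment])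
    have "admissible V" unfolding V_def by (rule pot_admissible[OF conv])
    moreover have "one_cut V" using cut by (auto simp: one_cut_def)
    ultimately show "a \<in> one_cut_seqs"
      using potential_eq_pot(2)[where m = m and a = a, OF supp]
      by (auto simp: one_cut_seqs_def Vp simp del: power_Suc of_nat_Suc)
    show "planar_R a = R" "planar_S a = S"
      unfolding planar_R_def planar_S_def Vp has_cut_unique[OF cut] using c by simp_all
    show "E.moment 0 = 1" by (rule E.moment_0)
    show "\<bar>E.moment k\<bar> \<le> (\<bar>S\<bar> + 2 * sqrt R) ^ k" for k
      using E.moment_bound[of k] by (simp add: c_def)
    show "E.moment (Suc n) = (\<Sum>k<n. E.moment k * E.moment (n - 1 - k)) + (\<Sum>i<m. a i * E.moment (n + i))" for n
    proof -
      have "(\<Sum>k<n. E.moment k * E.moment (n - 1 - k)) = (\<integral>x. pot' m a x * x ^ n \<partial>?\<mu>)"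
        using E.loop_equation[OF pot'_deriv pot''_continuous] by simp
      also have "\<dots> = (\<integral>x. x ^ Suc n - (\<Sum>i<m. a i * x ^ (n + i)) \<partial>?\<mu>)"
        by (intro Bochner_Integration.integral_cong refl)
          (simp add: pot'_def right_diff_distrib sum_distrib_left power_add mult_ac)
      also have "\<dots> = E.moment (Suc n) - (\<integral>x. (\<Sum>i<m. a i * x ^ (n + i)) \<partial>?\<mu>)"
        unfolding E.moment_def
        by (intro Bochner_Integration.integral_diff Bochner_Integration.integrable_sum integrable_mult_right pw)
      also have "(\<integral>x. (\<Sum>i<m. a i * x ^ (n + i)) \<partial>?\<mu>) = (\<Sum>i<m. a i * E.moment (n + i))"
        unfolding E.moment_def
        by (subst Bochner_Integration.integral_sum) (intro integrable_mult_right pw, simp only: integral_mult_right_zero)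
      finally show ?thesis by simp
    qed
    show "min_energy (potential a) = ereal (3 / 4 - planar_F a)"
      unfolding Vp F min by simp
    show "planar_F a = 3 / 4 - ((E.moment 2 / 2 - (\<Sum>i<m. a i * E.moment (Suc i) / real (Suc i))) / 2 +
       circle_mean (\<lambda>\<theta>. pot m a (S + sqrt R * (2 * cos \<theta>))) / 2 - ln (sqrt R))"
      unfolding F VI[of a, folded V_def] E.robin_def E.v_0_eq by (simp add: V_def c_def diff_divide_distrib)
    fix a' :: "nat \<Rightarrow> real" assume a': "\<And>i. m \<le> i \<Longrightarrow> a' i = 0"
    have i: "integrable ?\<mu> (pot m a')" for a' by (rule E.eq_measure_integrable[OF pot_continuous])
    have "(\<integral>x. pot m a' x - V x \<partial>?\<mu>) = - (\<Sum>i<m. (a' i - a i) * E.moment (Suc i) / real (Suc i))"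
      unfolding V_def by (simp add: i VI left_diff_distrib diff_divide_distrib sum_subtractf)
    then show "min_energy (potential a') \<le> min_energy (potential a) +
        ereal (- (\<Sum>i<m. (a' i - a i) * E.moment (Suc i) / real (Suc i)))"
      using E.min_energy_le[OF pot_continuous[of UNIV m a']]
      by (simp only: Vp potential_eq_pot(1)[where m = m and a = a', OF a'])
  qed
qed

section \<open>Solutions and equilibrium measures along a ray\<close>

lemma small_solution:
  fixes a :: "nat \<Rightarrow> real"
  obtains t\<^sub>0 where "0 < t\<^sub>0" "\<And>t. 0 \<le> t \<Longrightarrow> t \<le> t\<^sub>0 \<Longrightarrow> \<exists>R S. \<bar>R - 1\<bar> \<le> 1 / 2 \<and> \<bar>S\<bar> \<le> 1 / 2 \<and>
     R = 1 + t * (\<Sum>i<m. a i * sys_R i R S) \<and> S = t * (\<Sum>i<m. a i * sys_S i R S)"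
proof -
  let ?K = "cball (1, 0) (1 / 2) :: (real \<times> real) set"
  define f where "f p = (\<Sum>i<m. a i * sys_R i (fst p) (snd p))" for p :: "real \<times> real"
  define g where "g p = (\<Sum>i<m. a i * sys_S i (fst p) (snd p))" for p :: "real \<times> real"
  have cf: "continuous_on ?K f" unfolding f_def sys_R_def by (intro continuous_intros)
  have cg: "continuous_on ?K g" unfolding g_def sys_S_def by (intro continuous_intros)
  have "bounded (f ` ?K)" "bounded (g ` ?K)"
    by (intro compact_imp_bounded compact_continuous_image cf cg compact_cball)+
  then obtain Bf Bg where "\<forall>x\<in>f ` ?K. norm x \<le> Bf" "\<forall>x\<in>g ` ?K. norm x \<le> Bg"
    unfolding bounded_iff by blast
  then have Bf: "\<bar>f p\<bar> \<le> Bf" and Bg: "\<bar>g p\<bar> \<le> Bg" if "p \<in> ?K" for p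
    using that by (metis imageI real_norm_def)+
  define B where "B = \<bar>Bf\<bar> + \<bar>Bg\<bar> + 1"
  show thesis
  \<comment> \<open>For t up to this value the map moves every point of the ball \<open>?K\<close>
    to within 1/2 of (1, 0), hence into \<open>?K\<close>.\<close>
  proof (rule that[of "1 / (2 * B)"])
    show "0 < 1 / (2 * B)" by (simp add: B_def add_nonneg_pos)
    fix t assume t: "0 \<le> t" "t \<le> 1 / (2 * B)"
    define \<Phi> where "\<Phi> p = (1 + t * f p, t * g p)" for p
    have "\<Phi> ` ?K \<subseteq> ?K"
    proof
      fix q assume "q \<in> \<Phi> ` ?K"
      then obtain p where p: "p \<in> ?K" "q = \<Phi> p" by blast
      have "dist (1, 0) q = norm (t * f p, t * g p)"
        unfolding p(2) \<Phi>_def dist_norm by (simp add: norm_Pair)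
      also have "\<dots> \<le> norm (t * f p) + norm (t * g p)" by (rule norm_Pair_le)
      also have "\<dots> = t * (\<bar>f p\<bar> + \<bar>g p\<bar>)" using t by (simp add: abs_mult distrib_left)
      also have "\<dots> \<le> 1 / (2 * B) * B"
        using t Bf[OF p(1)] Bg[OF p(1)] by (intro mult_mono) (auto simp: B_def)
      also have "\<dots> = 1 / 2" by (simp add: B_def add_nonneg_eq_0_iff)
      finally show "q \<in> ?K" by simp
    qed
    moreover have "continuous_on ?K \<Phi>" unfolding \<Phi>_def by (intro continuous_intros cf cg)
    moreover have "?K \<noteq> {}" by simp
    \<comment> \<open>A solution for each t separately, possibly jumping with t. This is enough: it
      will be recognised as \<open>planar_R\<close> and \<open>planar_S\<close> of the potential,
      which are functions of t.\<close>
    ultimately obtain p where p: "p \<in> ?K" "\<Phi> p = p"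
      using brouwer[OF compact_cball convex_cball, where f = \<Phi>] by blast
    have "\<bar>fst p - 1\<bar> \<le> 1 / 2" "\<bar>snd p\<bar> \<le> 1 / 2"
      using p(1) dist_fst_le[of "(1, 0)" p] dist_snd_le[of "(1, 0)" p] by (auto simp: dist_real_def abs_minus_commute)
    moreover have "fst p = 1 + t * f p" "snd p = t * g p" using p(2) by (auto simp: \<Phi>_def prod_eq_iff)
    ultimately show "\<exists>R S. \<bar>R - 1\<bar> \<le> 1 / 2 \<and> \<bar>S\<bar> \<le> 1 / 2 \<and>
     R = 1 + t * (\<Sum>i<m. a i * sys_R i R S) \<and> S = t * (\<Sum>i<m. a i * sys_S i R S)"
      unfolding f_def g_def by blast
  qed
qed

text \<open>C bounds the second derivative of the perturbation from above on the whole line, so V''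
  \<ge> 1 - t |C|, which stays above 1/2 for small t. Each t then falls under
  \<open>equilibrium_polynomial\<close>, with bounds uniform in t; the supporting line of the
  minimal energy becomes one of \<open>planar_F\<close> from below.\<close>

lemma planar_ray:
  fixes a :: "nat \<Rightarrow> real"
  assumes supp: "\<And>i. m \<le> i \<Longrightarrow> a i = 0"
    and bound: "\<And>x. (\<Sum>i<m. a i * (real i * x ^ (i - 1))) \<le> C"
  obtains t\<^sub>0 mom where "0 < t\<^sub>0"
    "\<And>t. 0 \<le> t \<Longrightarrow> t \<le> t\<^sub>0 \<Longrightarrow> (\<lambda>i. t * a i) \<in> one_cut_seqs"
    "\<And>t. 0 \<le> t \<Longrightarrow> t \<le> t\<^sub>0 \<Longrightarrow> \<bar>planar_R (\<lambda>i. t * a i)\<bar> \<le> 2 \<and> \<bar>planar_S (\<lambda>i. t * a i)\<bar> \<le> 1"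
    "\<And>t. 0 \<le> t \<Longrightarrow> t \<le> t\<^sub>0 \<Longrightarrow> planar_R (\<lambda>i. t * a i) =
       1 + t * (\<Sum>i<m. a i * sys_R i (planar_R (\<lambda>i. t * a i)) (planar_S (\<lambda>i. t * a i)))"
    "\<And>t. 0 \<le> t \<Longrightarrow> t \<le> t\<^sub>0 \<Longrightarrow> planar_S (\<lambda>i. t * a i) =
       t * (\<Sum>i<m. a i * sys_S i (planar_R (\<lambda>i. t * a i)) (planar_S (\<lambda>i. t * a i)))"
    "\<And>t. 0 \<le> t \<Longrightarrow> t \<le> t\<^sub>0 \<Longrightarrow> mom t 0 = 1"
    "\<And>t k. 0 \<le> t \<Longrightarrow> t \<le> t\<^sub>0 \<Longrightarrow> \<bar>mom t k\<bar> \<le> 4 ^ k"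
    "\<And>t n. 0 \<le> t \<Longrightarrow> t \<le> t\<^sub>0 \<Longrightarrow> mom t (Suc n) =
       (\<Sum>k<n. mom t k * mom t (n - 1 - k)) + t * (\<Sum>i<m. a i * mom t (n + i))"
    "\<And>t t'. 0 \<le> t \<Longrightarrow> t \<le> t\<^sub>0 \<Longrightarrow> 0 \<le> t' \<Longrightarrow> t' \<le> t\<^sub>0 \<Longrightarrow>
       (t' - t) * (\<Sum>i<m. a i * mom t (Suc i) / real (Suc i)) \<le> planar_F (\<lambda>i. t' * a i) - planar_F (\<lambda>i. t * a i)"
    "planar_F (\<lambda>i. 0) = 0"
proof -
  obtain t\<^sub>1 where t\<^sub>1: "0 < t\<^sub>1" "\<And>t. 0 \<le> t \<Longrightarrow> t \<le> t\<^sub>1 \<Longrightarrow> \<exists>R S. \<bar>R - 1\<bar> \<le> 1 / 2 \<and> \<bar>S\<bar> \<le> 1 / 2 \<and>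
     R = 1 + t * (\<Sum>i<m. a i * sys_R i R S) \<and> S = t * (\<Sum>i<m. a i * sys_S i R S)"
    using small_solution[where m = m and a = a] by blast
  \<comment> \<open>The second entry makes t |C| at most 1/2, the first keeps t in the range of
    \<open>small_solution\<close>.\<close>
  define t\<^sub>0 where "t\<^sub>0 = min t\<^sub>1 (1 / (2 * (\<bar>C\<bar> + 1)))"
  have t\<^sub>0: "0 < t\<^sub>0" "t\<^sub>0 \<le> t\<^sub>1" "t\<^sub>0 \<le> 1 / (2 * (\<bar>C\<bar> + 1))" using t\<^sub>1(1) by (auto simp: t\<^sub>0_def)
  have conv: "1 / 2 \<le> pot'' m (\<lambda>i. t * a i) x" if t: "0 \<le> t" "t \<le> t\<^sub>0" for t x
  proof -
    have "t * (\<Sum>i<m. a i * (real i * x ^ (i - 1))) \<le> t * \<bar>C\<bar>"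
      using bound[of x] t by (intro mult_left_mono) auto
    also have "\<dots> \<le> 1 / (2 * (\<bar>C\<bar> + 1)) * \<bar>C\<bar>" using t t\<^sub>0 by (intro mult_right_mono) auto
    also have "\<dots> \<le> 1 / 2" by (simp add: divide_le_eq)
    finally show ?thesis by (simp add: pot''_def sum_distrib_left mult.assoc)
  qed
  \<comment> \<open>All statements about one t, bundled so that a single choice of moments serves
    them simultaneously.\<close>
  define P where "P t M \<longleftrightarrow> (\<lambda>i. t * a i) \<in> one_cut_seqs \<and>
    \<bar>planar_R (\<lambda>i. t * a i)\<bar> \<le> 2 \<and> \<bar>planar_S (\<lambda>i. t * a i)\<bar> \<le> 1 \<and>
    planar_R (\<lambda>i. t * a i) = 1 + t * (\<Sum>i<m. a i * sys_R i (planar_R (\<lambda>i. t * a i)) (planar_S (\<lambda>i. t * a i))) \<and>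
    planar_S (\<lambda>i. t * a i) = t * (\<Sum>i<m. a i * sys_S i (planar_R (\<lambda>i. t * a i)) (planar_S (\<lambda>i. t * a i))) \<and>
    M 0 = 1 \<and> (\<forall>k. \<bar>M k\<bar> \<le> 4 ^ k) \<and>
    (\<forall>n. M (Suc n) = (\<Sum>k<n. M k * M (n - 1 - k)) + t * (\<Sum>i<m. a i * M (n + i))) \<and>
    min_energy (potential (\<lambda>i. t * a i)) = ereal (3 / 4 - planar_F (\<lambda>i. t * a i)) \<and>
    (\<forall>t'. min_energy (potential (\<lambda>i. t' * a i)) \<le> min_energy (potential (\<lambda>i. t * a i)) +
        ereal (- ((t' - t) * (\<Sum>i<m. a i * M (Suc i) / real (Suc i))))) \<and>
    (t = 0 \<longrightarrow> planar_F (\<lambda>i. t * a i) = 0)" for t and M :: "nat \<Rightarrow> real"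
  have "\<exists>M. P t M" if t: "0 \<le> t" "t \<le> t\<^sub>0" for t
  proof -
    obtain R S where RS: "\<bar>R - 1\<bar> \<le> 1 / 2" "\<bar>S\<bar> \<le> 1 / 2"
      "R = 1 + t * (\<Sum>i<m. a i * sys_R i R S)" "S = t * (\<Sum>i<m. a i * sys_S i R S)"
      using t\<^sub>1(2)[of t] t t\<^sub>0 by auto
    have R: "1 / 2 \<le> R" "R \<le> 3 / 2" using RS(1) unfolding abs_le_iff by linarith+
    have eqs: "R = 1 + (\<Sum>i<m. t * a i * sys_R i R S)" "S = (\<Sum>i<m. t * a i * sys_S i R S)"
      using RS(3,4) by (simp_all only: sum_distrib_left mult.assoc)
    have supp': "m \<le> i \<Longrightarrow> t * a i = 0" for i t using supp by simp
    have "0 < R" using R by simp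
    from equilibrium_polynomial[OF supp' conv[OF t] this eqs]
    obtain M where M: "(\<lambda>i. t * a i) \<in> one_cut_seqs" "planar_R (\<lambda>i. t * a i) = R" "planar_S (\<lambda>i. t * a i) = S" "M 0 = 1"
      "\<And>k. \<bar>M k\<bar> \<le> (\<bar>S\<bar> + 2 * sqrt R) ^ k"
      "\<And>n. M (Suc n) = (\<Sum>k<n. M k * M (n - 1 - k)) + (\<Sum>i<m. t * a i * M (n + i))"
      "min_energy (potential (\<lambda>i. t * a i)) = ereal (3 / 4 - planar_F (\<lambda>i. t * a i))"
      "planar_F (\<lambda>i. t * a i) = 3 / 4 - ((M 2 / 2 - (\<Sum>i<m. t * a i * M (Suc i) / real (Suc i))) / 2 +
         circle_mean (\<lambda>\<theta>. pot m (\<lambda>i. t * a i) (S + sqrt R * (2 * cos \<theta>))) / 2 - ln (sqrt R))"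
      "\<And>a'. (\<And>i. m \<le> i \<Longrightarrow> a' i = 0) \<Longrightarrow>
        min_energy (potential a') \<le> min_energy (potential (\<lambda>i. t * a i)) + ereal (- (\<Sum>i<m. (a' i - t * a i) * M (Suc i) / real (Suc i)))"
      by blast
    \<comment> \<open>The support lies within |S| + 2 sqrt R \<le> 1/2 + 3 of the origin, whence the
      bound 4^k, uniform in t.\<close>
    have "sqrt R \<le> 3 / 2" using R by (intro real_le_lsqrt) (auto simp: power2_eq_square)
    then have "(\<bar>S\<bar> + 2 * sqrt R) ^ k \<le> 4 ^ k" for k using RS(2) R by (intro power_mono) auto
    then have bd: "\<bar>M k\<bar> \<le> 4 ^ k" for k using M(5)[of k] order_trans by blast
    \<comment> \<open>At t = 0 the potential is x^2/2, and the energy is half of the mean 1/2 under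
      the equilibrium measure plus half of the arcsine mean 1, that is 3/4: the constant in the
      definition of \<open>planar_F\<close>.\<close>
    have zero: "planar_F (\<lambda>i. t * a i) = 0" if "t = 0"
    proof -
      have RS0: "R = 1" "S = 0" using RS(3,4) that by auto
      have "M 2 = 1" using M(6)[of 1] M(4) that by (simp add: numeral_2_eq_2)
      moreover have "circle_mean (\<lambda>\<theta>. pot m (\<lambda>i. t * a i) (S + sqrt R * (2 * cos \<theta>))) = circle_mean (\<lambda>\<theta>. (2 * cos \<theta>) ^ 2) / 2"
        using that by (simp add: RS0 pot_def)
      moreover have "circle_mean (\<lambda>\<theta>. (2 * cos \<theta>) ^ 2) = 2"
        unfolding circle_mean_2cos_power by (simp add: numeral_2_eq_2)
      ultimately show ?thesis unfolding M(8) using that by (simp add: RS0)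
    qed
    have env: "min_energy (potential (\<lambda>i. t' * a i)) \<le> min_energy (potential (\<lambda>i. t * a i)) +
        ereal (- ((t' - t) * (\<Sum>i<m. a i * M (Suc i) / real (Suc i))))" for t'
    proof -
      have "(\<Sum>i<m. (t' * a i - t * a i) * M (Suc i) / real (Suc i)) = (t' - t) * (\<Sum>i<m. a i * M (Suc i) / real (Suc i))"
        unfolding sum_distrib_left by (intro sum.cong refl) (simp add: left_diff_distrib diff_divide_distrib)
      then show ?thesis using M(9)[of "\<lambda>i. t' * a i"] supp' by simp
    qed
    have "P t M" unfolding P_def
      using M(1,4,7) RS bd zero env M(6) R
      by (auto simp: M(2,3) sum_distrib_left mult.assoc simp del: of_nat_Suc)
    then show ?thesis by blast
  qed
  then have "\<forall>t. \<exists>M. 0 \<le> t \<and> t \<le> t\<^sub>0 \<longrightarrow> P t M" by blast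
  then obtain mom where mom: "\<And>t. 0 \<le> t \<Longrightarrow> t \<le> t\<^sub>0 \<Longrightarrow> P t (mom t)" unfolding choice_iff by blast
  note mom1 = mom[unfolded P_def]
  note mom2 = mom1[THEN conjunct2]
  note mom3 = mom2[THEN conjunct2]
  note mom4 = mom3[THEN conjunct2]
  note mom5 = mom4[THEN conjunct2]
  note mom6 = mom5[THEN conjunct2]
  note mom7 = mom6[THEN conjunct2]
  note mom8 = mom7[THEN conjunct2]
  note mom9 = mom8[THEN conjunct2]
  note mom10 = mom9[THEN conjunct2]
  note mom11 = mom10[THEN conjunct2]
  have "planar_F (\<lambda>i. 0 * a i) = 0" using mom11[of 0] t\<^sub>0(1) by simp
  then have zero: "planar_F (\<lambda>i. 0) = 0" by simp
  have env: "(t' - t) * (\<Sum>i<m. a i * mom t (Suc i) / real (Suc i)) \<le> planar_F (\<lambda>i. t' * a i) - planar_F (\<lambda>i. t * a i)"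
    if t: "0 \<le> t" "t \<le> t\<^sub>0" and t': "0 \<le> t'" "t' \<le> t\<^sub>0" for t t'
  proof -
    have "ereal (3 / 4 - planar_F (\<lambda>i. t' * a i)) \<le> ereal (3 / 4 - planar_F (\<lambda>i. t * a i)) +
        ereal (- ((t' - t) * (\<Sum>i<m. a i * mom t (Suc i) / real (Suc i))))"
      using mom10[OF t, THEN conjunct1, THEN spec, of t'] unfolding mom9[OF t, THEN conjunct1] mom9[OF t', THEN conjunct1] .
    then show ?thesis by (simp del: of_nat_Suc)
  qed
  show thesis
    by (rule that[OF t\<^sub>0(1) mom1[THEN conjunct1] conjI[OF mom2[THEN conjunct1] mom3[THEN conjunct1]]
      mom4[THEN conjunct1] mom5[THEN conjunct1] mom6[THEN conjunct1] mom7[THEN conjunct1, THEN spec]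
      mom8[THEN conjunct1, THEN spec] env zero])
qed

section \<open>Expansions along rays\<close>

text \<open>\<open>expands K \<phi> f\<close>: the first \<open>K\<close> terms of \<open>f\<close> are an asymptotic expansion of \<open>\<phi>\<close> as
  $t \downarrow 0$, with error $O(t^K)$.\<close>

primrec expands :: "nat \<Rightarrow> (real \<Rightarrow> complex) \<Rightarrow> complex fps \<Rightarrow> bool" where
  "expands 0 \<phi> f \<longleftrightarrow> (\<exists>B. \<forall>\<^sub>F t in at_right 0. cmod (\<phi> t) \<le> B)"
| "expands (Suc K) \<phi> f \<longleftrightarrow> (\<exists>\<psi>. (\<forall>\<^sub>F t in at_right 0. \<phi> t = fps_nth f 0 + of_real t * \<psi> t) \<and> expands K \<psi> (fps_shift 1 f))"

lemma expands_cong: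
  assumes "expands K \<phi> f" "\<forall>\<^sub>F t in at_right 0. \<phi> t = \<psi> t"
  shows "expands K \<psi> f"
proof (cases K)
  case 0
  then obtain B where "\<forall>\<^sub>F t in at_right 0. cmod (\<phi> t) \<le> B" using assms(1) by auto
  with assms(2) have "\<forall>\<^sub>F t in at_right 0. cmod (\<psi> t) \<le> B" by eventually_elim simp
  then show ?thesis using 0 by auto
next
  case (Suc K')
  then obtain \<omega> where \<omega>: "\<forall>\<^sub>F t in at_right 0. \<phi> t = fps_nth f 0 + of_real t * \<omega> t" "expands K' \<omega> (fps_shift 1 f)"
    using assms(1) by auto
  from \<omega>(1) assms(2) have "\<forall>\<^sub>F t in at_right 0. \<psi> t = fps_nth f 0 + of_real t * \<omega> t" by eventually_elim simp
  then show ?thesis using Suc \<omega>(2) by auto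
qed

lemma expands_0: "expands K (\<lambda>_. 0) 0"
  by (induction K) (auto intro!: exI[of _ "\<lambda>_. 0"] exI[of _ 0])

lemma expands_const: "expands K (\<lambda>_. c) (fps_const c)"
proof (cases K)
  case (Suc K')
  have "fps_shift 1 (fps_const c) = 0" by (rule fps_ext) simp
  then show ?thesis using Suc expands_0 by (auto intro!: exI[of _ "\<lambda>_. 0"])
qed auto

lemma expands_add:
  assumes "expands K \<phi> f" "expands K \<psi> g"
  shows "expands K (\<lambda>t. \<phi> t + \<psi> t) (f + g)"
  using assms
proof (induction K arbitrary: \<phi> \<psi> f g)
  case 0
  then obtain B C where "\<forall>\<^sub>F t in at_right 0. cmod (\<phi> t) \<le> B" "\<forall>\<^sub>F t in at_right 0. cmod (\<psi> t) \<le> C" by auto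
  then have "\<forall>\<^sub>F t in at_right 0. cmod (\<phi> t + \<psi> t) \<le> B + C"
    by eventually_elim (rule norm_triangle_mono)
  then show ?case by auto
next
  case (Suc K)
  then obtain \<phi>' \<psi>' where *: "\<forall>\<^sub>F t in at_right 0. \<phi> t = fps_nth f 0 + of_real t * \<phi>' t" "expands K \<phi>' (fps_shift 1 f)"
    "\<forall>\<^sub>F t in at_right 0. \<psi> t = fps_nth g 0 + of_real t * \<psi>' t" "expands K \<psi>' (fps_shift 1 g)" by auto
  from *(1,3) have "\<forall>\<^sub>F t in at_right 0. \<phi> t + \<psi> t = fps_nth (f + g) 0 + of_real t * (\<phi>' t + \<psi>' t)"
    by eventually_elim (simp add: distrib_left)
  moreover have "expands K (\<lambda>t. \<phi>' t + \<psi>' t) (fps_shift 1 (f + g))"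
    unfolding fps_shift_add by (rule Suc.IH[OF *(2,4)])
  ultimately show ?case by auto
qed

lemma expands_sum:
  assumes "\<And>i. i \<in> A \<Longrightarrow> expands K (\<phi> i) (f i)"
  shows "expands K (\<lambda>t. \<Sum>i\<in>A. \<phi> i t) (\<Sum>i\<in>A. f i)"
  using assms by (induction A rule: infinite_finite_induct) (auto simp: expands_0 expands_add)

lemma expands_Suc_imp:
  assumes "expands (Suc K) \<phi> f"
  shows "expands K \<phi> f"
  using assms
proof (induction K arbitrary: \<phi> f)
  case 0
  then obtain \<psi> B where *: "\<forall>\<^sub>F t in at_right 0. \<phi> t = fps_nth f 0 + of_real t * \<psi> t"
    "\<forall>\<^sub>F t in at_right 0. cmod (\<psi> t) \<le> B" by auto
  have one: "0 < (1 :: real)" by simp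
  have "\<forall>\<^sub>F t in at_right 0. cmod (\<phi> t) \<le> cmod (fps_nth f 0) + B"
    using * eventually_at_right_real[OF one]
  proof eventually_elim
    case (elim t)
    have "cmod (of_real t * \<psi> t) \<le> cmod (\<psi> t)" using elim by (simp add: norm_mult mult_left_le_one_le)
    then show ?case unfolding elim(1) using elim(2) norm_triangle_ineq[of "fps_nth f 0" "of_real t * \<psi> t"] by linarith
  qed
  then show ?case by auto
next
  case (Suc K)
  then obtain \<psi> where *: "\<forall>\<^sub>F t in at_right 0. \<phi> t = fps_nth f 0 + of_real t * \<psi> t"
    "expands (Suc K) \<psi> (fps_shift 1 f)" by (subst (asm) expands.simps(2)[of "Suc K"]) blast
  show ?case unfolding expands.simps(2)[of K] using *(1) Suc.IH[OF *(2)] by blast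
qed

lemma expands_imp_bounded: "expands K \<phi> f \<Longrightarrow> \<exists>B. \<forall>\<^sub>F t in at_right 0. cmod (\<phi> t) \<le> B"
  by (induction K) (auto dest: expands_Suc_imp simp del: expands.simps(2))

lemma expands_mult:
  assumes "expands K \<phi> f" "expands K \<psi> g"
  shows "expands K (\<lambda>t. \<phi> t * \<psi> t) (f * g)"
  using assms
proof (induction K arbitrary: \<phi> \<psi> f g)
  case 0
  then obtain B C where "\<forall>\<^sub>F t in at_right 0. cmod (\<phi> t) \<le> B" "\<forall>\<^sub>F t in at_right 0. cmod (\<psi> t) \<le> C" by auto
  then have "\<forall>\<^sub>F t in at_right 0. cmod (\<phi> t * \<psi> t) \<le> B * C"
    by eventually_elim (simp add: norm_mult mult_mono')
  then show ?case by auto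
next
  case (Suc K)
  obtain \<phi>' where \<phi>': "\<forall>\<^sub>F t in at_right 0. \<phi> t = fps_nth f 0 + of_real t * \<phi>' t" "expands K \<phi>' (fps_shift 1 f)"
    using Suc.prems(1) by auto
  obtain \<psi>' where \<psi>': "\<forall>\<^sub>F t in at_right 0. \<psi> t = fps_nth g 0 + of_real t * \<psi>' t" "expands K \<psi>' (fps_shift 1 g)"
    using Suc.prems(2) by auto
  from \<phi>'(1) \<psi>'(1) have "\<forall>\<^sub>F t in at_right 0. \<phi> t * \<psi> t = fps_nth (f * g) 0 + of_real t * (fps_nth f 0 * \<psi>' t + \<phi>' t * \<psi> t)"
    by eventually_elim (simp add: algebra_simps)
  moreover have "fps_shift 1 (f * g) = fps_const (fps_nth f 0) * fps_shift 1 g + fps_shift 1 f * g"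
  proof -
    have f: "f = fps_const (fps_nth f 0) + fps_X * fps_shift 1 f" by (rule fps_ext) auto
    have "fps_shift 1 (f * g) = fps_shift 1 (fps_const (fps_nth f 0) * g + fps_X * (fps_shift 1 f * g))"
      by (subst f) (simp add: distrib_right mult.assoc)
    also have "\<dots> = fps_const (fps_nth f 0) * fps_shift 1 g + fps_shift 1 f * g"
      by (rule fps_ext) (simp add: fps_shift_add)
    finally show ?thesis .
  qed
  moreover have "expands K (\<lambda>t. fps_nth f 0 * \<psi>' t + \<phi>' t * \<psi> t)
      (fps_const (fps_nth f 0) * fps_shift 1 g + fps_shift 1 f * g)"
    by (intro expands_add Suc.IH expands_const \<phi>'(2) \<psi>'(2) expands_Suc_imp[OF Suc.prems(2)])
  ultimately show ?case by (auto intro!: exI[of _ "\<lambda>t. fps_nth f 0 * \<psi>' t + \<phi>' t * \<psi> t"])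
qed

lemma expands_power: "expands K \<phi> f \<Longrightarrow> expands K (\<lambda>t. \<phi> t ^ n) (f ^ n)"
  using expands_const[of K 1] by (induction n) (auto intro: expands_mult)

lemma expands_of_nat: "expands K (\<lambda>t. of_nat n) (of_nat n)"
  using expands_const[of K "of_nat n"] by (simp add: fps_of_nat)

lemma expands_X_mult: "expands K \<phi> f \<Longrightarrow> expands (Suc K) (\<lambda>t. of_real t * \<phi> t) (fps_X * f)"
proof -
  assume "expands K \<phi> f"
  moreover have "fps_shift 1 (fps_X * f) = f" by (rule fps_ext) simp
  ultimately show ?thesis by (auto intro!: exI[of _ \<phi>])
qed

lemma expands_tendsto:
  assumes "expands (Suc K) \<phi> f"
  shows "(\<phi> \<longlongrightarrow> fps_nth f 0) (at_right 0)"
proof -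
  obtain \<psi> B where *: "\<forall>\<^sub>F t in at_right 0. \<phi> t = fps_nth f 0 + of_real t * \<psi> t"
    "\<forall>\<^sub>F t in at_right 0. cmod (\<psi> t) \<le> B" using assms expands_imp_bounded by (auto, blast)
  have "((\<lambda>t. of_real t * \<psi> t) \<longlongrightarrow> 0) (at_right 0)"
  proof (rule Lim_null_comparison)
    show "\<forall>\<^sub>F t in at_right 0. cmod (of_real t * \<psi> t) \<le> t * B"
      using *(2) eventually_at_right_less[of 0] by eventually_elim (simp add: norm_mult mult_left_mono)
    show "((\<lambda>t. t * B) \<longlongrightarrow> 0) (at_right 0)" by (auto intro!: tendsto_eq_intros)
  qed
  then have "((\<lambda>t. fps_nth f 0 + of_real t * \<psi> t) \<longlongrightarrow> fps_nth f 0) (at_right 0)"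
    by (auto intro: tendsto_eq_intros)
  then show ?thesis by (rule Lim_transform_eventually) (use *(1) in eventually_elim, simp)
qed

text \<open>The limit at 0 is the constant term. Subtracting it and dividing by t lowers the order
  by one, and the two quotients agree for small t > 0.\<close>

lemma expands_unique:
  assumes "\<And>K. expands K \<phi> f" "\<And>K. expands K \<phi> g"
  shows "f = g"
proof (rule fps_ext)
  fix n
  note lim = expands_tendsto
  have "expands (Suc n) \<phi> f \<Longrightarrow> expands (Suc n) \<phi> g \<Longrightarrow> fps_nth f n = fps_nth g n" for \<phi> f g
  proof (induction n arbitrary: \<phi> f g)
    case 0
    show ?case by (rule tendsto_unique[OF _ lim[OF 0(1)] lim[OF 0(2)]]) simp
  next
    case (Suc n)
    have eq0: "fps_nth f 0 = fps_nth g 0" by (rule tendsto_unique[OF _ lim[OF Suc.prems(1)] lim[OF Suc.prems(2)]]) simp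
    obtain \<psi> where \<psi>: "\<forall>\<^sub>F t in at_right 0. \<phi> t = fps_nth f 0 + of_real t * \<psi> t" "expands (Suc n) \<psi> (fps_shift 1 f)"
      using Suc.prems(1) by (subst (asm) expands.simps(2)[of "Suc n"]) blast
    obtain \<omega> where \<omega>: "\<forall>\<^sub>F t in at_right 0. \<phi> t = fps_nth g 0 + of_real t * \<omega> t" "expands (Suc n) \<omega> (fps_shift 1 g)"
      using Suc.prems(2) by (subst (asm) expands.simps(2)[of "Suc n"]) blast
    have "\<forall>\<^sub>F t in at_right 0. \<omega> t = \<psi> t"
      using \<psi>(1) \<omega>(1) eventually_at_right_less[of 0] by eventually_elim (simp add: eq0)
    from Suc.IH[OF \<psi>(2) expands_cong[OF \<omega>(2) this]] show ?case by simp
  qed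
  from this[OF assms] show "fps_nth f n = fps_nth g n" .
qed

lemma expands_sums:
  assumes "0 < \<epsilon>" "\<And>t. 0 < t \<Longrightarrow> t < \<epsilon> \<Longrightarrow> (\<lambda>k. fps_nth f k * of_real t ^ k) sums \<phi> t"
  shows "expands K \<phi> f"
  using assms(2)
proof (induction K arbitrary: \<phi> f)
  case 0
  \<comment> \<open>Strictly inside \<epsilon>/2, where the series converges: absolute convergence
    at r bounds the sum uniformly for 0 < t < r.\<close>
  define r where "r = \<epsilon> / 3"
  have r: "0 < r" using assms(1) by (simp add: r_def)
  have "summable (\<lambda>k. fps_nth f k * (of_real (\<epsilon> / 2)) ^ k)" using 0[of "\<epsilon> / 2"] assms(1) sums_summable by auto
  then have s: "summable (\<lambda>k. cmod (fps_nth f k * of_real r ^ k))"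
    by (rule powser_insidea) (use assms(1) in \<open>simp add: r_def\<close>)
  have "\<forall>\<^sub>F t in at_right 0. cmod (\<phi> t) \<le> (\<Sum>k. cmod (fps_nth f k * of_real r ^ k))"
    using eventually_at_right_real[OF r]
  proof (eventually_elim)
    case (elim t)
    have le: "cmod (fps_nth f k * of_real t ^ k) \<le> cmod (fps_nth f k * of_real r ^ k)" for k
      using elim by (simp add: norm_mult norm_power mult_left_mono power_mono)
    have st: "summable (\<lambda>k. cmod (fps_nth f k * of_real t ^ k))"
      by (rule summable_comparison_test'[OF s, of 0]) (use le in simp)
    have "\<phi> t = (\<Sum>k. fps_nth f k * of_real t ^ k)"
      by (rule sums_unique, rule 0) (use elim assms(1) in \<open>auto simp: r_def\<close>)
    then have "cmod (\<phi> t) \<le> (\<Sum>k. cmod (fps_nth f k * of_real t ^ k))"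
      using summable_norm[OF st] by simp
    also have "\<dots> \<le> (\<Sum>k. cmod (fps_nth f k * of_real r ^ k))" by (rule suminf_le[OF le st s])
    finally show ?case .
  qed
  then show ?case by auto
next
  case (Suc K)
  define \<psi> where "\<psi> t = (\<phi> t - fps_nth f 0) / of_real t" for t
  have "expands K \<psi> (fps_shift 1 f)"
  proof (rule Suc.IH)
    fix t :: real assume t: "0 < t" "t < \<epsilon>"
    have "(\<lambda>k. fps_nth f (Suc k) * of_real t ^ Suc k) sums (\<phi> t - fps_nth f 0 * of_real t ^ 0)"
      using Suc.prems[OF t] by (subst sums_Suc_iff) simp
    then have *: "(\<lambda>k. fps_nth f (Suc k) * of_real t ^ Suc k / of_real t) sums ((\<phi> t - fps_nth f 0 * of_real t ^ 0) / of_real t)"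
      by (rule sums_divide)
    then show "(\<lambda>k. fps_nth (fps_shift 1 f) k * of_real t ^ k) sums \<psi> t" using * t by (simp add: \<psi>_def)
  qed
  moreover have "\<forall>\<^sub>F t in at_right 0. \<phi> t = fps_nth f 0 + of_real t * \<psi> t"
    using eventually_at_right_less[of 0] by eventually_elim (simp add: \<psi>_def)
  ultimately show ?case by auto
qed

section \<open>Choice of the rays and restriction of Taylor series to them\<close>

lemma power_sum_bounded_above:
  fixes a :: "nat \<Rightarrow> real"
  assumes m: "even m" "4 \<le> m" and neg: "a (m - 1) < 0"
  shows "\<exists>C. \<forall>x. (\<Sum>i<m. a i * (real i * x ^ (i - 1))) \<le> C"
proof -
  define B where "B = (\<Sum>i<m - 1. \<bar>a i\<bar> * real i)"
  define k where "k = - a (m - 1) * real (m - 1)"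
  have k: "0 < k" unfolding k_def by (rule mult_pos_pos) (use m neg in auto)
  \<comment> \<open>Beyond \<open>X\<close> the leading term -k x^(m-2), of even degree, outweighs
    the others, whose degrees are at most m - 3. Inside, the sum is bounded term by term.\<close>
  define X where "X = max 1 (B / k)"
  have mm: "m = Suc (m - 1)" using m by simp
  have large: "(\<Sum>i<m. a i * (real i * x ^ (i - 1))) \<le> 0" if x: "X \<le> \<bar>x\<bar>" for x
  proof -
    have x1: "1 \<le> \<bar>x\<bar>" and xk: "B \<le> k * \<bar>x\<bar>" using x k by (simp_all add: X_def divide_le_eq mult.commute)
    have "(\<Sum>i<m - 1. a i * (real i * x ^ (i - 1))) \<le> (\<Sum>i<m - 1. \<bar>a i\<bar> * real i * \<bar>x\<bar> ^ (m - 3))"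
    proof (rule sum_mono)
      fix i assume i: "i \<in> {..<m - 1}"
      have "a i * (real i * x ^ (i - 1)) \<le> \<bar>a i * (real i * x ^ (i - 1))\<bar>" by (rule abs_ge_self)
      also have "\<dots> = \<bar>a i\<bar> * real i * \<bar>x\<bar> ^ (i - 1)" by (simp add: abs_mult power_abs)
      also have "\<dots> \<le> \<bar>a i\<bar> * real i * \<bar>x\<bar> ^ (m - 3)"
        using x1 i by (intro mult_left_mono power_increasing) auto
      finally show "a i * (real i * x ^ (i - 1)) \<le> \<bar>a i\<bar> * real i * \<bar>x\<bar> ^ (m - 3)" .
    qed
    also have "\<dots> = B * \<bar>x\<bar> ^ (m - 3)" by (simp add: B_def sum_distrib_right)
    also have "\<dots> \<le> k * \<bar>x\<bar> * \<bar>x\<bar> ^ (m - 3)" by (intro mult_right_mono xk) simp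
    also have "\<dots> = k * x ^ (m - 2)"
    proof -
      have "m - 2 = Suc (m - 3)" using m by simp
      then have "\<bar>x\<bar> * \<bar>x\<bar> ^ (m - 3) = \<bar>x\<bar> ^ (m - 2)" by (simp only: power_Suc)
      also have "\<dots> = x ^ (m - 2)" by (rule power_even_abs) (use m in simp)
      finally show ?thesis by (simp only: mult.assoc)
    qed
    finally have "(\<Sum>i<m - 1. a i * (real i * x ^ (i - 1))) + a (m - 1) * (real (m - 1) * x ^ (m - 2)) \<le> 0"
      by (simp add: k_def mult.assoc)
    moreover have "m - 1 - 1 = m - 2" by simp
    ultimately show ?thesis by (subst mm, subst sum.lessThan_Suc) (simp only:)
  qed
  have small: "(\<Sum>i<m. a i * (real i * x ^ (i - 1))) \<le> (\<Sum>i<m. \<bar>a i\<bar> * (real i * X ^ (i - 1)))" if x: "\<bar>x\<bar> \<le> X" for x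
  proof (rule sum_mono)
    fix i
    have "a i * (real i * x ^ (i - 1)) \<le> \<bar>a i * (real i * x ^ (i - 1))\<bar>" by (rule abs_ge_self)
    also have "\<dots> = \<bar>a i\<bar> * (real i * \<bar>x\<bar> ^ (i - 1))" by (simp add: abs_mult power_abs)
    also have "\<dots> \<le> \<bar>a i\<bar> * (real i * X ^ (i - 1))" by (intro mult_left_mono power_mono x) auto
    finally show "a i * (real i * x ^ (i - 1)) \<le> \<bar>a i\<bar> * (real i * X ^ (i - 1))" .
  qed
  have "0 \<le> (\<Sum>i<m. \<bar>a i\<bar> * (real i * X ^ (i - 1)))" by (intro sum_nonneg mult_nonneg_nonneg) (auto simp: X_def)
  then have "(\<Sum>i<m. a i * (real i * x ^ (i - 1))) \<le> (\<Sum>i<m. \<bar>a i\<bar> * (real i * X ^ (i - 1)))" for x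
    using large[of x] small[of x] by linarith
  then show ?thesis by blast
qed

lemma l1_finite_support:
  fixes h :: "nat \<Rightarrow> complex"
  assumes "\<And>i. m \<le> i \<Longrightarrow> h i = 0"
  shows "h \<in> l1_space r" "l1_norm r h = (\<Sum>i<m. cmod (h i) * r ^ Suc i)"
proof -
  have "(\<lambda>i. cmod (h i) * r ^ Suc i) sums (\<Sum>i<m. cmod (h i) * r ^ Suc i)"
    by (rule sums_finite) (use assms in auto)
  then show "h \<in> l1_space r" "l1_norm r h = (\<Sum>i<m. cmod (h i) * r ^ Suc i)"
    by (auto simp: l1_space_def l1_norm_def sums_iff simp del: power_Suc)
qed

lemma l1_norm_ray_small:
  assumes supp: "\<And>i. m \<le> i \<Longrightarrow> a i = 0" and "0 < r" "0 < \<rho>"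
  shows "\<exists>\<epsilon>>0. \<forall>t. \<bar>t\<bar> < \<epsilon> \<longrightarrow> l1_norm r (\<lambda>i. complex_of_real (t * a i)) < \<rho>"
proof -
  define A where "A = (\<Sum>i<m. \<bar>a i\<bar> * r ^ Suc i)"
  have A: "0 \<le> A" unfolding A_def by (intro sum_nonneg mult_nonneg_nonneg) (use assms in auto)
  show ?thesis
  proof (intro exI conjI allI impI)
    show "0 < \<rho> / (A + 1)" using A assms by simp
    fix t assume t: "\<bar>t\<bar> < \<rho> / (A + 1)"
    have "l1_norm r (\<lambda>i. complex_of_real (t * a i)) = \<bar>t\<bar> * A"
      by (subst l1_finite_support(2)[of m])
        (auto simp: supp A_def sum_distrib_left abs_mult norm_mult mult.assoc simp del: power_Suc)
    also have "\<dots> \<le> \<bar>t\<bar> * (A + 1)" by (intro mult_left_mono) auto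
    also have "\<dots> < \<rho>" using t A by (simp add: less_divide_eq)
    finally show "l1_norm r (\<lambda>i. complex_of_real (t * a i)) < \<rho>" .
  qed
qed

text \<open>Unconditional convergence allows the sum over monomials to be grouped by degree.
  Monomials containing a variable beyond the support of a vanish on the ray, so each group is a
  finite sum, equal to a coefficient of \<open>mps_ray\<close> times a power of t.\<close>

lemma taylor_series_ray:
  assumes c: "has_taylor_series r f (\<lambda>_. 0) c" and "0 < r" and supp: "\<And>i. m \<le> i \<Longrightarrow> a i = 0"
  obtains \<epsilon> where "0 < \<epsilon>" "\<And>t. \<bar>t\<bar> < \<epsilon> \<Longrightarrow>
    (\<lambda>k. fps_nth (mps_ray m (\<lambda>i. complex_of_real (a i)) c) k * of_real t ^ k) sums f (\<lambda>i. of_real (t * a i))"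
proof -
  obtain \<rho> where \<rho>: "0 < \<rho>" "\<And>h. h \<in> l1_space r \<Longrightarrow> l1_norm r h < \<rho> \<Longrightarrow>
      ((\<lambda>l. mps_coeff c l * (\<Prod>i\<in>#l. h i)) has_sum f h) UNIV"
    using c by (auto simp: has_taylor_series_def)
  obtain \<epsilon> where \<epsilon>: "0 < \<epsilon>" "\<And>t. \<bar>t\<bar> < \<epsilon> \<Longrightarrow> l1_norm r (\<lambda>i. complex_of_real (t * a i)) < \<rho>"
    using l1_norm_ray_small[where a = a and m = m, OF supp \<open>0 < r\<close> \<rho>(1)] by blast
  let ?z = "\<lambda>i. complex_of_real (a i)"
  show thesis
  proof (rule that[OF \<epsilon>(1)])
    fix t assume "\<bar>t\<bar> < \<epsilon>"
    define u where "u l = mps_coeff c l * (\<Prod>i\<in>#l. complex_of_real (t * a i))" for l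
    have "(u has_sum f (\<lambda>i. of_real (t * a i))) UNIV"
      unfolding u_def using \<rho>(2) l1_finite_support(1)[of m] \<epsilon>(2)[OF \<open>\<bar>t\<bar> < \<epsilon>\<close>] supp by simp
    also have "?this \<longleftrightarrow> ((\<lambda>(k, l). u l) has_sum f (\<lambda>i. of_real (t * a i))) (SIGMA k:UNIV. {l. size l = k})"
      by (rule has_sum_reindex_bij_witness[of _ snd "\<lambda>l. (size l, l)"]) auto
    finally have "((\<lambda>k. \<Sum>l\<in>msets_below m k. u l) has_sum f (\<lambda>i. of_real (t * a i))) UNIV"
    proof (rule has_sum_SigmaD)
      fix k :: nat
      have "(u has_sum (\<Sum>l\<in>msets_below m k. u l)) (msets_below m k)" by (rule has_sum_finite) simp
      then have "(u has_sum (\<Sum>l\<in>msets_below m k. u l)) {l. size l = k}"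
      proof (rule has_sum_cong_neutral[THEN iffD1, rotated -1])
        fix l assume "l \<in> {l. size l = k} - msets_below m k"
        then have "\<not> set_mset l \<subseteq> {..<m}" by (simp add: msets_below_def)
        then obtain i where i: "i \<in># l" "m \<le> i" by (meson lessThan_iff not_less subsetI)
        from i(2) have "0 = complex_of_real (t * a i)" by (simp add: supp)
        with i(1) have "(\<Prod>i\<in>#l. complex_of_real (t * a i)) = 0"
          unfolding prod_mset_zero_iff set_image_mset by (rule rev_image_eqI)
        then show "u l = 0" by (simp add: u_def)
      qed (auto simp: msets_below_def)
      then show "((\<lambda>l. (case (k, l) of (k, l) \<Rightarrow> u l)) has_sum (\<Sum>l\<in>msets_below m k. u l)) {l. size l = k}" by simp
    qed
    moreover have "(\<Sum>l\<in>msets_below m k. u l) = fps_nth (mps_ray m ?z c) k * of_real t ^ k" for k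
    proof -
      have "(\<Prod>i\<in>#l. complex_of_real (t * a i)) = of_real t ^ size l * (\<Prod>i\<in>#l. ?z i)" for l
        by (induction l) (auto simp: mult_ac)
      then show ?thesis unfolding mps_ray_nth sum_distrib_right u_def
        by (intro sum.cong refl) (auto simp: msets_below_def)
    qed
    ultimately show "(\<lambda>k. fps_nth (mps_ray m ?z c) k * of_real t ^ k) sums f (\<lambda>i. of_real (t * a i))"
      by (simp add: has_sum_imp_sums)
  qed
qed

text \<open>In each degree the equality on rays is the vanishing of a polynomial in finitely many
  variables, all of them arbitrary real except the last, which is negative; real and negative real
  numbers form infinite subsets of the complex field.\<close>

lemma mps_eq_by_rays:
  fixes c d :: "complex mps"
  assumes rays: "\<And>m a. even m \<Longrightarrow> 4 \<le> m \<Longrightarrow> (\<And>i. m \<le> i \<Longrightarrow> a i = 0) \<Longrightarrow> a (m - 1) < 0 \<Longrightarrow>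
      mps_ray m (\<lambda>i. complex_of_real (a i)) c = mps_ray m (\<lambda>i. complex_of_real (a i)) d"
  shows "c = d"
proof (rule mps_eqI)
  fix l :: "nat multiset"
  obtain b where b: "\<forall>i\<in>set_mset l. i < b" using finite_nat_set_iff_bounded[of "set_mset l"] by auto
  \<comment> \<open>Even, at least 4, and larger than every variable of the monomial l.\<close>
  define m where "m = 2 * b + 4"
  have m: "even m" "4 \<le> m" by (auto simp: m_def)
  define I where "I i = complex_of_real ` (if i = m - 1 then {..<0} else UNIV)" for i
  have "mps_coeff c l - mps_coeff d l = 0"
  proof (rule multiset_polynomial_eq_0[where S = "{..<m}" and A = "msets_below m (size l)" and I = I and
        d = "\<lambda>l. mps_coeff c l - mps_coeff d l"])
    show "infinite (I i)" for i
      unfolding I_def by (subst finite_image_iff) (auto simp: inj_on_def infinite_UNIV_char_0 infinite_Iio)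
    show "l \<in> msets_below m (size l)" using b by (force simp: msets_below_def m_def)
    fix x assume x: "\<forall>i\<in>{..<m}. x i \<in> I i"
    define a where "a i = (if i < m then Re (x i) else 0)" for i
    have xa: "x i = complex_of_real (a i)" if "i < m" for i
    proof -
      have "x i \<in> I i" using x that by simp
      then obtain y where "x i = complex_of_real y" unfolding I_def by blast
      then show ?thesis using that by (simp add: a_def)
    qed
    have "x (m - 1) \<in> I (m - 1)" using x m by simp
    then have "a (m - 1) < 0" using m by (auto simp: I_def a_def)
    with m have "fps_nth (mps_ray m (\<lambda>i. complex_of_real (a i)) c) (size l) = fps_nth (mps_ray m (\<lambda>i. complex_of_real (a i)) d) (size l)"
      using rays[of m a] by (simp add: a_def)
    then have "(\<Sum>l'\<in>msets_below m (size l). (mps_coeff c l' - mps_coeff d l') * (\<Prod>i\<in>#l'. complex_of_real (a i))) = 0"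
      unfolding mps_ray_nth left_diff_distrib sum_subtractf by (simp only: diff_self)
    moreover have "(\<Prod>i\<in>#l'. x i) = (\<Prod>i\<in>#l'. complex_of_real (a i))" if "l' \<in> msets_below m (size l)" for l'
    proof -
      have "image_mset x l' = image_mset (\<lambda>i. complex_of_real (a i)) l'"
      proof (rule image_mset_cong)
        fix i assume "i \<in># l'"
        then have "i < m" using that unfolding msets_below_def by blast
        then show "x i = complex_of_real (a i)" by (rule xa)
      qed
      then show ?thesis by (rule arg_cong)
    qed
    ultimately show "(\<Sum>l'\<in>msets_below m (size l). (mps_coeff c l' - mps_coeff d l') * (\<Prod>i\<in>#l'. x i)) = 0"
      by (simp only: cong: sum.cong)
  next
    show "set_mset l' \<subseteq> {..<m}" if "l' \<in> msets_below m (size l)" for l' using that by (simp add: msets_below_def)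
  qed simp_all
  then show "mps_coeff c l = mps_coeff d l" by simp
qed

section \<open>Comparison of formal and analytic expansions on a ray\<close>

lemma expands_sys:
  assumes "expands K \<phi> f" "expands K \<psi> g"
  shows "expands K (\<lambda>t. sys_R i (\<phi> t) (\<psi> t)) (sys_R i f g)" "expands K (\<lambda>t. sys_S i (\<phi> t) (\<psi> t)) (sys_S i f g)"
  unfolding sys_R_def sys_S_def by (intro expands_sum expands_mult expands_power expands_of_nat assms)+

lemma of_real_sys:
  "of_real (sys_R i R S) = sys_R i (of_real R) (of_real S :: complex)"
  "of_real (sys_S i R S) = sys_S i (of_real R) (of_real S :: complex)"
  by (simp_all add: sys_R_def sys_S_def)

lemma mps_map_of_rat_sys:
  "mps_map of_rat (sys_R i R S) = sys_R i (mps_map of_rat R) (mps_map of_rat S :: complex mps)"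
  "mps_map of_rat (sys_S i R S) = sys_S i (mps_map of_rat R) (mps_map of_rat S :: complex mps)"
  unfolding sys_R_def sys_S_def
  by (simp_all only: mps_map_of_rat_sum mps_map_of_rat_mult mps_map_of_rat_power mps_map_of_rat_of_nat)

lemma mps_ray_sys:
  "mps_ray m a (sys_R i R S) = sys_R i (mps_ray m a R) (mps_ray m a S)"
  "mps_ray m a (sys_S i R S) = sys_S i (mps_ray m a R) (mps_ray m a S)"
  unfolding sys_R_def sys_S_def
  by (simp_all only: mps_ray_sum mps_ray_mult mps_ray_power mps_ray_of_nat)

lemma formal_system_altdef:
  "formal_system R S \<longleftrightarrow> mps_coeff R {#} = 1 \<and> mps_coeff S {#} = 0 \<and>
     R = 1 + mps_suminf (\<lambda>i. mps_X i * sys_R i R S) \<and> S = mps_suminf (\<lambda>i. mps_X i * sys_S i R S)"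
proof -
  have R: "(let n = Suc i in mps_X i *
      (\<Sum>j = 1..n. of_nat ((n - 1 choose (j - 1)) * (n - j choose j)) * R ^ j * S ^ (n - 2 * j))) = mps_X i * sys_R i R S" for i
    unfolding Let_def sys_R_def diff_Suc_1 ..
  have s: "Suc i - 2 * j - 1 = i - 2 * j" for i j by presburger
  have S: "(let n = Suc i in mps_X i *
      (\<Sum>j = 0..n. of_nat ((n - 1 choose (2 * j)) * (2 * j choose j)) * R ^ j * S ^ (n - 2 * j - 1))) = mps_X i * sys_S i R S" for i
    unfolding Let_def sys_S_def diff_Suc_1 s ..
  show ?thesis unfolding formal_system_def R S ..
qed

text \<open>Extension of scalars and restriction to a ray respect products and the sums over
  variables, so the system descends to series in t.\<close>

lemma formal_system_ray:
  fixes z :: "nat \<Rightarrow> complex" and m :: nat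
  assumes "formal_system Rf Sf"
  defines "\<rho> \<equiv> mps_ray m z (mps_map of_rat Rf)" and "\<sigma> \<equiv> mps_ray m z (mps_map of_rat Sf)"
  shows "\<rho> = 1 + fps_X * (\<Sum>i<m. fps_const (z i) * sys_R i \<rho> \<sigma>)"
    and "\<sigma> = fps_X * (\<Sum>i<m. fps_const (z i) * sys_S i \<rho> \<sigma>)"
proof -
  note homs = mps_map_of_rat_add mps_map_of_rat_1 mps_map_of_rat_suminf mps_map_of_rat_mult
    mps_map_of_rat_X mps_map_of_rat_sys mps_ray_add mps_ray_1 mps_ray_suminf_X mps_ray_sys
  have "mps_ray m z (mps_map of_rat (1 + mps_suminf (\<lambda>i. mps_X i * sys_R i Rf Sf))) =
      1 + fps_X * (\<Sum>i<m. fps_const (z i) * sys_R i \<rho> \<sigma>)"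
    "mps_ray m z (mps_map of_rat (mps_suminf (\<lambda>i. mps_X i * sys_S i Rf Sf))) =
      fps_X * (\<Sum>i<m. fps_const (z i) * sys_S i \<rho> \<sigma>)"
    by (simp_all only: homs \<rho>_def \<sigma>_def)
  moreover have "Rf = 1 + mps_suminf (\<lambda>i. mps_X i * sys_R i Rf Sf)" "Sf = mps_suminf (\<lambda>i. mps_X i * sys_S i Rf Sf)"
    by (rule assms(1)[unfolded formal_system_altdef, THEN conjunct2, THEN conjunct2, THEN conjunct1],
        rule assms(1)[unfolded formal_system_altdef, THEN conjunct2, THEN conjunct2, THEN conjunct2])
  ultimately show "\<rho> = 1 + fps_X * (\<Sum>i<m. fps_const (z i) * sys_R i \<rho> \<sigma>)"
    "\<sigma> = fps_X * (\<Sum>i<m. fps_const (z i) * sys_S i \<rho> \<sigma>)"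
    unfolding \<rho>_def \<sigma>_def by metis+
qed

text \<open>Each pass through the fixed point equation gains one power of \<open>t\<close>.\<close>

lemma system_expands:
  assumes bounded: "\<forall>\<^sub>F t in at_right 0. cmod (R t) \<le> 2" "\<forall>\<^sub>F t in at_right 0. cmod (S t) \<le> 1"
    and eqR: "\<forall>\<^sub>F t in at_right 0. R t = 1 + of_real t * (\<Sum>i<m. z i * sys_R i (R t) (S t))"
    and eqS: "\<forall>\<^sub>F t in at_right 0. S t = of_real t * (\<Sum>i<m. z i * sys_S i (R t) (S t))"
    and \<rho>: "\<rho> = 1 + fps_X * (\<Sum>i<m. fps_const (z i) * sys_R i \<rho> \<sigma>)"
    and \<sigma>: "\<sigma> = fps_X * (\<Sum>i<m. fps_const (z i) * sys_S i \<rho> \<sigma>)"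
  shows "expands K R \<rho> \<and> expands K S \<sigma>"
proof (induction K)
  case 0
  show ?case unfolding expands.simps using bounded by blast
next
  case (Suc K)
  note IH = conjunct1[OF Suc] conjunct2[OF Suc]
  have "expands (Suc K) (\<lambda>t. 1 + of_real t * (\<Sum>i<m. z i * sys_R i (R t) (S t)))
      (fps_const 1 + fps_X * (\<Sum>i<m. fps_const (z i) * sys_R i \<rho> \<sigma>))"
    by (rule expands_add[OF expands_const expands_X_mult[OF expands_sum]], rule expands_mult[OF expands_const], rule expands_sys[OF IH])
  then have "expands (Suc K) (\<lambda>t. 1 + of_real t * (\<Sum>i<m. z i * sys_R i (R t) (S t))) \<rho>"
    by (subst \<rho>) (simp only: fps_const_1_eq_1)
  then have R: "expands (Suc K) R \<rho>"
    by (rule expands_cong[OF _ eventually_mono[OF eqR sym]])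
  have "expands (Suc K) (\<lambda>t. of_real t * (\<Sum>i<m. z i * sys_S i (R t) (S t)))
      (fps_X * (\<Sum>i<m. fps_const (z i) * sys_S i \<rho> \<sigma>))"
    by (rule expands_X_mult[OF expands_sum], rule expands_mult[OF expands_const], rule expands_sys[OF IH])
  then have "expands (Suc K) (\<lambda>t. of_real t * (\<Sum>i<m. z i * sys_S i (R t) (S t))) \<sigma>"
    by (subst \<sigma>)
  then have "expands (Suc K) S \<sigma>"
    by (rule expands_cong[OF _ eventually_mono[OF eqS sym]])
  with R show ?case ..
qed

text \<open>Double induction, on the order K outside and on n inside. In the recursion the higher
  moments n + i carry a factor t, so they are needed only to order K, while the quadratic terms
  involve moments below n + 1 and are needed to the full order.\<close>

lemma moments_expand:
  assumes bounded: "\<And>n. \<exists>B. \<forall>\<^sub>F t in at_right 0. cmod (mom t n) \<le> B"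
    and mom_0: "\<forall>\<^sub>F t in at_right 0. mom t 0 = 1"
    and mom_Suc: "\<And>n. \<forall>\<^sub>F t in at_right 0. mom t (Suc n) =
       (\<Sum>k<n. mom t k * mom t (n - 1 - k)) + of_real t * (\<Sum>i<m. z i * mom t (n + i))"
    and M_0: "M 0 = 1"
    and M_Suc: "\<And>n. M (Suc n) = (\<Sum>k<n. M k * M (n - 1 - k)) + fps_X * (\<Sum>i<m. fps_const (z i) * M (n + i))"
  shows "expands K (\<lambda>t. mom t n) (M n)"
proof (induction K arbitrary: n)
  case 0
  show ?case using bounded by simp
next
  case (Suc K)
  note IH = Suc
  show ?case
  proof (induction n rule: less_induct)
    case (less n)
    show ?case
    proof (cases n)
      case 0
      have "expands (Suc K) (\<lambda>t. 1) (fps_const 1)" by (rule expands_const)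
      then have "expands (Suc K) (\<lambda>t. mom t 0) (fps_const 1)"
        by (rule expands_cong[OF _ eventually_mono[OF mom_0 sym]])
      then show ?thesis by (simp only: 0 M_0 fps_const_1_eq_1)
    next
      case (Suc n')
      have "expands (Suc K) (\<lambda>t. (\<Sum>k<n'. mom t k * mom t (n' - 1 - k)) + of_real t * (\<Sum>i<m. z i * mom t (n' + i))) (M (Suc n'))"
        unfolding M_Suc
      proof (rule expands_add[OF expands_sum expands_X_mult[OF expands_sum]])
        show "expands (Suc K) (\<lambda>t. mom t k * mom t (n' - 1 - k)) (M k * M (n' - 1 - k))" if "k \<in> {..<n'}" for k
          by (rule expands_mult; rule less.IH) (use that Suc in auto)
        show "expands K (\<lambda>t. z i * mom t (n' + i)) (fps_const (z i) * M (n' + i))" for i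
          by (rule expands_mult[OF expands_const IH])
      qed
      then have "expands (Suc K) (\<lambda>t. mom t (Suc n')) (M (Suc n'))"
        by (rule expands_cong[OF _ eventually_mono[OF mom_Suc[of n'] sym]])
      then show ?thesis by (simp only: Suc)
    qed
  qed
qed

text \<open>The germ condition is available along rays through members of
  \<open>one_cut_seqs\<close>. The direction a need not be one, but \<open>t\<^sub>0\<close> a is,
  and the parameter is rescaled accordingly.\<close>

lemma analytic_extension_ray:
  assumes ext: "analytic_extension r \<phi> f" and "0 < r" and supp: "\<And>i. m \<le> i \<Longrightarrow> a i = 0" and "0 < t\<^sub>0"
    and cut: "\<And>t. 0 \<le> t \<Longrightarrow> t \<le> t\<^sub>0 \<Longrightarrow> (\<lambda>i. t * a i) \<in> one_cut_seqs"
  obtains \<delta> where "0 < \<delta>"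
    "\<And>t. 0 < t \<Longrightarrow> t < \<delta> \<Longrightarrow> f (\<lambda>i. complex_of_real (t * a i)) = complex_of_real (\<phi> (\<lambda>i. t * a i))"
proof -
  have "(\<lambda>i. t\<^sub>0 * a i) \<in> one_cut_seqs" using cut[of t\<^sub>0] \<open>0 < t\<^sub>0\<close> by simp
  from bspec[OF conjunct2[OF ext[unfolded analytic_extension_def]] this]
  have "\<forall>\<^sub>F s in at_right 0. (\<lambda>i. s * (t\<^sub>0 * a i)) \<in> one_cut_seqs \<and> (\<lambda>i. complex_of_real (s * (t\<^sub>0 * a i))) \<in> l1_ball r \<longrightarrow>
        f (\<lambda>i. complex_of_real (s * (t\<^sub>0 * a i))) = complex_of_real (\<phi> (\<lambda>i. s * (t\<^sub>0 * a i)))" .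
  then obtain b where b: "0 < b" "\<And>s. 0 < s \<Longrightarrow> s < b \<Longrightarrow> (\<lambda>i. s * (t\<^sub>0 * a i)) \<in> one_cut_seqs \<Longrightarrow>
      (\<lambda>i. complex_of_real (s * (t\<^sub>0 * a i))) \<in> l1_ball r \<Longrightarrow>
        f (\<lambda>i. complex_of_real (s * (t\<^sub>0 * a i))) = complex_of_real (\<phi> (\<lambda>i. s * (t\<^sub>0 * a i)))"
    unfolding eventually_at_right_field by blast
  obtain \<epsilon> where \<epsilon>: "0 < \<epsilon>" "\<And>t. \<bar>t\<bar> < \<epsilon> \<Longrightarrow> l1_norm r (\<lambda>i. complex_of_real (t * a i)) < 1"
    using l1_norm_ray_small[where a = a and m = m and \<rho> = 1, OF supp \<open>0 < r\<close>] by auto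
  show thesis
  proof (rule that[of "min t\<^sub>0 (min (b * t\<^sub>0) \<epsilon>)"])
    show "0 < min t\<^sub>0 (min (b * t\<^sub>0) \<epsilon>)" using b(1) \<epsilon>(1) \<open>0 < t\<^sub>0\<close> by simp
    fix t assume t: "0 < t" "t < min t\<^sub>0 (min (b * t\<^sub>0) \<epsilon>)"
    have "t / t\<^sub>0 * (t\<^sub>0 * a i) = t * a i" for i using \<open>0 < t\<^sub>0\<close> by simp
    moreover have "0 < t / t\<^sub>0" "t / t\<^sub>0 < b" using t \<open>0 < t\<^sub>0\<close> by (auto simp: divide_less_eq)
    moreover have "(\<lambda>i. t * a i) \<in> one_cut_seqs" using t by (intro cut) auto
    moreover have "(\<lambda>i. complex_of_real (t * a i)) \<in> l1_ball r"
      unfolding l1_ball_def using t \<epsilon>(2)[of t] l1_finite_support(1)[of m] supp by simp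
    ultimately show "f (\<lambda>i. complex_of_real (t * a i)) = complex_of_real (\<phi> (\<lambda>i. t * a i))"
      using b(2)[of "t / t\<^sub>0"] by (simp only:)
  qed
qed

lemma analytic_extension_taylor_0:
  assumes "analytic_extension r \<phi> f"
  shows "\<exists>c. has_taylor_series r f (\<lambda>_. 0) c"
proof -
  have "(\<lambda>_. 0) \<in> l1_ball r" by (simp add: l1_ball_def l1_space_def l1_norm_def)
  then show ?thesis using assms unfolding analytic_extension_def analytic_on_ball_def by blast
qed

text \<open>A supporting line from below at every point determines the derivative.\<close>

lemma power_series_deriv_from_below:
  fixes f :: "complex fps" and \<Phi> A :: "real \<Rightarrow> real"
  assumes "0 < \<epsilon>" and sums: "\<And>t. 0 < t \<Longrightarrow> t < \<epsilon> \<Longrightarrow> (\<lambda>k. fps_nth f k * of_real t ^ k) sums of_real (\<Phi> t)"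
    and below: "\<And>t t'. 0 < t \<Longrightarrow> t < \<epsilon> \<Longrightarrow> 0 < t' \<Longrightarrow> t' < \<epsilon> \<Longrightarrow> (t' - t) * A t \<le> \<Phi> t' - \<Phi> t"
    and t: "0 < t" "t < \<epsilon>"
  shows "(\<lambda>k. fps_nth (fps_deriv f) k * of_real t ^ k) sums of_real (A t)"
proof -
  define G where "G z = (\<Sum>k. fps_nth f k * z ^ k)" for z :: complex
  define D where "D = (\<Sum>k. diffs (fps_nth f) k * of_real t ^ k)"
  have summ: "summable (\<lambda>k. fps_nth f k * of_real s ^ k)" if "0 < s" "s < \<epsilon>" for s
    using sums[OF that] sums_summable by blast
  define s where "s = (t + \<epsilon>) / 2"
  have s: "t < s" "s < \<epsilon>" "0 < s" using t by (auto simp: s_def)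
  have "(G has_field_derivative D) (at (of_real t))"
    unfolding G_def D_def by (rule termdiffs_strong[OF summ[OF s(3,2)]]) (use s t in simp)
  then have D: "((\<lambda>x. G (of_real x)) has_vector_derivative D) (at t)" by (rule has_vector_derivative_real_field)
  have Gt: "G (of_real x) = of_real (\<Phi> x)" if "0 < x" "x < \<epsilon>" for x
    unfolding G_def by (rule sums_unique[symmetric, OF sums[OF that]])
  have near: "0 < x \<and> x < \<epsilon>" if "\<bar>t - x\<bar> < min t (\<epsilon> - t)" for x
    using that unfolding abs_less_iff by linarith
  have "((\<lambda>x. Re (G (of_real x))) has_real_derivative Re D) (at t)"
    using bounded_linear.has_vector_derivative[OF bounded_linear_Re D]
    unfolding has_real_derivative_iff_has_vector_derivative .
  then have "((\<lambda>x. Re (G (of_real x)) - x * A t) has_real_derivative Re D - 1 * A t) (at t)"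
    by (intro DERIV_diff DERIV_cmult_right DERIV_ident)
  then have "((\<lambda>x. Re (G (of_real x)) - x * A t) has_real_derivative Re D - A t) (at t)" by simp
  then have "Re D - A t = 0"
  proof (rule DERIV_local_min[where d = "min t (\<epsilon> - t)"])
    show "\<forall>x. \<bar>t - x\<bar> < min t (\<epsilon> - t) \<longrightarrow> Re (G (of_real t)) - t * A t \<le> Re (G (of_real x)) - x * A t"
    proof (intro allI impI)
      fix x assume "\<bar>t - x\<bar> < min t (\<epsilon> - t)"
      from near[OF this] below[OF t, of x] show "Re (G (of_real t)) - t * A t \<le> Re (G (of_real x)) - x * A t"
        by (simp add: Gt t left_diff_distrib)
    qed
  qed (use t in simp)
  moreover have "((\<lambda>x. Im (G (of_real x))) has_real_derivative Im D) (at t)"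
    using bounded_linear.has_vector_derivative[OF bounded_linear_Im D]
    unfolding has_real_derivative_iff_has_vector_derivative .
  then have "Im D = 0"
  proof (rule DERIV_local_min[where d = "min t (\<epsilon> - t)"])
    show "\<forall>x. \<bar>t - x\<bar> < min t (\<epsilon> - t) \<longrightarrow> Im (G (of_real t)) \<le> Im (G (of_real x))"
    proof (intro allI impI)
      fix x assume "\<bar>t - x\<bar> < min t (\<epsilon> - t)"
      from near[OF this] show "Im (G (of_real t)) \<le> Im (G (of_real x))" by (simp add: Gt t)
    qed
  qed (use t in simp)
  ultimately have DA: "D = of_real (A t)" by (intro complex_eqI) simp_all
  have "summable (\<lambda>k. diffs (fps_nth f) k * of_real t ^ k)"
  proof (rule termdiff_converges)
    show "norm (complex_of_real t) < s" using s t by simp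
    fix z :: complex assume "norm z < s"
    then show "summable (\<lambda>k. fps_nth f k * z ^ k)"
      by (intro powser_inside[OF summ[OF s(3,2)]]) (use s in simp)
  qed
  then have "(\<lambda>k. diffs (fps_nth f) k * of_real t ^ k) sums of_real (A t)"
    unfolding DA[symmetric] D_def by (rule summable_sums)
  moreover have "diffs (fps_nth f) = fps_nth (fps_deriv f)" by (simp add: fun_eq_iff diffs_def)
  ultimately show ?thesis by (simp only:)
qed

text \<open>For R and S the convergent Taylor series and the formal series are two expansions of the
  same function of t > 0, hence equal. For the free energy the derivatives are compared in this way,
  and the constant terms separately.\<close>

lemma taylor_series_eq_formal_on_ray:
  assumes "0 < r" and ext: "analytic_extension r planar_F F\<^sub>0" "analytic_extension r planar_R R" "analytic_extension r planar_S S"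
    and formal: "formal_system Rf Sf" and genus: "genus_expansion Ff"
    and taylor: "has_taylor_series r F\<^sub>0 (\<lambda>_. 0) cF" "has_taylor_series r R (\<lambda>_. 0) cR" "has_taylor_series r S (\<lambda>_. 0) cS"
    and m: "even m" "4 \<le> m" and supp: "\<And>i. m \<le> i \<Longrightarrow> a i = 0" and neg: "a (m - 1) < 0"
  defines "z \<equiv> \<lambda>i. complex_of_real (a i)"
  shows "mps_ray m z cR = mps_ray m z (mps_map of_rat Rf)"
    and "mps_ray m z cS = mps_ray m z (mps_map of_rat Sf)"
    and "mps_ray m z cF = mps_ray m z (mps_map of_rat (Ff 0))"
proof -
  obtain C where C: "\<And>x. (\<Sum>i<m. a i * (real i * x ^ (i - 1))) \<le> C"
    using power_sum_bounded_above[where a = a and m = m, OF m neg] by blast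
  define PR where "PR t = planar_R (\<lambda>i. t * a i)" for t
  define PS where "PS t = planar_S (\<lambda>i. t * a i)" for t
  define PF where "PF t = planar_F (\<lambda>i. t * a i)" for t
  obtain t\<^sub>0 mom where t\<^sub>0: "0 < t\<^sub>0"
    and cut: "\<And>t. 0 \<le> t \<Longrightarrow> t \<le> t\<^sub>0 \<Longrightarrow> (\<lambda>i. t * a i) \<in> one_cut_seqs"
    and RS_bound: "\<And>t. 0 \<le> t \<Longrightarrow> t \<le> t\<^sub>0 \<Longrightarrow> \<bar>PR t\<bar> \<le> 2 \<and> \<bar>PS t\<bar> \<le> 1"
    and eqR: "\<And>t. 0 \<le> t \<Longrightarrow> t \<le> t\<^sub>0 \<Longrightarrow> PR t = 1 + t * (\<Sum>i<m. a i * sys_R i (PR t) (PS t))"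
    and eqS: "\<And>t. 0 \<le> t \<Longrightarrow> t \<le> t\<^sub>0 \<Longrightarrow> PS t = t * (\<Sum>i<m. a i * sys_S i (PR t) (PS t))"
    and mom_0: "\<And>t. 0 \<le> t \<Longrightarrow> t \<le> t\<^sub>0 \<Longrightarrow> mom t 0 = 1"
    and mom_bound: "\<And>t k. 0 \<le> t \<Longrightarrow> t \<le> t\<^sub>0 \<Longrightarrow> \<bar>mom t k\<bar> \<le> 4 ^ k"
    and mom_Suc: "\<And>t n. 0 \<le> t \<Longrightarrow> t \<le> t\<^sub>0 \<Longrightarrow> mom t (Suc n) =
       (\<Sum>k<n. mom t k * mom t (n - 1 - k)) + t * (\<Sum>i<m. a i * mom t (n + i))"
    and below: "\<And>t t'. 0 \<le> t \<Longrightarrow> t \<le> t\<^sub>0 \<Longrightarrow> 0 \<le> t' \<Longrightarrow> t' \<le> t\<^sub>0 \<Longrightarrow>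
       (t' - t) * (\<Sum>i<m. a i * mom t (Suc i) / real (Suc i)) \<le> PF t' - PF t"
    and F_0: "planar_F (\<lambda>i. 0) = 0"
    by (rule planar_ray[where a = a and m = m, OF supp C, folded PR_def PS_def PF_def]) (assumption | rule that)+
  have small: "\<forall>\<^sub>F t in at_right 0. 0 \<le> t \<and> t \<le> t\<^sub>0"
    using eventually_at_right_real[OF t\<^sub>0] by eventually_elim simp
  have series: "\<exists>\<epsilon>. 0 < \<epsilon> \<and> \<epsilon> \<le> t\<^sub>0 \<and> (\<forall>t. 0 < t \<longrightarrow> t < \<epsilon> \<longrightarrow>
      (\<lambda>k. fps_nth (mps_ray m z c) k * of_real t ^ k) sums of_real (\<phi> (\<lambda>i. t * a i)))"
    if f: "analytic_extension r \<phi> f" "has_taylor_series r f (\<lambda>_. 0) c" for \<phi> f c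
  proof -
    obtain \<delta> where \<delta>: "0 < \<delta>"
      "\<And>t. 0 < t \<Longrightarrow> t < \<delta> \<Longrightarrow> f (\<lambda>i. complex_of_real (t * a i)) = complex_of_real (\<phi> (\<lambda>i. t * a i))"
      by (rule analytic_extension_ray[where a = a and m = m, OF f(1) \<open>0 < r\<close> supp t\<^sub>0 cut]) (assumption | rule that)+
    obtain \<epsilon> where \<epsilon>: "0 < \<epsilon>" "\<And>t. \<bar>t\<bar> < \<epsilon> \<Longrightarrow>
        (\<lambda>k. fps_nth (mps_ray m z c) k * of_real t ^ k) sums f (\<lambda>i. of_real (t * a i))"
      by (rule taylor_series_ray[where a = a and m = m, OF f(2) \<open>0 < r\<close> supp, folded z_def]) (assumption | rule that)+
    show ?thesis
    proof (intro exI[of _ "min t\<^sub>0 (min \<delta> \<epsilon>)"] conjI allI impI)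
      fix t assume t: "0 < t" "t < min t\<^sub>0 (min \<delta> \<epsilon>)"
      have "(\<lambda>k. fps_nth (mps_ray m z c) k * of_real t ^ k) sums f (\<lambda>i. of_real (t * a i))"
        by (rule \<epsilon>(2)) (use t in simp)
      also have "f (\<lambda>i. of_real (t * a i)) = of_real (\<phi> (\<lambda>i. t * a i))"
        by (rule \<delta>(2)) (use t in simp_all)
      finally show "(\<lambda>k. fps_nth (mps_ray m z c) k * of_real t ^ k) sums of_real (\<phi> (\<lambda>i. t * a i))" .
    qed (use \<delta>(1) \<epsilon>(1) t\<^sub>0 in auto)
  qed
  let ?\<rho> = "mps_ray m z (mps_map of_rat Rf)" and ?\<sigma> = "mps_ray m z (mps_map of_rat Sf)"
  have eqR': "\<forall>\<^sub>F t in at_right 0. complex_of_real (PR t) =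
      1 + of_real t * (\<Sum>i<m. z i * sys_R i (of_real (PR t)) (of_real (PS t)))"
    using small
  proof eventually_elim
    case (elim t)
    have "complex_of_real (PR t) = of_real (1 + t * (\<Sum>i<m. a i * sys_R i (PR t) (PS t)))"
      using eqR elim by (intro arg_cong[of _ _ complex_of_real]) blast
    then show ?case by (simp only: of_real_add of_real_1 of_real_mult of_real_sum of_real_sys z_def)
  qed
  have eqS': "\<forall>\<^sub>F t in at_right 0. complex_of_real (PS t) =
      of_real t * (\<Sum>i<m. z i * sys_S i (of_real (PR t)) (of_real (PS t)))"
    using small
  proof eventually_elim
    case (elim t)
    have "complex_of_real (PS t) = of_real (t * (\<Sum>i<m. a i * sys_S i (PR t) (PS t)))"
      using eqS elim by (intro arg_cong[of _ _ complex_of_real]) blast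
    then show ?case by (simp only: of_real_mult of_real_sum of_real_sys z_def)
  qed
  have RS: "expands K (\<lambda>t. of_real (PR t)) ?\<rho> \<and> expands K (\<lambda>t. of_real (PS t)) ?\<sigma>" for K
  proof (rule system_expands[OF _ _ eqR' eqS' formal_system_ray[OF formal]])
    show "\<forall>\<^sub>F t in at_right 0. cmod (of_real (PR t)) \<le> 2" "\<forall>\<^sub>F t in at_right 0. cmod (of_real (PS t)) \<le> 1"
      using small by (eventually_elim, use RS_bound in simp)+
  qed
  show "mps_ray m z cR = ?\<rho>"
  proof (rule expands_unique)
    obtain \<epsilon> where "0 < \<epsilon>" "\<forall>t. 0 < t \<longrightarrow> t < \<epsilon> \<longrightarrow>
        (\<lambda>k. fps_nth (mps_ray m z cR) k * of_real t ^ k) sums of_real (PR t)"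
      using series[OF ext(2) taylor(2)] unfolding PR_def by blast
    then show "expands K (\<lambda>t. of_real (PR t)) (mps_ray m z cR)" for K by (intro expands_sums) auto
    show "expands K (\<lambda>t. of_real (PR t)) ?\<rho>" for K using RS ..
  qed
  show "mps_ray m z cS = ?\<sigma>"
  proof (rule expands_unique)
    obtain \<epsilon> where "0 < \<epsilon>" "\<forall>t. 0 < t \<longrightarrow> t < \<epsilon> \<longrightarrow>
        (\<lambda>k. fps_nth (mps_ray m z cS) k * of_real t ^ k) sums of_real (PS t)"
      using series[OF ext(3) taylor(3)] unfolding PS_def by blast
    then show "expands K (\<lambda>t. of_real (PS t)) (mps_ray m z cS)" for K by (intro expands_sums) auto
    show "expands K (\<lambda>t. of_real (PS t)) ?\<sigma>" for K using RS ..
  qed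

  \<comment> \<open>The planar loop equation makes the series \<open>norm_moment L\<close>,
    restricted to the ray, satisfy the recursion of the moments of the equilibrium measures.\<close>
  define L where "L = (mps_map of_rat (Ff 0) :: complex mps)"
  have moments: "expands K (\<lambda>t. of_real (mom t n)) (mps_ray m z (norm_moment L n))" for K n
  proof (rule moments_expand[where mom = "\<lambda>t n. complex_of_real (mom t n)" and M = "\<lambda>n. mps_ray m z (norm_moment L n)"])
    fix n
    have "\<forall>\<^sub>F t in at_right 0. cmod (of_real (mom t n)) \<le> 4 ^ n"
      using small by eventually_elim (use mom_bound in simp)
    then show "\<exists>B. \<forall>\<^sub>F t in at_right 0. cmod (of_real (mom t n)) \<le> B" by blast
    show "\<forall>\<^sub>F t in at_right 0. complex_of_real (mom t 0) = 1"
      using small by eventually_elim (use mom_0 in simp)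
    show "\<forall>\<^sub>F t in at_right 0. complex_of_real (mom t (Suc n)) =
        (\<Sum>k<n. of_real (mom t k) * of_real (mom t (n - 1 - k))) + of_real t * (\<Sum>i<m. z i * of_real (mom t (n + i)))"
      using small
    proof eventually_elim
      case (elim t)
      then show ?case by (simp only: mom_Suc of_real_add of_real_mult of_real_sum z_def)
    qed
    show "mps_ray m z (norm_moment L (Suc n)) = (\<Sum>k<n. mps_ray m z (norm_moment L k) * mps_ray m z (norm_moment L (n - 1 - k))) +
        fps_X * (\<Sum>i<m. fps_const (z i) * mps_ray m z (norm_moment L (n + i)))"
      unfolding L_def planar_loop_equation[OF genus]
      by (simp only: mps_ray_add mps_ray_sum mps_ray_mult mps_ray_suminf_X)
  qed simp
  \<comment> \<open>The slope at t of the supporting line of \<open>PF\<close>. By the expansion of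
    the moments it also expands into the derivative of the formal planar free energy.\<close>
  define A where "A t = (\<Sum>i<m. a i * mom t (Suc i) / real (Suc i))" for t
  have "(\<lambda>t. complex_of_real (A t)) = (\<lambda>t. \<Sum>i<m. z i * (1 / of_nat (Suc i) * of_real (mom t (Suc i))))"
    by (simp add: fun_eq_iff A_def z_def del: of_nat_Suc)
  moreover have "fps_deriv (mps_ray m z L) =
      (\<Sum>i<m. fps_const (z i) * (fps_const (1 / of_nat (Suc i)) * mps_ray m z (norm_moment L (Suc i))))"
  proof -
    have "mps_deriv i L = mps_const (1 / of_nat (Suc i)) * norm_moment L (Suc i)" for i
      by (rule mps_eqI) (simp del: of_nat_Suc)
    then show ?thesis unfolding fps_deriv_mps_ray by (simp only: mps_ray_mult mps_ray_const)
  qed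
  ultimately have A: "expands K (\<lambda>t. of_real (A t)) (fps_deriv (mps_ray m z L))" for K
    by (simp only:) (intro expands_sum expands_mult expands_const moments)
  obtain \<epsilon> where \<epsilon>: "0 < \<epsilon>" "\<epsilon> \<le> t\<^sub>0" and sums: "\<And>t. 0 < t \<Longrightarrow> t < \<epsilon> \<Longrightarrow>
      (\<lambda>k. fps_nth (mps_ray m z cF) k * of_real t ^ k) sums of_real (PF t)"
    using series[OF ext(1) taylor(1)] unfolding PF_def by blast
  have "(\<lambda>k. fps_nth (fps_deriv (mps_ray m z cF)) k * of_real t ^ k) sums of_real (A t)" if t: "0 < t" "t < \<epsilon>" for t
  proof (rule power_series_deriv_from_below[OF \<epsilon>(1) sums _ t])
    show "(t' - t) * A t \<le> PF t' - PF t" if "0 < t" "t < \<epsilon>" "0 < t'" "t' < \<epsilon>" for t t'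
      unfolding A_def by (rule below) (use that \<epsilon> in auto)
  qed
  then have "expands K (\<lambda>t. of_real (A t)) (fps_deriv (mps_ray m z cF))" for K
    by (rule expands_sums[OF \<epsilon>(1)])
  from expands_unique[OF this A] have deriv: "fps_deriv (mps_ray m z cF) = fps_deriv (mps_ray m z L)" .
  have "PF 0 = 0" using F_0 by (simp add: PF_def)
  \<comment> \<open>The series is known to represent \<open>PF\<close> only for t > 0, so its
    constant term is found as a limit: the supporting lines at 0 and at t enclose PF t between t
    A(0) and t A(t), and A is bounded.\<close>
  have "fps_nth (mps_ray m z cF) 0 = 0"
  proof (rule tendsto_unique[OF _ expands_tendsto[OF expands_sums[OF \<epsilon>(1) sums]]])
    define B where "B = (\<Sum>i<m. \<bar>a i\<bar> * 4 ^ Suc i / real (Suc i))"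
    have A_bound: "\<bar>A t\<bar> \<le> B" if "0 \<le> t" "t \<le> t\<^sub>0" for t
      unfolding A_def B_def
      by (intro order_trans[OF sum_abs] sum_mono)
        (use mom_bound[OF that] in \<open>auto simp: abs_mult intro!: divide_right_mono mult_left_mono simp del: power_Suc of_nat_Suc\<close>)
    show "((\<lambda>t. complex_of_real (PF t)) \<longlongrightarrow> 0) (at_right 0)"
    proof (rule Lim_null_comparison)
      show "\<forall>\<^sub>F t in at_right 0. cmod (complex_of_real (PF t)) \<le> t * B"
        using small
      proof eventually_elim
        case (elim t)
        have "t * A 0 \<le> PF t" "PF t \<le> t * A t"
          using below[of 0 t] below[of t 0] elim t\<^sub>0 \<open>PF 0 = 0\<close> by (simp_all add: A_def)
        moreover have "\<bar>t * A 0\<bar> \<le> t * B" "\<bar>t * A t\<bar> \<le> t * B"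
          using A_bound[of 0] A_bound[of t] elim t\<^sub>0 by (simp_all add: abs_mult mult_left_mono)
        ultimately have "\<bar>PF t\<bar> \<le> t * B" unfolding abs_le_iff by linarith
        then show ?case by simp
      qed
      show "((\<lambda>t. t * B) \<longlongrightarrow> 0) (at_right 0)" by (auto intro!: tendsto_eq_intros)
    qed
  qed simp_all
  moreover have "fps_nth (mps_ray m z L) 0 = 0"
    by (simp add: mps_ray_nth L_def mps_coeff_map genus_expansion_const_term[OF genus])
  ultimately show "mps_ray m z cF = mps_ray m z (mps_map of_rat (Ff 0))"
    using deriv unfolding L_def fps_deriv_eq_iff by simp
qed

theorem theorem1p2:
  fixes r :: real
    and F\<^sub>0 R S :: "(nat \<Rightarrow> complex) \<Rightarrow> complex"
    and Rf Sf :: "rat mps"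
    and Ff :: "nat \<Rightarrow> rat mps"
  assumes "r > 0"
    and "analytic_extension r planar_F F\<^sub>0"
    and "analytic_extension r planar_R R"
    and "analytic_extension r planar_S S"
    and "formal_system Rf Sf"
    and "genus_expansion Ff"
  shows "has_taylor_series r R (\<lambda>_. 0) (mps_map of_rat Rf) \<and>
         has_taylor_series r S (\<lambda>_. 0) (mps_map of_rat Sf) \<and>
         has_taylor_series r F\<^sub>0 (\<lambda>_. 0) (mps_map of_rat (Ff 0))"
proof -
  \<comment> \<open>Analyticity provides some Taylor series at 0 for each extension; it remains to
    identify the coefficients.\<close>
  obtain cF cR cS where taylor: "has_taylor_series r F\<^sub>0 (\<lambda>_. 0) cF"
      "has_taylor_series r R (\<lambda>_. 0) cR" "has_taylor_series r S (\<lambda>_. 0) cS"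
    using assms(2-4) analytic_extension_taylor_0 by meson
  note ray = taylor_series_eq_formal_on_ray[OF assms taylor]
  have "cR = mps_map of_rat Rf" by (rule mps_eq_by_rays) (rule ray(1))
  moreover have "cS = mps_map of_rat Sf" by (rule mps_eq_by_rays) (rule ray(2))
  moreover have "cF = mps_map of_rat (Ff 0)" by (rule mps_eq_by_rays) (rule ray(3))
  ultimately show ?thesis using taylor by simp
qed

end
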